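(* Let $p$ be a prime, $X$ a finite connected graph with vertices labeled $v_1,\dots,v_g$, $\alpha:\mathbf{E}_X\to\mathbb{Z}_p$ with $\alpha(\bar s)=-\alpha(s)$, and $\mathcal{G}=\{G_v\}_{v\in V_X}$ a family of closed subgroups of $\mathbb{Z}_p$, labeled so that $V^{unr}=\{v\in V_X:G_v=0\}=\{v_1,\dots,v_t\}$ and $V^{ram}=\{v:G_v\neq0\}=\{v_{t+1},\dots,v_g\}$; for $v\in V^{ram}$ write $G_v=p^{k_v}\mathbb{Z}_p$. Let $X_n=X(\Gamma_n,\mathcal{G}_n,\alpha_n)$ as in the context and assume all $X_n$ are connected. Then, in $\mathbb{Z}_p[[T]]$, $$\mathrm{char}_{\mathbb{Z}_p[[T]]}(\mathrm{Pic}^0_\Lambda)\cdot(T)=(g(T))\cdot\prod_{v\in V^{ram}}\big((1+T)^{p^{k_v}}-1\big),$$ where $g(T)=\det(\widetilde{D}-\widetilde{A}_\rho)\in\mathbb{Z}_p[[T]]$, $\widetilde D$ is the $t\times t$ diagonal matrix with entries $\mathrm{val}_X(v_i)$, $1\le i\le t$, and $\widetilde A_\rho$ is the $t\times t$ matrix with $(i,j)$ entry $\sum_{s\in\mathbf{E}_X,\,o(s)=v_j,\,t(s)=v_i}(1+T)^{\alpha(s)}$ (with $g(T)=1$ if $t=0$).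
   Context: Graphs in Serre's sense: vertex set $V_Y$, directed edges $\mathbf{E}_Y$, maps $o,t$, fixed-point-free involution $\varepsilon\mapsto\bar\varepsilon$ with $o(\bar\varepsilon)=t(\varepsilon)$; $\mathrm{val}_Y(w)=|\{\varepsilon:o(\varepsilon)=w\}|$. Voltage graph $X(G,\{H_v\},\beta)$ for abelian $G$ (additive), $\beta:\mathbf{E}_X\to G$ with $\beta(\bar s)=-\beta(s)$, subgroups $H_v\le G$: vertices $(v,\sigma+H_v)$, directed edges $(s,\sigma)\in\mathbf{E}_X\times G$, $o(s,\sigma)=(o(s),\sigma+H_{o(s)})$, $t(s,\sigma)=(t(s),\sigma+\beta(s)+H_{t(s)})$, $\overline{(s,\sigma)}=(\bar s,\sigma+\beta(s))$; $G$ acts by translation in the second coordinate. Here $\Gamma_n=\mathbb{Z}_p/p^n\mathbb{Z}_p$, $\pi_n:\mathbb{Z}_p\to\Gamma_n$, $\mathcal{G}_n=\{\pi_n(G_v)\}$, $\alpha_n=\pi_n\circ\alpha$; there are natural branched covers $X_{n+1}\to X_n$ reducing the second coordinates mod $p^n$. For a finite connected graph $Y$, $\mathrm{Div}(Y)$ is the free abelian group on $V_Y$, $\mathrm{Div}^0(Y)$ its degree-zero part, $\mathrm{Pr}(Y)$ the image of the Laplacian $w\mapsto \mathrm{val}_Y(w)w-\sum_{o(\varepsilon)=w}t(\varepsilon)$, and $\mathrm{Pic}^0(Y)=\mathrm{Div}^0(Y)/\mathrm{Pr}(Y)$ (a finite group). $\mathrm{Pic}^0_\Lambda=\varprojlim_n\mathrm{Pic}^0(X_n)[p^\infty]$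 with transition maps induced by pushing forward divisors along $X_{n+1}\to X_n$; it is a finitely generated torsion module over $\Lambda=\mathbb{Z}_p[[\mathbb{Z}_p]]$ (with $\mathbb{Z}_p$ acting through $\Gamma_n$ on $X_n$), and $\Lambda$ is identified with $\mathbb{Z}_p[[T]]$ via $1\mapsto 1+T$. $(1+T)^a=\sum_{i\ge0}\binom{a}{i}T^i$ for $a\in\mathbb{Z}_p$. *)

theory Defs
  imports
    "HOL-Algebra.Algebraic_Closure_Type"
    "HOL-Algebra.Free_Abelian_Groups"
    "HOL-Algebra.Ideal_Product"
    "HOL-Algebra.Module"
    "HOL-Library.Extended_Nat"
    "HOL-Computational_Algebra.Formal_Power_Series"
    "Berlekamp_Zassenhaus.Finite_Field"
    "Jordan_Normal_Form.Determinant"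
    "Graph_Theory.Digraph_Component"
begin

no_notation Polynomials.var (\<open>X\<index>\<close>)

section \<open>The \<open>p\<close>-adic integers\<close>

text \<open>
  The prime \<open>p\<close> is the cardinality of the index type \<open>'p\<close>. A \<open>p\<close>-adic integer is the
  coherent sequence of its residues; the equation below forces the \<open>n\<close>-th entry into
  \<open>{0..<p^n}\<close>.
\<close>

typedef (overloaded) 'p padic_int =
  "{x :: nat \<Rightarrow> int. \<forall>n. x n = x (Suc n) mod int CARD('p :: prime_card) ^ n}"
  morphisms residue Abs_padic_int
  by (rule exI[of _ "\<lambda>_. 0"]) simp

lemma residue_Suc_mod:
  "residue (x :: 'p :: prime_card padic_int) (Suc n) mod int CARD('p) ^ n = residue x n"
  using residue[of x] unfolding mem_Collect_eq by metis

lemma residue_mod [simp]: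
  "residue (x :: 'p :: prime_card padic_int) n mod int CARD('p) ^ n = residue x n"
  by (metis residue_Suc_mod mod_mod_trivial)

lemma residue_mod_le:
  assumes "m \<le> n"
  shows "residue (x :: 'p :: prime_card padic_int) n mod int CARD('p) ^ m = residue x m"
  using assms
proof (induction n rule: dec_induct)
  case base
  then show ?case by simp
next
  case (step n)
  have "residue x (Suc n) mod int CARD('p) ^ m
      = residue x (Suc n) mod int CARD('p) ^ n mod int CARD('p) ^ m"
    using step.hyps by (simp add: mod_mod_cancel le_imp_power_dvd)
  then show ?case using step.IH by (simp add: residue_Suc_mod)
qed

lemma residue_Abs:
  assumes "\<And>n. f (Suc n) mod int CARD('p) ^ n = f n mod int CARD('p) ^ n"
  shows "residue (Abs_padic_int (\<lambda>n. f n mod int CARD('p) ^ n) :: 'p :: prime_card padic_int) n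
    = f n mod int CARD('p) ^ n"
proof -
  have "f n mod int CARD('p) ^ n = f (Suc n) mod int CARD('p) ^ Suc n mod int CARD('p) ^ n" for n
    using assms[of n] mod_mod_cancel[OF le_imp_power_dvd[of n "Suc n" "int CARD('p)"], of "f (Suc n)"]
    by simp
  then have "(\<lambda>n. f n mod int CARD('p) ^ n)
      \<in> {x. \<forall>n. x n = x (Suc n) mod int CARD('p) ^ n}"
    by blast
  then show ?thesis by (simp only: Abs_padic_int_inverse)
qed

lemma padic_int_eqI: "(\<And>n. residue x n = residue y n) \<Longrightarrow> x = y"
  by (simp add: residue_inject[symmetric] fun_eq_iff)

instantiation padic_int :: (prime_card) comm_ring_1
begin

definition zero_padic_int :: "'a padic_int"
  where "0 = Abs_padic_int (\<lambda>n. 0 mod int CARD('a) ^ n)"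

definition one_padic_int :: "'a padic_int"
  where "1 = Abs_padic_int (\<lambda>n. 1 mod int CARD('a) ^ n)"

definition plus_padic_int :: "'a padic_int \<Rightarrow> 'a padic_int \<Rightarrow> 'a padic_int"
  where "x + y = Abs_padic_int (\<lambda>n. (residue x n + residue y n) mod int CARD('a) ^ n)"

definition minus_padic_int :: "'a padic_int \<Rightarrow> 'a padic_int \<Rightarrow> 'a padic_int"
  where "x - y = Abs_padic_int (\<lambda>n. (residue x n - residue y n) mod int CARD('a) ^ n)"

definition uminus_padic_int :: "'a padic_int \<Rightarrow> 'a padic_int"
  where "- x = Abs_padic_int (\<lambda>n. (- residue x n) mod int CARD('a) ^ n)"

definition times_padic_int :: "'a padic_int \<Rightarrow> 'a padic_int \<Rightarrow> 'a padic_int"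
  where "x * y = Abs_padic_int (\<lambda>n. (residue x n * residue y n) mod int CARD('a) ^ n)"

lemma residue_0 [simp]: "residue (0 :: 'a padic_int) n = 0"
  unfolding zero_padic_int_def by (subst residue_Abs) auto

lemma residue_1: "residue (1 :: 'a padic_int) n = 1 mod int CARD('a) ^ n"
  unfolding one_padic_int_def by (subst residue_Abs) auto

lemma residue_add:
  "residue (x + y :: 'a padic_int) n = (residue x n + residue y n) mod int CARD('a) ^ n"
  unfolding plus_padic_int_def
  by (subst residue_Abs) (auto intro!: mod_add_cong simp: residue_Suc_mod)

lemma residue_diff:
  "residue (x - y :: 'a padic_int) n = (residue x n - residue y n) mod int CARD('a) ^ n"
  unfolding minus_padic_int_def
  by (subst residue_Abs) (auto intro!: mod_diff_cong simp: residue_Suc_mod)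

lemma residue_uminus:
  "residue (- x :: 'a padic_int) n = (- residue x n) mod int CARD('a) ^ n"
  unfolding uminus_padic_int_def
  by (subst residue_Abs) (auto intro!: mod_minus_cong simp: residue_Suc_mod)

lemma residue_mult:
  "residue (x * y :: 'a padic_int) n = (residue x n * residue y n) mod int CARD('a) ^ n"
  unfolding times_padic_int_def
  by (subst residue_Abs) (auto intro!: mod_mult_cong simp: residue_Suc_mod)

instance
proof
  fix a b c :: "'a padic_int"
  show "a * b * c = a * (b * c)"
    by (rule padic_int_eqI) (simp add: residue_mult mod_simps mult.assoc)
  show "a * b = b * a"
    by (rule padic_int_eqI) (simp add: residue_mult mult.commute)
  show "1 * a = a"
    by (rule padic_int_eqI) (simp add: residue_mult residue_1 mod_simps)
  show "a + b + c = a + (b + c)"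
    by (rule padic_int_eqI) (simp add: residue_add mod_simps add.assoc)
  show "a + b = b + a"
    by (rule padic_int_eqI) (simp add: residue_add add.commute)
  show "0 + a = a"
    by (rule padic_int_eqI) (simp add: residue_add)
  show "- a + a = 0"
    by (rule padic_int_eqI) (simp add: residue_add residue_uminus mod_simps)
  show "a - b = a + - b"
    by (rule padic_int_eqI) (simp add: residue_add residue_uminus residue_diff mod_simps)
  show "(a + b) * c = a * c + b * c"
    by (rule padic_int_eqI) (simp add: residue_add residue_mult mod_simps algebra_simps)
  have "residue (1 :: 'a padic_int) 1 = 1"
    using prime_gt_1_nat[OF prime_card[where 'a = 'a]] by (simp add: residue_1)
  then show "(0 :: 'a padic_int) \<noteq> 1"
    using residue_0[of 1] by (metis zero_neq_one)
qed

end

lemma residue_of_nat: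
  "residue (of_nat k :: 'p :: prime_card padic_int) n = int k mod int CARD('p) ^ n"
  by (induction k) (simp_all add: residue_add residue_1 mod_simps)

instance padic_int :: (prime_card) ring_char_0
proof
  show "inj (of_nat :: nat \<Rightarrow> 'a padic_int)"
  proof (rule injI)
    fix k l :: nat
    assume eq: "(of_nat k :: 'a padic_int) = of_nat l"
    let ?n = "k + l"
    have "k + l < CARD('a) ^ ?n"
      using prime_gt_1_nat[OF prime_card[where 'a = 'a]] by (simp add: power_gt_expt)
    then have "int k < int CARD('a) ^ ?n" "int l < int CARD('a) ^ ?n"
      by (simp_all flip: of_nat_power)
    with arg_cong[OF eq, of "\<lambda>x. residue x ?n"] show "k = l"
      by (simp add: residue_of_nat)
  qed
qed

text \<open>As usual for integral domains in HOL, \<open>x div y\<close> is the exact quotient when it exists.\<close>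

instantiation padic_int :: (prime_card) divide
begin

definition divide_padic_int :: "'a padic_int \<Rightarrow> 'a padic_int \<Rightarrow> 'a padic_int"
  where "divide_padic_int x y = (if y \<noteq> 0 \<and> y dvd x then THE z. x = z * y else 0)"

instance ..

end

instance padic_int :: (prime_card) idom_divide
proof -
  have no_zero_div: "a * b \<noteq> 0" if "a \<noteq> 0" "b \<noteq> 0" for a b :: "'a padic_int"
  proof
    assume ab: "a * b = 0"
    from that obtain m n where "residue a m \<noteq> 0" "residue b n \<noteq> 0"
      using padic_int_eqI[of a 0] padic_int_eqI[of b 0] by auto
    let ?p = "int CARD('a)" and ?A = "residue a (m + n)" and ?B = "residue b (m + n)"
    have p: "prime ?p" using prime_card_int .
    have A: "\<not> ?p ^ m dvd ?A"
      using \<open>residue a m \<noteq> 0\<close> residue_mod_le[of m "m + n" a] by (simp add: dvd_eq_mod_eq_0)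
    have B: "\<not> ?p ^ n dvd ?B"
      using \<open>residue b n \<noteq> 0\<close> residue_mod_le[of n "m + n" b] by (simp add: dvd_eq_mod_eq_0)
    from A B have nz: "?A \<noteq> 0" "?B \<noteq> 0" by auto
    have "multiplicity ?p ?A < m" "multiplicity ?p ?B < n"
      using A B multiplicity_dvd'[of m ?p ?A] multiplicity_dvd'[of n ?p ?B] not_less by blast+
    moreover have "?p ^ (m + n) dvd ?A * ?B"
      using arg_cong[OF ab, of "\<lambda>x. residue x (m + n)"] by (simp add: residue_mult dvd_eq_mod_eq_0)
    then have "m + n \<le> multiplicity ?p (?A * ?B)"
      using nz p by (intro multiplicity_geI) auto
    then have "m + n \<le> multiplicity ?p ?A + multiplicity ?p ?B"
      using nz p by (simp add: prime_elem_multiplicity_mult_distrib)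
    ultimately show False by linarith
  qed
  have cancel: "a = c" if "b \<noteq> 0" "a * b = c * b" for a b c :: "'a padic_int"
    using no_zero_div[of "a - c" b] that by (auto simp: algebra_simps)
  show "OFCLASS('a padic_int, idom_divide_class)"
  proof
    fix a b :: "'a padic_int"
    show "a \<noteq> 0 \<Longrightarrow> b \<noteq> 0 \<Longrightarrow> a * b \<noteq> 0" by (rule no_zero_div)
    show "a div 0 = 0" by (simp add: divide_padic_int_def)
    assume b: "b \<noteq> 0"
    have "(THE z. a * b = z * b) = a"
      by (rule the_equality) (rule refl, rule cancel[OF b sym])
    with b show "a * b div b = a" by (simp add: divide_padic_int_def)
  qed
qed

instantiation padic_int :: (prime_card) topological_space
begin

definition open_padic_int :: "'a padic_int set \<Rightarrow> bool"
  where "open U \<longleftrightarrow> (\<forall>x\<in>U. \<exists>n. {y. residue y n = residue x n} \<subseteq> U)"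

instance
proof
  show "open (UNIV :: 'a padic_int set)" by (simp add: open_padic_int_def)
next
  fix S T :: "'a padic_int set"
  assume ST: "open S" "open T"
  show "open (S \<inter> T)"
    unfolding open_padic_int_def
  proof
    fix x assume "x \<in> S \<inter> T"
    with ST obtain m n where mn: "{y. residue y m = residue x m} \<subseteq> S"
      "{y. residue y n = residue x n} \<subseteq> T"
      unfolding open_padic_int_def by blast
    have "{y. residue y (max m n) = residue x (max m n)} \<subseteq> S \<inter> T"
    proof
      fix y :: "'a padic_int"
      assume "y \<in> {y. residue y (max m n) = residue x (max m n)}"
      then have "residue y m = residue x m" "residue y n = residue x n"
        using residue_mod_le[of m "max m n" x] residue_mod_le[of m "max m n" y]
          residue_mod_le[of n "max m n" x] residue_mod_le[of n "max m n" y]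
        by simp_all
      with mn show "y \<in> S \<inter> T" by blast
    qed
    then show "\<exists>n. {y. residue y n = residue x n} \<subseteq> S \<inter> T" by blast
  qed
next
  fix K :: "'a padic_int set set"
  assume K: "\<forall>S\<in>K. open S"
  show "open (\<Union>K)"
    unfolding open_padic_int_def
  proof
    fix x assume "x \<in> \<Union>K"
    then obtain S where S: "S \<in> K" "x \<in> S" by blast
    with K obtain n where "{y. residue y n = residue x n} \<subseteq> S"
      unfolding open_padic_int_def by blast
    with S show "\<exists>n. {y. residue y n = residue x n} \<subseteq> \<Union>K" by blast
  qed
qed

end

abbreviation Zp_group :: "'p :: prime_card padic_int monoid"
  where "Zp_group \<equiv> \<lparr>carrier = UNIV, monoid.mult = (+), one = 0\<rparr>"

definition p_power_multiples :: "nat \<Rightarrow> 'p :: prime_card padic_int set"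
  where "p_power_multiples n = range (\<lambda>x. of_nat CARD('p) ^ n * x)"

definition Gamma :: "nat \<Rightarrow> 'p :: prime_card padic_int set monoid"
  where "Gamma n = Zp_group Mod p_power_multiples n"

definition proj :: "nat \<Rightarrow> 'p :: prime_card padic_int \<Rightarrow> 'p padic_int set"
  where "proj n x = p_power_multiples n #>\<^bsub>Zp_group\<^esub> x"

text \<open>The reduction map from level \<open>n + 1\<close> to level \<open>n\<close>, sending \<open>x + p^(n+1)\<close> to \<open>x + p^n\<close>.\<close>

definition Gamma_reduce :: "nat \<Rightarrow> 'p :: prime_card padic_int set \<Rightarrow> 'p padic_int set"
  where "Gamma_reduce n c = p_power_multiples n <#>\<^bsub>Zp_group\<^esub> c"


section \<open>The Iwasawa algebra\<close>

abbreviation Lambda :: "'p :: prime_card padic_int fps ring"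
  where "Lambda \<equiv> ring_of_type_algebra"

text \<open>
  This is the library's generalised binomial coefficient, whose type is constrained to fields.
  The quotient is exact: \<open>k!\<close> divides \<open>a (a - 1) \<dots> (a - k + 1)\<close> in \<open>\<int>\<^sub>p\<close>.
\<close>

definition padic_binomial :: "'p :: prime_card padic_int \<Rightarrow> nat \<Rightarrow> 'p padic_int"
  where "padic_binomial a k = (\<Prod>i=0..<k. a - of_nat i) div fact k"

definition one_plus_T_powr :: "'p :: prime_card padic_int \<Rightarrow> 'p padic_int fps"
  where "one_plus_T_powr a = Abs_fps (padic_binomial a)"


section \<open>Characteristic ideals\<close>

text \<open>
  The characteristic ideal of a finitely generated torsion module \<open>M\<close> over \<open>R\<close> is the product,
  over the prime ideals \<open>P\<close> of height one, of \<open>P\<close> raised to the length of the localisation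
  \<open>M\<^sub>P\<close> over \<open>R\<^sub>P\<close>. Elements of localisations are the classes of
  fractions \<open>m/s\<close>, represented as sets of pairs; the operations on classes are unions over
  representatives, all of which give the same class.
\<close>

definition regular_module :: "('r, 'b) ring_scheme \<Rightarrow> ('r, 'r) module"
  where "regular_module R = \<lparr>carrier = carrier R, monoid.mult = monoid.mult R, one = \<one>\<^bsub>R\<^esub>,
    ring.zero = \<zero>\<^bsub>R\<^esub>, add = add R, module.smult = monoid.mult R\<rparr>"

definition fraction ::
    "('r, 'b) ring_scheme \<Rightarrow> 'r set \<Rightarrow> ('r, 'm, 'c) module_scheme \<Rightarrow> 'm \<Rightarrow> 'r \<Rightarrow> ('m \<times> 'r) set"
  where "fraction R P M m s = {(n, t). n \<in> carrier M \<and> t \<in> carrier R - P \<and>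
    (\<exists>u \<in> carrier R - P. u \<odot>\<^bsub>M\<^esub> (t \<odot>\<^bsub>M\<^esub> m) = u \<odot>\<^bsub>M\<^esub> (s \<odot>\<^bsub>M\<^esub> n))}"

definition fractions ::
    "('r, 'b) ring_scheme \<Rightarrow> 'r set \<Rightarrow> ('r, 'm, 'c) module_scheme \<Rightarrow> ('m \<times> 'r) set set"
  where "fractions R P M = {fraction R P M m s | m s. m \<in> carrier M \<and> s \<in> carrier R - P}"

definition fraction_add ::
    "('r, 'b) ring_scheme \<Rightarrow> 'r set \<Rightarrow> ('r, 'm, 'c) module_scheme \<Rightarrow>
      ('m \<times> 'r) set \<Rightarrow> ('m \<times> 'r) set \<Rightarrow> ('m \<times> 'r) set"
  where "fraction_add R P M A B = (\<Union>(m, s)\<in>A. \<Union>(n, t)\<in>B.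
    fraction R P M (t \<odot>\<^bsub>M\<^esub> m \<oplus>\<^bsub>M\<^esub> s \<odot>\<^bsub>M\<^esub> n) (s \<otimes>\<^bsub>R\<^esub> t))"

definition fraction_smult ::
    "('r, 'b) ring_scheme \<Rightarrow> 'r set \<Rightarrow> ('r, 'm, 'c) module_scheme \<Rightarrow>
      ('r \<times> 'r) set \<Rightarrow> ('m \<times> 'r) set \<Rightarrow> ('m \<times> 'r) set"
  where "fraction_smult R P M A B = (\<Union>(r, s)\<in>A. \<Union>(m, t)\<in>B.
    fraction R P M (r \<odot>\<^bsub>M\<^esub> m) (s \<otimes>\<^bsub>R\<^esub> t))"

definition localized_ring :: "('r, 'b) ring_scheme \<Rightarrow> 'r set \<Rightarrow> ('r \<times> 'r) set ring"
  where "localized_ring R P =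
    \<lparr>carrier = fractions R P (regular_module R),
     monoid.mult = fraction_smult R P (regular_module R),
     one = fraction R P (regular_module R) \<one>\<^bsub>R\<^esub> \<one>\<^bsub>R\<^esub>,
     ring.zero = fraction R P (regular_module R) \<zero>\<^bsub>R\<^esub> \<one>\<^bsub>R\<^esub>,
     add = fraction_add R P (regular_module R)\<rparr>"

definition localized_module ::
    "('r, 'b) ring_scheme \<Rightarrow> 'r set \<Rightarrow> ('r, 'm, 'c) module_scheme \<Rightarrow>
      (('r \<times> 'r) set, ('m \<times> 'r) set) module"
  where "localized_module R P M =
    \<lparr>carrier = fractions R P M,
     monoid.mult = undefined,
     one = undefined,
     ring.zero = fraction R P M \<zero>\<^bsub>M\<^esub> \<one>\<^bsub>R\<^esub>,
     add = fraction_add R P M,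
     module.smult = fraction_smult R P M\<rparr>"

definition module_length :: "('r, 'b) ring_scheme \<Rightarrow> ('r, 'm, 'c) module_scheme \<Rightarrow> enat"
  where "module_length R M = Sup {enat n | n. \<exists>N :: nat \<Rightarrow> 'm set.
    (\<forall>i\<le>n. submodule (N i) R M) \<and> (\<forall>i<n. N i \<subset> N (Suc i))}"

definition height_one_primes :: "('r, 'b) ring_scheme \<Rightarrow> 'r set set"
  where "height_one_primes R = {P. primeideal P R \<and>
    (\<exists>Q. primeideal Q R \<and> Q \<subset> P) \<and>
    \<not> (\<exists>Q Q'. primeideal Q R \<and> primeideal Q' R \<and> Q \<subset> Q' \<and> Q' \<subset> P)}"

definition char_ideal :: "('r, 'b) ring_scheme \<Rightarrow> ('r, 'm, 'c) module_scheme \<Rightarrow> 'r set"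
  where "char_ideal R M = gfinprod (ideals_set R)
    (\<lambda>P. P [^]\<^bsub>ideals_set R\<^esub>
      the_enat (module_length (localized_ring R P) (localized_module R P M)))
    (height_one_primes R)"


section \<open>Graphs, divisors and Picard groups\<close>

locale serre_graph = wf_digraph G for G :: "('v, 'e) pre_digraph" +
  fixes bar :: "'e \<Rightarrow> 'e"
  assumes bar_in_arcs: "e \<in> arcs G \<Longrightarrow> bar e \<in> arcs G"
    and bar_neq: "e \<in> arcs G \<Longrightarrow> bar e \<noteq> e"
    and bar_bar: "e \<in> arcs G \<Longrightarrow> bar (bar e) = e"
    and tail_bar: "e \<in> arcs G \<Longrightarrow> tail G (bar e) = head G e"

abbreviation Div :: "('v, 'e) pre_digraph \<Rightarrow> ('v \<Rightarrow>\<^sub>0 int) monoid"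
  where "Div Y \<equiv> free_Abelian_group (verts Y)"

definition divisor_degree :: "('v \<Rightarrow>\<^sub>0 int) \<Rightarrow> int"
  where "divisor_degree D = (\<Sum>w \<in> Poly_Mapping.keys D. Poly_Mapping.lookup D w)"

definition Div0 :: "('v, 'e) pre_digraph \<Rightarrow> ('v \<Rightarrow>\<^sub>0 int) monoid"
  where "Div0 Y = (Div Y)\<lparr>carrier := {D \<in> carrier (Div Y). divisor_degree D = 0}\<rparr>"

definition laplacian :: "('v, 'e) pre_digraph \<Rightarrow> ('v \<Rightarrow>\<^sub>0 int) \<Rightarrow> ('v \<Rightarrow>\<^sub>0 int)"
  where "laplacian Y = frag_extend (\<lambda>w.
    frag_cmul (int (out_degree Y w)) (frag_of w) - (\<Sum>e \<in> out_arcs Y w. frag_of (head Y e)))"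

definition principal_divisors :: "('v, 'e) pre_digraph \<Rightarrow> ('v \<Rightarrow>\<^sub>0 int) set"
  where "principal_divisors Y = laplacian Y ` carrier (Div Y)"

definition Pic0 :: "('v, 'e) pre_digraph \<Rightarrow> ('v \<Rightarrow>\<^sub>0 int) set monoid"
  where "Pic0 Y = Div0 Y Mod principal_divisors Y"

definition pushforward :: "('v \<Rightarrow> 'w) \<Rightarrow> ('v \<Rightarrow>\<^sub>0 int) \<Rightarrow> ('w \<Rightarrow>\<^sub>0 int)"
  where "pushforward \<phi> = frag_extend (\<lambda>w. frag_of (\<phi> w))"

definition Pic0_map ::
    "('w, 'f) pre_digraph \<Rightarrow> ('v \<Rightarrow> 'w) \<Rightarrow> ('v \<Rightarrow>\<^sub>0 int) set \<Rightarrow> ('w \<Rightarrow>\<^sub>0 int) set"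
  where "Pic0_map Z \<phi> c =
    the_elem ((\<lambda>D. principal_divisors Z #>\<^bsub>Div0 Z\<^esub> pushforward \<phi> D) ` c)"

definition p_primary_part :: "nat \<Rightarrow> ('a, 'b) monoid_scheme \<Rightarrow> 'a set"
  where "p_primary_part p A = {x \<in> carrier A. \<exists>n :: nat. x [^]\<^bsub>A\<^esub> (p ^ n) = \<one>\<^bsub>A\<^esub>}"


section \<open>Voltage graphs and the branched tower\<close>

definition voltage_graph ::
    "('a, 'b) monoid_scheme \<Rightarrow> ('v \<Rightarrow> 'a set) \<Rightarrow> ('v, 'e) pre_digraph \<Rightarrow> ('e \<Rightarrow> 'a) \<Rightarrow>
      ('v \<times> 'a set, 'e \<times> 'a) pre_digraph"
  where "voltage_graph A H X \<beta> =
    \<lparr>verts = {(v, H v #>\<^bsub>A\<^esub> \<sigma>) | v \<sigma>. v \<in> verts X \<and> \<sigma> \<in> carrier A},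
     arcs = arcs X \<times> carrier A,
     tail = (\<lambda>(s, \<sigma>). (tail X s, H (tail X s) #>\<^bsub>A\<^esub> \<sigma>)),
     head = (\<lambda>(s, \<sigma>). (head X s, H (head X s) #>\<^bsub>A\<^esub> (\<sigma> \<otimes>\<^bsub>A\<^esub> \<beta> s)))\<rparr>"

definition voltage_bar ::
    "('a, 'b) monoid_scheme \<Rightarrow> ('e \<Rightarrow> 'e) \<Rightarrow> ('e \<Rightarrow> 'a) \<Rightarrow> 'e \<times> 'a \<Rightarrow> 'e \<times> 'a"
  where "voltage_bar A bar \<beta> = (\<lambda>(s, \<sigma>). (bar s, \<sigma> \<otimes>\<^bsub>A\<^esub> \<beta> s))"

lemma serre_graph_voltage_graph:
  assumes "comm_group A" "serre_graph X bar" "\<And>s. s \<in> arcs X \<Longrightarrow> \<beta> s \<in> carrier A"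
    and "\<And>s. s \<in> arcs X \<Longrightarrow> \<beta> (bar s) = inv\<^bsub>A\<^esub> \<beta> s"
  shows "serre_graph (voltage_graph A H X \<beta>) (voltage_bar A bar \<beta>)"
proof -
  interpret A: comm_group A by fact
  interpret X: serre_graph X bar by fact
  let ?Y = "voltage_graph A H X \<beta>" and ?bar = "voltage_bar A bar \<beta>"
  note defs = voltage_graph_def voltage_bar_def
  have arcs: "e \<in> arcs ?Y \<longleftrightarrow> fst e \<in> arcs X \<and> snd e \<in> carrier A" for e
    by (cases e) (simp add: defs)
  show ?thesis
  proof (unfold_locales)
    fix e assume e: "e \<in> arcs ?Y"
    obtain s \<sigma> where [simp]: "e = (s, \<sigma>)" by (cases e)
    have s: "s \<in> arcs X" and \<sigma>: "\<sigma> \<in> carrier A" using e by (simp_all add: arcs)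
    note \<beta> = assms(3)[OF s]
    show "tail ?Y e \<in> verts ?Y"
      using X.tail_in_verts[OF s] \<sigma> by (simp add: defs) blast
    show "head ?Y e \<in> verts ?Y"
      using X.head_in_verts[OF s] A.m_closed[OF \<sigma> \<beta>] by (simp add: defs) blast
    show "?bar e \<in> arcs ?Y"
      using X.bar_in_arcs[OF s] A.m_closed[OF \<sigma> \<beta>] by (simp add: defs)
    show "?bar e \<noteq> e"
      using X.bar_neq[OF s] by (simp add: defs)
    show "?bar (?bar e) = e"
      using X.bar_bar[OF s] \<sigma> \<beta> assms(4)[OF s] by (simp add: defs A.m_assoc)
    show "tail ?Y (?bar e) = head ?Y e"
      using X.tail_bar[OF s] by (simp add: defs)
  qed
qed

definition layer ::
    "('v, 'e) pre_digraph \<Rightarrow> ('v \<Rightarrow> 'p :: prime_card padic_int set) \<Rightarrow> ('e \<Rightarrow> 'p padic_int) \<Rightarrow>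
      nat \<Rightarrow> ('v \<times> 'p padic_int set set, 'e \<times> 'p padic_int set) pre_digraph"
  where "layer X G \<alpha> n =
    voltage_graph (Gamma n) (\<lambda>v. proj n ` G v) X (\<lambda>s. proj n (\<alpha> s))"

definition layer_reduce ::
    "nat \<Rightarrow> 'v \<times> 'p :: prime_card padic_int set set \<Rightarrow> 'v \<times> 'p padic_int set set"
  where "layer_reduce n = (\<lambda>(v, C). (v, Gamma_reduce n ` C))"

definition layer_translate ::
    "nat \<Rightarrow> 'p :: prime_card padic_int \<Rightarrow> 'v \<times> 'p padic_int set set \<Rightarrow> 'v \<times> 'p padic_int set set"
  where "layer_translate n a = (\<lambda>(v, C). (v, C #>\<^bsub>Gamma n\<^esub> proj n a))"

text \<open>
  If \<open>\<gamma>\<close> is an automorphism of \<open>p\<close>-power order of a finite abelian \<open>p\<close>-group \<open>A\<close>, then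
  \<open>\<gamma> - 1\<close> is nilpotent on \<open>A\<close>, and \<open>T\<close> acting as \<open>\<gamma> - 1\<close> makes \<open>A\<close> (written
  multiplicatively here) a \<open>\<int>\<^sub>p[[T]]\<close>-module: the partial sums \<open>\<Sum>i<N. (f\<^sub>i mod p\<^sup>N) (\<gamma> - 1)\<^sup>i x\<close>
  are eventually constant, with value \<open>f x\<close>. This is the action of the completed group
  ring under \<open>\<gamma> \<mapsto> 1 + T\<close>.
\<close>

definition power_series_action ::
    "('a, 'b) monoid_scheme \<Rightarrow> ('a \<Rightarrow> 'a) \<Rightarrow> 'p :: prime_card padic_int fps \<Rightarrow> 'a \<Rightarrow> 'a"
  where "power_series_action A \<gamma> f x = (THE y. \<forall>\<^sub>F N in sequentially. y =
    (\<Otimes>\<^bsub>A\<^esub>i\<in>{..<N}. ((\<lambda>z. \<gamma> z \<otimes>\<^bsub>A\<^esub> inv\<^bsub>A\<^esub> z) ^^ i) x [^]\<^bsub>A\<^esub> residue (fps_nth f i) N))"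

definition Pic0_Lambda ::
    "('v, 'e) pre_digraph \<Rightarrow> ('v \<Rightarrow> 'p :: prime_card padic_int set) \<Rightarrow> ('e \<Rightarrow> 'p padic_int) \<Rightarrow>
      ('p padic_int fps, nat \<Rightarrow> ('v \<times> 'p padic_int set set \<Rightarrow>\<^sub>0 int) set) module"
  where "Pic0_Lambda X G \<alpha> =
    \<lparr>carrier = {x. \<forall>n. x n \<in> p_primary_part CARD('p) (Pic0 (layer X G \<alpha> n)) \<and>
       Pic0_map (layer X G \<alpha> n) (layer_reduce n) (x (Suc n)) = x n},
     monoid.mult = undefined,
     one = undefined,
     ring.zero = (\<lambda>n. \<one>\<^bsub>Pic0 (layer X G \<alpha> n)\<^esub>),
     add = (\<lambda>x y n. x n \<otimes>\<^bsub>Pic0 (layer X G \<alpha> n)\<^esub> y n),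
     module.smult = (\<lambda>f x n. power_series_action (Pic0 (layer X G \<alpha> n))
       (Pic0_map (layer X G \<alpha> n) (layer_translate n 1)) f (x n))\<rparr>"

definition valency_matrix ::
    "('v, 'e) pre_digraph \<Rightarrow> (nat \<Rightarrow> 'v) \<Rightarrow> nat \<Rightarrow> 'p :: prime_card padic_int fps mat"
  where "valency_matrix X v t =
    mat t t (\<lambda>(i, j). if i = j then of_nat (out_degree X (v (Suc i))) else 0)"

definition voltage_adjacency_matrix ::
    "('v, 'e) pre_digraph \<Rightarrow> ('e \<Rightarrow> 'p :: prime_card padic_int) \<Rightarrow> (nat \<Rightarrow> 'v) \<Rightarrow> nat \<Rightarrow>
      'p padic_int fps mat"
  where "voltage_adjacency_matrix X \<alpha> v t =
    mat t t (\<lambda>(i, j). \<Sum>s | s \<in> arcs X \<and> tail X s = v (Suc j) \<and> head X s = v (Suc i).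
      one_plus_T_powr (\<alpha> s))"

end

theory Submission
  imports Defs "HOL-Library.Function_Algebras"
begin

text \<open>
  Write \<open>\<gamma> = 1 + T\<close>, \<open>\<omega>\<^sub>n = \<gamma>^(p^n) - 1\<close>. As a module over \<open>\<int>[\<gamma>]\<close>, \<open>Div(X\<^sub>n)\<close> is the sum over the
  vertices \<open>v\<close> of \<open>\<int>[\<gamma>] / \<omega>\<^sub>n\<close> (unramified) or \<open>\<int>[\<gamma>] / \<omega>\<^sub>k\<close>, \<open>k = min(k\<^sub>v, n)\<close> (ramified), and the
  Laplacian of a ramified vertex carries the factor \<open>\<omega>\<^sub>n / \<omega>\<^sub>k\<close>, which tends to \<open>0\<close> in the Iwasawa
  algebra. Hence, by compactness, the limit of the \<open>p\<close>-parts of the Picard groups is the degree zero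
  part of \<open>\<Lambda>\<^sup>g\<close> modulo the columns of a square block triangular matrix with diagonal blocks
  \<open>D - A\<^sub>\<rho>\<close> and \<open>diag(\<omega>\<^sub>k)\<close>. A basis of the degree zero part is given by a matrix of determinant \<open>T\<close>.

  The length of the localisation of the cokernel of a square matrix at a height one prime \<open>(\<pi>)\<close> is
  the \<open>\<pi>\<close>-adic valuation of its determinant, and the Iwasawa algebra has unique factorisation, so the
  characteristic ideal of such a cokernel is generated by the determinant.
\<close>


section \<open>Lengths of localised modules\<close>

text \<open>Two kinds of object have to be matched: the layers give finite abelian groups with a
  prime-to-\<open>p\<close> part and integer coefficients, while the conclusion concerns power
  series over the p-adic integers. The layers are therefore treated with integer polynomials in
  \<gamma>, and power series enter only as limits for the filtration by the powers of the ideal (p,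
  T). This filtration also drives the algebra of the Iwasawa algebra: its intersection is zero,
  which bounds the exponent of a prime element and makes factorisation terminate, and its quotients
  are finite, which yields limit points. A second obstacle is that the determinant has to be
  nonzero, since otherwise the lengths are infinite. With a ramified vertex the block
  \<open>D - A\<close> is already nonsingular at T = 0, where it is the Laplacian of X with vertices
  deleted. Without one it is singular there, and the connectedness of all layers takes over: a null
  vector would be constant on each of them, hence killed by T. Localisations are replaced by
  saturated submodules of one fixed module, so that additivity of length becomes a statement about
  chains.\<close>

locale saturation = Modules.module scale for scale :: "'a :: comm_ring_1 \<Rightarrow> 'm :: ab_group_add \<Rightarrow> 'm" +
  fixes S :: "'a set"
  assumes one_in_S: "1 \<in> S" and mult_in_S: "s \<in> S \<Longrightarrow> t \<in> S \<Longrightarrow> s * t \<in> S"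
begin

text \<open>For submodules \<open>L\<close> and \<open>F\<close> these are the submodules of the
  localisation of \<open>F / L\<close> at \<open>S\<close>, pulled back to \<open>F\<close>;
  saturation says that elements of \<open>S\<close> can be cancelled.\<close>

definition sat_sub :: "'m set \<Rightarrow> 'm set \<Rightarrow> 'm set \<Rightarrow> bool"
  where "sat_sub L F H \<longleftrightarrow> subspace H \<and> L \<subseteq> H \<and> H \<subseteq> F \<and>
    (\<forall>s\<in>S. \<forall>x\<in>F. scale s x \<in> H \<longrightarrow> x \<in> H)"

definition sat_chain :: "'m set \<Rightarrow> 'm set \<Rightarrow> nat \<Rightarrow> bool"
  where "sat_chain L F n \<longleftrightarrow> (\<exists>H :: nat \<Rightarrow> 'm set. (\<forall>i\<le>n. sat_sub L F (H i)) \<and> (\<forall>i<n. H i \<subset> H (Suc i)))"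

text \<open>A relation and not a function, so that finiteness of the length is part of the
  assertion.\<close>

definition sat_length :: "'m set \<Rightarrow> 'm set \<Rightarrow> nat \<Rightarrow> bool"
  where "sat_length L F n \<longleftrightarrow> sat_chain L F n \<and> (\<forall>m. sat_chain L F m \<longrightarrow> m \<le> n)"

definition sat :: "'m set \<Rightarrow> 'm set \<Rightarrow> 'm set"
  where "sat F N = {x \<in> F. \<exists>s\<in>S. scale s x \<in> N}"

lemma subspace_sat:
  assumes F: "subspace F" and N: "subspace N"
  shows "subspace (sat F N)"
proof (rule subspaceI)
  show "0 \<in> sat F N"
    using one_in_S subspace_0[OF F] subspace_0[OF N] by (auto simp: sat_def)
next
  fix x y assume "x \<in> sat F N" "y \<in> sat F N"
  then obtain s t where *: "x \<in> F" "y \<in> F" "s \<in> S" "t \<in> S" "scale s x \<in> N" "scale t y \<in> N"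
    by (auto simp: sat_def)
  have "scale (s * t) (x + y) = scale t (scale s x) + scale s (scale t y)"
    by (simp add: scale_right_distrib mult.commute)
  also have "\<dots> \<in> N" using * N by (blast intro: subspace_add subspace_scale)
  finally show "x + y \<in> sat F N"
    using * F mult_in_S by (auto simp: sat_def intro!: subspace_add)
next
  fix c x assume "x \<in> sat F N"
  then obtain s where *: "x \<in> F" "s \<in> S" "scale s x \<in> N" by (auto simp: sat_def)
  have "scale s (scale c x) = scale c (scale s x)" by (simp add: mult.commute)
  also have "\<dots> \<in> N" using * N by (blast intro: subspace_scale)
  finally show "scale c x \<in> sat F N" using * F by (auto simp: sat_def intro!: subspace_scale)
qed

lemma subset_sat: "N \<subseteq> F \<Longrightarrow> N \<subseteq> sat F N"
  using one_in_S by (auto simp: sat_def intro!: bexI[of _ 1])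

lemma sat_sub_sat:
  assumes F: "subspace F" and N: "subspace N" and "L \<subseteq> N" "N \<subseteq> F"
  shows "sat_sub L F (sat F N)"
  unfolding sat_sub_def
proof (intro conjI ballI impI)
  fix s x assume "s \<in> S" "x \<in> F" "scale s x \<in> sat F N"
  then obtain t where t: "t \<in> S" "scale t (scale s x) \<in> N" by (auto simp: sat_def)
  then show "x \<in> sat F N"
    using \<open>x \<in> F\<close> mult_in_S[OF t(1) \<open>s \<in> S\<close>] by (auto simp: sat_def)
qed (use assms subset_sat[of N F] subspace_sat[OF F N] in \<open>auto simp: sat_def\<close>)

lemma strict_chain_mono:
  assumes "\<And>i. i < n \<Longrightarrow> H i \<subset> (H (Suc i) :: 'm set)" "i \<le> j" "j \<le> n"
  shows "H i \<subseteq> H j"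
  using assms(2,3)
proof (induction j rule: dec_induct)
  case (step j) then show ?case using assms(1)[of j] by auto
qed auto

text \<open>Dropping repetitions leaves a strict chain with one step for each strict inclusion. Its
  last member is recorded because the induction appends to it.\<close>

lemma sat_chain_of_weak_chain:
  assumes "\<And>i. i \<le> n \<Longrightarrow> sat_sub L F (H i)" "\<And>i. i < n \<Longrightarrow> H i \<subseteq> H (Suc i)"
  shows "\<exists>H'. (\<forall>i\<le>card {i. i < n \<and> H i \<noteq> H (Suc i)}. sat_sub L F (H' i)) \<and>
    (\<forall>i<card {i. i < n \<and> H i \<noteq> H (Suc i)}. H' i \<subset> H' (Suc i)) \<and>
    H' (card {i. i < n \<and> H i \<noteq> H (Suc i)}) = H n"
  using assms
proof (induction n)
  case 0
  then show ?case by (intro exI[of _ H]) auto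
next
  case (Suc n)
  let ?A = "{i. i < n \<and> H i \<noteq> H (Suc i)}" and ?B = "{i. i < Suc n \<and> H i \<noteq> H (Suc i)}"
  from Suc obtain H' where H': "\<forall>i\<le>card ?A. sat_sub L F (H' i)"
    "\<forall>i<card ?A. H' i \<subset> H' (Suc i)" "H' (card ?A) = H n" by force
  show ?case
  proof (cases "H n = H (Suc n)")
    case True
    then have "?B = ?A" by (auto simp: less_Suc_eq)
    with H' True show ?thesis by auto
  next
    case False
    then have "?B = insert n ?A" by (auto simp: less_Suc_eq)
    then have c: "card ?B = Suc (card ?A)" by simp
    have sub: "H n \<subset> H (Suc n)" using False Suc.prems(2)[of n] by auto
    let ?H = "\<lambda>i. if i \<le> card ?A then H' i else H (Suc n)"
    have "(\<forall>i\<le>card ?B. sat_sub L F (?H i)) \<and> (\<forall>i<card ?B. ?H i \<subset> ?H (Suc i)) \<and>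
        ?H (card ?B) = H (Suc n)"
      unfolding c using H' sub Suc.prems(1)[of "Suc n"] by (auto simp: less_Suc_eq)
    then show ?thesis by (intro exI[of _ ?H])
  qed
qed

text \<open>A chain below \<open>N\<close>, saturated in \<open>F\<close>, is glued to a chain above
  \<open>N\<close>. Conversely, a chain in \<open>F\<close> has traces on \<open>N\<close> and on
  \<open>F / N\<close>, and each of its steps is strict in at least one of them.\<close>

lemma sat_length_add:
  assumes L: "subspace L" and N: "subspace N" and F: "subspace F" and LN: "L \<subseteq> N" and NF: "N \<subseteq> F"
    and a: "sat_length L N a" and b: "sat_length N F b"
  shows "sat_length L F (a + b)"
proof -
  from a b obtain H G where H: "\<And>i. i \<le> a \<Longrightarrow> sat_sub L N (H i)" "\<And>i. i < a \<Longrightarrow> H i \<subset> H (Suc i)"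
    and G: "\<And>i. i \<le> b \<Longrightarrow> sat_sub N F (G i)" "\<And>i. i < b \<Longrightarrow> G i \<subset> G (Suc i)"
    unfolding sat_length_def sat_chain_def by metis
  have sub: "sat_sub L F (sat F (H i))" if "i \<le> a" for i
    using H(1)[OF that] NF by (intro sat_sub_sat[OF F]) (auto simp: sat_sub_def)
  \<comment> \<open>Intersecting with \<open>N\<close> undoes the saturation in \<open>F\<close>, so
    strict inclusions survive it.\<close>
  have HN: "sat F (H i) \<inter> N = H i" if "i \<le> a" for i
    using H(1)[OF that] NF subset_sat[of "H i" F] by (auto simp: sat_sub_def sat_def)
  have step: "sat F (H i) \<subset> sat F (H (Suc i))" if "i < a" for i
  proof -
    have "sat F (H i) \<subseteq> sat F (H (Suc i))" using H(2)[OF that] by (auto simp: sat_def)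
    moreover have "sat F (H i) \<noteq> sat F (H (Suc i))"
      using HN[of i] HN[of "Suc i"] H(2)[OF that] that by auto
    ultimately show ?thesis by auto
  qed
  have top: "sat F (H i) \<subseteq> G 0" if "i \<le> a" for i
    using H(1)[OF that] G(1)[of 0] by (auto simp: sat_sub_def sat_def)
  have subG: "sat_sub L F (G i)" if "i \<le> b" for i
    using G(1)[OF that] LN by (auto simp: sat_sub_def)
  have "sat_chain L F (a + b)"
    unfolding sat_chain_def
  \<comment> \<open>The saturation of \<open>H a\<close> is left out and \<open>G 0\<close>, which
    contains it, takes its place: the two chains share this index.\<close>
  proof (intro exI[of _ "\<lambda>i. if i < a then sat F (H i) else G (i - a)"] conjI allI impI)
    fix i assume "i \<le> a + b"
    then show "sat_sub L F (if i < a then sat F (H i) else G (i - a))"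
      using sub subG by auto
  next
    fix i assume i: "i < a + b"
    consider "Suc i < a" | "Suc i = a" | "a \<le> i" by linarith
    then show "(if i < a then sat F (H i) else G (i - a)) \<subset>
        (if Suc i < a then sat F (H (Suc i)) else G (Suc i - a))"
    proof cases
      case 1 then show ?thesis using step[of i] by auto
    next
      case 2 then show ?thesis using step[of i] top[of "Suc i"] by auto
    next
      case 3 then show ?thesis using G(2)[of "i - a"] i by (auto simp: Suc_diff_le)
    qed
  qed
  moreover have "n \<le> a + b" if "sat_chain L F n" for n
  proof -
    from that obtain K where K: "\<And>i. i \<le> n \<Longrightarrow> sat_sub L F (K i)" "\<And>i. i < n \<Longrightarrow> K i \<subset> K (Suc i)"
      unfolding sat_chain_def by metis
    define P where "P i = K i \<inter> N" for i
    define Q where "Q i = sat F {x + y | x y. x \<in> K i \<and> y \<in> N}" for i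
    have Psub: "sat_sub L N (P i)" if "i \<le> n" for i
      using K(1)[OF that] N LN NF by (auto simp: sat_sub_def P_def intro!: subspace_inter)
    have Qsub: "sat_sub N F (Q i)" if "i \<le> n" for i
      unfolding Q_def
    proof (rule sat_sub_sat[OF F])
      note Ki = K(1)[OF that, unfolded sat_sub_def]
      show "subspace {x + y |x y. x \<in> K i \<and> y \<in> N}"
      proof (rule subspaceI)
        show "0 \<in> {x + y |x y. x \<in> K i \<and> y \<in> N}"
          using subspace_0[of "K i"] subspace_0[OF N] Ki by force
      next
        fix u w assume "u \<in> {x + y |x y. x \<in> K i \<and> y \<in> N}" "w \<in> {x + y |x y. x \<in> K i \<and> y \<in> N}"
        then obtain a b c d where "u = a + b" "w = c + d" "a \<in> K i" "c \<in> K i" "b \<in> N" "d \<in> N" by blast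
        moreover from this have "u + w = (a + c) + (b + d)" by simp
        ultimately show "u + w \<in> {x + y |x y. x \<in> K i \<and> y \<in> N}"
          using Ki subspace_add[OF N] subspace_add[of "K i"] by blast
      next
        fix r w assume "w \<in> {x + y |x y. x \<in> K i \<and> y \<in> N}"
        then obtain c d where "w = c + d" "c \<in> K i" "d \<in> N" by blast
        moreover from this have "scale r w = scale r c + scale r d" by (simp add: scale_right_distrib)
        ultimately show "scale r w \<in> {x + y |x y. x \<in> K i \<and> y \<in> N}"
          using Ki subspace_scale[OF N] subspace_scale[of "K i"] by blast
      qed
      show "N \<subseteq> {x + y |x y. x \<in> K i \<and> y \<in> N}"
      proof
        fix y assume "y \<in> N"
        then show "y \<in> {x + y |x y. x \<in> K i \<and> y \<in> N}"
          using Ki subspace_0[of "K i"] add_0[of y] by (metis (mono_tags, lifting) mem_Collect_eq)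
      qed
      show "{x + y |x y. x \<in> K i \<and> y \<in> N} \<subseteq> F"
        using Ki NF subspace_add[OF F] by blast
    qed
    have Pm: "P i \<subseteq> P (Suc i)" and Qm: "Q i \<subseteq> Q (Suc i)" if "i < n" for i
      using K(2)[OF that] by (auto simp: P_def Q_def sat_def)
    define CP where "CP = {i. i < n \<and> P i \<noteq> P (Suc i)}"
    define CQ where "CQ = {i. i < n \<and> Q i \<noteq> Q (Suc i)}"
    have "\<exists>H'. (\<forall>i\<le>card CP. sat_sub L N (H' i)) \<and> (\<forall>i<card CP. H' i \<subset> H' (Suc i))"
      using sat_chain_of_weak_chain[of n L N P] Psub Pm unfolding CP_def by blast
    then have "card CP \<le> a" using a unfolding sat_length_def sat_chain_def by blast
    moreover have "\<exists>H'. (\<forall>i\<le>card CQ. sat_sub N F (H' i)) \<and> (\<forall>i<card CQ. H' i \<subset> H' (Suc i))"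
      using sat_chain_of_weak_chain[of n N F Q] Qsub Qm unfolding CQ_def by blast
    then have "card CQ \<le> b" using b unfolding sat_length_def sat_chain_def by blast
    moreover have "{..<n} \<subseteq> CP \<union> CQ"
    proof
      fix i assume "i \<in> {..<n}"
      then have i: "i < n" by simp
      show "i \<in> CP \<union> CQ"
      proof (rule ccontr)
        assume "i \<notin> CP \<union> CQ"
        then have eq: "P i = P (Suc i)" "Q i = Q (Suc i)" using i by (auto simp: CP_def CQ_def)
        have Ki: "sat_sub L F (K i)" and Ki': "sat_sub L F (K (Suc i))" using K(1) i by auto
        \<comment> \<open>The modular law with denominators: for x in \<open>K (Suc i)\<close> some
          s x equals y + z with y in \<open>K i\<close> and z in \<open>N\<close>. Then z lies in
          the larger trace on \<open>N\<close>, hence in the smaller one, and s is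
          cancelled.\<close>
        have "K (Suc i) \<subseteq> K i"
        proof
          fix x assume x: "x \<in> K (Suc i)"
          have xF: "x \<in> F" using Ki' x by (auto simp: sat_sub_def)
          have "x \<in> Q (Suc i)"
          proof -
            have "scale 1 x = x + 0" by simp
            then show ?thesis using x xF one_in_S subspace_0[OF N] unfolding Q_def sat_def by blast
          qed
          then have "x \<in> Q i" using eq by simp
          then obtain s y z where s: "s \<in> S" "scale s x = y + z" "y \<in> K i" "z \<in> N"
            unfolding Q_def sat_def by blast
          have "y \<in> K (Suc i)" using s(3) K(2)[OF i] by auto
          then have "z \<in> K (Suc i)"
            using s(2) Ki' x subspace_diff[of "K (Suc i)" "scale s x" y] subspace_scale[of "K (Suc i)" x s]
            by (auto simp: sat_sub_def)
          then have "z \<in> P (Suc i)" using s by (simp add: P_def)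
          then have "z \<in> K i" using eq by (auto simp: P_def)
          then have "scale s x \<in> K i" using s Ki by (auto simp: sat_sub_def intro!: subspace_add)
          then show "x \<in> K i" using s xF Ki by (auto simp: sat_sub_def)
        qed
        then show False using K(2)[OF i] by auto
      qed
    qed
    then have "n \<le> card (CP \<union> CQ)"
      using card_mono[of "CP \<union> CQ" "{..<n}"] by (auto simp: CP_def CQ_def)
    ultimately show ?thesis using card_Un_le[of CP CQ] by linarith
  qed
  ultimately show ?thesis by (auto simp: sat_length_def)
qed

lemma sat_length_cong:
  assumes "\<And>H. sat_sub L F H \<longleftrightarrow> sat_sub L' F H" "sat_length L F n"
  shows "sat_length L' F n"
  using assms by (simp add: sat_length_def sat_chain_def)

lemma sat_length_refl:
  assumes "subspace L" shows "sat_length L L 0"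
proof -
  have "sat_sub L L H \<longleftrightarrow> H = L" for H using assms by (auto simp: sat_sub_def)
  then show ?thesis
    by (auto simp: sat_length_def sat_chain_def)
qed

end

section \<open>Localisation at a principal prime: cyclic modules and square matrices\<close>

locale prime_saturation = Modules.module scale for scale :: "'a :: idom \<Rightarrow> 'm :: ab_group_add \<Rightarrow> 'm" +
  fixes \<pi> :: 'a
  assumes prime_pi: "prime_elem \<pi>"
    and pi_adic: "x \<noteq> 0 \<Longrightarrow> \<exists>n y. x = \<pi> ^ n * y \<and> \<not> \<pi> dvd y"

text \<open>The denominators are the elements outside (\<pi>). By \<open>pi_adic\<close> every
  nonzero element becomes a power of \<pi> times a unit, so the localised ring is a discrete
  valuation ring.\<close>

sublocale prime_saturation \<subseteq> saturation scale "{s. \<not> \<pi> dvd s}"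
proof unfold_locales
  show "1 \<in> {s. \<not> \<pi> dvd s}" using prime_elem_not_unit[OF prime_pi] by simp
  show "s * t \<in> {s. \<not> \<pi> dvd s}" if "s \<in> {s. \<not> \<pi> dvd s}" "t \<in> {s. \<not> \<pi> dvd s}" for s t
    using that prime_elem_dvd_mult_iff[OF prime_pi] by simp
qed

lemma prime_elem_power_dvd_multD:
  fixes \<pi> :: "'a :: idom"
  assumes "prime_elem \<pi>" "\<not> \<pi> dvd s" "\<pi> ^ j dvd s * r"
  shows "\<pi> ^ j dvd r"
  using assms(3)
proof (induction j arbitrary: r)
  case (Suc j)
  then have "\<pi> dvd s * r" by (metis dvd_mult_left power_Suc)
  then obtain r' where r': "r = \<pi> * r'"
    using prime_elem_dvd_multD[OF assms(1)] assms(2) by (metis dvdE)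
  then have "\<pi> * \<pi> ^ j dvd \<pi> * (s * r')" using Suc.prems(1) by (simp add: mult_ac)
  then have "\<pi> ^ j dvd s * r'" using assms(1) by (metis dvd_mult_cancel_left not_prime_elem_zero)
  then have "\<pi> ^ j dvd r'" by (rule Suc.IH)
  then show ?case unfolding r' power_Suc by (rule mult_dvd_mono[OF dvd_refl])
qed auto

context prime_saturation
begin

text \<open>The quotient is generated by \<open>e\<close> with annihilator
  (\<open>\<pi> ^ n * b\<close>), and \<open>b\<close> becomes a unit. What remains is R / (\<pi>^n)
  over a discrete valuation ring, whose submodules form the single chain generated by the
  \<open>\<pi> ^ j\<close>.\<close>

lemma sat_length_cyclic:
  assumes N: "subspace N" and a: "\<And>r. scale r e \<in> N \<longleftrightarrow> \<pi> ^ n * b dvd r" and b: "\<not> \<pi> dvd b"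
  shows "sat_length N {x + scale r e | x r. x \<in> N} n"
proof -
  let ?F = "{x + scale r e | x r. x \<in> N}"
  define I where "I j = {x + scale (r * \<pi> ^ j) e | x r. x \<in> N}" for j
  have pi0: "\<pi> \<noteq> 0" using prime_pi by auto
  have II: "x + scale (r * \<pi> ^ j) e \<in> I j" if "x \<in> N" for x r j
    using that unfolding I_def by blast
  have subI: "subspace (I j)" for j
  proof (rule subspaceI)
    have "0 = 0 + scale (0 * \<pi> ^ j) e" by simp
    then show "0 \<in> I j" using subspace_0[OF N] unfolding I_def by blast
  next
    fix x y assume "x \<in> I j" "y \<in> I j"
    then obtain x' r y' s where "x = x' + scale (r * \<pi> ^ j) e" "y = y' + scale (s * \<pi> ^ j) e" "x' \<in> N" "y' \<in> N"
      by (auto simp: I_def)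
    moreover from this have "x + y = (x' + y') + scale ((r + s) * \<pi> ^ j) e"
      by (simp add: scale_left_distrib distrib_right)
    ultimately show "x + y \<in> I j" using II[of "x' + y'" "r + s" j] subspace_add[OF N] by metis
  next
    fix c x assume "x \<in> I j"
    then obtain x' r where "x = x' + scale (r * \<pi> ^ j) e" "x' \<in> N" by (auto simp: I_def)
    moreover from this have "scale c x = scale c x' + scale ((c * r) * \<pi> ^ j) e"
      by (simp add: scale_right_distrib mult.assoc)
    ultimately show "scale c x \<in> I j" using II[of "scale c x'" "c * r" j] subspace_scale[OF N] by metis
  qed
  have memI: "scale r e \<in> I j \<longleftrightarrow> \<pi> ^ j dvd r" if "j \<le> n" for r j
  proof
    assume "scale r e \<in> I j"
    then obtain x s where "x \<in> N" "scale r e = x + scale (s * \<pi> ^ j) e" by (auto simp: I_def)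
    then have "scale (r - s * \<pi> ^ j) e \<in> N" by (simp add: scale_left_diff_distrib)
    then have "\<pi> ^ n * b dvd r - s * \<pi> ^ j" using a by simp
    then have "\<pi> ^ j dvd r - s * \<pi> ^ j"
      using that by (meson dvd_mult_left dvd_trans le_imp_power_dvd)
    then have "\<pi> ^ j dvd (r - s * \<pi> ^ j) + s * \<pi> ^ j" by (intro dvd_add) auto
    then show "\<pi> ^ j dvd r" by simp
  next
    assume "\<pi> ^ j dvd r"
    then obtain s where "r = s * \<pi> ^ j" by (auto simp: dvd_def mult.commute)
    then show "scale r e \<in> I j" using II[OF subspace_0[OF N], of s j] by simp
  qed
  have satI: "sat_sub N ?F (I j)" if "j \<le> n" for j
    unfolding sat_sub_def
  proof (intro conjI ballI impI)
    show "N \<subseteq> I j" using II[of _ 0 j] by auto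
    show "I j \<subseteq> ?F" unfolding I_def by blast
    fix s x assume s: "s \<in> {s. \<not> \<pi> dvd s}" and "x \<in> ?F" and sx: "scale s x \<in> I j"
    then obtain y r where x: "x = y + scale r e" "y \<in> N" by blast
    have yI: "y \<in> I j" using x(2) \<open>N \<subseteq> I j\<close> by blast
    have "scale s x - scale s y = scale (s * r) e" by (simp add: x scale_right_distrib)
    then have "scale (s * r) e \<in> I j"
      using subspace_diff[OF subI sx subspace_scale[OF subI yI, of s]] by simp
    then have "\<pi> ^ j dvd s * r" using memI that by simp
    moreover have "\<not> \<pi> dvd s" using s by simp
    ultimately have "\<pi> ^ j dvd r" using prime_elem_power_dvd_multD[OF prime_pi] by blast
    then have "scale r e \<in> I j" using memI[OF that] by simp
    then show "x \<in> I j" using x(1) yI subspace_add[OF subI] by metis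
  qed (rule subI)
  have dec: "I (Suc j) \<subset> I j" if "Suc j \<le> n" for j
  proof -
    have "I (Suc j) \<subseteq> I j"
    proof
      fix x assume "x \<in> I (Suc j)"
      then obtain y r where "x = y + scale (r * \<pi> ^ Suc j) e" "y \<in> N" unfolding I_def by blast
      then have "x = y + scale ((r * \<pi>) * \<pi> ^ j) e" by (simp add: mult_ac)
      then show "x \<in> I j" using II[OF \<open>y \<in> N\<close>] by metis
    qed
    moreover have "scale (\<pi> ^ j) e \<in> I j" using memI[of j "\<pi> ^ j"] that by simp
    moreover have "\<not> \<pi> ^ Suc j dvd \<pi> ^ j"
      using prime_pi pi0 by (metis dvd_times_right_cancel_iff mult.right_neutral mult.commute power_Suc prime_elem_not_unit power_not_zero)
    then have "scale (\<pi> ^ j) e \<notin> I (Suc j)" using memI[of "Suc j" "\<pi> ^ j"] that by simp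
    ultimately show ?thesis by auto
  qed
  have "sat_chain N ?F n"
    unfolding sat_chain_def
  proof (intro exI[of _ "\<lambda>i. I (n - i)"] conjI allI impI)
    fix i assume "i < n"
    then show "I (n - i) \<subset> I (n - Suc i)" using dec[of "n - Suc i"] by (simp add: Suc_diff_Suc)
  qed (use satI in auto)
  moreover have "m \<le> n" if chain: "sat_chain N ?F m" for m
  proof -
    \<comment> \<open>The index j is the least exponent with \<open>scale (\<pi> ^ j) e\<close> in
      \<open>H\<close>. Any multiplier is a power of \<pi> times an element prime to \<pi>, and
      saturation cancels the latter.\<close>
    have cls: "\<exists>j\<le>n. H = I j" if H: "sat_sub N ?F H" for H
    proof -
      have Hs: "subspace H" "N \<subseteq> H" "H \<subseteq> ?F" and sH: "\<And>s x. \<not> \<pi> dvd s \<Longrightarrow> x \<in> ?F \<Longrightarrow> scale s x \<in> H \<Longrightarrow> x \<in> H"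
        using H by (auto simp: sat_sub_def)
      have eF: "scale r e \<in> ?F" for r using subspace_0[OF N] add_0 by (metis (mono_tags, lifting) mem_Collect_eq)
      have "scale (b * \<pi> ^ n) e \<in> H" using a[of "b * \<pi> ^ n"] Hs(2) by (simp add: mult.commute subsetD)
      then have "scale b (scale (\<pi> ^ n) e) \<in> H" by simp
      then have nH: "scale (\<pi> ^ n) e \<in> H" using sH b eF by blast
      define j where "j = (LEAST j. scale (\<pi> ^ j) e \<in> H)"
      have jn: "j \<le> n" unfolding j_def by (rule Least_le) (rule nH)
      have jH: "scale (\<pi> ^ j) e \<in> H" unfolding j_def by (rule LeastI) (rule nH)
      have "I j \<subseteq> H"
      proof
        fix x assume "x \<in> I j"
        then obtain y r where "x = y + scale r (scale (\<pi> ^ j) e)" "y \<in> N" by (auto simp: I_def)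
        then show "x \<in> H" using Hs(1,2) jH by (metis subsetD subspace_add subspace_scale)
      qed
      moreover have "H \<subseteq> I j"
      proof
        fix x assume x: "x \<in> H"
        then obtain y r where y: "x = y + scale r e" "y \<in> N" using Hs(3) by blast
        then have re: "scale r e \<in> H"
          using Hs(1,2) x subspace_diff[of H x y] by auto
        have yI: "y \<in> I j" using y satI[OF jn] by (auto simp: sat_sub_def)
        have "scale r e \<in> I j"
        proof (cases "r = 0")
          case True then show ?thesis using subspace_0[OF subI] by simp
        next
          case False
          then obtain k s where r: "r = \<pi> ^ k * s" "\<not> \<pi> dvd s" using pi_adic by blast
          then have "scale s (scale (\<pi> ^ k) e) = scale r e" by (simp add: mult.commute)
          then have "scale s (scale (\<pi> ^ k) e) \<in> H" using re by (simp only:)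
          then have "scale (\<pi> ^ k) e \<in> H" using sH[OF r(2)] eF by blast
          then have "j \<le> k" unfolding j_def by (rule Least_le)
          then have "\<pi> ^ j dvd r" unfolding r by (intro dvd_mult2 le_imp_power_dvd)
          then show ?thesis using memI[OF jn] by simp
        qed
        then show "x \<in> I j" using y(1) yI subspace_add[OF subI] by metis
      qed
      ultimately show ?thesis using jn by blast
    qed
    from chain obtain H where H: "\<And>i. i \<le> m \<Longrightarrow> sat_sub N ?F (H i)" "\<And>i. i < m \<Longrightarrow> H i \<subset> H (Suc i)"
      unfolding sat_chain_def by blast
    have lt: "H i \<subset> H j" if "i < j" "j \<le> m" for i j
    proof -
      have "H i \<subset> H (Suc i)" using H(2) that by simp
      also have "H (Suc i) \<subseteq> H j" using that by (intro strict_chain_mono[of m] H(2)) auto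
      finally show ?thesis .
    qed
    have "inj_on H {..m}"
    proof (rule inj_onI)
      fix i j assume "i \<in> {..m}" "j \<in> {..m}" "H i = H j"
      then show "i = j" using lt[of i j] lt[of j i] by (cases i j rule: linorder_cases) auto
    qed
    then have "Suc m = card (H ` {..m})" by (simp add: card_image)
    also have "\<dots> \<le> card (I ` {..n})"
    proof (rule card_mono)
      show "H ` {..m} \<subseteq> I ` {..n}"
      proof
        fix h assume "h \<in> H ` {..m}"
        then obtain i where i: "h = H i" "i \<le> m" by auto
        with cls[OF H(1)] obtain j where "j \<le> n" "H i = I j" by blast
        with i show "h \<in> I ` {..n}" by simp
      qed
    qed simp
    also have "\<dots> \<le> Suc n" using card_image_le[of "{..n}" I] by simp
    finally show ?thesis by simp
  qed
  ultimately show ?thesis by (auto simp: sat_length_def)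
qed

end

text \<open>Vectors are functions on all of \<open>nat\<close>, which makes them an additive group
  by type class; only finitely many coordinates will be constrained.\<close>

definition fun_scale :: "'a :: idom \<Rightarrow> (nat \<Rightarrow> 'a) \<Rightarrow> nat \<Rightarrow> 'a"
  where "fun_scale c f = (\<lambda>i. c * f i)"

lemma module_fun_scale: "Modules.module fun_scale"
  by unfold_locales (auto simp: fun_scale_def fun_eq_iff algebra_simps)

text \<open>Coordinates from \<open>m\<close> on are free, so the quotient of all functions by this
  submodule is the cokernel of the first \<open>m\<close> rows. Raising \<open>m\<close> gives a
  descending filtration.\<close>

definition column_module :: "nat \<Rightarrow> nat \<Rightarrow> 'a :: idom mat \<Rightarrow> (nat \<Rightarrow> 'a) set"
  where "column_module m n A = {f. \<exists>u. \<forall>i<m. f i = (\<Sum>j<n. A $$ (i, j) * u j)}"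

lemma subspace_column_module: "module.subspace fun_scale (column_module m n A)"
proof -
  interpret Modules.module fun_scale by (rule module_fun_scale)
  show ?thesis
  proof (rule subspaceI)
    show "0 \<in> column_module m n A" by (auto simp: column_module_def intro!: exI[of _ "\<lambda>_. 0"])
  next
    fix f g assume "f \<in> column_module m n A" "g \<in> column_module m n A"
    then obtain u v where "\<forall>i<m. f i = (\<Sum>j<n. A $$ (i, j) * u j)" "\<forall>i<m. g i = (\<Sum>j<n. A $$ (i, j) * v j)"
      by (auto simp: column_module_def)
    then show "f + g \<in> column_module m n A"
      by (auto simp: column_module_def distrib_left sum.distrib intro!: exI[of _ "\<lambda>j. u j + v j"])
  next
    fix c f assume "f \<in> column_module m n A"
    then obtain u where "\<forall>i<m. f i = (\<Sum>j<n. A $$ (i, j) * u j)"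
      by (auto simp: column_module_def)
    then show "fun_scale c f \<in> column_module m n A"
      by (auto simp: column_module_def fun_scale_def sum_distrib_left mult_ac intro!: exI[of _ "\<lambda>j. c * u j"])
  qed
qed

lemma index_mult_mat_sum:
  assumes "A \<in> carrier_mat n m" "B \<in> carrier_mat m k" "i < n" "j < k"
  shows "(A * B) $$ (i, j) = (\<Sum>l<m. A $$ (i, l) * B $$ (l, j))"
  using assms by (auto simp: times_mat_def scalar_prod_def lessThan_atLeast0)

lemma prime_elem_power_cancel:
  fixes \<pi> :: "'a :: idom"
  assumes "prime_elem \<pi>" "\<pi> ^ m * a = \<pi> ^ n * b" "\<not> \<pi> dvd a" "\<not> \<pi> dvd b"
  shows "m = n"
proof -
  have *: "m \<le> n" if "\<pi> ^ m * a = \<pi> ^ n * b" "\<not> \<pi> dvd b" for m n a b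
  proof (rule ccontr)
    assume "\<not> m \<le> n"
    then obtain k where k: "m = n + Suc k" by (metis add_Suc_right less_imp_Suc_add not_le)
    have "\<pi> ^ n * (\<pi> ^ Suc k * a) = \<pi> ^ n * b" using that k by (simp add: power_add mult_ac)
    then have "\<pi> * (\<pi> ^ k * a) = b" using assms(1) by (simp add: mult_ac)
    then show False using that(2) by (metis dvd_triv_left)
  qed
  show ?thesis using *[of m a n b] *[of n b m a] assms by auto
qed

lemma prime_elem_dvd_prodD:
  fixes \<pi> :: "'a :: idom"
  assumes "prime_elem \<pi>" "finite I" "\<pi> dvd prod f I"
  shows "\<exists>i\<in>I. \<pi> dvd f i"
  using assms(2,3)
proof (induction I rule: finite_induct)
  case empty
  then show ?case using prime_elem_not_unit[OF assms(1)] by simp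
next
  case (insert i I)
  then show ?case using prime_elem_dvd_mult_iff[OF assms(1)] by auto
qed

context prime_saturation
begin

text \<open>Column elimination over the discrete valuation ring, cleared of denominators: the pivot
  is an entry of least \<pi>-adic valuation in its row, and the transformation is only invertible
  after localisation, that is, its determinant is prime to \<pi>.\<close>

lemma exists_column_triangularisation:
  assumes A: "(A :: 'a mat) \<in> carrier_mat n n" and "k \<le> n"
  shows "\<exists>E \<in> carrier_mat n n. \<not> \<pi> dvd det E \<and> (\<forall>i<k. \<forall>j<n. i < j \<longrightarrow> (A * E) $$ (i, j) = 0)"
  using assms(2)
proof (induction k)
  case 0
  have "\<not> \<pi> dvd det (1\<^sub>m n)" using prime_elem_not_unit[OF prime_pi] by simp
  then show ?case by (intro bexI[of _ "1\<^sub>m n"]) auto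
next
  case (Suc k)
  then obtain E where E: "E \<in> carrier_mat n n" "\<not> \<pi> dvd det E"
    "\<And>i j. i < k \<Longrightarrow> j < n \<Longrightarrow> i < j \<Longrightarrow> (A * E) $$ (i, j) = 0" by auto
  have k: "k < n" using Suc by simp
  define B where "B = A * E"
  have B: "B \<in> carrier_mat n n" using A E by (auto simp: B_def)
  have B0: "B $$ (i, j) = 0" if "i < k" "j < n" "i < j" for i j using E(3) that by (simp add: B_def)
  show ?case
  proof (cases "\<forall>j. k \<le> j \<and> j < n \<longrightarrow> B $$ (k, j) = 0")
    case True
    have "(A * E) $$ (i, j) = 0" if "i < Suc k" "j < n" "i < j" for i j
      using that B0[of i j] True by (auto simp: less_Suc_eq B_def)
    then show ?thesis using E by auto
  next
    case False
    \<comment> \<open>Some entry of row \<open>k\<close>, from the diagonal on, has valuation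
      exactly \<open>m\<close>. The least such \<open>m\<close> belongs to the pivot.\<close>
    define Q where "Q m \<longleftrightarrow> (\<exists>j y. k \<le> j \<and> j < n \<and> B $$ (k, j) = \<pi> ^ m * y \<and> \<not> \<pi> dvd y)" for m
    have "\<exists>m. Q m" using False pi_adic unfolding Q_def by blast
    then have "Q (LEAST m. Q m)" by (rule LeastI_ex)
    then obtain l a where l: "k \<le> l" "l < n" "B $$ (k, l) = \<pi> ^ (LEAST m. Q m) * a" "\<not> \<pi> dvd a"
      unfolding Q_def by blast
    have dvd: "\<exists>b. B $$ (k, j) = \<pi> ^ (LEAST m. Q m) * b" if "k \<le> j" "j < n" for j
    proof (cases "B $$ (k, j) = 0")
      case True then show ?thesis by (intro exI[of _ 0]) simp
    next
      case False
      then obtain m y where m: "B $$ (k, j) = \<pi> ^ m * y" "\<not> \<pi> dvd y" using pi_adic by blast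
      then have "Q m" using that unfolding Q_def by blast
      then have "(LEAST m. Q m) \<le> m" by (rule Least_le)
      then have "\<pi> ^ (LEAST m. Q m) dvd B $$ (k, j)" unfolding m(1) by (intro dvd_mult2 le_imp_power_dvd)
      then show ?thesis by (auto elim: dvdE)
    qed
    define W where "W = (if k = l then 1\<^sub>m n else swaprows_mat n k l :: 'a mat)"
    have W: "W \<in> carrier_mat n n" by (auto simp: W_def)
    have detW: "det W = 1 \<or> det W = -1" using det_swaprows_mat[OF k l(2)] by (auto simp: W_def)
    define C where "C = B * W"
    have C: "C \<in> carrier_mat n n" using B W by (auto simp: C_def)
    have Cij: "C $$ (i, j) = B $$ (i, if j = k then l else if j = l then k else j)" if "i < n" "j < n" for i j
    proof (cases "k = l")
      case True then show ?thesis using B by (auto simp: C_def W_def)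
    next
      case False
      then have "C = swapcols k l B" using swapcols_mat[OF B k l(2)] by (simp add: C_def W_def)
      then show ?thesis using that B False by auto
    qed
    have "\<forall>j. \<exists>b. k < j \<and> j < n \<longrightarrow> C $$ (k, j) = \<pi> ^ (LEAST m. Q m) * b"
    proof
      fix j show "\<exists>b. k < j \<and> j < n \<longrightarrow> C $$ (k, j) = \<pi> ^ (LEAST m. Q m) * b"
        using Cij[OF k, of j] dvd[of j] dvd[of k] k by auto
    qed
    then obtain b where b: "\<And>j. k < j \<Longrightarrow> j < n \<Longrightarrow> C $$ (k, j) = \<pi> ^ (LEAST m. Q m) * b j" by metis
    \<comment> \<open>Column \<open>j > k\<close> becomes \<open>a\<close> times itself minus
      \<open>b j\<close> times the pivot column. Scaling by \<open>a\<close>, the part of the pivot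
      prime to \<pi>, stands in for a division.\<close>
    define V where "V = mat n n (\<lambda>(i, j). if i = j then (if k < j then a else 1)
      else if i = k \<and> k < j then - b j else 0)"
    have V: "V \<in> carrier_mat n n" by (simp add: V_def)
    have "det V = prod_list (diag_mat V)"
      by (rule det_upper_triangular[OF _ V]) (auto simp: upper_triangular_def V_def)
    also have "\<dots> = (\<Prod>i = 0..<n. if k < i then a else 1)"
      using V by (simp add: prod_list_diag_prod V_def)
    finally have detV: "\<not> \<pi> dvd det V"
      using l(4) prime_elem_not_unit[OF prime_pi]
        prime_elem_dvd_prodD[OF prime_pi, of "{0..<n}" "\<lambda>i. if k < i then a else 1"]
      by (auto split: if_splits)
    have CV: "(C * V) $$ (i, j) = (if k < j then a * C $$ (i, j) - b j * C $$ (i, k) else C $$ (i, j))"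
      if "i < n" "j < n" for i j
    proof -
      have "(C * V) $$ (i, j) = (\<Sum>m<n. C $$ (i, m) * V $$ (m, j))"
        using index_mult_mat_sum[OF C V that] .
      also have "\<dots> = (\<Sum>m<n. (if m = j then C $$ (i, m) * (if k < j then a else 1) else 0) +
          (if m = k then (if k < j then - b j * C $$ (i, m) else 0) else 0))"
        using that by (intro sum.cong) (auto simp: V_def)
      also have "\<dots> = (if k < j then a * C $$ (i, j) - b j * C $$ (i, k) else C $$ (i, j))"
        using that k by (subst sum.distrib) (auto simp: sum.delta)
      finally show ?thesis .
    qed
    have eq: "A * (E * W * V) = C * V"
      using A E W V by (simp add: C_def B_def assoc_mult_mat[of _ n n _ n _ n])
    have "(A * (E * W * V)) $$ (i, j) = 0" if ij: "i < Suc k" "j < n" "i < j" for i j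
    proof (cases "i = k")
      case True
      then show ?thesis
        using ij CV[of k j] b[of j] Cij[OF k k] l(3) k unfolding eq by (simp add: mult_ac)
    next
      case False
      then have "i < k" using ij by simp
      then show ?thesis
        using ij CV[of i j] Cij[of i j] Cij[of i k] k l B0[of i j] B0[of i l] B0[of i k]
        unfolding eq by (auto split: if_splits)
    qed
    moreover have "\<not> \<pi> dvd det (E * W * V)"
      using E(2) detW detV E(1) W V
      by (auto simp: det_mult[of _ n] prime_elem_dvd_mult_iff[OF prime_pi])
    moreover have "E * W * V \<in> carrier_mat n n" using E W V by auto
    ultimately show ?thesis by blast
  qed
qed

end

text \<open>For a lower triangular matrix, imposing the rows one at a time gives cyclic quotients,
  each with a diagonal entry generating the annihilator; the lengths add up to the valuation of the
  determinant. A general matrix is first made triangular by \<open>E\<close>.\<close>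

lemma sat_length_column_module:
  fixes A :: "'a :: idom mat"
  assumes "prime_saturation (fun_scale :: 'a \<Rightarrow> _) \<pi>"
    and A: "A \<in> carrier_mat n n" and det: "det A = \<pi> ^ d * c" "\<not> \<pi> dvd c"
  shows "saturation.sat_length fun_scale {s. \<not> \<pi> dvd s} (column_module n n A) UNIV d"
proof -
  interpret prime_saturation fun_scale \<pi> by fact
  obtain E where E: "E \<in> carrier_mat n n" "\<not> \<pi> dvd det E"
    and tri: "\<And>i j. j < n \<Longrightarrow> i < j \<Longrightarrow> (A * E) $$ (i, j) = 0"
    using exists_column_triangularisation[OF A, of n] by fastforce
  define B where "B = A * E"
  have B: "B \<in> carrier_mat n n" using A E by (auto simp: B_def)
  have detB: "det B = (\<Prod>i<n. B $$ (i, i))"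
    using det_lower_triangular[of n B] tri B prod_list_diag_prod[of B]
    by (auto simp: B_def lessThan_atLeast0)
  have "det B = \<pi> ^ d * (c * det E)" using det E A by (simp add: B_def det_mult[of _ n] mult_ac)
  moreover have cE: "\<not> \<pi> dvd c * det E" using det(2) E(2) prime_elem_dvd_mult_iff[OF prime_pi] by simp
  ultimately have "det B \<noteq> 0" using prime_pi by (metis dvd_0_right mult_eq_0_iff not_prime_elem_zero power_not_zero)
  then have nz: "B $$ (i, i) \<noteq> 0" if "i < n" for i using detB that by auto
  have "\<forall>i. \<exists>e b. i < n \<longrightarrow> B $$ (i, i) = \<pi> ^ e * b \<and> \<not> \<pi> dvd b"
    using nz pi_adic by blast
  then obtain e b where eb: "\<And>i. i < n \<Longrightarrow> B $$ (i, i) = \<pi> ^ e i * b i" "\<And>i. i < n \<Longrightarrow> \<not> \<pi> dvd b i" by metis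
  have "det B = \<pi> ^ (\<Sum>i<n. e i) * (\<Prod>i<n. b i)"
    unfolding detB by (simp add: eb prod.distrib power_sum)
  moreover have "\<not> \<pi> dvd (\<Prod>i<n. b i)"
    using eb(2) prime_elem_dvd_prodD[OF prime_pi, of "{..<n}" b] by auto
  ultimately have d: "d = (\<Sum>i<n. e i)"
    using prime_elem_power_cancel[OF prime_pi] cE \<open>det B = \<pi> ^ d * (c * det E)\<close> by metis
  define N where "N k = column_module k n B" for k
  have N: "subspace (N k)" for k unfolding N_def by (rule subspace_column_module)
  have Nmono: "N (Suc k) \<subseteq> N k" for k
    unfolding N_def column_module_def by (auto intro: less_SucI)
  have step: "sat_length (N (Suc k)) (N k) (e k)" if k: "k < n" for k
  proof -
    let ?e = "(\<lambda>i. if i = k then 1 else 0) :: nat \<Rightarrow> 'a"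
    have "N k = {x + fun_scale r ?e |x r. x \<in> N (Suc k)}"
    proof (intro equalityI subsetI)
      fix f assume "f \<in> N k"
      then obtain u where u: "\<forall>i<k. f i = (\<Sum>j<n. B $$ (i, j) * u j)" by (auto simp: N_def column_module_def)
      let ?r = "f k - (\<Sum>j<n. B $$ (k, j) * u j)"
      have "f - fun_scale ?r ?e \<in> N (Suc k)"
        unfolding N_def column_module_def mem_Collect_eq
        using u by (intro exI[of _ u]) (auto simp: fun_scale_def less_Suc_eq)
      moreover have "f = (f - fun_scale ?r ?e) + fun_scale ?r ?e" by simp
      ultimately show "f \<in> {x + fun_scale r ?e |x r. x \<in> N (Suc k)}" by blast
    next
      fix f assume "f \<in> {x + fun_scale r ?e |x r. x \<in> N (Suc k)}"
      then obtain x r where f: "f = x + fun_scale r ?e" "x \<in> N (Suc k)" by blast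
      have "fun_scale r ?e \<in> N k"
        unfolding N_def column_module_def mem_Collect_eq
        by (intro exI[of _ "\<lambda>_. 0"]) (auto simp: fun_scale_def)
      then show "f \<in> N k" using f Nmono N by (auto intro: subspace_add)
    qed
    moreover have "fun_scale r ?e \<in> N (Suc k) \<longleftrightarrow> \<pi> ^ e k * b k dvd r" for r
    proof
      assume "fun_scale r ?e \<in> N (Suc k)"
      then obtain u where u: "\<And>i. i < Suc k \<Longrightarrow> fun_scale r ?e i = (\<Sum>j<n. B $$ (i, j) * u j)"
        by (auto simp: N_def column_module_def)
      have low: "(\<Sum>j<n. B $$ (i, j) * u j) = (\<Sum>j\<le>i. B $$ (i, j) * u j)" if "i \<le> k" for i
        using that k tri by (intro sum.mono_neutral_right) (auto simp: B_def)
      \<comment> \<open>Forward substitution: the rows before \<open>k\<close> are triangular with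
        nonzero diagonal and right-hand side zero.\<close>
      have z: "u i = 0" if "i < k" for i
        using that
      proof (induction i rule: less_induct)
        case (less i)
        have "0 = (\<Sum>j\<le>i. B $$ (i, j) * u j)" using u[of i] low[of i] less.prems by (simp add: fun_scale_def)
        also have "\<dots> = B $$ (i, i) * u i + (\<Sum>j<i. B $$ (i, j) * u j)"
          by (simp add: lessThan_Suc_atMost[symmetric])
        also have "(\<Sum>j<i. B $$ (i, j) * u j) = 0" using less by (intro sum.neutral) auto
        finally show ?case using nz[of i] less.prems k by simp
      qed
      have "r = (\<Sum>j\<le>k. B $$ (k, j) * u j)" using u[of k] low[of k] by (simp add: fun_scale_def)
      also have "\<dots> = B $$ (k, k) * u k + (\<Sum>j<k. B $$ (k, j) * u j)"
        by (simp add: lessThan_Suc_atMost[symmetric])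
      also have "(\<Sum>j<k. B $$ (k, j) * u j) = 0" using z by (intro sum.neutral) auto
      finally show "\<pi> ^ e k * b k dvd r" using eb(1)[OF k] by simp
    next
      assume "\<pi> ^ e k * b k dvd r"
      then obtain s where s: "r = B $$ (k, k) * s" using eb(1)[OF k] by (auto elim: dvdE)
      have "fun_scale r ?e i = (\<Sum>j<n. B $$ (i, j) * (if j = k then s else 0))" if "i < Suc k" for i
      proof -
        have "(\<Sum>j<n. B $$ (i, j) * (if j = k then s else 0)) = (\<Sum>j<n. if j = k then B $$ (i, k) * s else 0)"
          by (intro sum.cong) auto
        also have "\<dots> = B $$ (i, k) * s" using k by simp
        finally show ?thesis using that k tri[of k i] s by (cases "i = k") (auto simp: fun_scale_def B_def)
      qed
      then show "fun_scale r ?e \<in> N (Suc k)"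
        unfolding N_def column_module_def mem_Collect_eq by (intro exI[of _ "\<lambda>j. if j = k then s else 0"]) blast
    qed
    ultimately show ?thesis
      using sat_length_cyclic[OF N, of ?e "Suc k" "e k" "b k"] eb(2)[OF k] by simp
  qed
  have "sat_length (N k) UNIV (\<Sum>i<k. e i)" if "k \<le> n" for k
    using that
  proof (induction k)
    case 0
    have "N 0 = UNIV" by (auto simp: N_def column_module_def)
    then show ?case using sat_length_refl[OF N, of 0] by simp
  next
    case (Suc k)
    then show ?case
      using sat_length_add[OF N N subspace_UNIV Nmono _ step Suc.IH] by (simp add: add.commute)
  qed
  then have "sat_length (N n) UNIV d" using d by simp
  \<comment> \<open>The column module of \<open>B = A * E\<close> is contained in that of
    \<open>A\<close> and, by the adjugate of \<open>E\<close>, contains \<open>det E\<close> times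
    it. As \<open>det E\<close> is prime to \<pi>, the same saturated submodules lie above
    both.\<close>
  moreover have "sat_sub (N n) UNIV H \<longleftrightarrow> sat_sub (column_module n n A) UNIV H" for H
  proof -
    have "column_module n n A \<subseteq> H" if H: "sat_sub (N n) UNIV H"
    proof
      fix f assume "f \<in> column_module n n A"
      then obtain u where u: "\<And>i. i < n \<Longrightarrow> f i = (\<Sum>j<n. A $$ (i, j) * u j)" by (auto simp: column_module_def)
      let ?J = "adj_mat E"
      have J: "?J \<in> carrier_mat n n" "E * ?J = det E \<cdot>\<^sub>m 1\<^sub>m n" using adj_mat[OF E(1)] by auto
      have BJ: "B * ?J = det E \<cdot>\<^sub>m A"
        unfolding B_def using A E(1) J by (simp add: assoc_mult_mat[of _ n n _ n _ n] mult_smult_distrib[of _ n n _ n])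
      have "fun_scale (det E) f i = (\<Sum>j<n. B $$ (i, j) * (\<Sum>l<n. ?J $$ (j, l) * u l))" if i: "i < n" for i
      proof -
        have "(\<Sum>j<n. B $$ (i, j) * (\<Sum>l<n. ?J $$ (j, l) * u l)) =
            (\<Sum>j<n. \<Sum>l<n. B $$ (i, j) * ?J $$ (j, l) * u l)"
          by (simp add: sum_distrib_left mult.assoc)
        also have "\<dots> = (\<Sum>l<n. (\<Sum>j<n. B $$ (i, j) * ?J $$ (j, l)) * u l)"
          by (subst sum.swap) (simp add: sum_distrib_right)
        also have "\<dots> = (\<Sum>l<n. (B * ?J) $$ (i, l) * u l)"
          using i by (intro sum.cong) (auto simp: index_mult_mat_sum[OF B J(1)])
        also have "\<dots> = (\<Sum>l<n. det E * (A $$ (i, l) * u l))"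
          unfolding BJ using A i by (intro sum.cong) auto
        also have "\<dots> = fun_scale (det E) f i" using u[OF i] by (simp add: fun_scale_def sum_distrib_left)
        finally show ?thesis by simp
      qed
      then have "fun_scale (det E) f \<in> N n" unfolding N_def column_module_def mem_Collect_eq by (intro exI[of _ "\<lambda>j. \<Sum>l<n. ?J $$ (j, l) * u l"]) blast
      then show "f \<in> H" using H E(2) unfolding sat_sub_def by blast
    qed
    moreover have "N n \<subseteq> column_module n n A"
    proof
      fix f assume "f \<in> N n"
      then obtain u where u: "\<And>i. i < n \<Longrightarrow> f i = (\<Sum>j<n. B $$ (i, j) * u j)" by (auto simp: N_def column_module_def)
      have "f i = (\<Sum>l<n. A $$ (i, l) * (\<Sum>j<n. E $$ (l, j) * u j))" if i: "i < n" for i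
      proof -
        have "f i = (\<Sum>j<n. (\<Sum>l<n. A $$ (i, l) * E $$ (l, j)) * u j)"
          unfolding u[OF i] B_def using i by (intro sum.cong) (auto simp: index_mult_mat_sum[OF A E(1)])
        also have "\<dots> = (\<Sum>l<n. \<Sum>j<n. A $$ (i, l) * E $$ (l, j) * u j)"
          by (subst sum.swap) (simp add: sum_distrib_right)
        finally show ?thesis by (simp add: sum_distrib_left mult.assoc)
      qed
      then show "f \<in> column_module n n A" unfolding column_module_def mem_Collect_eq by (intro exI[of _ "\<lambda>l. \<Sum>j<n. E $$ (l, j) * u j"]) blast
    qed
    ultimately show ?thesis by (auto simp: sat_sub_def)
  qed
  ultimately show ?thesis by (rule sat_length_cong[rotated])
qed

text \<open>Operations on fractions are unions over representatives. Once the resulting class does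
  not depend on them, the union collapses to it; the two members exclude an empty union.\<close>

lemma UN_pairs_const:
  assumes "a \<in> A" "b \<in> B" "\<And>m s n t. (m, s) \<in> A \<Longrightarrow> (n, t) \<in> B \<Longrightarrow> F m s n t = C"
  shows "(\<Union>(m, s)\<in>A. \<Union>(n, t)\<in>B. F m s n t) = C"
proof -
  have "(case y of (n, t) \<Rightarrow> F m s n t) = C" if "(m, s) \<in> A" "y \<in> B" for m s y
    using assms(3) that by (cases y) auto
  then have "(\<Union>(n, t)\<in>B. F m s n t) = C" if "(m, s) \<in> A" for m s
    using that assms(2) by auto
  then have "(case x of (m, s) \<Rightarrow> \<Union>(n, t)\<in>B. F m s n t) = C" if "x \<in> A" for x
    using that by (cases x) auto
  then show ?thesis using assms(1) by auto
qed

section \<open>Submodules of a localised module by extension and contraction\<close>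

locale module_presentation = prime_saturation scale \<pi>
  for scale :: "'a :: idom \<Rightarrow> 'n :: ab_group_add \<Rightarrow> 'n" and \<pi> +
  fixes M :: "('a, 'm, 'c) module_scheme" and \<Phi> :: "'n \<Rightarrow> 'm" and K :: "'n set"
  assumes carrier_M: "carrier M = range \<Phi>"
    and Phi_add: "\<Phi> (f + g) = \<Phi> f \<oplus>\<^bsub>M\<^esub> \<Phi> g"
    and Phi_scale: "\<Phi> (scale r f) = r \<odot>\<^bsub>M\<^esub> \<Phi> f"
    and Phi_0: "\<zero>\<^bsub>M\<^esub> = \<Phi> 0"
    and Phi_eq_iff: "\<Phi> f = \<Phi> g \<longleftrightarrow> f - g \<in> K"
begin

abbreviation R :: "'a ring" where "R \<equiv> ring_of_type_algebra"
abbreviation P :: "'a set" where "P \<equiv> {r. \<pi> dvd r}"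
abbreviation SK :: "'n set" where "SK \<equiv> sat UNIV K"

definition frac :: "'n \<Rightarrow> 'a \<Rightarrow> ('m \<times> 'a) set"
  where "frac f s = fraction R P M (\<Phi> f) s"

lemma R_simps [simp]: "carrier R = UNIV" "x \<otimes>\<^bsub>R\<^esub> y = x * y" "\<one>\<^bsub>R\<^esub> = 1" "\<zero>\<^bsub>R\<^esub> = 0"
  by (simp_all add: ring_of_type_algebra_def)

lemma subspace_K: "subspace K"
proof (rule subspaceI)
  show 0: "0 \<in> K" using Phi_eq_iff[of 0 0] by simp
  have *: "f \<in> K \<longleftrightarrow> \<Phi> f = \<Phi> 0" for f using Phi_eq_iff[of f 0] by simp
  show "x + y \<in> K" if "x \<in> K" "y \<in> K" for x y
    using that Phi_add[of x y] Phi_add[of 0 0] by (simp add: *)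
  show "scale c x \<in> K" if "x \<in> K" for c x
    using that Phi_scale[of c x] Phi_scale[of c 0] by (simp add: *)
qed

lemma subspace_SK: "subspace SK"
  using subspace_sat[OF subspace_UNIV subspace_K] .

lemma SK_iff: "x \<in> SK \<longleftrightarrow> (\<exists>u. \<not> \<pi> dvd u \<and> scale u x \<in> K)"
  by (auto simp: sat_def)

lemma SK_saturated: "\<not> \<pi> dvd s \<Longrightarrow> scale s x \<in> SK \<longleftrightarrow> x \<in> SK"
  using sat_sub_sat[OF subspace_UNIV subspace_K subset_refl subset_UNIV] subspace_scale[OF subspace_SK]
  unfolding sat_sub_def by blast

lemma not_dvd_1: "\<not> \<pi> dvd 1" using prime_elem_not_unit[OF prime_pi] .

lemma not_dvd_mult: "\<not> \<pi> dvd s \<Longrightarrow> \<not> \<pi> dvd t \<Longrightarrow> \<not> \<pi> dvd s * t"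
  using prime_elem_dvd_mult_iff[OF prime_pi] by simp

text \<open>The auxiliary multiplier in the equality of fractions is absorbed by the saturation of
  \<open>K\<close>, so fractions of \<open>M\<close> can be compared upstairs.\<close>

lemma mem_frac_iff: "(\<Phi> h, t) \<in> frac f s \<longleftrightarrow> \<not> \<pi> dvd t \<and> scale t f - scale s h \<in> SK"
proof -
  have "u \<odot>\<^bsub>M\<^esub> (t \<odot>\<^bsub>M\<^esub> \<Phi> f) = u \<odot>\<^bsub>M\<^esub> (s \<odot>\<^bsub>M\<^esub> \<Phi> h) \<longleftrightarrow> scale u (scale t f - scale s h) \<in> K" for u
  proof -
    have "u \<odot>\<^bsub>M\<^esub> (t \<odot>\<^bsub>M\<^esub> \<Phi> f) = \<Phi> (scale u (scale t f))" "u \<odot>\<^bsub>M\<^esub> (s \<odot>\<^bsub>M\<^esub> \<Phi> h) = \<Phi> (scale u (scale s h))"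
      by (simp_all only: Phi_scale)
    then show ?thesis by (simp only: Phi_eq_iff scale_right_diff_distrib)
  qed
  then show ?thesis by (auto simp: frac_def fraction_def carrier_M SK_iff)
qed

lemma frac_memE:
  assumes "x \<in> frac f s"
  obtains h t where "x = (\<Phi> h, t)" "\<not> \<pi> dvd t" "scale t f - scale s h \<in> SK"
proof -
  obtain m t where x: "x = (m, t)" by (cases x)
  then obtain h where "m = \<Phi> h" using assms by (auto simp: frac_def fraction_def carrier_M)
  with x that assms mem_frac_iff show ?thesis by blast
qed

lemma frac_eqI:
  assumes s: "\<not> \<pi> dvd s" and t: "\<not> \<pi> dvd t" and d: "scale t f - scale s h \<in> SK"
  shows "frac f s = frac h t"
proof -
  have key: "scale t' f - scale s h' \<in> SK \<longleftrightarrow> scale t' h - scale t h' \<in> SK" for h' t'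
  proof -
    \<comment> \<open>Transitivity of equality of fractions; the factors \<open>t\<close> and
      \<open>s\<close> are cancelled afterwards because the saturation of \<open>K\<close> is
      saturated.\<close>
    have e: "scale t (scale t' f - scale s h') - scale t' (scale t f - scale s h) = scale s (scale t' h - scale t h')"
      by (simp add: scale_right_diff_distrib mult_ac)
    have "scale t' f - scale s h' \<in> SK \<longleftrightarrow> scale t (scale t' f - scale s h') \<in> SK"
      using SK_saturated[OF t] by simp
    also have "\<dots> \<longleftrightarrow> scale s (scale t' h - scale t h') \<in> SK"
      using e subspace_diff[OF subspace_SK] subspace_add[OF subspace_SK] subspace_scale[OF subspace_SK d, of t']
      by (metis diff_add_cancel)
    also have "\<dots> \<longleftrightarrow> scale t' h - scale t h' \<in> SK" using SK_saturated[OF s] by simp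
    finally show ?thesis .
  qed
  show ?thesis
  proof (intro equalityI subsetI)
    fix x assume "x \<in> frac f s"
    then show "x \<in> frac h t" using key by (elim frac_memE) (simp add: mem_frac_iff)
  next
    fix x assume "x \<in> frac h t"
    then show "x \<in> frac f s" using key by (elim frac_memE) (simp add: mem_frac_iff)
  qed
qed

lemma mem_frac_self: "\<not> \<pi> dvd s \<Longrightarrow> (\<Phi> f, s) \<in> frac f s"
  using subspace_0[OF subspace_SK] by (simp add: mem_frac_iff)

lemma frac_eq_iff:
  assumes "\<not> \<pi> dvd s" "\<not> \<pi> dvd t"
  shows "frac f s = frac h t \<longleftrightarrow> scale t f - scale s h \<in> SK"
  using frac_eqI[OF assms] mem_frac_self[OF assms(2), of h] mem_frac_iff[of h t f s] by metis

lemma fractions_M: "fractions R P M = {frac f s | f s. \<not> \<pi> dvd s}"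
  by (auto simp: fractions_def frac_def carrier_M)

lemma fraction_add_frac:
  assumes s: "\<not> \<pi> dvd s" and t: "\<not> \<pi> dvd t"
  shows "fraction_add R P M (frac f s) (frac h t) = frac (scale t f + scale s h) (s * t)"
proof -
  have *: "fraction R P M (t' \<odot>\<^bsub>M\<^esub> m \<oplus>\<^bsub>M\<^esub> s' \<odot>\<^bsub>M\<^esub> n) (s' \<otimes>\<^bsub>R\<^esub> t') = frac (scale t f + scale s h) (s * t)"
    if m: "(m, s') \<in> frac f s" and n: "(n, t') \<in> frac h t" for m s' n t'
  proof -
    obtain f' where f': "m = \<Phi> f'" "\<not> \<pi> dvd s'" "scale s' f - scale s f' \<in> SK" using m by (elim frac_memE) auto
    obtain h' where h': "n = \<Phi> h'" "\<not> \<pi> dvd t'" "scale t' h - scale t h' \<in> SK" using n by (elim frac_memE) auto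
    have "scale (s * t) (scale t' f' + scale s' h') - scale (s' * t') (scale t f + scale s h)
        = - scale (t * t') (scale s' f - scale s f') - scale (s * s') (scale t' h - scale t h')"
      by (simp add: scale_right_diff_distrib scale_right_distrib mult_ac)
    also have "\<dots> \<in> SK"
      by (rule subspace_diff[OF subspace_SK subspace_neg[OF subspace_SK subspace_scale[OF subspace_SK f'(3)]]
            subspace_scale[OF subspace_SK h'(3)]])
    finally have "frac (scale t' f' + scale s' h') (s' * t') = frac (scale t f + scale s h) (s * t)"
      using f' h' s t by (intro frac_eqI not_dvd_mult)
    then show ?thesis by (simp add: f' h' frac_def Phi_scale Phi_add)
  qed
  show ?thesis
    unfolding fraction_add_def
    by (rule UN_pairs_const[OF mem_frac_self[OF s, of f] mem_frac_self[OF t, of h] *])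
qed

definition rfrac :: "'a \<Rightarrow> 'a \<Rightarrow> ('a \<times> 'a) set"
  where "rfrac r s = fraction R P (regular_module R) r s"

lemma mem_rfrac_iff: "(r', s') \<in> rfrac r s \<longleftrightarrow> \<not> \<pi> dvd s' \<and> s' * r = s * r'"
proof -
  have "(\<exists>u. \<not> \<pi> dvd u \<and> u * (s' * r) = u * (s * r')) \<longleftrightarrow> s' * r = s * r'"
  proof
    assume "\<exists>u. \<not> \<pi> dvd u \<and> u * (s' * r) = u * (s * r')"
    then obtain u where "\<not> \<pi> dvd u" "u * (s' * r) = u * (s * r')" by blast
    moreover from this have "u \<noteq> 0" by auto
    ultimately show "s' * r = s * r'" by simp
  next
    assume "s' * r = s * r'"
    then show "\<exists>u. \<not> \<pi> dvd u \<and> u * (s' * r) = u * (s * r')"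
      using not_dvd_1 by (intro exI[of _ 1]) simp
  qed
  then show ?thesis by (simp add: rfrac_def fraction_def regular_module_def Bex_def)
qed

lemma fraction_smult_frac:
  assumes s: "\<not> \<pi> dvd s" and t: "\<not> \<pi> dvd t"
  shows "fraction_smult R P M (rfrac r s) (frac h t) = frac (scale r h) (s * t)"
proof -
  have *: "fraction R P M (r' \<odot>\<^bsub>M\<^esub> n) (s' \<otimes>\<^bsub>R\<^esub> t') = frac (scale r h) (s * t)"
    if m: "(r', s') \<in> rfrac r s" and n: "(n, t') \<in> frac h t" for r' s' n t'
  proof -
    have r': "\<not> \<pi> dvd s'" "s' * r = s * r'" using m by (auto simp: mem_rfrac_iff)
    obtain h' where h': "n = \<Phi> h'" "\<not> \<pi> dvd t'" "scale t' h - scale t h' \<in> SK" using n by (elim frac_memE) auto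
    have a: "s * t * r' = t * (s' * r)" using r' by (simp add: mult_ac)
    have "scale (s * t) (scale r' h') - scale (s' * t') (scale r h)
        = scale (s * t * r') h' - scale (s' * r * t') h" by (simp add: mult_ac)
    also have "\<dots> = - scale (s' * r) (scale t' h - scale t h')"
      unfolding a by (simp add: scale_right_diff_distrib mult_ac)
    also have "\<dots> \<in> SK" by (rule subspace_neg[OF subspace_SK subspace_scale[OF subspace_SK h'(3)]])
    finally have "frac (scale r' h') (s' * t') = frac (scale r h) (s * t)"
      using r' h' s t by (intro frac_eqI not_dvd_mult)
    then show ?thesis by (simp add: h' frac_def Phi_scale)
  qed
  have "(r, s) \<in> rfrac r s" using s by (simp add: mem_rfrac_iff)
  then show ?thesis
    unfolding fraction_smult_def by (rule UN_pairs_const[OF _ mem_frac_self[OF t, of h] *])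
qed

abbreviation RP where "RP \<equiv> localized_ring R P"
abbreviation MP where "MP \<equiv> localized_module R P M"

lemma RP_carrier: "carrier RP = {rfrac r s | r s. \<not> \<pi> dvd s}"
  by (auto simp: localized_ring_def fractions_def rfrac_def regular_module_def)

lemma MP_simps: "carrier MP = {frac f s | f s. \<not> \<pi> dvd s}" "add MP = fraction_add R P M"
  "module.smult MP = fraction_smult R P M" "\<zero>\<^bsub>MP\<^esub> = frac 0 1"
  by (auto simp: localized_module_def fractions_M frac_def Phi_0)

lemma frac_0: "\<not> \<pi> dvd s \<Longrightarrow> frac 0 s = frac 0 1"
  using subspace_0[OF subspace_SK] not_dvd_1 by (intro frac_eqI) auto

text \<open>A submodule must be closed under the inverse of the additive monoid, which is a definite
  description. It is evaluated directly, by existence and uniqueness.\<close>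

lemma MP_inv:
  assumes s: "\<not> \<pi> dvd s"
  shows "inv\<^bsub>add_monoid MP\<^esub> (frac f s) = frac (- f) s"
proof -
  have z: "fraction_add R P M (frac f s) (frac (- f) s) = frac 0 1"
    "fraction_add R P M (frac (- f) s) (frac f s) = frac 0 1"
    using s not_dvd_mult[OF s s] frac_0 by (simp_all add: fraction_add_frac)
  have u: "y = frac (- f) s" if y: "y \<in> carrier MP" "fraction_add R P M (frac f s) y = frac 0 1" for y
  proof -
    obtain h t where h: "y = frac h t" "\<not> \<pi> dvd t" using y by (auto simp: MP_simps)
    have "frac (scale t f + scale s h) (s * t) = frac 0 1" using y h s by (simp add: fraction_add_frac)
    then have "scale t f + scale s h \<in> SK"
      using frac_eq_iff[OF not_dvd_mult[OF s h(2)] not_dvd_1, of "scale t f + scale s h" 0] by simp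
    then have "scale s h - scale t (- f) \<in> SK" by (simp add: add.commute)
    then show ?thesis using h s frac_eqI[of t s h "- f"] by simp
  qed
  show ?thesis
    unfolding m_inv_def using z s u
    by (intro the_equality) (auto simp: MP_simps)
qed

lemma submodule_extension:
  assumes H: "sat_sub K UNIV H"
  shows "submodule {frac f s | f s. f \<in> H \<and> \<not> \<pi> dvd s} RP MP"
proof -
  have sH: "subspace H" using H by (simp add: sat_sub_def)
  let ?E = "{frac f s | f s. f \<in> H \<and> \<not> \<pi> dvd s}"
  have "subgroup ?E (add_monoid MP)"
  proof (rule subgroup.intro)
    show "?E \<subseteq> carrier (add_monoid MP)" by (auto simp: MP_simps)
    show "\<one>\<^bsub>add_monoid MP\<^esub> \<in> ?E" using subspace_0[OF sH] not_dvd_1 by (auto simp: MP_simps)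
    show "x \<otimes>\<^bsub>add_monoid MP\<^esub> y \<in> ?E" if xy: "x \<in> ?E" "y \<in> ?E" for x y
    proof -
      obtain f s h t where "x = frac f s" "y = frac h t" "f \<in> H" "h \<in> H" and st: "\<not> \<pi> dvd s" "\<not> \<pi> dvd t" using xy by blast
      then have "x \<otimes>\<^bsub>add_monoid MP\<^esub> y = frac (scale t f + scale s h) (s * t)" "scale t f + scale s h \<in> H"
        using subspace_add[OF sH subspace_scale[OF sH] subspace_scale[OF sH]]
        by (simp_all add: MP_simps fraction_add_frac)
      then show ?thesis using not_dvd_mult[OF st] by blast
    qed
    show "inv\<^bsub>add_monoid MP\<^esub> x \<in> ?E" if x: "x \<in> ?E" for x
    proof -
      obtain f s where f: "x = frac f s" "f \<in> H" "\<not> \<pi> dvd s" using x by blast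
      then have "inv\<^bsub>add_monoid MP\<^esub> x = frac (- f) s" "- f \<in> H"
        using MP_inv subspace_neg[OF sH] by simp_all
      then show ?thesis using f(3) by blast
    qed
  qed
  moreover have "a \<odot>\<^bsub>MP\<^esub> x \<in> ?E" if ax: "a \<in> carrier RP" "x \<in> ?E" for a x
  proof -
    obtain r s h t where "a = rfrac r s" "x = frac h t" and st: "\<not> \<pi> dvd s" "\<not> \<pi> dvd t" and "h \<in> H"
      using ax unfolding RP_carrier by blast
    then have "a \<odot>\<^bsub>MP\<^esub> x = frac (scale r h) (s * t)" "scale r h \<in> H"
      using subspace_scale[OF sH] by (simp_all add: MP_simps fraction_smult_frac)
    then show ?thesis using not_dvd_mult[OF st] by blast
  qed
  ultimately show ?thesis by (auto simp: submodule_def submodule_axioms_def)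
qed

lemma mem_extension_iff:
  assumes H: "sat_sub K UNIV H" and s: "\<not> \<pi> dvd s"
  shows "frac f s \<in> {frac f s | f s. f \<in> H \<and> \<not> \<pi> dvd s} \<longleftrightarrow> f \<in> H"
proof
  have sH: "subspace H" "K \<subseteq> H" and sat: "\<And>s x. \<not> \<pi> dvd s \<Longrightarrow> scale s x \<in> H \<Longrightarrow> x \<in> H"
    using H unfolding sat_sub_def by blast+
  have SKH: "SK \<subseteq> H" using sH(2) sat SK_iff by blast
  assume "frac f s \<in> {frac f s | f s. f \<in> H \<and> \<not> \<pi> dvd s}"
  then obtain h t where h: "frac f s = frac h t" "h \<in> H" "\<not> \<pi> dvd t" by blast
  then have "scale t f - scale s h \<in> H" using frac_eq_iff[OF s h(3)] SKH by blast
  then have "scale t f - scale s h + scale s h \<in> H" using subspace_scale[OF sH(1) h(2)] by (intro subspace_add[OF sH(1)])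
  then show "f \<in> H" using sat[OF h(3)] by simp
qed (use s in blast)

text \<open>Denominators act invertibly, so a fraction lies in \<open>N\<close> as soon as its
  numerator over 1 does. Hence \<open>N\<close> is determined by its preimage, and the preimage is
  saturated.\<close>

lemma contraction:
  assumes N: "submodule N RP MP"
  shows "sat_sub K UNIV {f. frac f 1 \<in> N}" (is "sat_sub K UNIV ?C")
    and "\<not> \<pi> dvd s \<Longrightarrow> frac f s \<in> N \<longleftrightarrow> f \<in> {f. frac f 1 \<in> N}"
proof -
  interpret subgroup N "add_monoid MP" using N by (simp add: submodule_def)
  have sm: "fraction_smult R P M (rfrac r s) x \<in> N" if "\<not> \<pi> dvd s" "x \<in> N" for r s x
    using submodule.smult_closed[OF N, of "rfrac r s" x] that by (auto simp: RP_carrier MP_simps)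
  have sc: "frac (scale r f) (s * t) \<in> N" if "frac f t \<in> N" "\<not> \<pi> dvd s" "\<not> \<pi> dvd t" for r f s t
    using sm[OF that(2,1), of r] fraction_smult_frac[OF that(2,3)] by simp
  have K: "K \<subseteq> ?C"
  proof
    fix f assume "f \<in> K"
    then have "f \<in> SK" using subset_sat[of K UNIV] by auto
    then have "frac f 1 = frac 0 1" by (intro frac_eqI not_dvd_1) simp
    then show "f \<in> ?C" using one_closed by (simp add: MP_simps)
  qed
  have sub: "subspace ?C"
  proof (rule subspaceI)
    show "0 \<in> ?C" using K subspace_0[OF subspace_K] by auto
    show "x + y \<in> ?C" if "x \<in> ?C" "y \<in> ?C" for x y
      using m_closed[of "frac x 1" "frac y 1"] that not_dvd_1 by (simp add: MP_simps fraction_add_frac)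
    show "scale c x \<in> ?C" if "x \<in> ?C" for c x
      using sc[of x 1 1 c] that not_dvd_1 by simp
  qed
  have cancel: "frac (scale s f) s = frac f 1" if "\<not> \<pi> dvd s" for s f
    using that not_dvd_1 subspace_0[OF subspace_SK] by (intro frac_eqI) auto
  show "sat_sub K UNIV ?C"
    unfolding sat_sub_def
  proof (intro conjI ballI impI)
    fix s x assume "s \<in> {s. \<not> \<pi> dvd s}" "scale s x \<in> ?C"
    then have "frac (scale 1 (scale s x)) (s * 1) \<in> N" by (intro sc) (auto simp: not_dvd_1)
    then show "x \<in> ?C" using cancel \<open>s \<in> _\<close> by simp
  qed (use K sub in auto)
  show "frac f s \<in> N \<longleftrightarrow> f \<in> ?C" if s: "\<not> \<pi> dvd s"
  proof
    assume "frac f s \<in> N"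
    then have "frac (scale s f) (1 * s) \<in> N" using s not_dvd_1 by (intro sc)
    then show "f \<in> ?C" using cancel[OF s] by simp
  next
    assume "f \<in> ?C"
    then have "frac (scale 1 f) (s * 1) \<in> N" using s not_dvd_1 by (intro sc) auto
    then show "frac f s \<in> N" by simp
  qed
qed

text \<open>Extension and contraction both preserve strict inclusions, so chains of the same lengths
  exist on either side.\<close>

theorem module_length_localized:
  assumes "sat_length K UNIV d"
  shows "module_length RP MP = enat d"
proof -
  have iff: "(\<exists>N :: nat \<Rightarrow> _ set. (\<forall>i\<le>n. submodule (N i) RP MP) \<and> (\<forall>i<n. N i \<subset> N (Suc i))) \<longleftrightarrow> sat_chain K UNIV n" for n
  proof
    assume "\<exists>N. (\<forall>i\<le>n. submodule (N i) RP MP) \<and> (\<forall>i<n. N i \<subset> N (Suc i))"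
    then obtain N where N: "\<And>i. i \<le> n \<Longrightarrow> submodule (N i) RP MP" "\<And>i. i < n \<Longrightarrow> N i \<subset> N (Suc i)" by blast
    have "{f. frac f 1 \<in> N i} \<subset> {f. frac f 1 \<in> N (Suc i)}" if i: "i < n" for i
    proof -
      obtain x where x: "x \<in> N (Suc i)" "x \<notin> N i" using N(2)[OF i] by blast
      have "N (Suc i) \<subseteq> carrier MP"
        using N(1)[of "Suc i"] i by (auto simp: submodule_def subgroup_def)
      then obtain f s where f: "x = frac f s" "\<not> \<pi> dvd s" using x by (auto simp: MP_simps)
      then have "frac f 1 \<in> N (Suc i)" "frac f 1 \<notin> N i"
        using x contraction(2)[OF N(1)] i by auto
      then show ?thesis using N(2)[OF i] by blast
    qed
    moreover have "sat_sub K UNIV {f. frac f 1 \<in> N i}" if "i \<le> n" for i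
      using contraction(1)[OF N(1)[OF that]] .
    ultimately show "sat_chain K UNIV n"
      unfolding sat_chain_def by (intro exI[of _ "\<lambda>i. {f. frac f 1 \<in> N i}"]) blast
  next
    assume "sat_chain K UNIV n"
    then obtain H where H: "\<And>i. i \<le> n \<Longrightarrow> sat_sub K UNIV (H i)" "\<And>i. i < n \<Longrightarrow> H i \<subset> H (Suc i)"
      unfolding sat_chain_def by blast
    define N where "N i = {frac f s | f s. f \<in> H i \<and> \<not> \<pi> dvd s}" for i
    have "N i \<subset> N (Suc i)" if i: "i < n" for i
    proof -
      obtain f where f: "f \<in> H (Suc i)" "f \<notin> H i" using H(2)[OF i] by blast
      have "frac f 1 \<in> N (Suc i)" "frac f 1 \<notin> N i"
        using f mem_extension_iff[OF H(1) not_dvd_1, of "Suc i"] mem_extension_iff[OF H(1) not_dvd_1, of i] i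
        unfolding N_def by auto
      moreover have "N i \<subseteq> N (Suc i)" using H(2)[OF i] unfolding N_def by blast
      ultimately show ?thesis by blast
    qed
    moreover have "submodule (N i) RP MP" if "i \<le> n" for i
      unfolding N_def using submodule_extension[OF H(1)[OF that]] .
    ultimately show "\<exists>N. (\<forall>i\<le>n. submodule (N i) RP MP) \<and> (\<forall>i<n. N i \<subset> N (Suc i))" by blast
  qed
  have "module_length RP MP = Sup {enat n | n. sat_chain K UNIV n}"
    unfolding module_length_def iff ..
  also have "\<dots> = enat d"
    using assms by (intro antisym Sup_least Sup_upper) (auto simp: sat_length_def)
  finally show ?thesis .
qed

end

section \<open>The ring of \<open>p\<close>-adic integers\<close>

abbreviation padic_p :: "'p :: prime_card padic_int"
  where "padic_p \<equiv> of_nat CARD('p)"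

lemma card_gt_1: "CARD('p :: prime_card) > 1"
  using prime_gt_1_nat[OF prime_card[where 'a = 'p]] .

lemma residue_nonneg: "residue (x :: 'p :: prime_card padic_int) n \<ge> 0"
  and residue_less: "residue x n < int CARD('p) ^ n"
proof -
  have "int CARD('p) ^ n > 0" using card_gt_1[where 'p = 'p] by simp
  then show "residue x n \<ge> 0" "residue x n < int CARD('p) ^ n"
    using residue_mod[of x n] by (metis pos_mod_sign, metis pos_mod_bound)
qed

lemma residue_of_int: "residue (of_int k :: 'p :: prime_card padic_int) n = k mod int CARD('p) ^ n"
proof (cases "k \<ge> 0")
  case True
  then obtain m where "k = int m" by (metis nonneg_eq_int)
  then show ?thesis by (simp add: residue_of_nat)
next
  case False
  then obtain m where "k = - int m" by (metis int_cases2 of_nat_0_le_iff)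
  then show ?thesis by (simp add: residue_of_nat residue_uminus mod_minus_eq)
qed

lemma padic_power_dvd_iff:
  "(padic_p :: 'p :: prime_card padic_int) ^ k dvd x \<longleftrightarrow> residue x k = 0"
proof
  assume "padic_p ^ k dvd x"
  then obtain y where x: "x = padic_p ^ k * y" by (elim dvdE)
  have "residue x k = (residue (of_nat (CARD('p) ^ k) :: 'p padic_int) k * residue y k) mod int CARD('p) ^ k"
    unfolding x by (simp only: residue_mult of_nat_power)
  then show "residue x k = 0" unfolding residue_of_nat by simp
next
  assume x0: "residue x k = 0"
  let ?p = "int CARD('p)"
  have p: "?p > 0" using card_gt_1[where 'p = 'p] by simp
  have dv: "?p ^ k dvd residue x (n + k)" for n
    using residue_mod_le[of k "n + k" x] x0 by (simp add: dvd_eq_mod_eq_0)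
  \<comment> \<open>Division by p^k drops k digits, so residue \<open>n\<close> of the quotient
    comes from residue \<open>n + k\<close> of \<open>x\<close>.\<close>
  define f where "f n = residue x (n + k) div ?p ^ k" for n
  have f: "?p ^ k * f n = residue x (n + k)" for n unfolding f_def using dv by simp
  have coh: "f (Suc n) mod ?p ^ n = f n mod ?p ^ n" for n
  proof -
    have "?p ^ k * (f (Suc n) mod ?p ^ n) = (?p ^ k * f (Suc n)) mod (?p ^ k * ?p ^ n)"
      by (rule mult_mod_right)
    also have "\<dots> = residue x (Suc (n + k)) mod ?p ^ (n + k)" using f[of "Suc n"] by (simp only: power_add mult.commute add_Suc)
    also have "\<dots> = residue x (n + k) mod ?p ^ (n + k)" by (simp add: residue_Suc_mod)
    also have "\<dots> = (?p ^ k * f n) mod (?p ^ k * ?p ^ n)" using f[of n] by (simp only: power_add mult.commute)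
    also have "\<dots> = ?p ^ k * (f n mod ?p ^ n)" by (rule mult_mod_right[symmetric])
    finally have "?p ^ k * (f (Suc n) mod ?p ^ n) = ?p ^ k * (f n mod ?p ^ n)" .
    moreover have "?p ^ k \<noteq> 0" using p by simp
    ultimately show ?thesis by (metis mult_left_cancel)
  qed
  define y :: "'p padic_int" where "y = Abs_padic_int (\<lambda>n. f n mod ?p ^ n)"
  have y: "residue y n = f n mod ?p ^ n" for n unfolding y_def by (rule residue_Abs[OF coh])
  have "x = padic_p ^ k * y"
  proof (rule padic_int_eqI)
    fix n
    have "residue (padic_p ^ k * y) n = (?p ^ k * f n) mod ?p ^ n"
      unfolding residue_mult y of_nat_power[symmetric] residue_of_nat by (simp add: mod_simps)
    also have "\<dots> = residue x (n + k) mod ?p ^ n" by (simp add: f)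
    also have "\<dots> = residue x n" by (rule residue_mod_le) simp
    finally show "residue x n = residue (padic_p ^ k * y) n" by simp
  qed
  then show "padic_p ^ k dvd x" by simp
qed

lemma residue_eq_iff_dvd:
  "residue x n = residue y n \<longleftrightarrow> (padic_p :: 'p :: prime_card padic_int) ^ n dvd x - y"
proof -
  have "residue x n = residue y n \<longleftrightarrow> residue x n mod int CARD('p) ^ n = residue y n mod int CARD('p) ^ n"
    by simp
  also have "\<dots> \<longleftrightarrow> (residue x n - residue y n) mod int CARD('p) ^ n = 0"
    by (simp only: mod_eq_dvd_iff dvd_eq_mod_eq_0)
  finally show ?thesis by (simp add: padic_power_dvd_iff residue_diff)
qed

lemma padic_approx: "(padic_p :: 'p :: prime_card padic_int) ^ n dvd x - of_int (residue x n)"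
  by (simp add: residue_eq_iff_dvd[symmetric] residue_of_int)

text \<open>Inverses modulo p^n exist and are unique, hence coherent in \<open>n\<close>, and so
  assemble to a p-adic integer.\<close>

lemma padic_unit:
  fixes x :: "'p :: prime_card padic_int"
  assumes "\<not> padic_p dvd x"
  shows "x dvd 1"
proof -
  let ?p = "int CARD('p)"
  have p: "prime ?p" using prime_card_int .
  have x1: "residue x 1 \<noteq> 0" using assms padic_power_dvd_iff[of 1 x] by simp
  have cop: "coprime (residue x n) (?p ^ n)" for n
  proof (cases "n = 0")
    case False
    then have "\<not> ?p dvd residue x n"
      using x1 residue_mod_le[of 1 n x] by (auto simp: dvd_eq_mod_eq_0)
    then show ?thesis using prime_imp_coprime[OF p] by (simp add: coprime_commute)
  qed simp
  then have "\<forall>n. \<exists>y. [residue x n * y = 1] (mod ?p ^ n)" using cong_solve_coprime_int by blast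
  then obtain f where f: "\<And>n. [residue x n * f n = 1] (mod ?p ^ n)" by metis
  have coh: "f (Suc n) mod ?p ^ n = f n mod ?p ^ n" for n
  proof -
    have "[residue x (Suc n) * f (Suc n) = 1] (mod ?p ^ n)"
      using f[of "Suc n"] by (rule cong_dvd_modulus) simp
    moreover have "[residue x (Suc n) = residue x n] (mod ?p ^ n)"
      by (simp add: cong_def residue_Suc_mod)
    ultimately have "[residue x n * f (Suc n) = 1] (mod ?p ^ n)"
      by (meson cong_scalar_right cong_sym cong_trans)
    then have "[residue x n * f (Suc n) = residue x n * f n] (mod ?p ^ n)"
      using f[of n] cong_sym cong_trans by blast
    then have "[f (Suc n) = f n] (mod ?p ^ n)" using cong_mult_lcancel[OF cop[of n]] by blast
    then show ?thesis by (simp add: cong_def)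
  qed
  define y :: "'p padic_int" where "y = Abs_padic_int (\<lambda>n. f n mod ?p ^ n)"
  have y: "residue y n = f n mod ?p ^ n" for n unfolding y_def by (rule residue_Abs[OF coh])
  have "x * y = 1"
  proof (rule padic_int_eqI)
    fix n show "residue (x * y) n = residue (1 :: 'p padic_int) n"
      using f[of n] by (simp add: residue_mult y residue_1 mod_simps cong_def)
  qed
  then show ?thesis by (metis dvd_triv_left)
qed

lemma padic_p_power_neq_0: "(padic_p :: 'p :: prime_card padic_int) ^ n \<noteq> 0"
  by (metis card_gt_1 less_nat_zero_code of_nat_eq_0_iff of_nat_power power_not_zero)

lemma padic_power_dvd_all_imp_0:
  assumes "\<And>n. (padic_p :: 'p :: prime_card padic_int) ^ n dvd x"
  shows "x = 0"
  using assms by (intro padic_int_eqI) (simp add: padic_power_dvd_iff)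

lemma padic_decomposition:
  fixes x :: "'p :: prime_card padic_int"
  assumes "x \<noteq> 0"
  shows "\<exists>n u. x = padic_p ^ n * u \<and> u dvd 1"
proof -
  have "\<exists>n. \<not> padic_p ^ n dvd x" using assms padic_power_dvd_all_imp_0 by blast
  define n where "n = (LEAST n. \<not> padic_p ^ n dvd x)"
  have n: "\<not> padic_p ^ n dvd x" unfolding n_def by (rule LeastI_ex) fact
  then obtain m where m: "n = Suc m" by (cases n) auto
  have "padic_p ^ m dvd x" using not_less_Least[of m "\<lambda>n. \<not> padic_p ^ n dvd x"] m n_def by auto
  then obtain u where u: "x = padic_p ^ m * u" by (elim dvdE)
  have "\<not> padic_p dvd u"
    using n unfolding m u by (metis dvd_refl mult_dvd_mono power_Suc2)
  then show ?thesis using u padic_unit by blast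
qed

text \<open>An element of least valuation divides all the others. This is applied to the constant
  terms of the members of a prime ideal.\<close>

lemma padic_exists_dvd_all:
  fixes C :: "'p :: prime_card padic_int set"
  assumes "x \<in> C" "x \<noteq> 0"
  shows "\<exists>a\<in>C. a \<noteq> 0 \<and> (\<forall>c\<in>C. a dvd c)"
proof -
  define Q where "Q n \<longleftrightarrow> (\<exists>u. padic_p ^ n * u \<in> C \<and> u dvd 1)" for n
  have "\<exists>n. Q n" using padic_decomposition[OF assms(2)] assms(1) unfolding Q_def by blast
  then have "Q (LEAST n. Q n)" by (rule LeastI_ex)
  then obtain u where u: "padic_p ^ (LEAST n. Q n) * u \<in> C" "u dvd 1" unfolding Q_def by blast
  have "padic_p ^ (LEAST n. Q n) * u dvd c" if "c \<in> C" for c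
  proof (cases "c = 0")
    case False
    then obtain n w where w: "c = padic_p ^ n * w" "w dvd 1" using padic_decomposition by blast
    then have "Q n" using that unfolding Q_def by blast
    then have "(LEAST n. Q n) \<le> n" by (rule Least_le)
    then have "padic_p ^ (LEAST n. Q n) dvd (padic_p ^ n :: 'p padic_int)" by (rule le_imp_power_dvd)
    moreover have "u dvd w" using u(2) by (meson dvd_trans one_dvd)
    ultimately show ?thesis unfolding w(1) by (rule mult_dvd_mono)
  qed simp
  moreover have "u \<noteq> 0" using u(2) by (metis dvd_0_left zero_neq_one)
  then have "padic_p ^ (LEAST n. Q n) * u \<noteq> 0" using padic_p_power_neq_0 by (simp only: mult_eq_0_iff) simp
  ultimately show ?thesis using u(1) by blast
qed

lemma padic_power_dvd_mult_unit:
  fixes x :: "'p :: prime_card padic_int"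
  assumes "coprime d CARD('p)" "padic_p ^ n dvd of_nat d * x"
  shows "padic_p ^ n dvd x"
proof -
  have "residue (of_nat d * x) n = 0" using assms(2) padic_power_dvd_iff by blast
  then have "int CARD('p) ^ n dvd int d * residue x n"
    by (simp add: residue_mult residue_of_nat mod_simps dvd_eq_mod_eq_0)
  moreover have "coprime (int CARD('p) ^ n) (int d)"
    using assms(1) by (simp add: coprime_commute)
  ultimately have "int CARD('p) ^ n dvd residue x n" using coprime_dvd_mult_right_iff by blast
  then have "residue x n mod int CARD('p) ^ n = 0" by (rule dvd_imp_mod_0)
  then show ?thesis unfolding padic_power_dvd_iff by simp
qed


section \<open>Powers of the maximal ideal of the Iwasawa algebra\<close>

text \<open>This is the \<open>n\<close>-th power of the maximal ideal \<open>(p, T)\<close>, described by its coefficients.\<close>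

definition max_power :: "nat \<Rightarrow> 'p :: prime_card padic_int fps set"
  where "max_power n = {f. \<forall>i. padic_p ^ (n - i) dvd fps_nth f i}"

lemma max_power_0 [simp]: "0 \<in> max_power n"
  by (simp add: max_power_def)

lemma max_power_zero [simp]: "max_power 0 = UNIV"
  by (simp add: max_power_def)

lemma max_power_add: "f \<in> max_power n \<Longrightarrow> g \<in> max_power n \<Longrightarrow> f + g \<in> max_power n"
  by (simp add: max_power_def)

lemma max_power_diff: "f \<in> max_power n \<Longrightarrow> g \<in> max_power n \<Longrightarrow> f - g \<in> max_power n"
  by (simp add: max_power_def)

lemma max_power_uminus: "f \<in> max_power n \<Longrightarrow> - f \<in> max_power n"
  by (simp add: max_power_def)

lemma max_power_sum: "(\<And>i. i \<in> I \<Longrightarrow> f i \<in> max_power n) \<Longrightarrow> sum f I \<in> max_power n"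
  by (induction I rule: infinite_finite_induct) (auto intro: max_power_add)

lemma max_power_mono: "m \<le> n \<Longrightarrow> f \<in> max_power n \<Longrightarrow> f \<in> max_power m"
  unfolding max_power_def mem_Collect_eq
  by (meson diff_le_mono dvd_trans le_imp_power_dvd)

lemma max_power_mult:
  fixes f g :: "'p :: prime_card padic_int fps"
  assumes "f \<in> max_power m" "g \<in> max_power n"
  shows "f * g \<in> max_power (m + n)"
  unfolding max_power_def mem_Collect_eq fps_mult_nth
proof (intro allI dvd_sum)
  fix i j :: nat assume j: "j \<in> {0..i}"
  have "padic_p ^ (m + n - i) dvd (padic_p ^ ((m - j) + (n - (i - j))) :: 'p padic_int)"
    using j by (intro le_imp_power_dvd) auto
  also have "\<dots> dvd fps_nth f j * fps_nth g (i - j)"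
    using assms by (simp add: max_power_def power_add mult_dvd_mono)
  finally show "padic_p ^ (m + n - i) dvd fps_nth f j * fps_nth g (i - j)" .
qed

lemma max_power_mult_left: "g \<in> max_power n \<Longrightarrow> f * g \<in> max_power n"
  using max_power_mult[of f 0 g n] by simp

lemma max_power_mult_right: "f \<in> max_power n \<Longrightarrow> f * g \<in> max_power n"
  using max_power_mult[of f n g 0] by simp

lemma max_power_power: "f \<in> max_power 1 \<Longrightarrow> f ^ n \<in> max_power n"
proof (induction n)
  case (Suc n)
  then show ?case using max_power_mult[of f 1 "f ^ n" n] by simp
qed simp

lemma fps_X_in_max_power: "fps_X \<in> max_power 1"
  by (simp add: max_power_def fps_X_def)

lemma of_nat_fps_nth: "fps_nth (of_nat k :: 'a :: comm_ring_1 fps) i = (if i = 0 then of_nat k else 0)"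
  by (simp add: fps_of_nat[symmetric])

lemma padic_p_in_max_power: "of_nat CARD('p) \<in> (max_power 1 :: 'p :: prime_card padic_int fps set)"
  by (simp add: max_power_def of_nat_fps_nth)

lemma max_power_all_imp_0:
  assumes "\<And>n. f \<in> max_power n"
  shows "f = 0"
proof (rule fps_ext)
  fix i
  have "padic_p ^ n dvd fps_nth f i" for n
    using assms[of "n + i"] unfolding max_power_def mem_Collect_eq by (metis add_diff_cancel_right')
  then show "fps_nth f i = fps_nth 0 i" by (simp add: padic_power_dvd_all_imp_0)
qed

lemma fps_unit_iff:
  "(f :: 'a :: comm_ring_1 fps) dvd 1 \<longleftrightarrow> fps_nth f 0 dvd 1"
proof
  assume "f dvd 1"
  then obtain g where "1 = f * g" by (elim dvdE)
  then have "1 = fps_nth f 0 * fps_nth g 0" by (metis fps_mult_nth_0 fps_one_nth)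
  then show "fps_nth f 0 dvd 1" by (metis dvd_triv_left)
next
  assume "fps_nth f 0 dvd 1"
  then obtain y where "fps_nth f 0 * y = 1" by (metis dvdE)
  then have "f * fps_right_inverse f y = 1" by (rule fps_right_inverse)
  then show "f dvd 1" by (metis dvd_triv_left)
qed

lemma nonunit_in_max_power: "\<not> f dvd 1 \<Longrightarrow> f \<in> max_power 1"
  using padic_unit[of "fps_nth f 0"] unfolding fps_unit_iff max_power_def mem_Collect_eq
  by (metis One_nat_def diff_0_eq_0 diff_Suc_Suc not0_implies_Suc one_dvd power_0 power_one_right minus_nat.diff_0)

text \<open>Coefficients move by one place, so division by T costs exactly one step of the
  filtration.\<close>

lemma fps_X_mult_in_max_power_iff: "fps_X * f \<in> max_power (Suc n) \<longleftrightarrow> f \<in> max_power n"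
proof
  assume *: "fps_X * f \<in> max_power (Suc n)"
  have "padic_p ^ (n - i) dvd fps_nth f i" for i
    using *[unfolded max_power_def mem_Collect_eq, rule_format, of "Suc i"] by simp
  then show "f \<in> max_power n" by (simp add: max_power_def)
next
  assume "f \<in> max_power n"
  then show "fps_X * f \<in> max_power (Suc n)" using max_power_mult[OF fps_X_in_max_power] by fastforce
qed

lemma max_power_mult_coprime:
  assumes "coprime d CARD('p :: prime_card)" "of_nat d * f \<in> (max_power n :: 'p padic_int fps set)"
  shows "f \<in> max_power n"
proof -
  have "fps_nth (of_nat d * f) i = of_nat d * fps_nth f i" for i
    by (simp add: fps_of_nat[symmetric])
  then show ?thesis using assms padic_power_dvd_mult_unit by (auto simp: max_power_def)
qed

text \<open>Koenig's lemma: the set of indices is shrunk one coordinate at a time, each time to a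
  value that is taken infinitely often.\<close>

lemma coordinatewise_accumulation:
  fixes x :: "nat \<Rightarrow> nat \<Rightarrow> 'a"
  assumes fin: "\<And>k. finite (range (\<lambda>n. x n k))"
  shows "\<exists>y. \<forall>m. infinite {n. \<forall>k<m. x n k = y k}"
proof -
  define s where "s k B = (SOME v. infinite {n \<in> B. x n k = v})" for k B
  define A where "A = rec_nat UNIV (\<lambda>k B. {n \<in> B. x n k = s k B})"
  have A0: "A 0 = UNIV" and AS: "A (Suc k) = {n \<in> A k. x n k = s k (A k)}" for k
    by (simp_all add: A_def)
  have inf: "infinite (A k)" for k
  proof (induction k)
    case (Suc k)
    have "finite ((\<lambda>n. x n k) ` A k)" using fin[of k] by (rule rev_finite_subset) auto
    then have "\<exists>a\<in>A k. infinite {n \<in> A k. x n k = x a k}"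
      using pigeonhole_infinite[OF Suc] by blast
    then have "infinite {n \<in> A k. x n k = s k (A k)}"
      unfolding s_def using someI[of "\<lambda>v. infinite {n \<in> A k. x n k = v}"] by blast
    then show ?case by (simp add: AS)
  qed (simp add: A0)
  have "A m = {n. \<forall>k<m. x n k = s k (A k)}" for m
    by (induction m) (auto simp: A0 AS less_Suc_eq)
  then show ?thesis using inf by (intro exI[of _ "\<lambda>k. s k (A k)"]) metis
qed

text \<open>Compactness of a product of copies of the Iwasawa algebra: the residues of all
  coefficients of all entries are countably many coordinates with finitely many values each. A
  single bound \<open>m\<close> controls both the number of entries and the precision.\<close>

lemma max_power_accumulation:
  fixes F :: "nat \<Rightarrow> nat \<Rightarrow> 'p :: prime_card padic_int fps"
  shows "\<exists>f. \<forall>m. infinite {n. \<forall>i<m. f i - F n i \<in> max_power m}"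
proof -
  let ?p = "int CARD('p)"
  define e where "e i j l = prod_encode (i, prod_encode (j, l))" for i j l
  define x where "x n k = (case prod_decode k of (i, c) \<Rightarrow> case prod_decode c of (j, l) \<Rightarrow> residue (fps_nth (F n i) j) l)" for n k
  have xe: "x n (e i j l) = residue (fps_nth (F n i) j) l" for n i j l by (simp add: x_def e_def)
  have "finite (range (\<lambda>n. x n k))" for k
  proof -
    obtain i j l where k: "k = e i j l" unfolding e_def by (metis prod_decode_inverse surj_pair)
    have "range (\<lambda>n. x n k) \<subseteq> {0..?p ^ l}"
      unfolding k using residue_nonneg residue_less by (fastforce simp: xe intro: less_imp_le)
    then show ?thesis by (rule finite_subset) simp
  qed
  then obtain y where y: "\<And>m. infinite {n. \<forall>k<m. x n k = y k}" using coordinatewise_accumulation by blast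
  have coh: "y (e i j l) = y (e i j (Suc l)) mod ?p ^ l" for i j l
  proof -
    have "infinite {n. \<forall>k<Suc (e i j l + e i j (Suc l)). x n k = y k}" using y .
    then obtain n where "\<forall>k<Suc (e i j l + e i j (Suc l)). x n k = y k"
      by (metis (mono_tags, lifting) Collect_empty_eq finite.emptyI)
    then have "x n (e i j l) = y (e i j l)" "x n (e i j (Suc l)) = y (e i j (Suc l))" by auto
    then show ?thesis unfolding xe by (metis residue_Suc_mod)
  qed
  define f where "f i = Abs_fps (\<lambda>j. Abs_padic_int (\<lambda>l. y (e i j l)) :: 'p padic_int)" for i
  have f: "residue (fps_nth (f i) j) l = y (e i j l)" for i j l
  proof -
    have "(\<lambda>l. y (e i j l)) \<in> {x. \<forall>n. x n = x (Suc n) mod ?p ^ n}" using coh by blast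
    then show ?thesis by (simp only: f_def fps_nth_Abs_fps Abs_padic_int_inverse)
  qed
  have "infinite {n. \<forall>i<m. f i - F n i \<in> max_power m}" for m
  proof -
    \<comment> \<open>\<open>M\<close> lies beyond the codes of the finitely many residues that
      decide membership in \<open>max_power m\<close>: coefficient \<open>j\<close> counts to
      precision \<open>m - j\<close>.\<close>
    define M where "M = Suc (Max ((\<lambda>(i, j). e i j (m - j)) ` ({..m} \<times> {..m})))"
    have M: "e i j (m - j) < M" if "i < m" "j < m" for i j
      unfolding M_def less_Suc_eq_le using that by (intro Max_ge) (auto intro!: image_eqI[of _ _ "(i, j)"])
    have "{n. \<forall>k<M. x n k = y k} \<subseteq> {n. \<forall>i<m. f i - F n i \<in> max_power m}"
    proof (intro subsetI CollectI allI impI)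
      fix n i assume n: "n \<in> {n. \<forall>k<M. x n k = y k}" and i: "i < m"
      have "padic_p ^ (m - j) dvd fps_nth (f i - F n i) j" for j
      proof (cases "j < m")
        case True
        then have "x n (e i j (m - j)) = y (e i j (m - j))" using n M[OF i True] by simp
        then have "residue (fps_nth (f i) j) (m - j) = residue (fps_nth (F n i) j) (m - j)"
          by (simp add: f xe)
        then show ?thesis by (simp add: residue_eq_iff_dvd)
      qed simp
      then show "f i - F n i \<in> max_power m" by (simp add: max_power_def)
    qed
    then show ?thesis using y[of M] infinite_super by blast
  qed
  then show ?thesis by blast
qed

section \<open>Height one primes of the Iwasawa algebra\<close>

lemma fps_X_dvd_iff: "fps_X dvd (f :: 'a :: comm_ring_1 fps) \<longleftrightarrow> fps_nth f 0 = 0"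
proof
  assume "fps_nth f 0 = 0"
  then have "f = fps_X * fps_shift 1 f" by (intro fps_ext) simp
  then show "fps_X dvd f" by (metis dvd_triv_left)
qed (auto elim!: dvdE)

lemma prime_elem_fps_X: "prime_elem (fps_X :: 'a :: idom fps)"
  by (auto simp: prime_elem_def fps_X_dvd_iff)

text \<open>A prime element lies in the maximal ideal, so its n-th power lies in the n-th power of
  that ideal. These powers intersect in zero, which bounds the exponent.\<close>

lemma iwasawa_pi_adic:
  fixes \<pi> f :: "'p :: prime_card padic_int fps"
  assumes "prime_elem \<pi>" "f \<noteq> 0"
  shows "\<exists>n y. f = \<pi> ^ n * y \<and> \<not> \<pi> dvd y"
proof -
  have pi: "\<pi> \<in> max_power 1" using nonunit_in_max_power prime_elem_not_unit[OF assms(1)] by blast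
  obtain N where N: "f \<notin> max_power N" using assms(2) max_power_all_imp_0 by blast
  have bd: "n < N" if "\<pi> ^ n dvd f" for n
  proof (rule ccontr)
    assume "\<not> n < N"
    moreover have "f \<in> max_power n"
      using that max_power_power[OF pi] max_power_mult_right by (metis dvdE)
    ultimately show False using N max_power_mono[of N n f] by simp
  qed
  define n where "n = (GREATEST n. \<pi> ^ n dvd f)"
  have n: "\<pi> ^ n dvd f" unfolding n_def by (rule GreatestI_nat[of _ 0 N]) (auto dest: bd)
  then obtain y where y: "f = \<pi> ^ n * y" by (elim dvdE)
  have "\<not> \<pi> dvd y"
  proof
    assume "\<pi> dvd y"
    then have "\<pi> ^ Suc n dvd f" unfolding y by (metis dvd_refl mult_dvd_mono power_Suc2)
    then have "Suc n \<le> n" unfolding n_def by (rule Greatest_le_nat[of _ _ N]) (auto dest: bd)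
    then show False by simp
  qed
  with y show ?thesis by blast
qed

text \<open>Successive approximation: subtract multiples of a generator with minimal constant term, and
  divide by \<open>T\<close>, which is not in \<open>P\<close>.\<close>

lemma prime_without_X_principal:
  fixes P :: "'p :: prime_card padic_int fps set"
  assumes add: "\<And>a b. a \<in> P \<Longrightarrow> b \<in> P \<Longrightarrow> a + b \<in> P"
    and mult: "\<And>a r. a \<in> P \<Longrightarrow> r * a \<in> P"
    and prime: "\<And>a b. a * b \<in> P \<Longrightarrow> a \<in> P \<or> b \<in> P"
    and X: "fps_X \<notin> P" and f: "f \<in> P" "f \<noteq> 0"
  shows "\<exists>\<pi>. prime_elem \<pi> \<and> P = {g. \<pi> dvd g}"
proof -
  have one: "1 \<notin> P" using mult[of 1 fps_X] X by auto
  \<comment> \<open>Powers of T are outside \<open>P\<close>, so \<open>f\<close> can be replaced by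
    a member of \<open>P\<close> with nonzero constant term.\<close>
  obtain n y where y: "f = fps_X ^ n * y" "\<not> fps_X dvd y"
    using iwasawa_pi_adic[OF prime_elem_fps_X f(2)] by blast
  have Xn: "fps_X ^ n \<notin> P" for n
    by (induction n) (use one X prime in auto)
  have yP: "y \<in> P" using prime[of "fps_X ^ n" y] f(1) y(1) Xn by auto
  have y0: "fps_nth y 0 \<noteq> 0" using y(2) by (simp add: fps_X_dvd_iff)
  obtain \<pi> where \<pi>: "\<pi> \<in> P" "fps_nth \<pi> 0 \<noteq> 0" and min: "\<And>h. h \<in> P \<Longrightarrow> fps_nth \<pi> 0 dvd fps_nth h 0"
    using padic_exists_dvd_all[of "fps_nth y 0" "(\<lambda>h. fps_nth h 0) ` P"] yP y0 by auto
  have "\<pi> dvd g" if g: "g \<in> P" for g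
  proof -
    define c where "c h = (SOME c. fps_nth h 0 = c * fps_nth \<pi> 0)" for h
    have c: "fps_nth h 0 = c h * fps_nth \<pi> 0" if "h \<in> P" for h
    proof -
      have "\<exists>c. fps_nth h 0 = c * fps_nth \<pi> 0" using min[OF that] by (metis dvdE mult.commute)
      then show ?thesis unfolding c_def by (rule someI_ex)
    qed
    define nx where "nx h = fps_shift 1 (h - fps_const (c h) * \<pi>)" for h
    have nx: "h = fps_const (c h) * \<pi> + fps_X * nx h" "nx h \<in> P" if h: "h \<in> P" for h
    proof -
      have "fps_X dvd h - fps_const (c h) * \<pi>" using c[OF h] by (simp add: fps_X_dvd_iff)
      then have e: "h - fps_const (c h) * \<pi> = fps_X * nx h"
      proof -
        obtain k where k: "h - fps_const (c h) * \<pi> = fps_X * k" using \<open>fps_X dvd _\<close> by (elim dvdE)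
        have "nx h = k" unfolding nx_def k by (intro fps_ext) simp
        then show ?thesis using k by simp
      qed
      then show "h = fps_const (c h) * \<pi> + fps_X * nx h" by (simp add: algebra_simps)
      have "h + (- fps_const (c h)) * \<pi> \<in> P" using h \<pi>(1) by (intro add mult)
      then have "fps_X * nx h \<in> P" unfolding e[symmetric] by (simp only: mult_minus_left diff_conv_add_uminus)
      then show "nx h \<in> P" using prime X by blast
    qed
    define s where "s n = (nx ^^ n) g" for n
    have s: "s n \<in> P" for n by (induction n) (auto simp: s_def g nx)
    define q where "q = Abs_fps (\<lambda>n. c (s n))"
    have expand: "g = \<pi> * (\<Sum>k<n. fps_const (c (s k)) * fps_X ^ k) + fps_X ^ n * s n" for n
    proof (induction n)
      case 0 then show ?case by (simp add: s_def)
    next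
      case (Suc n)
      have "s n = fps_const (c (s n)) * \<pi> + fps_X * s (Suc n)" using nx(1)[OF s[of n]] by (simp add: s_def)
      then have "fps_X ^ n * s n = fps_X ^ n * (fps_const (c (s n)) * \<pi> + fps_X * s (Suc n))"
        by (rule arg_cong)
      also have "\<dots> = \<pi> * (fps_const (c (s n)) * fps_X ^ n) + fps_X ^ Suc n * s (Suc n)"
        by (simp add: algebra_simps)
      finally have "fps_X ^ n * s n = \<dots>" .
      with Suc have "g = \<pi> * (\<Sum>k<n. fps_const (c (s k)) * fps_X ^ k) + (\<pi> * (fps_const (c (s n)) * fps_X ^ n) + fps_X ^ Suc n * s (Suc n))"
        by (simp only:)
      also have "\<dots> = \<pi> * (\<Sum>k<Suc n. fps_const (c (s k)) * fps_X ^ k) + fps_X ^ Suc n * s (Suc n)"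
        by (simp only: sum.lessThan_Suc distrib_left add.assoc)
      finally show ?case .
    qed
    have "g = \<pi> * q"
    proof (rule fps_ext)
      fix m
      have "fps_nth (\<Sum>k<Suc m. fps_const (c (s k)) * fps_X ^ k) i = fps_nth q i" if "i \<le> m" for i
      proof -
        have "fps_nth (\<Sum>k<Suc m. fps_const (c (s k)) * fps_X ^ k) i
            = (\<Sum>k<Suc m. if k = i then c (s k) else 0)"
          unfolding fps_sum_nth by (intro sum.cong) (auto simp: fps_X_power_nth)
        also have "\<dots> = c (s i)" using that by simp
        finally show ?thesis by (simp add: q_def)
      qed
      then have "fps_nth (\<pi> * (\<Sum>k<Suc m. fps_const (c (s k)) * fps_X ^ k)) m = fps_nth (\<pi> * q) m"
        unfolding fps_mult_nth by (intro sum.cong) auto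
      moreover have "fps_nth (fps_X ^ Suc m * s (Suc m)) m = 0" by (simp only: fps_X_power_mult_nth) simp
      ultimately show "fps_nth g m = fps_nth (\<pi> * q) m"
        using expand[of "Suc m"] by (metis add.right_neutral fps_add_nth)
    qed
    then show ?thesis by simp
  qed
  then have P: "P = {g. \<pi> dvd g}" using mult[OF \<pi>(1)] by (auto elim!: dvdE simp: mult.commute)
  moreover have "prime_elem \<pi>"
    unfolding prime_elem_def
  proof (intro conjI allI impI)
    show "\<pi> \<noteq> 0" using \<pi>(2) by auto
    show "\<not> \<pi> dvd 1" using one P by auto
    show "\<pi> dvd a \<or> \<pi> dvd b" if "\<pi> dvd a * b" for a b using prime[of a b] that P by auto
  qed
  ultimately show ?thesis by blast
qed

text \<open>If \<open>f\<close> divides a power of T, then T divides \<open>f\<close>. Otherwise an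
  ideal containing \<open>f\<close> and maximal among those without powers of T is prime and does
  not contain T; it is generated by a prime element, which therefore divides
  \<open>f\<close>.\<close>

lemma exists_prime_divisor:
  fixes f :: "'p :: prime_card padic_int fps"
  assumes f: "f \<noteq> 0" "\<not> f dvd 1"
  shows "\<exists>\<pi>. prime_elem \<pi> \<and> \<pi> dvd f"
proof (cases "\<exists>n. f dvd fps_X ^ n")
  case True
  then obtain n g where g: "fps_X ^ n = f * g" by (metis dvdE)
  have "fps_X dvd f"
  proof (rule ccontr)
    assume "\<not> fps_X dvd f"
    then have "fps_X ^ n dvd g"
      using prime_elem_power_dvd_multD[OF prime_elem_fps_X, of f n g] g by simp
    then obtain h where "g = fps_X ^ n * h" by (elim dvdE)
    then have "fps_X ^ n * (f * h) = fps_X ^ n * 1" using g by (simp add: mult_ac)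
    then have "f * h = 1" by (metis fps_X_neq_zero mult_left_cancel power_not_zero)
    then show False using f(2) by (metis dvd_triv_left)
  qed
  then show ?thesis using prime_elem_fps_X by blast
next
  case False
  define \<A> where "\<A> = {I :: 'p padic_int fps set. (\<forall>a\<in>I. \<forall>b\<in>I. a + b \<in> I) \<and> (\<forall>a\<in>I. \<forall>r. r * a \<in> I) \<and>
    f \<in> I \<and> (\<forall>n. fps_X ^ n \<notin> I)}"
  have "{g. f dvd g} \<in> \<A>" using False by (auto simp: \<A>_def)
  then have ne: "\<A> \<noteq> {}" by blast
  have "\<exists>M\<in>\<A>. \<forall>I\<in>\<A>. M \<subseteq> I \<longrightarrow> I = M"
  proof (rule subset_Zorn_nonempty[OF ne])
    fix \<C> assume C: "\<C> \<noteq> {}" "subset.chain \<A> \<C>"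
    have sub: "\<C> \<subseteq> \<A>" and tot: "\<And>I J. I \<in> \<C> \<Longrightarrow> J \<in> \<C> \<Longrightarrow> I \<subseteq> J \<or> J \<subseteq> I"
      using C(2) by (auto simp: subset.chain_def)
    have "a + b \<in> \<Union>\<C>" if "a \<in> \<Union>\<C>" "b \<in> \<Union>\<C>" for a b
    proof -
      obtain I J where IJ: "I \<in> \<C>" "a \<in> I" "J \<in> \<C>" "b \<in> J" using \<open>a \<in> \<Union>\<C>\<close> \<open>b \<in> \<Union>\<C>\<close> by blast
      then obtain L where "L \<in> \<C>" "a \<in> L" "b \<in> L" using tot[of I J] by blast
      then show ?thesis using sub unfolding \<A>_def by blast
    qed
    moreover have "r * a \<in> \<Union>\<C>" if "a \<in> \<Union>\<C>" for a r using that sub unfolding \<A>_def by blast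
    moreover have "f \<in> \<Union>\<C>" "\<And>n. fps_X ^ n \<notin> \<Union>\<C>" using C(1) sub unfolding \<A>_def by blast+
    ultimately show "\<Union>\<C> \<in> \<A>" unfolding \<A>_def by blast
  qed
  then obtain P where P: "P \<in> \<A>" and max: "\<And>I. I \<in> \<A> \<Longrightarrow> P \<subseteq> I \<Longrightarrow> I = P" by blast
  have add: "\<And>a b. a \<in> P \<Longrightarrow> b \<in> P \<Longrightarrow> a + b \<in> P" and mult: "\<And>a r. a \<in> P \<Longrightarrow> r * a \<in> P"
    and fP: "f \<in> P" and XP: "\<And>n. fps_X ^ n \<notin> P" using P unfolding \<A>_def by blast+
  have zero: "0 \<in> P" using mult[OF fP, of 0] by simp
  \<comment> \<open>By maximality, enlarging \<open>P\<close> by \<open>a\<close> produces a power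
    of T. Multiplying two such relations shows that \<open>P\<close> is prime.\<close>
  have ext: "\<exists>n x r. x \<in> P \<and> fps_X ^ n = x + a * r" if a: "a \<notin> P" for a
  proof (rule ccontr)
    assume neg: "\<not> ?thesis"
    define I where "I = {x + a * r | x r. x \<in> P}"
    have Imem: "x + a * r \<in> I" if "x \<in> P" for x r using that unfolding I_def by blast
    have sub: "P \<subseteq> I" using Imem[of _ 0] by auto
    have "I \<in> \<A>"
      unfolding \<A>_def mem_Collect_eq
    proof (intro conjI ballI allI)
      fix u w assume "u \<in> I" "w \<in> I"
      then obtain x r y s where "u = x + a * r" "w = y + a * s" "x \<in> P" "y \<in> P" unfolding I_def by blast
      then show "u + w \<in> I" using Imem[of "x + y" "r + s"] add by (simp add: algebra_simps)
    next
      fix u t assume "u \<in> I"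
      then obtain x r where "u = x + a * r" "x \<in> P" unfolding I_def by blast
      then show "t * u \<in> I" using Imem[of "t * x" "t * r"] mult by (simp add: algebra_simps)
    next
      show "f \<in> I" using sub fP by blast
      show "fps_X ^ n \<notin> I" for n using neg unfolding I_def by blast
    qed
    then have "I = P" using max sub by blast
    moreover have "a \<in> I" using Imem[OF zero, of 1] by simp
    ultimately show False using a by blast
  qed
  have prime: "a \<in> P \<or> b \<in> P" if ab: "a * b \<in> P" for a b
  proof (rule ccontr)
    assume "\<not> ?thesis"
    then obtain m x r n y s where x: "x \<in> P" "fps_X ^ m = x + a * r" and y: "y \<in> P" "fps_X ^ n = y + b * s"
      using ext by meson
    have "fps_X ^ (m + n) = (b * s) * x + ((a * r) * y + (y * x + (r * s) * (a * b)))"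
      unfolding power_add x(2) y(2) by (simp add: algebra_simps)
    also have "\<dots> \<in> P" by (rule add[OF mult[OF x(1)] add[OF mult[OF y(1)] add[OF mult[OF x(1)] mult[OF ab]]]])
    finally show False using XP by blast
  qed
  have "fps_X \<notin> P" using XP[of 1] by simp
  then have "\<exists>\<pi>. prime_elem \<pi> \<and> P = {g. \<pi> dvd g}"
    using prime_without_X_principal[of P f] add mult prime fP f(1) by blast
  then show ?thesis using fP by blast
qed

lemma ring_of_type_algebra_simps:
  "carrier (ring_of_type_algebra :: 'a :: comm_ring_1 ring) = UNIV"
  "x \<otimes>\<^bsub>ring_of_type_algebra\<^esub> y = x * y" "x \<oplus>\<^bsub>ring_of_type_algebra\<^esub> y = x + y"
  "\<one>\<^bsub>ring_of_type_algebra\<^esub> = (1 :: 'a)" "\<zero>\<^bsub>ring_of_type_algebra\<^esub> = (0 :: 'a)"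
  by (simp_all add: ring_of_type_algebra_def)

lemma PIdl_type: "PIdl\<^bsub>ring_of_type_algebra\<^esub> (a :: 'a :: comm_ring_1) = {g. a dvd g}"
  by (auto simp: cgenideal_def ring_of_type_algebra_simps mult.commute elim!: dvdE)

lemma ideal_multiples: "ideal {g. (a :: 'a :: comm_ring_1) dvd g} ring_of_type_algebra"
  using cring.cgenideal_ideal[OF cring_from_type_algebra, of a] by (simp add: PIdl_type ring_of_type_algebra_simps)

lemma ideal_typeD:
  fixes I :: "'a :: comm_ring_1 set"
  assumes "ideal I ring_of_type_algebra"
  shows "0 \<in> I" "a \<in> I \<Longrightarrow> b \<in> I \<Longrightarrow> a + b \<in> I" "a \<in> I \<Longrightarrow> r * a \<in> I"
proof -
  interpret ideal I "ring_of_type_algebra :: 'a ring" by fact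
  show "0 \<in> I" "a \<in> I \<Longrightarrow> b \<in> I \<Longrightarrow> a + b \<in> I" "a \<in> I \<Longrightarrow> r * a \<in> I"
    using additive_subgroup.zero_closed[OF is_additive_subgroup]
      additive_subgroup.a_closed[OF is_additive_subgroup, of a b] I_l_closed[of a r]
    by (simp_all add: ring_of_type_algebra_simps)
qed

lemma primeideal_typeD:
  fixes I :: "'a :: comm_ring_1 set"
  assumes "primeideal I ring_of_type_algebra"
  shows "ideal I ring_of_type_algebra" "1 \<notin> I" "a * b \<in> I \<Longrightarrow> a \<in> I \<or> b \<in> I"
proof -
  interpret primeideal I "ring_of_type_algebra :: 'a ring" by fact
  show id: "ideal I ring_of_type_algebra" by (rule is_ideal)
  show "a * b \<in> I \<Longrightarrow> a \<in> I \<or> b \<in> I" using I_prime[of a b] by (simp add: ring_of_type_algebra_simps)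
  show "1 \<notin> I"
  proof
    assume "1 \<in> I"
    then have "x \<in> I" for x using ideal_typeD(3)[OF id, of 1 x] by simp
    then have "I = UNIV" by blast
    then show False using I_notcarr by (simp add: ring_of_type_algebra_simps)
  qed
qed

lemma primeideal_multiples:
  fixes \<pi> :: "'a :: idom"
  assumes "\<not> \<pi> dvd 1" "\<And>a b. \<pi> dvd a * b \<Longrightarrow> \<pi> dvd a \<or> \<pi> dvd b"
  shows "primeideal {g. \<pi> dvd g} ring_of_type_algebra"
proof (rule primeidealI[OF ideal_multiples cring_from_type_algebra])
  show "carrier ring_of_type_algebra \<noteq> {g. \<pi> dvd g}" using assms(1) by (auto simp: ring_of_type_algebra_simps)
qed (use assms(2) in \<open>auto simp: ring_of_type_algebra_simps\<close>)

text \<open>Every nonzero prime contains a prime element: T, or its generator if T is not in it. So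
  height one forces it to be generated by that element. Conversely, a nonzero prime inside (\<pi>)
  but smaller contains some \<open>\<pi> ^ n * y\<close> with \<open>y\<close> outside (\<pi>),
  hence \<pi> itself.\<close>

lemma height_one_primes_iwasawa:
  "height_one_primes (Lambda :: 'p :: prime_card padic_int fps ring) = {{g. \<pi> dvd g} | \<pi>. prime_elem \<pi>}"
proof (intro equalityI subsetI)
  fix P :: "'p padic_int fps set"
  assume "P \<in> height_one_primes Lambda"
  then obtain Q where P: "primeideal P Lambda" and Q: "primeideal Q Lambda" "Q \<subset> P"
    and h1: "\<not> (\<exists>Q Q'. primeideal Q Lambda \<and> primeideal Q' Lambda \<and> Q \<subset> Q' \<and> Q' \<subset> P)"
    unfolding height_one_primes_def mem_Collect_eq by blast
  note PD = primeideal_typeD[OF P] and ID = ideal_typeD[OF primeideal_typeD(1)[OF P]]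
  obtain f where f: "f \<in> P" "f \<noteq> 0"
    using Q(2) ideal_typeD(1)[OF primeideal_typeD(1)[OF Q(1)]] by blast
  obtain \<pi> where \<pi>: "prime_elem \<pi>" "\<pi> \<in> P"
  proof (cases "fps_X \<in> P")
    case True then show ?thesis using that prime_elem_fps_X by blast
  next
    case False
    then obtain \<pi> where "prime_elem \<pi>" "P = {g. \<pi> dvd g}"
      using prime_without_X_principal[OF ID(2) ID(3) PD(3) False f] by blast
    then show ?thesis using that[of \<pi>] by simp
  qed
  have sub: "{g. \<pi> dvd g} \<subseteq> P" using ID(3)[OF \<pi>(2)] by (auto elim!: dvdE simp: mult.commute)
  have pr: "primeideal {g. \<pi> dvd g} Lambda"
    using \<pi>(1) by (intro primeideal_multiples) (auto simp: prime_elem_dvd_mult_iff dest: prime_elem_not_unit)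
  have z: "primeideal {g. 0 dvd g} Lambda" by (rule primeideal_multiples) auto
  have "{g. 0 dvd g} \<subset> {g. \<pi> dvd g}"
  proof -
    have "\<pi> \<noteq> 0" using \<pi>(1) by auto
    then have "\<pi> \<in> {g. \<pi> dvd g}" "\<pi> \<notin> {g. 0 dvd g}" by simp_all
    moreover have "{g. 0 dvd g} \<subseteq> {g. \<pi> dvd g}" by simp
    ultimately show ?thesis by blast
  qed
  then have "P = {g. \<pi> dvd g}" using h1 z pr sub by blast
  then show "P \<in> {{g. \<pi> dvd g} | \<pi>. prime_elem \<pi>}" using \<pi>(1) by blast
next
  fix P :: "'p padic_int fps set"
  assume "P \<in> {{g. \<pi> dvd g} | \<pi>. prime_elem \<pi>}"
  then obtain \<pi> where \<pi>: "prime_elem \<pi>" and P: "P = {g. \<pi> dvd g}" by blast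
  have pr: "primeideal P Lambda"
    unfolding P using \<pi> by (intro primeideal_multiples) (auto simp: prime_elem_dvd_mult_iff dest: prime_elem_not_unit)
  have z: "primeideal {g. 0 dvd g} Lambda" by (rule primeideal_multiples) auto
  have zP: "{g. 0 dvd g} \<subset> P"
  proof -
    have "\<pi> \<noteq> 0" using \<pi> by auto
    then have "\<pi> \<in> P" "\<pi> \<notin> {g. 0 dvd g}" unfolding P by simp_all
    moreover have "{g. 0 dvd g} \<subseteq> P" unfolding P by simp
    ultimately show ?thesis by blast
  qed
  have nochain: "False" if Q: "primeideal Q Lambda" "primeideal Q' Lambda" "Q \<subset> Q'" "Q' \<subset> P" for Q Q'
  proof -
    note QD = primeideal_typeD[OF Q(2)] and ID = ideal_typeD[OF primeideal_typeD(1)[OF Q(2)]]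
    obtain f where f: "f \<in> Q'" "f \<noteq> 0"
      using Q(3) ideal_typeD(1)[OF primeideal_typeD(1)[OF Q(1)]] by blast
    obtain n y where y: "f = \<pi> ^ n * y" "\<not> \<pi> dvd y" using iwasawa_pi_adic[OF \<pi> f(2)] by blast
    have "y \<notin> Q'" using y(2) Q(4) P by blast
    then have "\<pi> ^ n \<in> Q'" using QD(3)[of "\<pi> ^ n" y] f(1) y(1) by blast
    moreover have "\<pi> ^ n \<in> Q' \<longrightarrow> \<pi> \<in> Q'" for n by (induction n) (use QD in auto)
    ultimately have "\<pi> \<in> Q'" by blast
    then have "P \<subseteq> Q'" unfolding P using ID(3)[of \<pi>] by (auto elim!: dvdE simp: mult.commute)
    then show False using Q(4) by blast
  qed
  show "P \<in> height_one_primes Lambda"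
    unfolding height_one_primes_def mem_Collect_eq
  proof (intro conjI notI)
    show "\<exists>Q. primeideal Q Lambda \<and> Q \<subset> P" using z zP by (intro exI conjI)
    assume "\<exists>Q Q'. primeideal Q Lambda \<and> primeideal Q' Lambda \<and> Q \<subset> Q' \<and> Q' \<subset> P"
    then show False by (elim exE conjE) (rule nochain)
  qed (rule pr)
qed

section \<open>Products of powers of height one primes\<close>

lemma ideal_prod_multiples:
  "{g. (a :: 'a :: comm_ring_1) dvd g} \<cdot>\<^bsub>ring_of_type_algebra\<^esub> {g. b dvd g} = {g. a * b dvd g}"
proof (intro equalityI subsetI)
  fix x assume "x \<in> {g. a dvd g} \<cdot>\<^bsub>ring_of_type_algebra\<^esub> {g. b dvd g}"
  then show "x \<in> {g. a * b dvd g}"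
    by (induction rule: ideal_prod.induct) (auto simp: ring_of_type_algebra_simps mult_dvd_mono)
next
  fix x assume "x \<in> {g. a * b dvd g}"
  then obtain r where "x = a * (b * r)" by (auto elim!: dvdE simp: mult.assoc)
  moreover have "a \<otimes>\<^bsub>ring_of_type_algebra\<^esub> (b * r) \<in> {g. a dvd g} \<cdot>\<^bsub>ring_of_type_algebra\<^esub> {g. b dvd g}"
    by (rule ideal_prod.prod) auto
  ultimately show "x \<in> {g. a dvd g} \<cdot>\<^bsub>ring_of_type_algebra\<^esub> {g. b dvd g}" by (simp add: ring_of_type_algebra_simps)
qed

text \<open>Unique factorisation in the form that \<open>char_ideal\<close> requires. The induction
  is on \<open>N\<close> with \<open>f\<close> outside \<open>max_power N\<close>, since dividing by
  a prime element lowers \<open>N\<close> by one. Finiteness of the support is carried along because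
  \<open>gfinprod\<close> takes the value one on infinite supports.\<close>

lemma gfinprod_height_one_primes:
  fixes f :: "'p :: prime_card padic_int fps"
  assumes "f \<noteq> 0" "\<And>\<pi> n y. prime_elem \<pi> \<Longrightarrow> f = \<pi> ^ n * y \<Longrightarrow> \<not> \<pi> dvd y \<Longrightarrow> e {g. \<pi> dvd g} = n"
  shows "gfinprod (ideals_set Lambda) (\<lambda>P. P [^]\<^bsub>ideals_set Lambda\<^esub> (e P :: nat)) (height_one_primes Lambda)
    = {g. f dvd g}"
proof -
  let ?I = "ideals_set (Lambda :: 'p padic_int fps ring)" and ?H = "height_one_primes (Lambda :: 'p padic_int fps ring)"
  interpret I: comm_monoid ?I
    by (rule cring.ideals_set_is_comm_monoid) (rule cring_from_type_algebra)
  have Isimps: "carrier ?I = {I. ideal I Lambda}" "monoid.mult ?I = ideal_prod Lambda" "\<one>\<^bsub>?I\<^esub> = UNIV"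
    by (simp_all add: ideals_set_def ring_of_type_algebra_simps)
  have Hc: "?H \<subseteq> carrier ?I" unfolding height_one_primes_iwasawa Isimps using ideal_multiples by blast
  have pw: "(\<lambda>P. P [^]\<^bsub>?I\<^esub> (e P :: nat)) \<in> ?H \<rightarrow> carrier ?I" for e
    using Hc by (intro Pi_I I.nat_pow_closed) blast
  obtain N where "f \<notin> max_power N" using assms(1) max_power_all_imp_0 by blast
  then have "finite {P \<in> ?H. e P \<noteq> 0} \<and> gfinprod ?I (\<lambda>P. P [^]\<^bsub>?I\<^esub> e P) ?H = {g. f dvd g}"
    using assms
  proof (induction N arbitrary: f e)
    case 0 then show ?case by simp
  next
    case (Suc N)
    show ?case
    proof (cases "f dvd 1")
      case True
      have e0: "e P = 0" if PH: "P \<in> ?H" for P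
      proof -
        obtain \<pi> where \<pi>: "P = {g. \<pi> dvd g}" "prime_elem \<pi>" using PH unfolding height_one_primes_iwasawa by blast
        have "\<not> \<pi> dvd f" using True prime_elem_not_unit[OF \<pi>(2)] by (meson dvd_trans)
        then show ?thesis using Suc.prems(3)[OF \<pi>(2), of 0 f] \<pi>(1) by simp
      qed
      have "gfinprod ?I (\<lambda>P. P [^]\<^bsub>?I\<^esub> e P) ?H = gfinprod ?I (\<lambda>P. \<one>\<^bsub>?I\<^esub>) ?H"
        by (rule I.gfinprod_cong) (auto simp: e0)
      also have "\<dots> = UNIV" by (simp add: gfinprod_def Isimps)
      also have "\<dots> = {g. f dvd g}" using True by (auto intro: dvd_trans)
      finally have "gfinprod ?I (\<lambda>P. P [^]\<^bsub>?I\<^esub> e P) ?H = {g. f dvd g}" .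
      moreover have "{P \<in> ?H. e P \<noteq> 0} = {}" using e0 by simp
      ultimately show ?thesis by (simp only: finite.emptyI)
    next
      case False
      then obtain \<pi> h where \<pi>: "prime_elem \<pi>" and h: "f = \<pi> * h"
        using exists_prime_divisor[OF Suc.prems(2)] by (metis dvdE)
      let ?P = "{g. \<pi> dvd g}"
      have PH: "?P \<in> ?H" unfolding height_one_primes_iwasawa using \<pi> by blast
      have h0: "h \<noteq> 0" using Suc.prems(2) h by auto
      have "h \<notin> max_power N"
        using Suc.prems(1) max_power_mult[OF nonunit_in_max_power, of \<pi> h N] prime_elem_not_unit[OF \<pi>] h by auto
      \<comment> \<open>The exponents of \<open>h\<close>, the quotient of \<open>f\<close> by
        \<pi>. At \<open>?P\<close> the exponent of \<open>f\<close> is at least 1, so truncated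
        subtraction is exact.\<close>
      define e' where "e' P = e P - (if P = ?P then 1 else 0)" for P
      have main: "e' {g. \<rho> dvd g} = n \<and> e {g. \<rho> dvd g} = n + (if {g. \<rho> dvd g} = ?P then 1 else 0)"
        if \<rho>: "prime_elem \<rho>" "h = \<rho> ^ n * y" "\<not> \<rho> dvd y" for \<rho> n y
      proof (cases "{g. \<rho> dvd g} = ?P")
        case True
        then have "\<rho> dvd \<pi>" "\<pi> dvd \<rho>" by (blast intro: dvd_refl)+
        then obtain w where w: "\<pi> = \<rho> * w" by (elim dvdE)
        have "\<not> \<rho> dvd w"
        proof
          assume "\<rho> dvd w"
          then have "\<rho> * \<rho> dvd \<rho>" using \<open>\<pi> dvd \<rho>\<close> w by (metis dvd_refl dvd_trans mult_dvd_mono)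
          then have "\<rho> dvd 1" using \<rho>(1) by (metis dvd_times_left_cancel_iff mult.right_neutral not_prime_elem_zero)
          then show False using prime_elem_not_unit[OF \<rho>(1)] by simp
        qed
        then have "\<not> \<rho> dvd w * y" using \<rho>(3) prime_elem_dvd_mult_iff[OF \<rho>(1)] by blast
        moreover have "f = \<rho> ^ Suc n * (w * y)" unfolding h \<rho>(2) w by (simp add: mult_ac)
        ultimately have "e {g. \<rho> dvd g} = Suc n" using Suc.prems(3)[OF \<rho>(1)] by blast
        then show ?thesis using True by (simp add: e'_def)
      next
        case False
        have "\<not> \<rho> dvd \<pi>"
        proof
          assume "\<rho> dvd \<pi>"
          then obtain w where w: "\<pi> = \<rho> * w" by (elim dvdE)
          then have "\<pi> dvd \<rho> \<or> \<pi> dvd w" using prime_elem_dvd_multD[OF \<pi>, of \<rho> w] by simp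
          moreover have "\<not> \<pi> dvd w"
          proof
            assume "\<pi> dvd w"
            then obtain u where u: "w = \<pi> * u" by (elim dvdE)
            have "\<pi> * 1 = \<pi> * (\<rho> * u)" using w u by (metis mult.left_commute mult.right_neutral)
            then have "1 = \<rho> * u" using \<pi> by (metis mult_left_cancel not_prime_elem_zero)
            then show False using prime_elem_not_unit[OF \<rho>(1)] by (metis dvd_triv_left)
          qed
          ultimately have "\<pi> dvd \<rho>" by blast
          then have "{g. \<rho> dvd g} = ?P" using \<open>\<rho> dvd \<pi>\<close> by (blast intro: dvd_trans)
          then show False using False by blast
        qed
        then have "\<not> \<rho> dvd \<pi> * y" using \<rho>(3) prime_elem_dvd_mult_iff[OF \<rho>(1)] by blast
        moreover have "f = \<rho> ^ n * (\<pi> * y)" unfolding h \<rho>(2) by (simp add: mult_ac)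
        ultimately have "e {g. \<rho> dvd g} = n" using Suc.prems(3)[OF \<rho>(1)] by blast
        then show ?thesis using False by (simp add: e'_def)
      qed
      have IH: "finite {P \<in> ?H. e' P \<noteq> 0}" "gfinprod ?I (\<lambda>P. P [^]\<^bsub>?I\<^esub> e' P) ?H = {g. h dvd g}"
        using Suc.IH[OF \<open>h \<notin> max_power N\<close> h0, of e'] main by blast+
      define \<delta> where "\<delta> P = (if P = ?P then 1 else 0 :: nat)" for P
      have e: "e P = e' P + \<delta> P" if PH: "P \<in> ?H" for P
      proof -
        obtain \<rho> where \<rho>: "P = {g. \<rho> dvd g}" "prime_elem \<rho>" using PH unfolding height_one_primes_iwasawa by blast
        obtain n y where "h = \<rho> ^ n * y" "\<not> \<rho> dvd y" using iwasawa_pi_adic[OF \<rho>(2) h0] by blast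
        then show ?thesis using main[OF \<rho>(2)] \<rho>(1) unfolding \<delta>_def by metis
      qed
      have fin: "finite {P \<in> ?H. e P \<noteq> 0}"
      proof (rule finite_subset)
        have "P = ?P \<or> e' P \<noteq> 0" if "P \<in> ?H" "e P \<noteq> 0" for P
          using e[OF that(1)] that(2) unfolding \<delta>_def by (cases "P = ?P") simp_all
        then show "{P \<in> ?H. e P \<noteq> 0} \<subseteq> insert ?P {P \<in> ?H. e' P \<noteq> 0}" by blast
      qed (use IH(1) in simp)
      have s1: "finite {P \<in> ?H. P [^]\<^bsub>?I\<^esub> e' P \<noteq> \<one>\<^bsub>?I\<^esub>}"
      proof (rule finite_subset[OF _ IH(1)])
        have "P [^]\<^bsub>?I\<^esub> e' P = \<one>\<^bsub>?I\<^esub>" if "e' P = 0" for P using that by simp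
        then show "{P \<in> ?H. P [^]\<^bsub>?I\<^esub> e' P \<noteq> \<one>\<^bsub>?I\<^esub>} \<subseteq> {P \<in> ?H. e' P \<noteq> 0}" by blast
      qed
      have s2: "finite {P \<in> ?H. P [^]\<^bsub>?I\<^esub> \<delta> P \<noteq> \<one>\<^bsub>?I\<^esub>}"
      proof (rule finite_subset)
        have "P [^]\<^bsub>?I\<^esub> \<delta> P = \<one>\<^bsub>?I\<^esub>" if "P \<noteq> ?P" for P using that by (simp add: \<delta>_def)
        then show "{P \<in> ?H. P [^]\<^bsub>?I\<^esub> \<delta> P \<noteq> \<one>\<^bsub>?I\<^esub>} \<subseteq> {?P}" by blast
      qed simp
      have "gfinprod ?I (\<lambda>P. P [^]\<^bsub>?I\<^esub> e P) ?H = gfinprod ?I (\<lambda>P. P [^]\<^bsub>?I\<^esub> e' P \<otimes>\<^bsub>?I\<^esub> P [^]\<^bsub>?I\<^esub> \<delta> P) ?H"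
      proof -
        have eq: "P [^]\<^bsub>?I\<^esub> e P = P [^]\<^bsub>?I\<^esub> e' P \<otimes>\<^bsub>?I\<^esub> P [^]\<^bsub>?I\<^esub> \<delta> P" if "P \<in> ?H" for P
          using I.nat_pow_mult[of P "e' P" "\<delta> P"] Hc e[OF that] that by auto
        show ?thesis by (rule I.gfinprod_cong[OF refl pw]) (unfold simp_implies_def, rule eq)
      qed
      also have "\<dots> = gfinprod ?I (\<lambda>P. P [^]\<^bsub>?I\<^esub> e' P) ?H \<otimes>\<^bsub>?I\<^esub> gfinprod ?I (\<lambda>P. P [^]\<^bsub>?I\<^esub> \<delta> P) ?H"
        by (rule I.gfinprod_distrib[OF s1 s2 pw pw])
      also have "gfinprod ?I (\<lambda>P. P [^]\<^bsub>?I\<^esub> \<delta> P) ?H = gfinprod ?I (\<lambda>P. P [^]\<^bsub>?I\<^esub> \<delta> P) {?P}"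
      proof (rule I.gfinprod_mono_neutral_cong_right[OF _ _ _ pw])
        show "{?P} \<subseteq> ?H" using PH by blast
        show "P [^]\<^bsub>?I\<^esub> \<delta> P = \<one>\<^bsub>?I\<^esub>" if "P \<in> ?H - {?P}" for P using that by (simp add: \<delta>_def)
      qed simp
      also have "\<dots> = ?P"
      proof -
        have "?P \<in> carrier ?I" using PH Hc by blast
        then have c: "(\<lambda>P. P [^]\<^bsub>?I\<^esub> \<delta> P) \<in> {?P} \<rightarrow> carrier ?I" by (simp only: Pi_iff) (simp add: \<delta>_def)
        have "finprod ?I (\<lambda>P. P [^]\<^bsub>?I\<^esub> \<delta> P) {?P} = ?P [^]\<^bsub>?I\<^esub> \<delta> ?P"
          using c by (subst I.finprod_insert) simp_all
        also have "\<dots> = ?P" using \<open>?P \<in> carrier ?I\<close> by (simp add: \<delta>_def)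
        finally show ?thesis by (subst I.gfinprod_eq_finprod[OF _ c]) simp_all
      qed
      also have "gfinprod ?I (\<lambda>P. P [^]\<^bsub>?I\<^esub> e' P) ?H \<otimes>\<^bsub>?I\<^esub> ?P = {g. f dvd g}"
        unfolding IH(2) h Isimps ideal_prod_multiples by (simp add: mult.commute)
      finally show ?thesis using fin by blast
    qed
  qed
  then show ?thesis by blast
qed

section \<open>Polynomials in \<open>\<gamma> = 1 + T\<close>\<close>

text \<open>The sum is a product of \<open>r\<close> geometric sums with p terms, in
  \<open>y\<close>, \<open>y ^ p\<close> and so on. Each is congruent to p modulo its base minus 1
  and so lies in the maximal ideal.\<close>

lemma geometric_sum_max_power:
  fixes y :: "'p :: prime_card padic_int fps"
  assumes "y - 1 \<in> max_power 1"
  shows "(\<Sum>i<CARD('p) ^ r. y ^ i) \<in> max_power r"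
  using assms
proof (induction r arbitrary: y)
  case (Suc r)
  let ?p = "CARD('p)"
  have geo: "(z - 1) * (\<Sum>i<n. z ^ i) = z ^ n - 1" for z :: "'p padic_int fps" and n
    by (rule power_diff_1_eq[symmetric])
  have powm: "y ^ i - 1 \<in> max_power 1" for i
    using max_power_mult_right[OF Suc.prems] by (simp flip: geo)
  have "(\<Sum>i<?p. y ^ i) = (\<Sum>i<?p. y ^ i - 1) + of_nat ?p" by (simp add: sum_subtractf)
  also have "\<dots> \<in> max_power 1"
    by (rule max_power_add[OF max_power_sum[OF powm] padic_p_in_max_power])
  finally have s1: "(\<Sum>i<?p. y ^ i) \<in> max_power 1" .
  show ?case
  \<comment> \<open>The factorisation below is obtained by cancelling \<open>y - 1\<close>.\<close>
  proof (cases "y = 1")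
    case True
    have "of_nat ?p ^ Suc r \<in> (max_power (Suc r) :: 'p padic_int fps set)"
      by (rule max_power_power[OF padic_p_in_max_power])
    then show ?thesis unfolding True by (simp only: power_one sum_constant card_lessThan of_nat_power mult_1_right)
  next
    case False
    have "(y - 1) * (\<Sum>i<?p ^ Suc r. y ^ i) = (y ^ ?p) ^ (?p ^ r) - 1"
      unfolding geo by (simp add: power_mult)
    also have "\<dots> = (y - 1) * ((\<Sum>i<?p. y ^ i) * (\<Sum>i<?p ^ r. (y ^ ?p) ^ i))"
      unfolding mult.assoc[symmetric] geo ..
    finally have "(\<Sum>i<?p ^ Suc r. y ^ i) = (\<Sum>i<?p. y ^ i) * (\<Sum>i<?p ^ r. (y ^ ?p) ^ i)"
      using False by simp
    also have "\<dots> \<in> max_power (1 + r)"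
      by (rule max_power_mult[OF s1 Suc.IH[OF powm]])
    finally show ?thesis by simp
  qed
qed simp

lemma power_card_minus_1_max_power:
  fixes y :: "'p :: prime_card padic_int fps"
  assumes "y - 1 \<in> max_power 1"
  shows "y ^ (CARD('p) ^ n) - 1 \<in> max_power (Suc n)"
  using max_power_mult[OF assms geometric_sum_max_power[OF assms, of n]] by (simp add: power_diff_1_eq)

lemma one_plus_X_minus_1: "(1 + fps_X) ^ k - 1 \<in> max_power 1"
proof -
  have "(1 + fps_X :: 'a padic_int fps) ^ k - 1 = fps_X * (\<Sum>i<k. (1 + fps_X) ^ i)"
    using power_diff_1_eq[of "1 + fps_X :: 'a padic_int fps" k] by simp
  then show ?thesis using max_power_mult_right[OF fps_X_in_max_power] by simp
qed

text \<open>The variable of an integer polynomial stands for \<gamma>, so \<open>[:-1, 1:]\<close>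
  is T; this is the embedding of \<int>[\<gamma>] into the Iwasawa algebra.\<close>

definition iota :: "int poly \<Rightarrow> 'p :: prime_card padic_int fps"
  where "iota q = poly (map_poly of_int q) (1 + fps_X)"

lemma iota_simps [simp]:
  "iota 0 = 0" "iota 1 = 1" "iota (q + r) = iota q + iota r" "iota (q * r) = iota q * iota r"
  "iota (q - r) = iota q - iota r" "iota (- q) = - iota q"
  by (simp_all add: iota_def hom_distribs)

lemma iota_power [simp]: "iota (q ^ n) = iota q ^ n"
  by (induction n) simp_all

lemma iota_sum [simp]: "iota (sum f I) = (\<Sum>i\<in>I. iota (f i))"
  by (induction I rule: infinite_finite_induct) simp_all

lemma iota_of_nat [simp]: "iota (of_nat n) = of_nat n"
  by (induction n) simp_all

lemma iota_of_int [simp]: "iota [:c:] = of_int c"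
proof -
  have "[:c:] = of_int c" by (simp add: of_int_poly)
  then show ?thesis by (cases c rule: int_cases2) simp_all
qed

lemma iota_monom [simp]: "iota (monom 1 a) = (1 + fps_X) ^ a"
  by (simp add: iota_def map_poly_monom poly_monom)

lemma iota_X [simp]: "iota [:-1, 1:] = fps_X"
proof -
  have "[:-1, 1:] = monom 1 1 - (1 :: int poly)" by (simp add: monom_altdef one_pCons)
  then show ?thesis by (simp del: One_nat_def)
qed

lemma of_int_mult_fps_nth: "fps_nth (of_int k * f :: 'a :: comm_ring_1 fps) i = of_int k * fps_nth f i"
  by (simp add: fps_of_int[symmetric])

text \<open>The same truncation as in \<open>power_series_action\<close>: \<open>N\<close> bounds
  both the number of terms and the precision of the coefficients.\<close>

definition trunc :: "nat \<Rightarrow> 'p :: prime_card padic_int fps \<Rightarrow> int poly"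
  where "trunc N f = (\<Sum>i<N. [:residue (fps_nth f i) N:] * [:-1, 1:] ^ i)"

lemma sum_X_powers_nth:
  "fps_nth (\<Sum>i<N. of_int (c i) * fps_X ^ i) j = (if j < N then of_int (c j) else (0 :: 'a :: comm_ring_1))"
proof -
  have "fps_nth (\<Sum>i<N. of_int (c i) * fps_X ^ i) j = (\<Sum>i<N. if i = j then of_int (c i) else (0 :: 'a))"
    unfolding fps_sum_nth of_int_mult_fps_nth by (intro sum.cong) (auto simp: fps_X_power_nth)
  then show ?thesis by simp
qed

lemma trunc_approx: "f - iota (trunc N f) \<in> max_power N"
proof -
  have "padic_p ^ (N - j) dvd fps_nth (f - iota (trunc N f)) j" for j
  proof (cases "j < N")
    case True
    then have "fps_nth (f - iota (trunc N f)) j = fps_nth f j - of_int (residue (fps_nth f j) N)"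
      unfolding trunc_def iota_sum iota_simps iota_of_int iota_power iota_X fps_sub_nth sum_X_powers_nth by simp
    moreover have "padic_p ^ (N - j) dvd fps_nth f j - of_int (residue (fps_nth f j) N)"
      by (rule dvd_trans[OF le_imp_power_dvd padic_approx]) simp
    ultimately show ?thesis by simp
  qed simp
  then show ?thesis by (simp add: max_power_def)
qed

text \<open>Indexed by the exponent itself: the \<omega> of level \<open>n\<close> is
  \<open>omega (CARD('p) ^ n)\<close>.\<close>

definition omega :: "nat \<Rightarrow> int poly"
  where "omega m = monom 1 m - 1"

lemma iota_omega: "iota (omega m) = (1 + fps_X) ^ m - 1"
  by (simp add: omega_def)

lemma iota_omega_max_power: "iota (omega (CARD('p :: prime_card) ^ n)) \<in> (max_power (Suc n) :: 'p padic_int fps set)"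
  unfolding iota_omega using fps_X_in_max_power by (intro power_card_minus_1_max_power) simp

lemma monom_power: "(monom 1 a :: int poly) ^ b = monom 1 (a * b)"
  by (induction b) (simp_all add: mult_monom add.commute)

lemma omega_mult_eq: "omega (m * k) = omega m * (\<Sum>i<k. monom 1 (m * i))"
  unfolding omega_def monom_power[symmetric] by (rule power_diff_1_eq)

lemma omega_dvd: "m dvd n \<Longrightarrow> omega m dvd omega n"
  by (auto elim!: dvdE simp: omega_mult_eq)

lemma omega_dvd_monom_diff:
  assumes "a mod m = b mod m"
  shows "omega m dvd monom 1 a - monom 1 b"
proof -
  have *: "omega m dvd monom 1 a - monom 1 b" if "b \<le> a" "a mod m = b mod m" for a b
  proof -
    have "m dvd a - b" using that by (simp add: mod_eq_dvd_iff_nat)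
    then obtain k where k: "a - b = m * k" by (elim dvdE)
    then have "a = b + m * k" using that(1) by simp
    then have "monom 1 a - monom 1 b = monom 1 b * omega (m * k)"
      by (simp add: omega_def algebra_simps mult_monom)
    then show ?thesis using omega_dvd[of m "m * k"] by simp
  qed
  show ?thesis
  proof (cases "b \<le> a")
    case False
    then have "omega m dvd - (monom 1 b - monom 1 a)" using *[of a b] assms unfolding dvd_minus_iff by simp
    then show ?thesis by simp
  qed (use *[of b a] assms in blast)
qed

lemma prime_power_sum_cong:
  fixes a b :: "'a :: comm_ring_1"
  assumes "prime p"
  shows "\<exists>r. (a + b) ^ (p ^ n) = a ^ (p ^ n) + b ^ (p ^ n) + of_nat p * r"
proof -
  have frob: "\<exists>r. (a + b) ^ p = a ^ p + b ^ p + of_nat p * r" for a b :: 'a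
  proof -
    have p: "p > 1" using prime_gt_1_nat[OF assms] .
    have "{..p} = insert 0 (insert p {1..<p})" using p by auto
    then have "(a + b) ^ p = a ^ p + b ^ p + (\<Sum>k\<in>{1..<p}. of_nat (p choose k) * a ^ k * b ^ (p - k))"
      using p by (simp add: binomial_ring algebra_simps)
    moreover have "of_nat p dvd (\<Sum>k\<in>{1..<p}. of_nat (p choose k) * a ^ k * b ^ (p - k))"
    proof (intro dvd_sum dvd_mult2)
      fix k assume "k \<in> {1..<p}"
      then have "p dvd (p choose k)" using dvd_choose_prime[of k p] assms by auto
      then obtain c where "(p choose k) = p * c" by (elim dvdE)
      then show "(of_nat p :: 'a) dvd of_nat (p choose k)" by simp
    qed
    ultimately show ?thesis by (auto elim!: dvdE)
  qed
  show ?thesis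
  proof (induction n)
    case (Suc n)
    then obtain r where r: "(a + b) ^ (p ^ n) = (a ^ (p ^ n) + b ^ (p ^ n)) + of_nat p * r" by auto
    obtain s where s: "((a ^ (p ^ n) + b ^ (p ^ n)) + of_nat p * r) ^ p = (a ^ (p ^ n) + b ^ (p ^ n)) ^ p + (of_nat p * r) ^ p + of_nat p * s"
      using frob by blast
    obtain u where u: "(a ^ (p ^ n) + b ^ (p ^ n)) ^ p = (a ^ (p ^ n)) ^ p + (b ^ (p ^ n)) ^ p + of_nat p * u"
      using frob by blast
    have "(of_nat p * r) ^ p = (of_nat p * r) * (of_nat p * r) ^ (p - 1)"
      using prime_gt_0_nat[OF assms] by (simp add: power_eq_if)
    then have t: "(of_nat p * r) ^ p = of_nat p * (r * (of_nat p * r) ^ (p - 1))" by (simp only: mult.assoc)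
    have pw: "(x ^ (p ^ n)) ^ p = x ^ (p ^ Suc n)" for x :: 'a by (simp add: power_mult[symmetric] mult.commute)
    have "(a + b) ^ (p ^ Suc n) = ((a + b) ^ (p ^ n)) ^ p" by (rule pw[symmetric])
    also have "\<dots> = a ^ (p ^ Suc n) + b ^ (p ^ Suc n) + of_nat p * (u + r * (of_nat p * r) ^ (p - 1) + s)"
      unfolding r s u t pw by (simp only: distrib_left add_ac)
    finally show ?case by blast
  qed (auto intro!: exI[of _ 0])
qed

text \<open>Frobenius modulo p applied to T = \<gamma> - 1; for p = 2 the sign is repaired by 1 = -1
  + 2.\<close>

lemma X_power_omega:
  assumes "prime p"
  shows "\<exists>r. [:-1, 1:] ^ (p ^ n) = omega (p ^ n) + of_nat p * r"
proof -
  obtain r where r: "(monom 1 1 + (-1) :: int poly) ^ (p ^ n) = monom 1 1 ^ (p ^ n) + (-1) ^ (p ^ n) + of_nat p * r"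
    using prime_power_sum_cong[OF assms] by blast
  have X: "[:-1, 1:] = (monom 1 1 + (-1) :: int poly)" by (simp add: monom_altdef one_pCons)
  have "\<exists>s. (-1 :: int poly) ^ (p ^ n) = -1 + of_nat p * s"
  proof (cases "odd (p ^ n)")
    case True
    then show ?thesis by (intro exI[of _ 0]) simp
  next
    case False
    then have "p = 2" using assms by (metis even_power primes_dvd_imp_eq two_is_prime_nat)
    then show ?thesis using False by (intro exI[of _ 1]) simp
  qed
  then obtain s where "(-1 :: int poly) ^ (p ^ n) = -1 + of_nat p * s" by blast
  then have "[:-1, 1:] ^ (p ^ n) = omega (p ^ n) + of_nat p * (s + r)"
    unfolding X r monom_power by (simp add: omega_def algebra_simps)
  then show ?thesis by blast
qed

lemma padic_p_power_dvd_of_int: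
  "(padic_p :: 'p :: prime_card padic_int) ^ k dvd of_int c \<longleftrightarrow> int CARD('p) ^ k dvd c"
  by (simp add: padic_power_dvd_iff residue_of_int dvd_eq_mod_eq_0)

text \<open>Smallness in the Iwasawa algebra becomes divisibility modulo \<omega>. In powers of T,
  the coefficient of T^i is divisible by p^(N - i). Either N - i is at least a, or i is at least a
  p^n, and then T^i lies in the ideal (p^a, \<omega>), because T^(p^n) is congruent to \<omega>
  modulo p. The bound a (p^n + 1) makes the two cases exhaustive.\<close>

lemma iota_small_decomposition:
  assumes q: "iota q \<in> (max_power N :: 'p :: prime_card padic_int fps set)"
    and N: "N \<ge> a * (CARD('p) ^ n + 1)"
  shows "\<exists>q' q''. q = of_nat (CARD('p) ^ a) * q' + omega (CARD('p) ^ n) * q''"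
proof -
  let ?p = "CARD('p)"
  define I where "I = {r. \<exists>q' q''. r = of_nat (?p ^ a) * q' + omega (?p ^ n) * q''}"
  have I_add: "r + s \<in> I" if rs: "r \<in> I" "s \<in> I" for r s
  proof -
    obtain r' r'' s' s'' where "r = of_nat (?p ^ a) * r' + omega (?p ^ n) * r''" "s = of_nat (?p ^ a) * s' + omega (?p ^ n) * s''"
      using rs unfolding I_def by blast
    then have "r + s = of_nat (?p ^ a) * (r' + s') + omega (?p ^ n) * (r'' + s'')" by (simp only: algebra_simps)
    then show ?thesis unfolding I_def by blast
  qed
  have I_mult: "t * r \<in> I" if r: "r \<in> I" for r t
  proof -
    obtain r' r'' where "r = of_nat (?p ^ a) * r' + omega (?p ^ n) * r''" using r unfolding I_def by blast
    then have "t * r = of_nat (?p ^ a) * (t * r') + omega (?p ^ n) * (t * r'')" by (simp only: algebra_simps)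
    then show ?thesis unfolding I_def by blast
  qed
  have I0: "0 \<in> I" and Ip: "of_nat (?p ^ a) \<in> I" unfolding I_def by (force intro: exI[of _ 0])+
  have I_sum: "sum f S \<in> I" if "\<And>i. i \<in> S \<Longrightarrow> f i \<in> I" for f and S :: "nat set"
    using that by (induction S rule: infinite_finite_induct) (auto simp: I0 I_add)
  obtain r where r: "[:-1, 1:] ^ (?p ^ n) = omega (?p ^ n) + of_nat ?p * r"
    using X_power_omega[OF prime_card[where 'a = 'p]] by blast
  have xp: "\<exists>r s. [:-1, 1:] ^ (?p ^ n * b) = of_nat (?p ^ b) * r + omega (?p ^ n) * s" for b
  proof (induction b)
    case 0 show ?case by (intro exI[of _ 1] exI[of _ 0]) simp
  next
    case (Suc b)
    then obtain r1 s1 where e: "[:-1, 1:] ^ (?p ^ n * b) = of_nat (?p ^ b) * r1 + omega (?p ^ n) * s1" by blast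
    have "[:-1, 1:] ^ (?p ^ n * Suc b) = [:-1, 1:] ^ (?p ^ n) * [:-1, 1:] ^ (?p ^ n * b)"
      by (simp only: mult_Suc_right power_add)
    also have "\<dots> = of_nat (?p ^ Suc b) * (r * r1) + omega (?p ^ n) * (of_nat (?p ^ b) * r1 + omega (?p ^ n) * s1 + of_nat ?p * r * s1)"
      unfolding e r by (simp only: of_nat_mult power_Suc algebra_simps)
    finally show ?case by blast
  qed
  have Ix: "[:-1, 1:] ^ (?p ^ n * a) \<in> I" using xp[of a] unfolding I_def by blast
  \<comment> \<open>The Taylor coefficients of \<open>q\<close> at \<gamma> = 1.\<close>
  define c where "c = coeff (pcompose q [:1, 1:])"
  define D where "D = degree (pcompose q [:1, 1:])"
  have "q = pcompose (pcompose q [:1, 1:]) [:-1, 1:]"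
    by (simp add: pcompose_assoc[symmetric] pcompose_pCons)
  also have "\<dots> = (\<Sum>i\<le>D. [:c i:] * [:-1, 1:] ^ i)"
    unfolding pcompose_altdef poly_altdef c_def D_def by (simp add: coeff_map_poly degree_map_poly)
  finally have qs: "q = (\<Sum>i<Suc D. [:c i:] * [:-1, 1:] ^ i)" unfolding lessThan_Suc_atMost .
  have "iota q = (\<Sum>i<Suc D. of_int (c i) * fps_X ^ i :: 'p padic_int fps)"
    by (subst qs) (simp only: iota_sum iota_simps iota_of_int iota_power iota_X)
  then have ci: "fps_nth (iota q :: 'p padic_int fps) i = of_int (c i)" if "i < Suc D" for i
    using that by (simp only: sum_X_powers_nth if_True)
  have "[:c i:] * [:-1, 1:] ^ i \<in> I" if i: "i < Suc D" for i
  proof (cases "a \<le> N - i")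
    case True
    have "padic_p ^ (N - i) dvd fps_nth (iota q :: 'p padic_int fps) i" using q unfolding max_power_def by blast
    then have "int ?p ^ (N - i) dvd c i" unfolding ci[OF i] padic_p_power_dvd_of_int .
    then have "int ?p ^ a dvd c i" using True by (meson dvd_trans le_imp_power_dvd)
    then obtain d where d: "c i = int ?p ^ a * d" by (elim dvdE)
    have "[:c i:] * [:-1, 1:] ^ i = ([:d:] * [:-1, 1:] ^ i) * of_nat (?p ^ a)"
      unfolding d by (simp add: of_nat_poly mult.commute)
    then show ?thesis using I_mult[OF Ip] by (simp only:)
  next
    case False
    then have "?p ^ n * a \<le> i" using N by (simp add: algebra_simps)
    then have "[:c i:] * [:-1, 1:] ^ i = ([:c i:] * [:-1, 1:] ^ (i - ?p ^ n * a)) * [:-1, 1:] ^ (?p ^ n * a)"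
      by (simp only: mult.assoc power_add[symmetric] le_add_diff_inverse2)
    then show ?thesis using I_mult[OF Ix] by (simp only:)
  qed
  then have "q \<in> I" by (subst qs) (rule I_sum, simp)
  then show ?thesis unfolding I_def by blast
qed

section \<open>The binomial series with a p-adic exponent\<close>

lemma prod_falling_nat:
  "(\<Prod>i=0..<k. of_nat b - of_nat i) = (of_nat (fact k * (b choose k)) :: 'a :: comm_ring_1)"
proof -
  have "rat_of_int (\<Prod>i=0..<k. int b - int i) = (\<Prod>i=0..<k. rat_of_nat b - rat_of_nat i)" by simp
  also have "\<dots> = fact k * (rat_of_nat b gchoose k)" by (rule gbinomial_mult_fact[symmetric])
  also have "\<dots> = rat_of_int (int (fact k * (b choose k)))" by (simp add: binomial_gbinomial)
  finally have "(\<Prod>i=0..<k. int b - int i) = int (fact k * (b choose k))" by (simp only: of_int_eq_iff)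
  then have "(of_int (\<Prod>i=0..<k. int b - int i) :: 'a) = of_int (int (fact k * (b choose k)))" by (rule arg_cong)
  then show ?thesis by (simp only: of_int_prod of_int_diff of_int_of_nat_eq)
qed

lemma prod_diff_dvd:
  fixes f g :: "nat \<Rightarrow> 'a :: comm_ring_1"
  assumes "\<And>i. d dvd f i - g i"
  shows "d dvd prod f {0..<k} - prod g {0..<k}"
proof (induction k)
  case (Suc k)
  have "prod f {0..<Suc k} - prod g {0..<Suc k} =
      (prod f {0..<k} - prod g {0..<k}) * f k + prod g {0..<k} * (f k - g k)"
    by (simp add: algebra_simps)
  then show ?case using Suc assms by simp
qed simp

lemma padic_falling_approx:
  fixes a :: "'p :: prime_card padic_int"
  shows "padic_p ^ m dvd (\<Prod>i=0..<k. a - of_nat i) - of_nat (fact k * (nat (residue a m) choose k))"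
proof -
  have "padic_p ^ m dvd (a - of_nat i) - (of_nat (nat (residue a m)) - of_nat i)" for i
    using padic_approx[of m a] residue_nonneg[of a m] by (simp add: of_nat_nat)
  then have "padic_p ^ m dvd (\<Prod>i=0..<k. a - of_nat i) - (\<Prod>i=0..<k. of_nat (nat (residue a m)) - of_nat i)"
    by (rule prod_diff_dvd)
  then show ?thesis unfolding prod_falling_nat .
qed

text \<open>The division in \<open>padic_binomial\<close> is exact: up to the power of p in k!,
  \<open>a\<close> may be replaced by a natural number, for which k! divides the product.\<close>

lemma fact_mult_padic_binomial:
  "of_nat (fact k) * padic_binomial a k = (\<Prod>i=0..<k. a - of_nat i :: 'p :: prime_card padic_int)"
proof -
  have f0: "(of_nat (fact k) :: 'p padic_int) \<noteq> 0" by (simp only: of_nat_eq_0_iff fact_nonzero not_False_eq_True)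
  then obtain v u where v: "(of_nat (fact k) :: 'p padic_int) = padic_p ^ v * u" "u dvd 1"
    using padic_decomposition by blast
  have "padic_p ^ v dvd (\<Prod>i=0..<k. a - of_nat i) - of_nat (fact k * (nat (residue a v) choose k))"
    by (rule padic_falling_approx)
  moreover have "padic_p ^ v dvd (of_nat (fact k * (nat (residue a v) choose k)) :: 'p padic_int)"
    unfolding of_nat_mult v(1) by (intro dvd_mult2 dvd_triv_left)
  ultimately have "padic_p ^ v dvd (\<Prod>i=0..<k. a - of_nat i)" by (metis diff_add_cancel dvd_add)
  then obtain w where w: "(\<Prod>i=0..<k. a - of_nat i) = padic_p ^ v * w" by (elim dvdE)
  have "u dvd w" using v(2) by (meson dvd_trans one_dvd)
  then have "of_nat (fact k) dvd (\<Prod>i=0..<k. a - of_nat i)" unfolding v w by (intro mult_dvd_mono dvd_refl)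
  then obtain z where z: "(\<Prod>i=0..<k. a - of_nat i) = of_nat (fact k) * z" by (elim dvdE)
  have "padic_binomial a k = (of_nat (fact k) * z) div of_nat (fact k)"
    unfolding padic_binomial_def z by (simp only: of_nat_fact)
  also have "\<dots> = z" by (rule nonzero_mult_div_cancel_left[OF f0])
  finally show ?thesis by (simp only: z)
qed

lemma one_plus_X_power_nth:
  "fps_nth ((1 + fps_X :: 'a :: comm_ring_1 fps) ^ n) k = of_nat (n choose k)"
proof -
  have "(1 + fps_X :: 'a fps) ^ n = (fps_X + 1) ^ n" by (simp add: add.commute)
  also have "\<dots> = (\<Sum>i\<le>n. of_nat (n choose i) * fps_X ^ i)" by (simp add: binomial_ring)
  finally have "fps_nth ((1 + fps_X :: 'a fps) ^ n) k = fps_nth (\<Sum>i\<le>n. of_nat (n choose i) * fps_X ^ i) k"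
    by (rule arg_cong)
  also have "\<dots> = (\<Sum>i\<le>n. if i = k then of_nat (n choose i) else 0)"
    unfolding fps_sum_nth fps_of_nat[symmetric] fps_mult_left_const_nth
    by (intro sum.cong) (auto simp: fps_X_power_nth)
  also have "\<dots> = of_nat (n choose k)" by (auto simp: binomial_eq_0)
  finally show ?thesis .
qed

text \<open>Dividing by k! loses \<open>v k\<close> digits, and only the coefficients below
  \<open>N\<close> matter, so \<open>N\<close> digits and a finite reserve suffice in the exponent.
  This turns voltages into natural exponents of \<gamma>.\<close>

lemma one_plus_T_powr_approx:
  fixes a :: "'p :: prime_card padic_int"
  shows "\<exists>m0. \<forall>m\<ge>m0. one_plus_T_powr a - (1 + fps_X) ^ nat (residue a m) \<in> max_power N"
proof -
  have "\<exists>v u. (of_nat (fact k) :: 'p padic_int) = padic_p ^ v * u \<and> u dvd 1" for k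
    by (rule padic_decomposition) (simp only: of_nat_eq_0_iff fact_nonzero not_False_eq_True)
  then obtain v u where v: "\<And>k. (of_nat (fact k) :: 'p padic_int) = padic_p ^ v k * u k" "\<And>k. u k dvd 1" by metis
  have "one_plus_T_powr a - (1 + fps_X) ^ nat (residue a m) \<in> max_power N" if m: "m \<ge> N + (\<Sum>k<N. v k)" for m
    unfolding max_power_def mem_Collect_eq
  proof
    fix k
    let ?d = "padic_binomial a k - of_nat (nat (residue a m) choose k)"
    have nth: "fps_nth (one_plus_T_powr a - (1 + fps_X) ^ nat (residue a m)) k = ?d"
      by (simp add: one_plus_T_powr_def one_plus_X_power_nth)
    show "padic_p ^ (N - k) dvd fps_nth (one_plus_T_powr a - (1 + fps_X) ^ nat (residue a m)) k"
    proof (cases "k < N")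
      case True
      have vk: "v k \<le> (\<Sum>k<N. v k)" using True by (intro member_le_sum) auto
      have "padic_p ^ m dvd of_nat (fact k) * ?d"
        using padic_falling_approx[of m a k]
        unfolding of_nat_mult fact_mult_padic_binomial[symmetric] right_diff_distrib .
      then have "padic_p ^ (v k + (m - v k)) dvd padic_p ^ v k * (u k * ?d)"
        using m vk unfolding v(1) by (simp add: mult.assoc)
      then have ud: "padic_p ^ (m - v k) dvd u k * ?d"
        unfolding power_add dvd_mult_cancel_left using padic_p_power_neq_0[of "v k", where 'p = 'p] by blast
      obtain w where w: "1 = u k * w" using v(2)[of k] by (elim dvdE)
      have "padic_p ^ (m - v k) dvd w * (u k * ?d)" by (rule dvd_mult[OF ud])
      then have "padic_p ^ (m - v k) dvd (u k * w) * ?d" by (simp only: mult_ac)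
      then have "padic_p ^ (m - v k) dvd ?d" unfolding w[symmetric] by simp
      moreover have "N - k \<le> m - v k" using m vk by simp
      ultimately show ?thesis unfolding nth by (meson dvd_trans le_imp_power_dvd)
    qed simp
  qed
  then show ?thesis by blast
qed

section \<open>The limit of a tower of torsion quotients of \<open>\<int>[\<gamma>]\<^sup>g\<close>\<close>

lemma coprime_inverse_mod_power:
  fixes c p :: nat
  assumes "coprime c p"
  obtains h z :: int where "h * int c = 1 + int p ^ N * z"
proof -
  have "coprime (int c) (int p ^ N)" using assms by simp
  then obtain h where "[int c * h = 1] (mod int p ^ N)" using cong_solve_coprime_int by blast
  then have "int p ^ N dvd int c * h - 1" by (simp add: cong_iff_dvd_diff)
  then obtain z where "int c * h - 1 = int p ^ N * z" by (elim dvdE)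
  then have "h * int c = 1 + int p ^ N * z" by (simp add: algebra_simps)
  then show thesis by (rule that)
qed

text \<open>The Picard groups of the layers in abstract form: \<gamma> is the action of the
  generator, \<rho> the transition map, \<theta> a surjection from vectors over \<int>[\<gamma>].
  The groups are torsion but not p-groups, so a projection to the p-part has to be built.
  \<open>TP\<close> carries the prime.\<close>

locale torsion_tower =
  fixes Y :: "nat \<Rightarrow> 'b monoid" and \<gamma> \<rho> :: "nat \<Rightarrow> 'b \<Rightarrow> 'b"
    and \<theta> :: "nat \<Rightarrow> (nat \<Rightarrow> int poly) \<Rightarrow> 'b" and g :: nat and TP :: "'p :: prime_card itself"
  assumes Y_group: "comm_group (Y n)"
    and Y_carrier: "carrier (Y n) = range (\<theta> n)"
    and theta_add: "\<theta> n (q + r) = \<theta> n q \<otimes>\<^bsub>Y n\<^esub> \<theta> n r"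
    and theta_cong: "(\<And>i. i < g \<Longrightarrow> q i = r i) \<Longrightarrow> \<theta> n q = \<theta> n r"
    and theta_gamma: "\<gamma> n (\<theta> n q) = \<theta> n (\<lambda>i. monom 1 1 * q i)"
    and theta_omega: "\<theta> n (\<lambda>i. omega (CARD('p) ^ n) * q i) = \<one>\<^bsub>Y n\<^esub>"
    and theta_rho: "\<rho> n (\<theta> (Suc n) q) = \<theta> n q"
    and torsion: "\<exists>d>0. \<forall>q. \<theta> n (\<lambda>i. of_nat d * q i) = \<one>\<^bsub>Y n\<^esub>"
begin

definition kern :: "nat \<Rightarrow> (nat \<Rightarrow> int poly) set"
  where "kern n = {q. \<theta> n q = \<one>\<^bsub>Y n\<^esub>}"

definition pm :: "int poly \<Rightarrow> (nat \<Rightarrow> int poly) \<Rightarrow> nat \<Rightarrow> int poly"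
  where "pm s q = (\<lambda>i. s * q i)"

lemma pm_pm: "pm s (pm t q) = pm (s * t) q" by (simp add: pm_def mult.assoc)
lemma pm_add: "pm s (q + r) = pm s q + pm s r" by (simp add: pm_def fun_eq_iff distrib_left)
lemma pm_diff: "pm s (q - r) = pm s q - pm s r" by (simp add: pm_def fun_eq_iff right_diff_distrib)
lemma pm_add_left: "pm (s + t) q = pm s q + pm t q" by (simp add: pm_def fun_eq_iff distrib_right)
lemma pm_diff_left: "pm (s - t) q = pm s q - pm t q" by (simp add: pm_def fun_eq_iff left_diff_distrib)
lemma pm_one: "pm 1 q = q" by (simp add: pm_def)

lemma pm_const: "pm [:k:] (pm [:l:] q) = pm [:k * l:] q" by (simp add: pm_pm mult.commute)
lemma pm_const_diff: "pm [:k - l:] q = pm [:k:] q - pm [:l:] q" by (simp add: pm_diff_left[symmetric])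

lemma pm_sum: "pm (\<Sum>i<N. s i) q = (\<Sum>i<N. pm (s i) q)" for N :: nat
proof (induction N)
  case 0
  show ?case by (simp add: pm_def fun_eq_iff)
next
  case (Suc N)
  then show ?case by (simp only: sum.lessThan_Suc pm_add_left)
qed

lemma theta_closed [simp]: "\<theta> n q \<in> carrier (Y n)" using Y_carrier by blast

lemma theta_0: "\<theta> n 0 = \<one>\<^bsub>Y n\<^esub>"
proof -
  interpret comm_group "Y n" by (rule Y_group)
  have "\<theta> n 0 \<otimes>\<^bsub>Y n\<^esub> \<theta> n 0 = \<theta> n 0" using theta_add[of n 0 0] by simp
  then show ?thesis using l_cancel_one'[OF theta_closed theta_closed] by metis
qed

lemma theta_uminus: "\<theta> n (- q) = inv\<^bsub>Y n\<^esub> \<theta> n q"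
proof -
  interpret comm_group "Y n" by (rule Y_group)
  have "\<theta> n (- q) \<otimes>\<^bsub>Y n\<^esub> \<theta> n q = \<one>\<^bsub>Y n\<^esub>" using theta_add[of n "- q" q] theta_0 by simp
  then show ?thesis using inv_equality[OF _ theta_closed theta_closed] by simp
qed

lemma theta_diff: "\<theta> n (q - r) = \<theta> n q \<otimes>\<^bsub>Y n\<^esub> inv\<^bsub>Y n\<^esub> \<theta> n r"
  using theta_add[of n q "- r"] by (simp add: theta_uminus)

lemma theta_eq_iff: "\<theta> n q = \<theta> n r \<longleftrightarrow> q - r \<in> kern n"
proof -
  interpret comm_group "Y n" by (rule Y_group)
  show ?thesis unfolding kern_def mem_Collect_eq theta_diff
    using inv_solve_right'[of "\<one>\<^bsub>Y n\<^esub>" "\<theta> n q" "\<theta> n r"] by auto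
qed

lemma kern_add: "q \<in> kern n \<Longrightarrow> r \<in> kern n \<Longrightarrow> q + r \<in> kern n"
proof -
  interpret comm_group "Y n" by (rule Y_group)
  show "q \<in> kern n \<Longrightarrow> r \<in> kern n \<Longrightarrow> q + r \<in> kern n" by (simp add: kern_def theta_add)
qed

lemma kern_uminus: "q \<in> kern n \<Longrightarrow> - q \<in> kern n"
proof -
  interpret comm_group "Y n" by (rule Y_group)
  show "q \<in> kern n \<Longrightarrow> - q \<in> kern n" by (simp add: kern_def theta_uminus)
qed

lemma kern_diff: "q \<in> kern n \<Longrightarrow> r \<in> kern n \<Longrightarrow> q - r \<in> kern n"
  using kern_add[of q n "- r"] kern_uminus by simp

lemma theta_int_power: "\<theta> n (pm [:k:] q) = \<theta> n q [^]\<^bsub>Y n\<^esub> (k :: int)"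
proof -
  interpret comm_group "Y n" by (rule Y_group)
  have nat: "\<theta> n (pm [:int m:] q) = \<theta> n q [^]\<^bsub>Y n\<^esub> m" for m
  proof (induction m)
    case 0
    have "pm [:int 0:] q = 0" by (simp add: pm_def fun_eq_iff)
    then show ?case by (simp only: theta_0 nat_pow_0)
  next
    case (Suc m)
    have "pm [:int (Suc m):] q = pm [:int m:] q + q" by (simp add: pm_def fun_eq_iff algebra_simps smult_add_left)
    then have "\<theta> n (pm [:int (Suc m):] q) = \<theta> n (pm [:int m:] q) \<otimes>\<^bsub>Y n\<^esub> \<theta> n q" by (simp only: theta_add)
    then show ?case using Suc by (simp only: nat_pow_Suc)
  qed
  show ?thesis
  proof (cases "k \<ge> 0")
    case True
    then obtain m where "k = int m" by (metis nonneg_eq_int)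
    then show ?thesis using nat by (simp add: int_pow_int)
  next
    case False
    then obtain m where m: "k = - int m" by (metis int_cases2 of_nat_0_le_iff)
    then have "pm [:k:] q = - pm [:int m:] q" by (simp add: pm_def fun_eq_iff)
    then show ?thesis using nat m by (simp add: theta_uminus int_pow_neg int_pow_int)
  qed
qed

lemma kern_int: "q \<in> kern n \<Longrightarrow> pm [:k:] q \<in> kern n"
proof -
  interpret comm_group "Y n" by (rule Y_group)
  show "q \<in> kern n \<Longrightarrow> pm [:k:] q \<in> kern n" by (simp add: kern_def theta_int_power)
qed

text \<open>Level \<open>n\<close> has an exponent p^(a n) \<open>c n\<close> with
  \<open>c n\<close> prime to p, and multiplication by \<open>e n\<close>, found by the Chinese
  remainder theorem, projects to the p-primary part. The exponents are partial products, hence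
  divide one another, which makes the projections of successive levels compatible.\<close>

lemma exists_projectors:
  "\<exists>(a :: nat \<Rightarrow> nat) (c :: nat \<Rightarrow> nat) (e :: nat \<Rightarrow> int). \<forall>n. coprime (c n) CARD('p) \<and>
    (\<forall>q. pm [:int (CARD('p) ^ a n * c n):] q \<in> kern n) \<and> int (CARD('p) ^ a n) dvd e n - 1 \<and> int (c n) dvd e n \<and>
    int (CARD('p) ^ a n * c n) dvd e (Suc n) - e n"
proof -
  obtain d where d: "\<And>n. d n > 0" "\<And>n q. \<theta> n (\<lambda>i. of_nat (d n) * q i) = \<one>\<^bsub>Y n\<^esub>" using torsion by metis
  define D where "D n = (\<Prod>i\<le>n. d i)" for n
  have D0: "D n > 0" for n using d(1) by (auto simp: D_def intro!: prod_pos)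
  have Dk: "pm [:int (D n):] q \<in> kern n" for n q
  proof -
    have "d n dvd D n" unfolding D_def by (intro dvd_prodI) auto
    then obtain k where "D n = k * d n" by (metis dvdE mult.commute)
    then have "pm [:int (D n):] q = pm [:int k:] (pm [:int (d n):] q)" by (simp add: pm_pm mult.commute)
    moreover have "pm [:int (d n):] q \<in> kern n" using d(2)[of n q] by (simp add: kern_def pm_def of_nat_poly)
    ultimately show ?thesis using kern_int by simp
  qed
  have pp: "prime CARD('p)" by (rule prime_card)
  define a where "a n = multiplicity CARD('p) (D n)" for n
  define c where "c n = D n div CARD('p) ^ a n" for n
  have Dac: "D n = CARD('p) ^ a n * c n" for n unfolding c_def a_def by (simp add: multiplicity_dvd)
  have cop: "coprime (c n) CARD('p)" for n
  proof -
    have "\<not> CARD('p) dvd c n"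
      unfolding c_def a_def using D0[of n] pp
      by (intro multiplicity_decompose) auto
    then show ?thesis using pp by (metis coprime_commute prime_imp_coprime)
  qed
  have DD: "D n dvd D (Suc n)" for n by (simp add: D_def)
  have aa: "a n \<le> a (Suc n)" for n unfolding a_def using D0 DD by (intro dvd_imp_multiplicity_le) auto
  have cc: "c n dvd c (Suc n)" for n
  proof -
    have "c n dvd CARD('p) ^ a (Suc n) * c (Suc n)" using DD[of n] unfolding Dac by (rule dvd_mult_right)
    moreover have "coprime (c n) (CARD('p) ^ a (Suc n))" using cop by simp
    ultimately show ?thesis using coprime_dvd_mult_right_iff by blast
  qed
  have "\<exists>e :: nat. [e = 1] (mod CARD('p) ^ a n) \<and> [e = 0] (mod c n)" for n
    using cop[of n] by (intro binary_chinese_remainder_nat) (simp add: coprime_commute)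
  then obtain e where e: "\<And>n. [e n = 1] (mod CARD('p) ^ a n)" "\<And>n. [e n = 0] (mod c n)" by metis
  have e1: "int (CARD('p) ^ a n) dvd int (e n) - 1" for n
    using e(1)[of n] cong_int_iff[of "e n" 1 "CARD('p) ^ a n"] by (simp add: cong_iff_dvd_diff)
  have e2: "int (c n) dvd int (e n)" for n using e(2)[of n] by (simp add: cong_0_iff)
  have e3: "int (CARD('p) ^ a n * c n) dvd int (e (Suc n)) - int (e n)" for n
  proof -
    have "int (CARD('p) ^ a n) dvd int (CARD('p) ^ a (Suc n))" using aa by (simp add: le_imp_power_dvd)
    then have "int (CARD('p) ^ a n) dvd int (e (Suc n)) - 1" using e1[of "Suc n"] by (rule dvd_trans)
    from dvd_diff[OF this e1[of n]] have p1: "int (CARD('p) ^ a n) dvd int (e (Suc n)) - int (e n)" by simp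
    have "int (c n) dvd int (c (Suc n))" using cc by simp
    then have "int (c n) dvd int (e (Suc n))" using e2[of "Suc n"] by (rule dvd_trans)
    from dvd_diff[OF this e2[of n]] have c1: "int (c n) dvd int (e (Suc n)) - int (e n)" .
    have "coprime (int (CARD('p) ^ a n)) (int (c n))" using cop[of n] by (simp add: coprime_commute)
    then show ?thesis using divides_mult[OF p1 c1] by simp
  qed
  show ?thesis using cop Dk[unfolded Dac] e1 e2 e3 by (intro exI[of _ a] exI[of _ c] exI[of _ "\<lambda>n. int (e n)"]) blast
qed

definition limit_module :: "('p padic_int fps, nat \<Rightarrow> 'b) module"
  where "limit_module =
    \<lparr>carrier = {x. \<forall>n. x n \<in> p_primary_part CARD('p) (Y n) \<and> \<rho> n (x (Suc n)) = x n},
     monoid.mult = undefined,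
     one = undefined,
     ring.zero = (\<lambda>n. \<one>\<^bsub>Y n\<^esub>),
     add = (\<lambda>x y n. x n \<otimes>\<^bsub>Y n\<^esub> y n),
     module.smult = (\<lambda>f x n. power_series_action (Y n) (\<gamma> n) f (x n))\<rparr>"

definition approx :: "nat \<Rightarrow> (nat \<Rightarrow> 'p padic_int fps) \<Rightarrow> (nat \<Rightarrow> int poly) \<Rightarrow> bool"
  where "approx N c q \<longleftrightarrow> (\<forall>i<g. c i - iota (q i) \<in> max_power N)"

text \<open>The intersection over \<open>n\<close> of the (p, T)-adic closures of the kernels of
  \<theta>.\<close>

definition closure_kern :: "(nat \<Rightarrow> 'p padic_int fps) set"
  where "closure_kern = {c. \<forall>n N. \<exists>q\<in>kern n. approx N c q}"

lemma approx_trunc: "approx N c (\<lambda>i. trunc N (c i))"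
  by (simp add: approx_def trunc_approx)

lemma approx_mono: "approx N c q \<Longrightarrow> M \<le> N \<Longrightarrow> approx M c q"
  unfolding approx_def using max_power_mono by blast

lemma approx_add: "approx N c q \<Longrightarrow> approx N d r \<Longrightarrow> approx N (c + d) (q + r)"
  unfolding approx_def
proof (intro allI impI)
  fix i assume *: "\<forall>i<g. c i - iota (q i) \<in> max_power N" "\<forall>i<g. d i - iota (r i) \<in> max_power N" "i < g"
  have "(c + d) i - iota ((q + r) i) = (c i - iota (q i)) + (d i - iota (r i))" by simp
  then show "(c + d) i - iota ((q + r) i) \<in> max_power N" using * max_power_add by metis
qed

lemma approx_mult:
  assumes "f - iota s \<in> max_power N" "approx N c q"
  shows "approx N (fun_scale f c) (pm s q)"
  unfolding approx_def
proof (intro allI impI)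
  fix i assume i: "i < g"
  have "fun_scale f c i - iota (pm s q i) = (f - iota s) * c i + iota s * (c i - iota (q i))"
    by (simp add: fun_scale_def pm_def algebra_simps)
  also have "\<dots> \<in> max_power N"
    using assms i by (intro max_power_add max_power_mult_right max_power_mult_left) (auto simp: approx_def)
  finally show "fun_scale f c i - iota (pm s q i) \<in> max_power N" .
qed

text \<open>A vector of power series is evaluated at level \<open>n\<close> on any sufficiently fine
  integer approximation, followed by the projection \<open>e n\<close>. Surjectivity is compactness:
  a limit point of lifts from higher and higher levels represents the given compatible
  family.\<close>

theorem limit_module_presentation:
  "\<exists>\<Phi>. carrier limit_module = range \<Phi> \<and> (\<forall>c d. \<Phi> (c + d) = \<Phi> c \<oplus>\<^bsub>limit_module\<^esub> \<Phi> d) \<and>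
    (\<forall>f c. \<Phi> (fun_scale f c) = f \<odot>\<^bsub>limit_module\<^esub> \<Phi> c) \<and> \<zero>\<^bsub>limit_module\<^esub> = \<Phi> 0 \<and>
    (\<forall>c d. \<Phi> c = \<Phi> d \<longleftrightarrow> c - d \<in> closure_kern)"
proof -
  obtain a c and e :: "nat \<Rightarrow> int" where cop: "\<And>n. coprime (c n) CARD('p)"
    and ac: "\<And>n q. pm [:int (CARD('p) ^ a n * c n):] q \<in> kern n" and e1: "\<And>n. int (CARD('p) ^ a n) dvd e n - 1"
    and e2: "\<And>n. int (c n) dvd e n" and e3: "\<And>n. int (CARD('p) ^ a n * c n) dvd e (Suc n) - e n"
    using exists_projectors by metis
  have dvd_kern: "pm [:k:] q \<in> kern n" if "int (CARD('p) ^ a n * c n) dvd k" for k n q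
  proof -
    obtain l where "k = l * int (CARD('p) ^ a n * c n)" using \<open>_ dvd k\<close> by (metis dvdE mult.commute)
    then have "pm [:k:] q = pm [:l:] (pm [:int (CARD('p) ^ a n * c n):] q)" by (simp add: pm_pm mult.commute)
    then show ?thesis using kern_int[OF ac] by simp
  qed
  have pe: "pm [:int (CARD('p) ^ a n) * e n:] q \<in> kern n" for n q
    using e2[of n] by (intro dvd_kern) (simp add: mult_dvd_mono)
  \<comment> \<open>Both p^b and p^(a n) \<open>c n\<close> kill the class of \<open>q\<close>;
    inverting \<open>c n\<close> modulo p^b shows that p^(a n) does too, and \<open>e n - 1\<close>
    is a multiple of it.\<close>
  have fix_primary: "pm [:e n - 1:] q \<in> kern n" if q: "pm [:int CARD('p) ^ b:] q \<in> kern n" for n b q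
  proof -
    obtain h z where hz: "h * int (c n) = 1 + int CARD('p) ^ b * z" using coprime_inverse_mod_power[OF cop] .
    have e: "int (CARD('p) ^ a n) = h * int (CARD('p) ^ a n * c n) - (z * int (CARD('p) ^ a n)) * int CARD('p) ^ b"
    proof -
      have "h * int (CARD('p) ^ a n * c n) = int (CARD('p) ^ a n) * (h * int (c n))" by simp
      then show ?thesis unfolding hz by (simp add: algebra_simps)
    qed
    have "pm [:int (CARD('p) ^ a n):] q = pm [:h:] (pm [:int (CARD('p) ^ a n * c n):] q) - pm [:z * int (CARD('p) ^ a n):] (pm [:int CARD('p) ^ b:] q)"
      unfolding pm_pm pm_diff_left[symmetric] by (subst e) (simp add: mult_ac)
    then have "pm [:int (CARD('p) ^ a n):] q \<in> kern n" using kern_diff[OF kern_int[OF ac] kern_int[OF q]] by simp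
    moreover obtain l where "e n - 1 = l * int (CARD('p) ^ a n)" using e1[of n] by (metis dvdE mult.commute)
    then have "pm [:e n - 1:] q = pm [:l:] (pm [:int (CARD('p) ^ a n):] q)" by (simp add: pm_pm mult.commute)
    ultimately show ?thesis using kern_int by simp
  qed
  \<comment> \<open>The threshold of \<open>iota_small_decomposition\<close> for the power p^(a n)
    at level \<open>n\<close>.\<close>
  define thr where "thr n = a n * (CARD('p) ^ n + 1)" for n
  have small: "pm [:e n:] q \<in> kern n" if q: "\<And>i. i < g \<Longrightarrow> iota (q i) \<in> (max_power (thr n) :: 'p padic_int fps set)" for n q
  proof -
    have "\<exists>q' q''. i < g \<longrightarrow> q i = of_nat (CARD('p) ^ a n) * q' + omega (CARD('p) ^ n) * q''" for i
    proof (cases "i < g")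
      case True
      have "a n * (CARD('p) ^ n + 1) \<le> thr n" by (simp add: thr_def)
      then show ?thesis using iota_small_decomposition[OF q[OF True], of "a n" n] by blast
    qed simp
    then obtain q' q'' where dec: "\<And>i. i < g \<Longrightarrow> q i = of_nat (CARD('p) ^ a n) * q' i + omega (CARD('p) ^ n) * q'' i" by metis
    have "\<theta> n (pm [:e n:] q) = \<theta> n (pm [:int (CARD('p) ^ a n) * e n:] q' + (\<lambda>i. omega (CARD('p) ^ n) * pm [:e n:] q'' i))"
    proof (rule theta_cong)
      fix i assume "i < g"
      have "[:int (CARD('p) ^ a n) * e n:] = of_nat (CARD('p) ^ a n) * [:e n:]" by (simp add: of_nat_poly)
      then show "pm [:e n:] q i = (pm [:int (CARD('p) ^ a n) * e n:] q' + (\<lambda>i. omega (CARD('p) ^ n) * pm [:e n:] q'' i)) i"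
        unfolding pm_def plus_fun_apply dec[OF \<open>i < g\<close>] by (simp only: algebra_simps)
    qed
    moreover have "pm [:int (CARD('p) ^ a n) * e n:] q' + (\<lambda>i. omega (CARD('p) ^ n) * pm [:e n:] q'' i) \<in> kern n"
      using pe theta_omega by (intro kern_add) (simp_all add: kern_def)
    ultimately show ?thesis by (simp add: kern_def)
  qed
  have indep: "\<theta> n (pm [:e n:] q) = \<theta> n (pm [:e n:] r)" if qr: "approx (thr n) x q" "approx (thr n) x r" for n x q r
  proof -
    have "iota ((q - r) i) \<in> (max_power (thr n) :: 'p padic_int fps set)" if i: "i < g" for i
    proof -
      have "(x i - iota (r i)) - (x i - iota (q i)) \<in> max_power (thr n)"
        by (rule max_power_diff[OF qr(2)[unfolded approx_def, rule_format, OF i] qr(1)[unfolded approx_def, rule_format, OF i]])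
      then show ?thesis by simp
    qed
    then have "pm [:e n:] (q - r) \<in> kern n" by (rule small)
    then show ?thesis unfolding theta_eq_iff pm_diff .
  qed
  define \<Phi> where "\<Phi> x n = \<theta> n (pm [:e n:] (\<lambda>i. trunc (thr n) (x i)))" for x :: "nat \<Rightarrow> 'p padic_int fps" and n
  have Phi: "\<Phi> x n = \<theta> n (pm [:e n:] q)" if "approx (thr n) x q" for x n q
    unfolding \<Phi>_def by (rule indep[OF approx_trunc that])
  have add: "\<Phi> (x + y) n = \<Phi> x n \<otimes>\<^bsub>Y n\<^esub> \<Phi> y n" for x y n
    using Phi[OF approx_add[OF approx_trunc[of "thr n" x] approx_trunc[of "thr n" y]]]
    unfolding pm_add theta_add \<Phi>_def .
  have prim: "\<Phi> x n \<in> p_primary_part CARD('p) (Y n)" for x n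
  proof -
    interpret comm_group "Y n" by (rule Y_group)
    have "\<theta> n (pm [:e n:] q) [^]\<^bsub>Y n\<^esub> int (CARD('p) ^ a n) = \<one>\<^bsub>Y n\<^esub>" for q
      unfolding theta_int_power[symmetric] pm_pm using pe[of n q] by (simp add: kern_def mult.commute)
    then have "\<Phi> x n [^]\<^bsub>Y n\<^esub> (CARD('p) ^ a n) = \<one>\<^bsub>Y n\<^esub>" unfolding \<Phi>_def int_pow_int .
    moreover have "\<Phi> x n \<in> carrier (Y n)" by (simp add: \<Phi>_def)
    ultimately show ?thesis unfolding p_primary_part_def by blast
  qed
  have compat: "\<rho> n (\<Phi> x (Suc n)) = \<Phi> x n" for x n
  proof -
    let ?N = "max (thr n) (thr (Suc n))" and ?q = "\<lambda>i. trunc (max (thr n) (thr (Suc n))) (x i)"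
    have q: "approx (thr n) x ?q" "approx (thr (Suc n)) x ?q" using approx_mono[OF approx_trunc[of ?N x]] by simp_all
    have "\<rho> n (\<Phi> x (Suc n)) = \<theta> n (pm [:e (Suc n):] ?q)" unfolding Phi[OF q(2)] by (rule theta_rho)
    also have "\<dots> = \<theta> n (pm [:e n:] ?q)"
      unfolding theta_eq_iff pm_diff_left[symmetric] using dvd_kern[OF e3] by simp
    finally show ?thesis unfolding Phi[OF q(1)] .
  qed
  have carr: "\<Phi> x \<in> carrier limit_module" for x
    using prim compat by (simp add: limit_module_def)
  have smult: "\<Phi> (fun_scale f x) n = power_series_action (Y n) (\<gamma> n) f (\<Phi> x n)" for f x n
  proof -
    interpret comm_group "Y n" by (rule Y_group)
    define q where "q = (\<lambda>i. trunc (thr n) (x i))"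
    have q: "approx (thr n) x q" unfolding q_def by (rule approx_trunc)
    define u where "u = pm [:e n:] q"
    have X: "[:-1, 1:] = monom 1 1 - (1 :: int poly)" by (simp add: monom_altdef one_pCons)
    have it: "((\<lambda>z. \<gamma> n z \<otimes>\<^bsub>Y n\<^esub> inv\<^bsub>Y n\<^esub> z) ^^ i) (\<theta> n r) = \<theta> n (pm ([:-1, 1:] ^ i) r)" for i r
    proof (induction i)
      case 0 then show ?case by (simp add: pm_one)
    next
      case (Suc i)
      have "\<gamma> n (\<theta> n s) \<otimes>\<^bsub>Y n\<^esub> inv\<^bsub>Y n\<^esub> \<theta> n s = \<theta> n (pm [:-1, 1:] s)" for s
        unfolding theta_gamma theta_diff[symmetric] X pm_diff_left pm_one by (simp add: pm_def)
      then show ?case using Suc by (simp add: pm_pm)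
    qed
    have fp: "finprod (Y n) (\<lambda>i. \<theta> n (h i)) {..<N} = \<theta> n (\<Sum>i<N. h i)" for h and N :: nat
    proof (induction N)
      case 0
      show ?case by (simp only: lessThan_0 finprod_empty sum.empty theta_0)
    next
      case (Suc N)
      have "finprod (Y n) (\<lambda>i. \<theta> n (h i)) {..<Suc N} = \<theta> n (h N) \<otimes>\<^bsub>Y n\<^esub> finprod (Y n) (\<lambda>i. \<theta> n (h i)) {..<N}"
        unfolding lessThan_Suc by (rule finprod_insert) auto
      then show ?case unfolding Suc theta_add[symmetric] sum.lessThan_Suc by (simp only: add.commute)
    qed
    \<comment> \<open>The partial sums of \<open>power_series_action\<close> are multiplications by
      \<open>trunc N f\<close>, hence constant from \<open>N = thr n\<close> on.\<close>
    have part: "(\<Otimes>\<^bsub>Y n\<^esub>i\<in>{..<N}. ((\<lambda>z. \<gamma> n z \<otimes>\<^bsub>Y n\<^esub> inv\<^bsub>Y n\<^esub> z) ^^ i) (\<theta> n u) [^]\<^bsub>Y n\<^esub> residue (fps_nth f i) N)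
        = \<theta> n (pm [:e n:] (pm (trunc N f) q))" for N
    proof -
      have "(\<Sum>i<N. pm ([:residue (fps_nth f i) N:] * [:-1, 1:] ^ i) u) = pm (trunc N f) u"
        unfolding trunc_def pm_sum ..
      moreover have "\<dots> = pm [:e n:] (pm (trunc N f) q)" by (simp only: u_def pm_pm mult.commute)
      ultimately show ?thesis unfolding it theta_int_power[symmetric] pm_pm fp by simp
    qed
    have ev: "\<theta> n (pm [:e n:] (pm (trunc N f) q)) = \<Phi> (fun_scale f x) n" if "N \<ge> thr n" for N
      by (rule Phi[symmetric]) (rule approx_mult[OF max_power_mono[OF that trunc_approx] q])
    have "power_series_action (Y n) (\<gamma> n) f (\<theta> n u) = \<Phi> (fun_scale f x) n"
      unfolding power_series_action_def part
    proof (rule the_equality)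
      show "\<forall>\<^sub>F N in sequentially. \<Phi> (fun_scale f x) n = \<theta> n (pm [:e n:] (pm (trunc N f) q))"
        using ev by (intro eventually_sequentiallyI[of "thr n"]) simp
      fix y assume "\<forall>\<^sub>F N in sequentially. y = \<theta> n (pm [:e n:] (pm (trunc N f) q))"
      then obtain M where M: "\<And>N. N \<ge> M \<Longrightarrow> y = \<theta> n (pm [:e n:] (pm (trunc N f) q))"
        by (auto simp: eventually_sequentially)
      have "y = \<theta> n (pm [:e n:] (pm (trunc (max M (thr n)) f) q))" by (rule M) simp
      also have "\<dots> = \<Phi> (fun_scale f x) n" by (rule ev) simp
      finally show "y = \<Phi> (fun_scale f x) n" .
    qed
    then show ?thesis unfolding Phi[OF q] u_def by simp
  qed
  have surj: "\<exists>x. \<Phi> x = y" if y: "y \<in> carrier limit_module" for y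
  proof -
    have yp: "y n \<in> p_primary_part CARD('p) (Y n)" and yr: "\<rho> n (y (Suc n)) = y n" for n
      using y by (simp_all add: limit_module_def)
    have "\<exists>q. y n = \<theta> n q" for n using yp[of n] Y_carrier[of n] unfolding p_primary_part_def by blast
    then obtain q where q: "\<And>n. y n = \<theta> n (q n)" by metis
    \<comment> \<open>The lift chosen at level \<open>m\<close> represents the family at all lower
      levels, so at level \<open>n\<close> any lift with \<open>m \<ge> n\<close> close to the limit
      point can be used.\<close>
    have down: "y n = \<theta> n (q m)" if "n \<le> m" for n m
      using that
    proof (induction n rule: inc_induct)
      case base show ?case by (rule q)
    next
      case (step n)
      then show ?case using yr[of n] theta_rho[of n "q m"] by simp
    qed
    obtain x where x: "\<And>m. infinite {n. \<forall>i<m. x i - iota (q n i) \<in> (max_power m :: 'p padic_int fps set)}"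
      using max_power_accumulation[of "\<lambda>n i. iota (q n i)"] by blast
    have "\<Phi> x n = y n" for n
    proof -
      interpret comm_group "Y n" by (rule Y_group)
      let ?m = "max g (thr n)"
      obtain m where m: "m \<ge> n" "\<forall>i<?m. x i - iota (q m i) \<in> (max_power ?m :: 'p padic_int fps set)"
        using x[of ?m] unfolding infinite_nat_iff_unbounded_le by blast
      have "approx (thr n) x (q m)"
        unfolding approx_def
      proof (intro allI impI)
        fix i assume "i < g"
        then have "x i - iota (q m i) \<in> max_power ?m" using m(2) by simp
        then show "x i - iota (q m i) \<in> max_power (thr n)" by (rule max_power_mono[rotated]) simp
      qed
      then have P: "\<Phi> x n = \<theta> n (pm [:e n:] (q m))" by (rule Phi)
      obtain b :: nat where "y n [^]\<^bsub>Y n\<^esub> (CARD('p) ^ b) = \<one>\<^bsub>Y n\<^esub>" using yp[of n] unfolding p_primary_part_def by blast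
      then have "\<theta> n (q m) [^]\<^bsub>Y n\<^esub> int (CARD('p) ^ b) = \<one>\<^bsub>Y n\<^esub>" using down[OF m(1)] by (simp only: int_pow_int)
      then have "pm [:int CARD('p) ^ b:] (q m) \<in> kern n" unfolding kern_def mem_Collect_eq theta_int_power by simp
      then have "pm [:e n - 1:] (q m) \<in> kern n" by (rule fix_primary)
      moreover have "pm [:e n - 1:] (q m) = pm [:e n:] (q m) - q m"
        by (simp add: pm_def fun_eq_iff smult_diff_left)
      ultimately have "\<theta> n (pm [:e n:] (q m)) = \<theta> n (q m)" unfolding theta_eq_iff by simp
      then show ?thesis using P down[OF m(1)] by simp
    qed
    then show ?thesis by (intro exI[of _ x]) (simp add: fun_eq_iff)
  qed
  have ker: "(\<forall>n. \<Phi> x n = \<one>\<^bsub>Y n\<^esub>) \<longleftrightarrow> x \<in> closure_kern" for x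
  proof
    assume z: "\<forall>n. \<Phi> x n = \<one>\<^bsub>Y n\<^esub>"
    have "\<exists>q\<in>kern n. approx N x q" for n N
    proof -
      let ?N = "max N (thr n)"
      define q where "q = (\<lambda>i. trunc ?N (x i))"
      have q: "approx ?N x q" unfolding q_def by (rule approx_trunc)
      have "pm [:e n:] q \<in> kern n"
        using z Phi[OF approx_mono[OF q]] by (simp add: kern_def)
      \<comment> \<open>Modulo the exponent, \<open>c n * e n\<close> equals \<open>c n\<close>, so
        \<open>c n\<close> sends \<open>q\<close> into the kernel. An inverse of \<open>c n\<close>
        modulo p^N then replaces it by 1 + p^N z, which alters \<open>q\<close> only beyond
        precision \<open>N\<close>.\<close>
      then have k1: "pm [:int (c n) * e n:] q \<in> kern n"
        using kern_int[of "pm [:e n:] q" n "int (c n)"] unfolding pm_const by blast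
      obtain l where l: "e n - 1 = int (CARD('p) ^ a n) * l" using e1[of n] by (elim dvdE)
      have "pm [:int (CARD('p) ^ a n * c n) * l:] q \<in> kern n" by (rule dvd_kern) simp
      from kern_diff[OF k1 this] have "pm [:int (c n) * e n - int (CARD('p) ^ a n * c n) * l:] q \<in> kern n"
        unfolding pm_const_diff .
      moreover have "int (c n) * e n - int (CARD('p) ^ a n * c n) * l = int (c n)"
      proof -
        have "e n = 1 + int (CARD('p) ^ a n) * l" using l by simp
        then show ?thesis by (simp add: algebra_simps)
      qed
      ultimately have cq: "pm [:int (c n):] q \<in> kern n" by simp
      obtain h z where hz: "h * int (c n) = 1 + int CARD('p) ^ N * z" using coprime_inverse_mod_power[OF cop] .
      have "pm [:1 + int CARD('p) ^ N * z:] q \<in> kern n" unfolding hz[symmetric] using kern_int[OF cq, of h] unfolding pm_const .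
      moreover have "approx N x (pm [:1 + int CARD('p) ^ N * z:] q)"
        unfolding approx_def
      proof (intro allI impI)
        fix i assume i: "i < g"
        have "(of_nat CARD('p) :: 'p padic_int fps) ^ N \<in> max_power N" by (rule max_power_power[OF padic_p_in_max_power])
        then have "of_nat CARD('p) ^ N * (of_int z * iota (q i)) \<in> (max_power N :: 'p padic_int fps set)" by (rule max_power_mult_right)
        moreover have "x i - iota (q i) \<in> max_power N" using approx_mono[OF q, of N] i by (simp add: approx_def)
        ultimately have "(x i - iota (q i)) - of_nat CARD('p) ^ N * (of_int z * iota (q i)) \<in> max_power N" by (rule max_power_diff[rotated])
        then show "x i - iota (pm [:1 + int CARD('p) ^ N * z:] q i) \<in> max_power N"
          unfolding pm_def iota_simps iota_of_int by (simp add: algebra_simps)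
      qed
      ultimately show ?thesis by blast
    qed
    then show "x \<in> closure_kern" unfolding closure_kern_def by blast
  next
    assume "x \<in> closure_kern"
    show "\<forall>n. \<Phi> x n = \<one>\<^bsub>Y n\<^esub>"
    proof
      fix n
      obtain q where "q \<in> kern n" "approx (thr n) x q" using \<open>x \<in> closure_kern\<close> unfolding closure_kern_def by blast
      then show "\<Phi> x n = \<one>\<^bsub>Y n\<^esub>" using Phi kern_int[of q n "e n"] by (simp add: kern_def)
    qed
  qed
  have Phi0: "\<Phi> 0 n = \<one>\<^bsub>Y n\<^esub>" for n
  proof -
    have "approx (thr n) 0 0" by (simp add: approx_def)
    then have "\<Phi> 0 n = \<theta> n (pm [:e n:] 0)" by (rule Phi)
    also have "pm [:e n:] 0 = 0" by (simp add: pm_def fun_eq_iff)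
    finally show ?thesis by (simp only: theta_0)
  qed
  have eq: "\<Phi> x = \<Phi> y \<longleftrightarrow> x - y \<in> closure_kern" for x y
  proof -
    have "\<Phi> x n = \<Phi> y n \<longleftrightarrow> \<Phi> (x - y) n = \<one>\<^bsub>Y n\<^esub>" for n
    proof -
      interpret comm_group "Y n" by (rule Y_group)
      have "\<Phi> x n = \<Phi> (x - y) n \<otimes>\<^bsub>Y n\<^esub> \<Phi> y n" using add[of "x - y" y n] by (simp only: diff_add_cancel)
      moreover have "\<Phi> (x - y) n \<in> carrier (Y n)" "\<Phi> y n \<in> carrier (Y n)" by (simp_all add: \<Phi>_def)
      ultimately show ?thesis using r_cancel[of "\<Phi> (x - y) n" "\<Phi> y n" "\<one>\<^bsub>Y n\<^esub>"] by auto
    qed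
    then show ?thesis unfolding ker[symmetric] fun_eq_iff[of "\<Phi> x"] by simp
  qed
  have "carrier limit_module = range \<Phi>" using carr surj by blast
  moreover have "\<Phi> (x + y) = \<Phi> x \<oplus>\<^bsub>limit_module\<^esub> \<Phi> y" for x y
    by (rule ext) (simp add: limit_module_def add)
  moreover have "\<Phi> (fun_scale f x) = f \<odot>\<^bsub>limit_module\<^esub> \<Phi> x" for f x
    by (rule ext) (simp add: limit_module_def smult)
  moreover have "\<zero>\<^bsub>limit_module\<^esub> = \<Phi> 0" by (rule ext) (simp add: limit_module_def Phi0)
  ultimately show ?thesis using eq by (intro exI[of _ \<Phi>] conjI allI)
qed

end

section \<open>The Laplacian of a finite connected graph\<close>

lemma divisor_degree_eq_sum:
  assumes "finite V" "Poly_Mapping.keys D \<subseteq> V"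
  shows "divisor_degree D = (\<Sum>w\<in>V. Poly_Mapping.lookup D w)"
  unfolding divisor_degree_def using assms
  by (intro sum.mono_neutral_left) (auto simp: in_keys_iff)

lemma divisor_degree_add: "divisor_degree (D + E) = divisor_degree D + divisor_degree E"
proof -
  let ?V = "Poly_Mapping.keys D \<union> Poly_Mapping.keys E"
  have "Poly_Mapping.keys (D + E) \<subseteq> ?V" by (rule keys_add)
  then show ?thesis
    by (simp add: divisor_degree_eq_sum[of ?V] lookup_add sum.distrib)
qed

lemma divisor_degree_0 [simp]: "divisor_degree 0 = 0"
  by (simp add: divisor_degree_def)

lemma divisor_degree_cmul: "divisor_degree (frag_cmul c D) = c * divisor_degree D"
proof -
  have "Poly_Mapping.keys (frag_cmul c D) \<subseteq> Poly_Mapping.keys D" by (rule keys_cmul)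
  then show ?thesis
    by (simp add: divisor_degree_eq_sum[of "Poly_Mapping.keys D"] sum_distrib_left)
qed

lemma divisor_degree_of [simp]: "divisor_degree (frag_of w) = 1"
  by (simp add: divisor_degree_def)

lemma divisor_degree_uminus: "divisor_degree (- D) = - divisor_degree D"
  using divisor_degree_add[of D "- D"] by simp

lemma divisor_degree_diff: "divisor_degree (D - E) = divisor_degree D - divisor_degree E"
  using divisor_degree_add[of D "- E"] by (simp add: divisor_degree_uminus)

lemma divisor_degree_sum: "divisor_degree (\<Sum>i\<in>I. f i) = (\<Sum>i\<in>I. divisor_degree (f i))"
  by (induction I rule: infinite_finite_induct) (simp_all add: divisor_degree_add)

locale connected_serre_graph = serre_graph G bar + fin_digraph G
  for G :: "('v, 'e) pre_digraph" and bar +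
  assumes conn: "connected G"
begin

lemma head_bar: "e \<in> arcs G \<Longrightarrow> head G (bar e) = tail G e"
  using tail_bar[of "bar e"] bar_in_arcs bar_bar by metis

lemma verts_nonempty: "verts G \<noteq> {}"
  using conn unfolding connected_def strongly_connected_def by simp

lemma symmetric_arcs: "symmetric G"
  unfolding symmetric_def
proof (rule symI)
  fix u w assume "(u, w) \<in> arcs_ends G"
  then obtain e where e: "e \<in> arcs G" "u = tail G e" "w = head G e" by (auto simp: arcs_ends_def arc_to_ends_def)
  then have "arc_to_ends G (bar e) = (w, u)" using tail_bar[OF e(1)] head_bar[OF e(1)] by (simp add: arc_to_ends_def)
  then show "(w, u) \<in> arcs_ends G" unfolding arcs_ends_def using bar_in_arcs[OF e(1)] by (metis image_eqI)
qed

lemma neighbour_closed_eq_verts: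
  assumes S: "S \<subseteq> verts G" "S \<noteq> {}" and cl: "\<And>e. e \<in> arcs G \<Longrightarrow> tail G e \<in> S \<Longrightarrow> head G e \<in> S"
  shows "S = verts G"
proof -
  obtain u where u: "u \<in> S" using S(2) by blast
  have "w \<in> S" if w: "w \<in> verts G" for w
  proof -
    have "u \<rightarrow>\<^sup>*\<^bsub>mk_symmetric G\<^esub> w"
      using conn u S(1) w unfolding connected_def strongly_connected_def by auto
    then have "u \<rightarrow>\<^sup>*\<^bsub>G\<^esub> w" using reachable_mk_symmetric_eq[OF symmetric_arcs] by blast
    then show ?thesis
    proof (induction rule: reachable_induct)
      case base then show ?case using u by simp
    next
      case (step x y)
      then obtain e where "e \<in> arcs G" "tail G e = x" "head G e = y"
        by (auto simp: arcs_ends_def arc_to_ends_def)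
      then show ?case using cl step by blast
    qed
  qed
  then show ?thesis using S(1) by blast
qed

text \<open>The Laplacian on integer functions. It sums over outgoing arcs, while the coefficient of
  \<open>laplacian G D\<close> at \<open>w\<close> collects incoming ones; the involution identifies
  the two.\<close>

definition lap :: "('v \<Rightarrow> int) \<Rightarrow> 'v \<Rightarrow> int"
  where "lap d w = (\<Sum>e\<in>out_arcs G w. d w - d (head G e))"

lemma lap_in_arcs: "lap d w = int (out_degree G w) * d w - (\<Sum>e | e \<in> arcs G \<and> head G e = w. d (tail G e))"
proof -
  have "(\<Sum>e\<in>out_arcs G w. d (head G e)) = (\<Sum>e | e \<in> arcs G \<and> head G e = w. d (tail G e))"
    by (rule sum.reindex_bij_witness[of _ bar bar])
      (auto simp: out_arcs_def bar_bar bar_in_arcs tail_bar head_bar)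
  then show ?thesis by (simp add: lap_def sum_subtractf out_degree_def)
qed

text \<open>The set where \<open>\<bar>d\<bar>\<close> is maximal is closed under passing to neighbours.\<close>

lemma maximum_principle:
  assumes U: "U \<subset> verts G" and harm: "\<And>w. w \<in> U \<Longrightarrow> lap d w = 0"
    and out: "\<And>w. w \<in> verts G \<Longrightarrow> w \<notin> U \<Longrightarrow> d w = 0" and w: "w \<in> verts G"
  shows "d w = 0"
proof (rule ccontr)
  assume dw: "d w \<noteq> 0"
  define M where "M = Max ((\<lambda>w. \<bar>d w\<bar>) ` verts G)"
  have le: "\<bar>d u\<bar> \<le> M" if "u \<in> verts G" for u unfolding M_def using that by (intro Max_ge) auto
  have M0: "M > 0" using le[OF w] dw by linarith
  define S where "S = {u \<in> verts G. \<bar>d u\<bar> = M}"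
  have "M \<in> (\<lambda>w. \<bar>d w\<bar>) ` verts G" unfolding M_def using verts_nonempty by (intro Max_in) auto
  then have "S \<noteq> {}" unfolding S_def by blast
  moreover have "head G e \<in> S" if e: "e \<in> arcs G" "tail G e \<in> S" for e
  proof -
    let ?u = "tail G e"
    have u: "?u \<in> verts G" "\<bar>d ?u\<bar> = M" using e by (auto simp: S_def)
    then have "?u \<in> U" using out M0 by fastforce
    then have z: "(\<Sum>e\<in>out_arcs G ?u. sgn (d ?u) * (d ?u - d (head G e))) = 0"
      using harm unfolding lap_def sum_distrib_left[symmetric] by simp
    have nn: "sgn (d ?u) * (d ?u - d (head G e')) \<ge> 0" if "e' \<in> out_arcs G ?u" for e'
    proof -
      have "\<bar>d (head G e')\<bar> \<le> M" using that by (intro le) (auto simp: out_arcs_def)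
      then show ?thesis using u(2) by (cases "d ?u > 0"; cases "d ?u < 0") auto
    qed
    have "sgn (d ?u) * (d ?u - d (head G e)) = 0"
      using sum_nonneg_0[OF finite_out_arcs nn z, of e] e by (simp add: out_arcs_def)
    then have "d (head G e) = d ?u" using u(2) M0 by (auto simp: sgn_eq_0_iff)
    then show ?thesis using u(2) e(1) by (simp add: S_def)
  qed
  ultimately have "S = verts G" by (intro neighbour_closed_eq_verts) (auto simp: S_def)
  moreover obtain u where "u \<in> verts G" "u \<notin> U" using U by blast
  ultimately show False using out[of u] M0 by (auto simp: S_def)
qed

text \<open>The block of the Laplacian at the vertices \<open>u 0\<close>, ...,
  \<open>u (m - 1)\<close>. Columns belong to tails and rows to heads, as in the voltage adjacency
  matrix.\<close>

definition red_lap :: "(nat \<Rightarrow> 'v) \<Rightarrow> nat \<Rightarrow> int mat"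
  where "red_lap u m = mat m m (\<lambda>(i, j). (if i = j then int (out_degree G (u i)) else 0)
    - int (card {e \<in> arcs G. tail G e = u j \<and> head G e = u i}))"

lemma red_lap_mult:
  assumes inj: "inj_on u {..<m}" and U: "u ` {..<m} \<subseteq> verts G"
    and d: "\<And>w. w \<in> verts G \<Longrightarrow> w \<notin> u ` {..<m} \<Longrightarrow> d w = 0" and i: "i < m"
  shows "(\<Sum>j<m. red_lap u m $$ (i, j) * d (u j)) = lap d (u i)"
proof -
  have "(\<Sum>j<m. red_lap u m $$ (i, j) * d (u j))
      = (\<Sum>j<m. (if j = i then int (out_degree G (u i)) * d (u i) else 0) - int (card {e \<in> arcs G. tail G e = u j \<and> head G e = u i}) * d (u j))"
    using i by (intro sum.cong) (auto simp: red_lap_def algebra_simps)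
  also have "\<dots> = int (out_degree G (u i)) * d (u i) - (\<Sum>j<m. \<Sum>e | e \<in> arcs G \<and> tail G e = u j \<and> head G e = u i. d (tail G e))"
    using i by (simp add: sum_subtractf)
  also have "(\<Sum>j<m. \<Sum>e | e \<in> arcs G \<and> tail G e = u j \<and> head G e = u i. d (tail G e))
      = (\<Sum>w\<in>u ` {..<m}. \<Sum>e | e \<in> arcs G \<and> tail G e = w \<and> head G e = u i. d (tail G e))"
    by (simp add: sum.reindex[OF inj])
  also have "\<dots> = (\<Sum>w\<in>verts G. \<Sum>e | e \<in> arcs G \<and> tail G e = w \<and> head G e = u i. d (tail G e))"
    using U d by (intro sum.mono_neutral_left) (auto intro!: sum.neutral)
  also have "\<dots> = (\<Sum>w\<in>verts G. \<Sum>e | e \<in> {e \<in> arcs G. head G e = u i} \<and> tail G e = w. d (tail G e))"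
    by (intro sum.cong) auto
  also have "\<dots> = (\<Sum>e | e \<in> arcs G \<and> head G e = u i. d (tail G e))"
    by (rule sum.group) auto
  finally show ?thesis unfolding lap_in_arcs .
qed

lemma red_lap_carrier: "red_lap u m \<in> carrier_mat m m" by (simp add: red_lap_def)

text \<open>A null vector, extended by zero, is harmonic on a proper subset of the vertices and zero
  elsewhere; the maximum principle makes it vanish.\<close>

lemma det_red_lap_nonzero:
  assumes inj: "inj_on u {..<m}" and U: "u ` {..<m} \<subset> verts G"
  shows "det (red_lap u m) \<noteq> 0"
proof
  assume "det (red_lap u m) = 0"
  then obtain x where x: "x \<in> carrier_vec m" "x \<noteq> 0\<^sub>v m" "red_lap u m *\<^sub>v x = 0\<^sub>v m"
    using det_0_iff_vec_prod_zero[OF red_lap_carrier] by blast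
  define d where "d w = (if w \<in> u ` {..<m} then x $ (the_inv_into {..<m} u w) else 0)" for w
  have du: "d (u j) = x $ j" if "j < m" for j using that by (auto simp: d_def the_inv_into_f_f[OF inj])
  have lap0: "lap d (u i) = 0" if i: "i < m" for i
  proof -
    have "lap d (u i) = (\<Sum>j<m. red_lap u m $$ (i, j) * d (u j))"
      using U i by (intro red_lap_mult[OF inj, symmetric]) (auto simp: d_def)
    also have "\<dots> = (\<Sum>j<m. red_lap u m $$ (i, j) * x $ j)" by (intro sum.cong) (auto simp: du)
    also have "\<dots> = (red_lap u m *\<^sub>v x) $ i"
      using i x(1) red_lap_carrier[of u m] by (auto simp: mult_mat_vec_def scalar_prod_def lessThan_atLeast0)
    finally show ?thesis using x(3) i by simp
  qed
  have d0: "d w = 0" if w: "w \<in> verts G" for w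
  proof (rule maximum_principle[OF U _ _ w])
    show "lap d w' = 0" if w': "w' \<in> u ` {..<m}" for w' using w' lap0 by blast
    show "d w' = 0" if w': "w' \<notin> u ` {..<m}" for w' using w' by (simp add: d_def)
  qed
  have "x $ j = 0" if j: "j < m" for j
  proof -
    have "u j \<in> verts G" using U j by blast
    then show ?thesis using d0[of "u j"] du[OF j] by simp
  qed
  then have "x = 0\<^sub>v m" using x(1) by (intro eq_vecI) auto
  then show False using x(2) by simp
qed

lemma keys_laplacian_of:
  "w \<in> verts G \<Longrightarrow> Poly_Mapping.keys (frag_cmul (int (out_degree G w)) (frag_of w) - (\<Sum>e\<in>out_arcs G w. frag_of (head G e))) \<subseteq> verts G"
proof -
  assume w: "w \<in> verts G"
  have a: "frag_cmul (int (out_degree G w)) (frag_of w) \<in> carrier (free_Abelian_group (verts G))"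
    using keys_cmul[of "int (out_degree G w)" "frag_of w"] w by auto
  have b: "(\<Sum>e\<in>out_arcs G w. frag_of (head G e)) \<in> carrier (free_Abelian_group (verts G))"
    by (intro sum_closed_free_Abelian_group) (auto simp: out_arcs_def)
  show ?thesis using a b keys_diff[of "frag_cmul (int (out_degree G w)) (frag_of w)" "\<Sum>e\<in>out_arcs G w. frag_of (head G e)"]
    by auto
qed

lemma keys_laplacian: "Poly_Mapping.keys D \<subseteq> verts G \<Longrightarrow> Poly_Mapping.keys (laplacian G D) \<subseteq> verts G"
proof (induction D rule: frag_induction[of _ "verts G"])
  case (diff a b)
  then show ?case using keys_diff[of "laplacian G a" "laplacian G b"] by (auto simp: laplacian_def frag_extend_diff)
qed (use keys_laplacian_of in \<open>auto simp: laplacian_def\<close>)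

lemma divisor_degree_laplacian: "Poly_Mapping.keys D \<subseteq> verts G \<Longrightarrow> divisor_degree (laplacian G D) = 0"
proof (induction D rule: frag_induction[of _ "verts G"])
  case (one w)
  then show ?case by (simp add: laplacian_def divisor_degree_diff divisor_degree_cmul divisor_degree_sum out_degree_def)
next
  case (diff a b)
  then show ?case by (simp add: laplacian_def frag_extend_diff divisor_degree_diff)
qed (simp_all add: laplacian_def)

lemma lookup_laplacian:
  "Poly_Mapping.keys D \<subseteq> verts G \<Longrightarrow> Poly_Mapping.lookup (laplacian G D) w = lap (Poly_Mapping.lookup D) w"
proof (induction D rule: frag_induction[of _ "verts G"])
  case (one u)
  have "(\<Sum>e\<in>out_arcs G u. Poly_Mapping.lookup (frag_of (head G e)) w) = int (card {e \<in> arcs G. tail G e = u \<and> head G e = w})"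
  proof -
    have "(\<Sum>e\<in>out_arcs G u. Poly_Mapping.lookup (frag_of (head G e)) w) = (\<Sum>e\<in>out_arcs G u. if head G e = w then 1 else 0)"
      by (intro sum.cong) auto
    also have "\<dots> = int (card {e \<in> out_arcs G u. head G e = w})"
      by (subst sum.inter_filter[symmetric]) auto
    also have "{e \<in> out_arcs G u. head G e = w} = {e \<in> arcs G. tail G e = u \<and> head G e = w}" by (auto simp: out_arcs_def)
    finally show ?thesis .
  qed
  moreover have "(\<Sum>e | e \<in> arcs G \<and> head G e = w. Poly_Mapping.lookup (frag_of u) (tail G e)) = int (card {e \<in> arcs G. tail G e = u \<and> head G e = w})"
  proof -
    have "(\<Sum>e | e \<in> arcs G \<and> head G e = w. Poly_Mapping.lookup (frag_of u) (tail G e)) = (\<Sum>e | e \<in> arcs G \<and> head G e = w. if tail G e = u then 1 else 0)"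
      by (intro sum.cong) auto
    also have "\<dots> = int (card {e \<in> {e \<in> arcs G. head G e = w}. tail G e = u})"
      by (subst sum.inter_filter[symmetric]) auto
    also have "{e \<in> {e \<in> arcs G. head G e = w}. tail G e = u} = {e \<in> arcs G. tail G e = u \<and> head G e = w}" by auto
    finally show ?thesis .
  qed
  ultimately show ?case unfolding lap_in_arcs by (simp add: laplacian_def lookup_minus lookup_sum)
next
  case (diff a b)
  then show ?case by (simp add: laplacian_def frag_extend_diff lookup_minus lap_def sum_subtractf right_diff_distrib)
qed (simp_all add: laplacian_def lap_def)

lemma exists_vertex_enumeration:
  assumes "w0 \<in> verts G"
  obtains u m where "inj_on u {..<m :: nat}" "u ` {..<m} = verts G - {w0}"
proof -
  have "finite (verts G - {w0})" by simp
  then obtain h where "bij_betw h {0..<card (verts G - {w0})} (verts G - {w0})"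
    using ex_bij_betw_nat_finite by blast
  then show thesis using that[of h "card (verts G - {w0})"] by (auto simp: bij_betw_def lessThan_atLeast0)
qed

text \<open>Up to sign \<open>d\<close> is the determinant of the Laplacian with the row and column
  of \<open>w0\<close> deleted, and the adjugate inverts that matrix up to \<open>d\<close>. The
  first conclusion gives an exponent of the Picard group; the second says that a function harmonic
  modulo \<open>a\<close> is, after multiplication by \<open>d\<close>, constant modulo
  \<open>a\<close>.\<close>

theorem laplacian_exponent:
  assumes w0: "w0 \<in> verts G"
  shows "\<exists>d :: int. d > 0 \<and>
    (\<forall>D. Poly_Mapping.keys D \<subseteq> verts G \<longrightarrow> divisor_degree D = 0 \<longrightarrow> frag_cmul d D \<in> principal_divisors G) \<and>
    (\<forall>D a w. Poly_Mapping.keys D \<subseteq> verts G \<longrightarrow> (\<forall>w. a dvd Poly_Mapping.lookup (laplacian G D) w) \<longrightarrow> w \<in> verts G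
      \<longrightarrow> a dvd d * (Poly_Mapping.lookup D w - Poly_Mapping.lookup D w0))"
proof -
  obtain u m where inj: "inj_on u {..<m :: nat}" and U: "u ` {..<m} = verts G - {w0}"
    using exists_vertex_enumeration[OF w0] .
  have Usub: "u ` {..<m} \<subset> verts G" using U w0 by blast
  let ?B = "red_lap u m"
  define d where "d = det ?B"
  have d0: "d \<noteq> 0" unfolding d_def by (rule det_red_lap_nonzero[OF inj Usub])
  note B = red_lap_carrier[of u m] and J = adj_mat[OF red_lap_carrier[of u m]]
  have BJ: "(\<Sum>j<m. ?B $$ (i, j) * adj_mat ?B $$ (j, l)) = (if i = l then d else 0)" if "i < m" "l < m" for i l
    using index_mult_mat_sum[OF B J(1) that] that unfolding J(2) d_def by auto
  have JB: "(\<Sum>j<m. adj_mat ?B $$ (i, j) * ?B $$ (j, l)) = (if i = l then d else 0)" if "i < m" "l < m" for i l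
    using index_mult_mat_sum[OF J(1) B that] that unfolding J(3) d_def by auto
  have pr: "frag_cmul d D \<in> principal_divisors G" if D: "Poly_Mapping.keys D \<subseteq> verts G" "divisor_degree D = 0" for D
  proof -
    let ?r = "\<lambda>i. Poly_Mapping.lookup D (u i)"
    define y where "y j = (\<Sum>l<m. adj_mat ?B $$ (j, l) * ?r l)" for j
    define E where "E = (\<Sum>j<m. frag_cmul (y j) (frag_of (u j)))"
    have EV: "E \<in> carrier (free_Abelian_group (verts G))"
      unfolding E_def
    proof (intro sum_closed_free_Abelian_group)
      fix j assume "j \<in> {..<m}"
      then show "frag_cmul (y j) (frag_of (u j)) \<in> carrier (free_Abelian_group (verts G))"
        using keys_cmul[of "y j" "frag_of (u j)"] U by auto
    qed
    then have EV': "Poly_Mapping.keys E \<subseteq> verts G" by simp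
    have Eu: "Poly_Mapping.lookup E (u j) = y j" if j: "j < m" for j
    proof -
      have "Poly_Mapping.lookup E (u j) = (\<Sum>i<m. if i = j then y i else 0)"
        unfolding E_def lookup_sum using j inj by (intro sum.cong) (auto simp: inj_on_def)
      then show ?thesis using j by simp
    qed
    have E0: "Poly_Mapping.lookup E w = 0" if "w \<notin> u ` {..<m}" for w
      unfolding E_def lookup_sum using that by (intro sum.neutral) auto
    have L: "Poly_Mapping.lookup (laplacian G E) (u i) = d * ?r i" if i: "i < m" for i
    proof -
      have "Poly_Mapping.lookup (laplacian G E) (u i) = (\<Sum>j<m. ?B $$ (i, j) * Poly_Mapping.lookup E (u j))"
        unfolding lookup_laplacian[OF EV'] using U E0 i by (intro red_lap_mult[OF inj, symmetric]) auto
      also have "\<dots> = (\<Sum>j<m. \<Sum>l<m. ?B $$ (i, j) * adj_mat ?B $$ (j, l) * ?r l)"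
        by (intro sum.cong) (auto simp: Eu y_def sum_distrib_left mult.assoc)
      also have "\<dots> = (\<Sum>l<m. (\<Sum>j<m. ?B $$ (i, j) * adj_mat ?B $$ (j, l)) * ?r l)"
        by (subst sum.swap) (simp add: sum_distrib_right)
      also have "\<dots> = (\<Sum>l<m. if l = i then d * ?r i else 0)"
        using i by (intro sum.cong) (auto simp: BJ)
      finally show ?thesis using i by simp
    qed
    have V: "verts G = insert w0 (verts G - {w0})" using w0 by blast
    have split: "divisor_degree F = Poly_Mapping.lookup F w0 + (\<Sum>w\<in>verts G - {w0}. Poly_Mapping.lookup F w)"
      if "Poly_Mapping.keys F \<subseteq> verts G" for F
      using that w0 by (simp add: divisor_degree_eq_sum[of "verts G"] sum.remove[of "verts G" w0])
    have agree: "Poly_Mapping.lookup (laplacian G E) w = d * Poly_Mapping.lookup D w" if "w \<in> verts G - {w0}" for w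
      using that L unfolding U[symmetric] by auto
    \<comment> \<open>The value at the deleted vertex is forced, as both divisors have degree
      zero.\<close>
    have "Poly_Mapping.lookup (laplacian G E) w0 = - (\<Sum>w\<in>verts G - {w0}. Poly_Mapping.lookup (laplacian G E) w)"
      using split[OF keys_laplacian[OF EV']] divisor_degree_laplacian[OF EV'] by simp
    also have "\<dots> = d * - (\<Sum>w\<in>verts G - {w0}. Poly_Mapping.lookup D w)"
      using agree by (simp add: sum_distrib_left)
    also have "- (\<Sum>w\<in>verts G - {w0}. Poly_Mapping.lookup D w) = Poly_Mapping.lookup D w0"
      using split[OF D(1)] D(2) by linarith
    finally have w0': "Poly_Mapping.lookup (laplacian G E) w0 = d * Poly_Mapping.lookup D w0" .
    have "laplacian G E = frag_cmul d D"
    proof (rule poly_mapping_eqI)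
      fix w
      show "Poly_Mapping.lookup (laplacian G E) w = Poly_Mapping.lookup (frag_cmul d D) w"
      proof (cases "w \<in> verts G")
        case True then show ?thesis using agree[of w] w0' by (cases "w = w0") auto
      next
        case False
        then have "w \<notin> Poly_Mapping.keys (laplacian G E)" "w \<notin> Poly_Mapping.keys D" using keys_laplacian[OF EV'] D(1) by auto
        then show ?thesis by (simp add: in_keys_iff)
      qed
    qed
    then show ?thesis using EV unfolding principal_divisors_def by (metis image_eqI)
  qed
  have dv: "a dvd d * (Poly_Mapping.lookup D w - Poly_Mapping.lookup D w0)"
    if D: "Poly_Mapping.keys D \<subseteq> verts G" and a: "\<And>w. a dvd Poly_Mapping.lookup (laplacian G D) w" and w: "w \<in> verts G" for D a w
  proof (cases "w = w0")
    case False
    \<comment> \<open>Subtracting a constant leaves the Laplacian unchanged and makes the function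
      vanish at \<open>w0\<close>, so the deleted block determines it.\<close>
    define x where "x w = Poly_Mapping.lookup D w - Poly_Mapping.lookup D w0" for w
    have lapx: "lap x w = Poly_Mapping.lookup (laplacian G D) w" for w
      unfolding lookup_laplacian[OF D] lap_def x_def by simp
    obtain i where i: "i < m" "w = u i" using w False U by blast
    have Bx: "a dvd (\<Sum>l<m. ?B $$ (j, l) * x (u l))" if "j < m" for j
    proof -
      have "(\<Sum>l<m. ?B $$ (j, l) * x (u l)) = lap x (u j)"
        using U that by (intro red_lap_mult[OF inj]) (auto simp: x_def)
      then show ?thesis using a lapx by simp
    qed
    have "d * x (u i) = (\<Sum>l<m. if l = i then d * x (u i) else 0)" using i by simp
    also have "\<dots> = (\<Sum>l<m. (\<Sum>j<m. adj_mat ?B $$ (i, j) * ?B $$ (j, l)) * x (u l))"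
      using i by (intro sum.cong) (auto simp: JB)
    also have "\<dots> = (\<Sum>j<m. \<Sum>l<m. adj_mat ?B $$ (i, j) * ?B $$ (j, l) * x (u l))"
      by (subst sum.swap) (simp add: sum_distrib_right)
    also have "\<dots> = (\<Sum>j<m. adj_mat ?B $$ (i, j) * (\<Sum>l<m. ?B $$ (j, l) * x (u l)))"
      by (simp add: sum_distrib_left mult.assoc)
    finally have "a dvd d * x (u i)" using Bx by (auto intro!: dvd_sum)
    then show ?thesis using i by (simp add: x_def)
  qed simp
  show ?thesis
  proof (intro exI[of _ "\<bar>d\<bar>"] conjI allI impI)
    show "\<bar>d\<bar> > 0" using d0 by simp
    fix D :: "'v \<Rightarrow>\<^sub>0 int" assume D: "Poly_Mapping.keys D \<subseteq> verts G"
    show "frag_cmul \<bar>d\<bar> D \<in> principal_divisors G" if "divisor_degree D = 0"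
    proof (cases "d > 0")
      case True then show ?thesis using pr[OF D that] by simp
    next
      case False
      have "Poly_Mapping.keys (- D) \<subseteq> verts G" "divisor_degree (- D) = 0" using D that by (simp_all add: divisor_degree_uminus)
      then have "frag_cmul d (- D) \<in> principal_divisors G" by (rule pr)
      moreover have "frag_cmul \<bar>d\<bar> D = frag_cmul d (- D)" using False by (intro poly_mapping_eqI) simp
      ultimately show ?thesis by simp
    qed
    fix a w assume "\<forall>w. a dvd Poly_Mapping.lookup (laplacian G D) w" "w \<in> verts G"
    then have "a dvd d * (Poly_Mapping.lookup D w - Poly_Mapping.lookup D w0)" using dv[OF D] by blast
    then show "a dvd \<bar>d\<bar> * (Poly_Mapping.lookup D w - Poly_Mapping.lookup D w0)"
      by (cases "d \<ge> 0") auto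
  qed
qed

end

section \<open>The layers of a branched tower\<close>

lemma p_power_multiples_iff: "x \<in> p_power_multiples n \<longleftrightarrow> (padic_p :: 'p :: prime_card padic_int) ^ n dvd x"
  by (auto simp: p_power_multiples_def elim!: dvdE)

lemma comm_group_Zp: "comm_group (Zp_group :: 'p :: prime_card padic_int monoid)"
proof (rule comm_groupI)
  fix x :: "'p padic_int" show "\<exists>y\<in>carrier Zp_group. y \<otimes>\<^bsub>Zp_group\<^esub> x = \<one>\<^bsub>Zp_group\<^esub>"
    by (intro bexI[of _ "- x"]) simp_all
qed (simp_all add: algebra_simps)

lemma inv_Zp: "inv\<^bsub>Zp_group\<^esub> x = - (x :: 'p :: prime_card padic_int)"
proof -
  interpret comm_group "Zp_group :: 'p padic_int monoid" by (rule comm_group_Zp)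
  show ?thesis by (rule inv_equality) simp_all
qed

lemma subgroup_p_power_multiples: "subgroup (p_power_multiples n) (Zp_group :: 'p :: prime_card padic_int monoid)"
  by (rule subgroup.intro) (auto simp: p_power_multiples_iff inv_Zp)

lemma normal_p_power_multiples: "normal (p_power_multiples n) (Zp_group :: 'p :: prime_card padic_int monoid)"
  using comm_group.subgroup_imp_normal[OF comm_group_Zp subgroup_p_power_multiples] .

lemma proj_eq: "proj n (x :: 'p :: prime_card padic_int) = {z. padic_p ^ n dvd z - x}"
proof (intro equalityI subsetI)
  fix z assume "z \<in> proj n x"
  then obtain h where "h \<in> p_power_multiples n" "z = h + x" by (auto simp: proj_def r_coset_def)
  then show "z \<in> {z. padic_p ^ n dvd z - x}" by (simp add: p_power_multiples_iff)
next
  fix z assume "z \<in> {z. padic_p ^ n dvd z - x}"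
  then have "z - x \<in> p_power_multiples n" by (simp add: p_power_multiples_iff)
  moreover have "z = (z - x) + x" by simp
  ultimately show "z \<in> proj n x" unfolding proj_def r_coset_def by (auto intro!: bexI[of _ "z - x"])
qed

lemma proj_eq_iff: "proj n x = proj n y \<longleftrightarrow> (padic_p :: 'p :: prime_card padic_int) ^ n dvd x - y"
proof
  assume "proj n x = proj n y"
  moreover have "x \<in> proj n x" by (simp add: proj_eq)
  ultimately have "x \<in> proj n y" by simp
  then show "padic_p ^ n dvd x - y" by (simp add: proj_eq)
next
  assume d: "padic_p ^ n dvd x - y"
  have "padic_p ^ n dvd z - x \<longleftrightarrow> padic_p ^ n dvd z - y" for z
  proof -
    have "z - y = (z - x) + (x - y)" by simp
    then show ?thesis using dvd_add_left_iff[OF d, of "z - x"] by (simp only:)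
  qed
  then show "proj n x = proj n y" by (simp add: proj_eq)
qed

lemma proj_cong_residue: "proj n (x + of_nat (nat (residue y n)) :: 'p :: prime_card padic_int) = proj n (x + y)"
proof -
  have "padic_p ^ n dvd y - of_nat (nat (residue y n))"
    using padic_approx[of n y] residue_nonneg[of y n] by (simp add: of_nat_nat)
  then have "padic_p ^ n dvd - (y - of_nat (nat (residue y n)))" unfolding dvd_minus_iff .
  then show ?thesis unfolding proj_eq_iff by (simp add: algebra_simps)
qed

lemma Gamma_carrier: "carrier (Gamma n) = range (proj n :: 'p :: prime_card padic_int \<Rightarrow> _)"
  by (auto simp: Gamma_def FactGroup_def RCOSETS_def proj_def)

lemma Gamma_mult: "proj n x \<otimes>\<^bsub>Gamma n\<^esub> proj n y = proj n (x + y :: 'p :: prime_card padic_int)"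
  using normal.rcos_sum[OF normal_p_power_multiples, of x y n] by (simp add: Gamma_def FactGroup_def proj_def)

lemma comm_group_Gamma: "comm_group (Gamma n :: 'p :: prime_card padic_int set monoid)"
  unfolding Gamma_def by (rule comm_group.abelian_FactGroup[OF comm_group_Zp subgroup_p_power_multiples])

lemma Gamma_one: "\<one>\<^bsub>Gamma n\<^esub> = proj n (0 :: 'p :: prime_card padic_int)"
  by (auto simp: Gamma_def FactGroup_def proj_eq p_power_multiples_iff)

lemma Gamma_inv: "inv\<^bsub>Gamma n\<^esub> proj n x = proj n (- x :: 'p :: prime_card padic_int)"
proof -
  interpret comm_group "Gamma n :: 'p padic_int set monoid" by (rule comm_group_Gamma)
  show ?thesis by (rule inv_equality) (auto simp: Gamma_mult Gamma_one Gamma_carrier)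
qed

lemma proj_residue_rep: "proj n x = proj n (of_nat (nat (residue x n)) :: 'p :: prime_card padic_int)"
  using proj_cong_residue[of n 0 x] by simp

lemma finite_Gamma: "finite (carrier (Gamma n :: 'p :: prime_card padic_int set monoid))"
proof -
  have "carrier (Gamma n :: 'p padic_int set monoid) \<subseteq> (\<lambda>j. proj n (of_nat j)) ` {..<CARD('p) ^ n}"
  proof
    fix c assume "c \<in> carrier (Gamma n :: 'p padic_int set monoid)"
    then obtain x :: "'p padic_int" where x: "c = proj n x" by (auto simp: Gamma_carrier)
    have "nat (residue x n) < CARD('p) ^ n" using residue_less[of x n] residue_nonneg[of x n]
      by (simp add: nat_less_iff)
    then show "c \<in> (\<lambda>j. proj n (of_nat j)) ` {..<CARD('p) ^ n}" unfolding x by (subst proj_residue_rep) blast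
  qed
  then show ?thesis by (rule finite_subset) simp
qed

lemma Gamma_reduce_proj: "Gamma_reduce n (proj (Suc n) x) = proj n (x :: 'p :: prime_card padic_int)"
proof (intro equalityI subsetI)
  fix z assume "z \<in> Gamma_reduce n (proj (Suc n) x)"
  then obtain h y where h: "h \<in> p_power_multiples n" "y \<in> proj (Suc n) x" "z = h + y"
    by (auto simp: Gamma_reduce_def set_mult_def)
  have "padic_p ^ n dvd y - x" using h(2) by (simp add: proj_eq) (metis dvd_mult_right power_Suc)
  then have "padic_p ^ n dvd h + (y - x)" using h(1) by (simp add: p_power_multiples_iff)
  then show "z \<in> proj n x" using h(3) by (simp add: proj_eq add_diff_eq)
next
  fix z assume "z \<in> proj n x"
  then have "z - x \<in> p_power_multiples n" by (simp add: proj_eq p_power_multiples_iff)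
  moreover have "x \<in> proj (Suc n) x" by (simp add: proj_eq)
  ultimately have "(z - x) \<otimes>\<^bsub>Zp_group\<^esub> x \<in> Gamma_reduce n (proj (Suc n) x)"
    unfolding Gamma_reduce_def set_mult_def by blast
  then show "z \<in> Gamma_reduce n (proj (Suc n) x)" by simp
qed

lemma poly_monom_induct:
  fixes q :: "int poly"
  assumes "P 0" "\<And>q r. P q \<Longrightarrow> P r \<Longrightarrow> P (q + r)" "\<And>c a. P (monom c a)"
  shows "P q"
proof -
  have "P (\<Sum>i\<in>I. monom (coeff q i) i)" if "finite I" for I
    using that by (induction I rule: finite_induct) (auto intro: assms)
  from this[of "{..degree q}"] show ?thesis by (simp add: poly_as_sum_of_monoms)
qed

lemma pushforward_simps:
  "pushforward \<phi> 0 = 0" "pushforward \<phi> (D + E) = pushforward \<phi> D + pushforward \<phi> E"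
  "pushforward \<phi> (D - E) = pushforward \<phi> D - pushforward \<phi> E"
  "pushforward \<phi> (frag_of w) = frag_of (\<phi> w)" "pushforward \<phi> (frag_cmul c D) = frag_cmul c (pushforward \<phi> D)"
  by (simp_all add: pushforward_def frag_extend_add frag_extend_diff frag_extend_cmul)

lemma pushforward_sum: "pushforward \<phi> (\<Sum>i\<in>I. f i) = (\<Sum>i\<in>I. pushforward \<phi> (f i))"
  by (induction I rule: infinite_finite_induct) (simp_all add: pushforward_simps)

text \<open>Vertices are indexed from \<open>0\<close>, so \<open>w i\<close> is the vertex labelled \<open>v\<^sub>i\<^sub>+\<^sub>1\<close> in the statement.\<close>

locale branched_tower = serre_graph X bar + fin_digraph X
  for X :: "('v, 'e) pre_digraph" and bar +
  fixes \<alpha> :: "'e \<Rightarrow> 'p :: prime_card padic_int" and G :: "'v \<Rightarrow> 'p padic_int set"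
    and k :: "'v \<Rightarrow> nat" and w :: "nat \<Rightarrow> 'v" and g t :: nat
  assumes alpha_bar: "s \<in> arcs X \<Longrightarrow> \<alpha> (bar s) = - \<alpha> s"
    and bij_w: "bij_betw w {..<g} (verts X)" and t_le: "t \<le> g"
    and G_unr: "i < t \<Longrightarrow> G (w i) = {0}"
    and G_ram: "t \<le> i \<Longrightarrow> i < g \<Longrightarrow> G (w i) = p_power_multiples (k (w i))"
    and connected_layer: "connected (layer X G \<alpha> n)"
begin

text \<open>The fibre of X_n over \<open>w i\<close> has p^(m i n) vertices; over a ramified vertex
  this number is bounded in \<open>n\<close>.\<close>

definition m :: "nat \<Rightarrow> nat \<Rightarrow> nat"
  where "m i n = (if i < t then n else min (k (w i)) n)"

text \<open>The vertex over \<open>w i\<close> given by the coset of \<open>a\<close>, labelled by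
  p-adic integers so that one label serves all levels.\<close>

definition vtx :: "nat \<Rightarrow> nat \<Rightarrow> 'p padic_int \<Rightarrow> 'v \<times> 'p padic_int set set"
  where "vtx n i a = (w i, (\<lambda>h. proj n (h + a)) ` G (w i))"

definition idx :: "'v \<Rightarrow> nat"
  where "idx = the_inv_into {..<g} w"

lemma m_le: "m i n \<le> n" by (simp add: m_def)

lemma w_idx: "u \<in> verts X \<Longrightarrow> w (idx u) = u" and idx_less: "u \<in> verts X \<Longrightarrow> idx u < g"
proof -
  assume "u \<in> verts X"
  then have u: "u \<in> w ` {..<g}" using bij_w by (simp add: bij_betw_def)
  have inj: "inj_on w {..<g}" using bij_w by (simp add: bij_betw_def)
  show "w (idx u) = u" unfolding idx_def by (rule f_the_inv_into_f[OF inj u])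
  show "idx u < g" using the_inv_into_into[OF inj u subset_refl] by (simp add: idx_def)
qed

lemma idx_w: "i < g \<Longrightarrow> idx (w i) = i"
  unfolding idx_def using bij_w by (simp add: bij_betw_def the_inv_into_f_f)

lemma w_verts: "i < g \<Longrightarrow> w i \<in> verts X" using bij_w by (auto simp: bij_betw_def)

lemma w_inj: "i < g \<Longrightarrow> j < g \<Longrightarrow> w i = w j \<longleftrightarrow> i = j"
  using bij_w by (auto simp: bij_betw_def inj_on_def)

lemma G_add: "i < g \<Longrightarrow> h \<in> G (w i) \<Longrightarrow> h' \<in> G (w i) \<Longrightarrow> h + h' \<in> G (w i)"
  and G_uminus: "i < g \<Longrightarrow> h \<in> G (w i) \<Longrightarrow> - h \<in> G (w i)" and G_0: "i < g \<Longrightarrow> 0 \<in> G (w i)"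
  using G_unr[of i] G_ram[of i] by (cases "i < t"; simp add: p_power_multiples_iff)+

text \<open>Cosets of the image of \<open>G (w i)\<close> in \<Gamma>_n are classes modulo the sum
  of \<open>G (w i)\<close> and the multiples of p^n. Ideals of the p-adic integers are nested, so
  this sum is the larger of the two.\<close>

lemma G_plus_multiples:
  assumes i: "i < g"
  shows "(\<exists>h\<in>G (w i). padic_p ^ n dvd x - h) \<longleftrightarrow> padic_p ^ m i n dvd x"
proof (cases "i < t")
  case True
  then show ?thesis using G_unr[OF True] by (simp add: m_def)
next
  case False
  then have G: "G (w i) = p_power_multiples (k (w i))" using G_ram i by simp
  show ?thesis
  proof
    assume "\<exists>h\<in>G (w i). padic_p ^ n dvd x - h"
    then obtain h where h: "padic_p ^ k (w i) dvd h" "padic_p ^ n dvd x - h" by (auto simp: G p_power_multiples_iff)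
    have "m i n \<le> k (w i)" using False by (simp add: m_def)
    then have "padic_p ^ m i n dvd h" by (rule dvd_trans[OF le_imp_power_dvd h(1)])
    moreover have "padic_p ^ m i n dvd x - h" by (rule dvd_trans[OF le_imp_power_dvd[OF m_le] h(2)])
    ultimately have "padic_p ^ m i n dvd (x - h) + h" by (rule dvd_add[rotated])
    then show "padic_p ^ m i n dvd x" by simp
  next
    assume x: "padic_p ^ m i n dvd x"
    show "\<exists>h\<in>G (w i). padic_p ^ n dvd x - h"
    proof (cases "k (w i) \<le> n")
      case True
      then show ?thesis using x False by (intro bexI[of _ x]) (simp_all add: G p_power_multiples_iff m_def)
    next
      case nk: False
      then show ?thesis using x False by (intro bexI[of _ 0]) (simp_all add: G p_power_multiples_iff m_def)
    qed
  qed
qed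

lemma vtx_eq_iff:
  assumes i: "i < g"
  shows "vtx n i a = vtx n i b \<longleftrightarrow> padic_p ^ m i n dvd a - b"
proof
  assume e: "vtx n i a = vtx n i b"
  have "proj n (0 + a) \<in> (\<lambda>h. proj n (h + a)) ` G (w i)" using G_0[OF i] by blast
  then have "proj n a \<in> (\<lambda>h. proj n (h + b)) ` G (w i)" using e by (simp add: vtx_def)
  then obtain h where "h \<in> G (w i)" "padic_p ^ n dvd a - (h + b)" by (auto simp: proj_eq_iff)
  then have "\<exists>h\<in>G (w i). padic_p ^ n dvd (a - b) - h" by (intro bexI[of _ h]) (simp_all add: algebra_simps)
  then show "padic_p ^ m i n dvd a - b" unfolding G_plus_multiples[OF i] .
next
  assume "padic_p ^ m i n dvd a - b"
  then obtain h where h: "h \<in> G (w i)" "padic_p ^ n dvd (a - b) - h" unfolding G_plus_multiples[OF i, symmetric] by blast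
  have d: "proj n (x + a) = proj n (x + h + b)" for x
    using h(2) by (simp add: proj_eq_iff algebra_simps)
  have d': "proj n (x + b) = proj n (x + - h + a)" for x
    unfolding d by simp
  have "(\<lambda>h. proj n (h + a)) ` G (w i) = (\<lambda>h. proj n (h + b)) ` G (w i)"
  proof (intro equalityI subsetI)
    fix c assume "c \<in> (\<lambda>h. proj n (h + a)) ` G (w i)"
    then obtain x where "x \<in> G (w i)" "c = proj n (x + a)" by blast
    then show "c \<in> (\<lambda>h. proj n (h + b)) ` G (w i)" using d[of x] G_add[OF i _ h(1)] by (intro image_eqI[of _ _ "x + h"]) auto
  next
    fix c assume "c \<in> (\<lambda>h. proj n (h + b)) ` G (w i)"
    then obtain x where "x \<in> G (w i)" "c = proj n (x + b)" by blast
    then show "c \<in> (\<lambda>h. proj n (h + a)) ` G (w i)" using d'[of x] G_add[OF i _ G_uminus[OF i h(1)]]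
      by (intro image_eqI[of _ _ "x + - h"]) auto
  qed
  then show "vtx n i a = vtx n i b" by (simp add: vtx_def)
qed

abbreviation Xn :: "nat \<Rightarrow> ('v \<times> 'p padic_int set set, 'e \<times> 'p padic_int set) pre_digraph"
  where "Xn n \<equiv> layer X G \<alpha> n"

lemma coset_vtx: "(proj n ` G (w i)) #>\<^bsub>Gamma n\<^esub> proj n a = (\<lambda>h. proj n (h + a)) ` G (w i)"
  by (auto simp: r_coset_def Gamma_mult)

lemma verts_Xn: "verts (Xn n) = {vtx n i a | i a. i < g}"
proof (intro equalityI subsetI)
  fix x assume "x \<in> verts (Xn n)"
  then obtain u a where "x = (u, (proj n ` G u) #>\<^bsub>Gamma n\<^esub> proj n a)" "u \<in> verts X"
    by (auto simp: layer_def voltage_graph_def Gamma_carrier)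
  then have "x = vtx n (idx u) a" using coset_vtx[of n "idx u" a] w_idx[of u] by (simp add: vtx_def)
  then show "x \<in> {vtx n i a | i a. i < g}" using idx_less[OF \<open>u \<in> verts X\<close>] by blast
next
  fix x assume "x \<in> {vtx n i a | i a. i < g}"
  then obtain i a where x: "x = vtx n i a" "i < g" by blast
  then have "x = (w i, (proj n ` G (w i)) #>\<^bsub>Gamma n\<^esub> proj n a)" by (simp add: vtx_def coset_vtx)
  then show "x \<in> verts (Xn n)" using w_verts[OF x(2)] by (auto simp: layer_def voltage_graph_def Gamma_carrier)
qed

lemma arcs_Xn: "arcs (Xn n) = arcs X \<times> range (proj n)"
  by (simp add: layer_def voltage_graph_def Gamma_carrier)

lemma tail_Xn: "s \<in> arcs X \<Longrightarrow> tail (Xn n) (s, proj n a) = vtx n (idx (tail X s)) a"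
  using coset_vtx[of n "idx (tail X s)" a] w_idx[of "tail X s"] by (simp add: layer_def voltage_graph_def vtx_def)

lemma head_Xn: "s \<in> arcs X \<Longrightarrow> head (Xn n) (s, proj n a) = vtx n (idx (head X s)) (a + \<alpha> s)"
  using coset_vtx[of n "idx (head X s)" "a + \<alpha> s"] w_idx[of "head X s"]
  by (simp add: layer_def voltage_graph_def vtx_def Gamma_mult)

sublocale Xn: connected_serre_graph "Xn n" "voltage_bar (Gamma n) bar (\<lambda>s. proj n (\<alpha> s))" for n
proof -
  have 1: "serre_graph (Xn n) (voltage_bar (Gamma n) bar (\<lambda>s. proj n (\<alpha> s)))"
    unfolding layer_def
  proof (rule serre_graph_voltage_graph[OF comm_group_Gamma])
    show "serre_graph X bar" by unfold_locales
  qed (auto simp: Gamma_carrier Gamma_inv alpha_bar)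
  have fa: "finite (arcs (Xn n))" using finite_Gamma[of n, where 'p = 'p] by (simp add: arcs_Xn Gamma_carrier)
  have "verts (Xn n) \<subseteq> (\<lambda>(i, c). (w i, (proj n ` G (w i)) #>\<^bsub>Gamma n\<^esub> c)) ` ({..<g} \<times> carrier (Gamma n))"
  proof
    fix x assume "x \<in> verts (Xn n)"
    then obtain i a where i: "i < g" "x = vtx n i a" unfolding verts_Xn by blast
    have "x = (\<lambda>(i, c). (w i, (proj n ` G (w i)) #>\<^bsub>Gamma n\<^esub> c)) (i, proj n a)"
      unfolding i(2) vtx_def by (simp only: split_conv coset_vtx)
    moreover have "(i, proj n a) \<in> {..<g} \<times> carrier (Gamma n)" using i(1) by (simp add: Gamma_carrier)
    ultimately show "x \<in> (\<lambda>(i, c). (w i, (proj n ` G (w i)) #>\<^bsub>Gamma n\<^esub> c)) ` ({..<g} \<times> carrier (Gamma n))" by (rule image_eqI)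
  qed
  then have fv: "finite (verts (Xn n))" by (rule finite_subset) (use finite_Gamma[of n, where 'p = 'p] in auto)
  interpret S: serre_graph "Xn n" "voltage_bar (Gamma n) bar (\<lambda>s. proj n (\<alpha> s))" by (rule 1)
  show "connected_serre_graph (Xn n) (voltage_bar (Gamma n) bar (\<lambda>s. proj n (\<alpha> s)))"
    using fa fv connected_layer by unfold_locales
qed

section \<open>Divisors of a layer as polynomial multiples of one vertex in each fibre\<close>

definition U :: "nat \<Rightarrow> nat \<Rightarrow> int poly \<Rightarrow> ('v \<times> 'p padic_int set set \<Rightarrow>\<^sub>0 int)"
  where "U n i q = (\<Sum>j\<le>degree q. frag_cmul (coeff q j) (frag_of (vtx n i (of_nat j))))"

lemma U_eq: "degree q \<le> N \<Longrightarrow> U n i q = (\<Sum>j\<le>N. frag_cmul (coeff q j) (frag_of (vtx n i (of_nat j))))"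
  unfolding U_def by (rule sum.mono_neutral_left) (auto simp: coeff_eq_0)

lemma U_0 [simp]: "U n i 0 = 0" by (simp add: U_def)

lemma U_add: "U n i (q + r) = U n i q + U n i r"
proof -
  let ?N = "max (degree q) (degree r)"
  have "degree (q + r) \<le> ?N" by (rule degree_add_le_max)
  then show ?thesis by (simp add: U_eq[of _ ?N] frag_cmul_distrib sum.distrib)
qed

lemma U_monom: "U n i (monom c a) = frag_cmul c (frag_of (vtx n i (of_nat a)))"
proof -
  have "U n i (monom c a) = (\<Sum>j\<le>a. frag_cmul (coeff (monom c a) j) (frag_of (vtx n i (of_nat j))))"
    by (rule U_eq) (rule degree_monom_le)
  also have "\<dots> = (\<Sum>j\<le>a. if j = a then frag_cmul c (frag_of (vtx n i (of_nat j))) else 0)"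
    by (intro sum.cong) auto
  finally show ?thesis by simp
qed

lemma U_smult: "U n i (smult c q) = frag_cmul c (U n i q)"
proof (induction q rule: poly_monom_induct)
  case (2 q r) then show ?case by (simp add: smult_add_right U_add frag_cmul_distrib2)
qed (simp_all add: smult_monom U_monom)

lemma U_uminus: "U n i (- q) = - U n i q"
  using U_add[of n i q "- q"] by (simp add: eq_neg_iff_add_eq_0 add.commute)

lemma U_diff: "U n i (q - r) = U n i q - U n i r"
  using U_add[of n i q "- r"] by (simp add: U_uminus)

lemma U_sum: "U n i (\<Sum>j\<in>I. f j) = (\<Sum>j\<in>I. U n i (f j))"
  by (induction I rule: infinite_finite_induct) (simp_all add: U_add)

lemma U_translate:
  assumes i: "i < g"
  shows "pushforward (layer_translate n 1) (U n i q) = U n i (monom 1 1 * q)"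
proof (induction q rule: poly_monom_induct)
  case (3 c a)
  have "layer_translate n 1 (vtx n i b) = vtx n i (b + 1)" for b
    by (auto simp: layer_translate_def vtx_def r_coset_def Gamma_mult add.assoc)
  then show ?case by (simp add: U_monom pushforward_simps mult_monom add.commute)
qed (simp_all add: pushforward_simps U_add distrib_left)

lemma U_reduce: "pushforward (layer_reduce n) (U (Suc n) i q) = U n i q"
proof (induction q rule: poly_monom_induct)
  case (3 c a)
  have "layer_reduce n (vtx (Suc n) i b) = vtx n i b" for b
    by (auto simp: layer_reduce_def vtx_def image_image Gamma_reduce_proj)
  then show ?case by (simp add: U_monom pushforward_simps)
qed (simp_all add: pushforward_simps U_add)

lemma U_periodic:
  assumes i: "i < g"
  shows "U n i (monom 1 (CARD('p) ^ m i n) * q) = U n i q"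
proof (induction q rule: poly_monom_induct)
  case (3 c a)
  have "vtx n i (of_nat (CARD('p) ^ m i n + a)) = vtx n i (of_nat a)"
    unfolding vtx_eq_iff[OF i] by simp
  then show ?case by (simp only: U_monom mult_monom mult_1)
qed (simp_all add: U_add distrib_left)

lemma U_omega:
  assumes i: "i < g" and q: "omega (CARD('p) ^ m i n) dvd q"
  shows "U n i q = 0"
proof -
  obtain r where "q = omega (CARD('p) ^ m i n) * r" using q by (elim dvdE)
  then have "q = monom 1 (CARD('p) ^ m i n) * r - r" by (simp add: omega_def algebra_simps)
  then show ?thesis using U_periodic[OF i, of n r] by (simp add: U_diff)
qed

lemma poly_reduce_omega:
  assumes "P > 0"
  shows "\<exists>c. omega P dvd q - (\<Sum>b<P. monom (c b) b)"
proof (induction q rule: poly_monom_induct)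
  case 1
  show ?case by (intro exI[of _ "\<lambda>_. 0"]) simp
next
  case (2 q r)
  then obtain c d where "omega P dvd q - (\<Sum>b<P. monom (c b) b)" "omega P dvd r - (\<Sum>b<P. monom (d b) b)" by blast
  then have "omega P dvd (q - (\<Sum>b<P. monom (c b) b)) + (r - (\<Sum>b<P. monom (d b) b))" by (rule dvd_add)
  then show ?case by (intro exI[of _ "\<lambda>b. c b + d b"]) (simp add: add_monom[symmetric] sum.distrib algebra_simps)
next
  case (3 c a)
  have "(\<Sum>b<P. monom (if b = a mod P then c else 0) b) = (\<Sum>b<P. if b = a mod P then monom c b else 0)"
    by (intro sum.cong) auto
  also have "\<dots> = monom c (a mod P)" using assms by simp
  finally have e: "(\<Sum>b<P. monom (if b = a mod P then c else 0) b) = monom c (a mod P)" .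
  have "omega P dvd monom 1 a - monom 1 (a mod P)" by (rule omega_dvd_monom_diff) simp
  then have "omega P dvd smult c (monom 1 a - monom 1 (a mod P))" by (rule dvd_smult)
  then show ?case unfolding e[symmetric] by (intro exI[of _ "\<lambda>b. if b = a mod P then c else 0"]) (simp add: e smult_diff_right smult_monom)
qed

text \<open>Reduction modulo \<omega> brings the degree below p^(m i n), and then the coefficients
  are the multiplicities at distinct vertices of the fibre. For \<open>d = 0\<close> this computes
  the kernel of \<open>U n i\<close>.\<close>

lemma U_dvd:
  assumes i: "i < g" and d: "\<And>x. d dvd Poly_Mapping.lookup (U n i q) x"
  shows "\<exists>z r. q = omega (CARD('p) ^ m i n) * z + smult d r"
proof -
  let ?P = "CARD('p) ^ m i n"
  have "?P > 0" using card_gt_1[where 'p = 'p] by simp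
  then obtain c where c: "omega ?P dvd q - (\<Sum>b<?P. monom (c b) b)" using poly_reduce_omega by blast
  have "U n i q = U n i (\<Sum>b<?P. monom (c b) b)" using U_omega[OF i c] by (simp add: U_diff)
  also have "\<dots> = (\<Sum>b<?P. frag_cmul (c b) (frag_of (vtx n i (of_nat b))))" by (simp add: U_sum U_monom)
  finally have Uq: "U n i q = \<dots>" .
  have inj: "b = b'" if "b < ?P" "b' < ?P" "vtx n i (of_nat b) = vtx n i (of_nat b')" for b b'
  proof -
    have "padic_p ^ m i n dvd (of_int (int b - int b') :: 'p padic_int)" using that(3) unfolding vtx_eq_iff[OF i] by simp
    then have "int ?P dvd int b - int b'" unfolding padic_p_power_dvd_of_int by simp
    then have "int b mod int ?P = int b' mod int ?P" by (simp add: mod_eq_dvd_iff)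
    then show ?thesis using that(1,2) by (simp flip: zmod_int)
  qed
  have "d dvd c b" if b: "b < ?P" for b
  proof -
    have "Poly_Mapping.lookup (U n i q) (vtx n i (of_nat b)) = (\<Sum>b'<?P. if b' = b then c b' else 0)"
      unfolding Uq lookup_sum using inj b by (intro sum.cong) auto
    then show ?thesis using d[of "vtx n i (of_nat b)"] b by simp
  qed
  then have "\<forall>b. \<exists>e. b < ?P \<longrightarrow> c b = d * e" by (auto elim!: dvdE)
  then obtain e where e: "\<And>b. b < ?P \<Longrightarrow> c b = d * e b" by metis
  obtain z where z: "q - (\<Sum>b<?P. monom (c b) b) = omega ?P * z" using c by (elim dvdE)
  have "(\<Sum>b<?P. monom (c b) b) = smult d (\<Sum>b<?P. monom (e b) b)"
    unfolding smult_sum2 by (intro sum.cong) (simp_all add: e smult_monom)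
  then have "q = omega ?P * z + smult d (\<Sum>b<?P. monom (e b) b)" using z by (simp add: algebra_simps)
  then show ?thesis by blast
qed

lemma lookup_U_other: "i < g \<Longrightarrow> j < g \<Longrightarrow> i \<noteq> j \<Longrightarrow> Poly_Mapping.lookup (U n i q) (vtx n j b) = 0"
proof -
  assume ij: "i < g" "j < g" "i \<noteq> j"
  have "vtx n j b \<noteq> vtx n i a" for a using w_inj[OF ij(1,2)] ij(3) by (auto simp: vtx_def)
  then show ?thesis by (simp add: U_def lookup_sum)
qed

lemma lookup_U_outside: "x \<notin> range (vtx n i) \<Longrightarrow> Poly_Mapping.lookup (U n i q) x = 0"
  unfolding U_def lookup_sum by (intro sum.neutral) auto

definition kappa :: "nat \<Rightarrow> (nat \<Rightarrow> int poly) \<Rightarrow> ('v \<times> 'p padic_int set set \<Rightarrow>\<^sub>0 int)"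
  where "kappa n q = (\<Sum>i<g. U n i (q i))"

lemma kappa_add: "kappa n (q + r) = kappa n q + kappa n r"
  by (simp add: kappa_def U_add sum.distrib)

lemma kappa_diff: "kappa n (q - r) = kappa n q - kappa n r"
  by (simp add: kappa_def U_diff sum_subtractf)

lemma kappa_cong: "(\<And>i. i < g \<Longrightarrow> q i = r i) \<Longrightarrow> kappa n q = kappa n r"
  by (simp add: kappa_def)

lemma kappa_cmul: "kappa n (\<lambda>i. smult c (q i)) = frag_cmul c (kappa n q)"
  by (simp add: kappa_def U_smult frag_cmul_sum)

lemma kappa_translate: "pushforward (layer_translate n 1) (kappa n q) = kappa n (\<lambda>i. monom 1 1 * q i)"
  by (simp add: kappa_def pushforward_sum U_translate)

lemma kappa_reduce: "pushforward (layer_reduce n) (kappa (Suc n) q) = kappa n q"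
  by (simp add: kappa_def pushforward_sum U_reduce)

lemma lookup_kappa: "i < g \<Longrightarrow> Poly_Mapping.lookup (kappa n q) (vtx n i b) = Poly_Mapping.lookup (U n i (q i)) (vtx n i b)"
proof -
  assume i: "i < g"
  have "Poly_Mapping.lookup (kappa n q) (vtx n i b) = (\<Sum>j<g. if j = i then Poly_Mapping.lookup (U n i (q i)) (vtx n i b) else 0)"
    unfolding kappa_def lookup_sum using i by (intro sum.cong) (auto simp: lookup_U_other)
  then show ?thesis using i by simp
qed

lemma kappa_dvd:
  assumes d: "\<And>x. d dvd Poly_Mapping.lookup (kappa n q) x" and i: "i < g"
  shows "\<exists>z r. q i = omega (CARD('p) ^ m i n) * z + smult d r"
proof (rule U_dvd[OF i])
  fix x show "d dvd Poly_Mapping.lookup (U n i (q i)) x"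
  proof (cases "x \<in> range (vtx n i)")
    case True
    then obtain b where "x = vtx n i b" by blast
    then show ?thesis using d[of x] lookup_kappa[OF i] by simp
  qed (simp add: lookup_U_outside)
qed

lemma kappa_eq_0_iff: "kappa n q = 0 \<longleftrightarrow> (\<forall>i<g. omega (CARD('p) ^ m i n) dvd q i)"
proof
  assume "kappa n q = 0"
  then have "\<exists>z r. q i = omega (CARD('p) ^ m i n) * z + smult 0 r" if "i < g" for i
    using kappa_dvd[of 0 n q i] that by simp
  then show "\<forall>i<g. omega (CARD('p) ^ m i n) dvd q i" by (metis smult_0_left add_0_right dvd_triv_left)
qed (simp add: kappa_def U_omega)

lemma kappa_eq_iff: "kappa n q = kappa n r \<longleftrightarrow> (\<forall>i<g. omega (CARD('p) ^ m i n) dvd q i - r i)"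
  using kappa_eq_0_iff[of n "q - r"] by (simp add: kappa_diff)

lemma keys_kappa: "Poly_Mapping.keys (kappa n q) \<subseteq> verts (Xn n)"
proof -
  have "kappa n q \<in> carrier (free_Abelian_group (verts (Xn n)))"
    unfolding kappa_def
  proof (intro sum_closed_free_Abelian_group)
    fix i assume "i \<in> {..<g}"
    then have v: "vtx n i a \<in> verts (Xn n)" for a by (auto simp: verts_Xn)
    show "U n i (q i) \<in> carrier (free_Abelian_group (verts (Xn n)))"
      unfolding U_def
    proof (intro sum_closed_free_Abelian_group)
      fix j show "frag_cmul (coeff (q i) j) (frag_of (vtx n i (of_nat j))) \<in> carrier (free_Abelian_group (verts (Xn n)))"
        using keys_cmul[of "coeff (q i) j" "frag_of (vtx n i (of_nat j))"] v[of "of_nat j"] by auto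
    qed
  qed
  then show ?thesis by simp
qed

lemma vtx_residue: "i < g \<Longrightarrow> vtx n i (a + of_nat (nat (residue x n))) = vtx n i (a + x)"
proof -
  assume i: "i < g"
  have "padic_p ^ n dvd (a + of_nat (nat (residue x n))) - (a + x)"
    using proj_cong_residue[of n a x] unfolding proj_eq_iff .
  then show ?thesis unfolding vtx_eq_iff[OF i] by (rule dvd_trans[OF le_imp_power_dvd[OF m_le]])
qed

lemma frag_of_vtx: "i < g \<Longrightarrow> frag_of (vtx n i a) = U n i (monom 1 (nat (residue a n)))"
  using vtx_residue[of i n 0 a] by (simp add: U_monom)

lemma kappa_single: "i < g \<Longrightarrow> kappa n (\<lambda>j. if j = i then q else 0) = U n i q"
proof -
  assume i: "i < g"
  have "kappa n (\<lambda>j. if j = i then q else 0) = (\<Sum>j<g. if j = i then U n i q else 0)"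
    unfolding kappa_def by (intro sum.cong) auto
  then show ?thesis using i by simp
qed

lemma kappa_surj:
  assumes "Poly_Mapping.keys D \<subseteq> verts (Xn n)"
  shows "\<exists>q. D = kappa n q"
  using assms
proof (induction D rule: frag_induction[of _ "verts (Xn n)"])
  case zero
  show ?case by (intro exI[of _ "\<lambda>_. 0"]) (simp add: kappa_def)
next
  case (one x)
  then obtain i a where i: "i < g" "x = vtx n i a" by (auto simp: verts_Xn)
  then show ?case using frag_of_vtx[OF i(1), of n a] kappa_single[OF i(1)] by metis
next
  case (diff a b)
  then show ?case using kappa_diff by metis
qed

lemma divisor_degree_kappa: "divisor_degree (kappa n q) = (\<Sum>i<g. poly (q i) 1)"
proof -
  have "divisor_degree (U n i q) = poly q 1" for i q
    by (simp add: U_def divisor_degree_sum divisor_degree_cmul poly_altdef)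
  then show ?thesis by (simp add: kappa_def divisor_degree_sum)
qed

section \<open>The Laplacian of a layer in polynomial coordinates\<close>

definition nu :: "nat \<Rightarrow> nat \<Rightarrow> int poly"
  where "nu j n = (\<Sum>l<CARD('p) ^ (n - m j n). monom 1 (CARD('p) ^ m j n * l))"

text \<open>Entry (i, j) of the full voltage Laplacian with voltages reduced modulo p^n to natural
  exponents. The source \<open>j\<close> comes before the target \<open>i\<close> in the
  arguments.\<close>

definition ell :: "nat \<Rightarrow> nat \<Rightarrow> nat \<Rightarrow> int poly"
  where "ell n j i = (if i = j then of_nat (out_degree X (w j)) else 0)
    - (\<Sum>s | s \<in> arcs X \<and> tail X s = w j \<and> head X s = w i. monom 1 (nat (residue (\<alpha> s) n)))"

text \<open>\<open>nu j n\<close> is a norm element. It records that, over a ramified vertex, p^(n -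
  m) of the arcs above one arc of X leave from the same vertex of the layer.\<close>

lemma nu_omega: "omega (CARD('p) ^ m j n) * nu j n = omega (CARD('p) ^ n)"
  unfolding nu_def omega_mult_eq[symmetric] using m_le[of j n] by (simp flip: power_add)

text \<open>An arc with second coordinate b starts at the coset of \<open>a\<close> when b and
  \<open>a\<close> agree modulo p^m, with \<open>m = m j n\<close>; b then runs through p^(n - m)
  classes modulo p^n.\<close>

lemma out_arcs_Xn:
  assumes j: "j < g"
  shows "bij_betw (\<lambda>(s, l). (s, proj n (a + of_nat (CARD('p) ^ m j n * l))))
    (out_arcs X (w j) \<times> {..<CARD('p) ^ (n - m j n)}) (out_arcs (Xn n) (vtx n j a))"
proof (rule bij_betw_imageI)
  let ?P = "CARD('p) ^ m j n" and ?L = "CARD('p) ^ (n - m j n)"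
  have PL: "?P * ?L = CARD('p) ^ n" using m_le[of j n] by (simp flip: power_add)
  have P0: "?P > 0" using card_gt_1[where 'p = 'p] by simp
  have tailj: "s \<in> arcs X \<and> tail (Xn n) (s, proj n b) = vtx n j a \<longleftrightarrow> s \<in> out_arcs X (w j) \<and> padic_p ^ m j n dvd b - a" for s b
  proof (cases "s \<in> arcs X \<and> tail X s = w j")
    case True
    then show ?thesis using tail_Xn[of s n b] idx_w[OF j] vtx_eq_iff[OF j, of n b a] by (auto simp: out_arcs_def)
  next
    case False
    then show ?thesis using tail_Xn[of s n b] w_idx[of "tail X s"] by (auto simp: out_arcs_def vtx_def)
  qed
  show "inj_on (\<lambda>(s, l). (s, proj n (a + of_nat (?P * l)))) (out_arcs X (w j) \<times> {..<?L})"
  proof (rule inj_onI, clarsimp)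
    fix l l' assume l: "l < ?L" "l' < ?L" and e: "proj n (a + padic_p ^ m j n * of_nat l) = proj n (a + padic_p ^ m j n * of_nat l')"
    have "padic_p ^ n dvd (of_int (int (?P * l) - int (?P * l')) :: 'p padic_int)" using e unfolding proj_eq_iff by simp
    then have "int (CARD('p) ^ n) dvd int (?P * l) - int (?P * l')" unfolding padic_p_power_dvd_of_int by simp
    then have "int (?P * l) mod int (CARD('p) ^ n) = int (?P * l') mod int (CARD('p) ^ n)" by (simp only: mod_eq_dvd_iff)
    then have "(?P * l) mod (CARD('p) ^ n) = (?P * l') mod (CARD('p) ^ n)" by (simp only: zmod_int[symmetric] of_nat_eq_iff)
    moreover have "?P * l < CARD('p) ^ n" "?P * l' < CARD('p) ^ n" using l P0 unfolding PL[symmetric] by simp_all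
    ultimately show "l = l'" using P0 by simp
  qed
  show "(\<lambda>(s, l). (s, proj n (a + of_nat (?P * l)))) ` (out_arcs X (w j) \<times> {..<?L}) = out_arcs (Xn n) (vtx n j a)"
  proof (intro equalityI subsetI)
    fix e assume "e \<in> (\<lambda>(s, l). (s, proj n (a + of_nat (?P * l)))) ` (out_arcs X (w j) \<times> {..<?L})"
    then obtain s l where e: "e = (s, proj n (a + of_nat (?P * l)))" "s \<in> out_arcs X (w j)" by auto
    then show "e \<in> out_arcs (Xn n) (vtx n j a)"
      using tailj[of s "a + of_nat (?P * l)"] by (auto simp: out_arcs_def[of "Xn n"] arcs_Xn)
  next
    fix e assume "e \<in> out_arcs (Xn n) (vtx n j a)"
    then obtain s b where e: "e = (s, proj n b)" "s \<in> arcs X" "tail (Xn n) (s, proj n b) = vtx n j a"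
      by (auto simp: out_arcs_def arcs_Xn)
    then have s: "s \<in> out_arcs X (w j)" "padic_p ^ m j n dvd b - a" using tailj[of s b] by auto
    then obtain c where c: "b - a = padic_p ^ m j n * c" by (elim dvdE)
    let ?l = "nat (residue c (n - m j n))"
    have l: "?l < ?L" using residue_less[of c "n - m j n"] residue_nonneg[of c "n - m j n"] by (simp add: nat_less_iff)
    have "padic_p ^ (n - m j n) dvd c - of_nat ?l"
      using padic_approx[of "n - m j n" c] residue_nonneg[of c "n - m j n"] by (simp add: of_nat_nat)
    then have "padic_p ^ m j n * padic_p ^ (n - m j n) dvd padic_p ^ m j n * (c - of_nat ?l)" by (rule mult_dvd_mono[OF dvd_refl])
    then have "padic_p ^ n dvd padic_p ^ m j n * (c - of_nat ?l)" using m_le[of j n] by (simp flip: power_add)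
    moreover have "b - (a + of_nat (?P * ?l)) = padic_p ^ m j n * (c - of_nat ?l)"
      using c by (simp add: algebra_simps)
    ultimately have "proj n b = proj n (a + of_nat (?P * ?l))" unfolding proj_eq_iff by simp
    then show "e \<in> (\<lambda>(s, l). (s, proj n (a + of_nat (?P * l)))) ` (out_arcs X (w j) \<times> {..<?L})"
      using e(1) s(1) l by (intro image_eqI[of _ _ "(s, ?l)"]) auto
  qed
qed

text \<open>Summing heads over the arcs above one arc of X multiplies by \<open>nu j n\<close>. The
  valency fits the same factor, because on the fibre of \<open>w j\<close> each of the p^(n - m)
  terms of \<open>nu j n\<close> acts as the identity.\<close>

lemma laplacian_vtx:
  assumes j: "j < g"
  shows "laplacian (Xn n) (frag_of (vtx n j (of_nat a))) = kappa n (\<lambda>i. nu j n * monom 1 a * ell n j i)"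
proof -
  let ?P = "CARD('p) ^ m j n" and ?L = "CARD('p) ^ (n - m j n)"
  let ?S = "out_arcs X (w j)"
  have S: "s \<in> arcs X" "tail X s = w j" if "s \<in> ?S" for s using that by (auto simp: out_arcs_def)
  have hd: "idx (head X s) < g" if "s \<in> ?S" for s using S[OF that] idx_less by simp
  have val: "out_degree (Xn n) (vtx n j (of_nat a)) = card ?S * ?L"
    using bij_betw_same_card[OF out_arcs_Xn[OF j, of n "of_nat a"]] by (simp add: out_degree_def card_cartesian_product)
  have "(\<Sum>e\<in>out_arcs (Xn n) (vtx n j (of_nat a)). frag_of (head (Xn n) e))
      = (\<Sum>x\<in>?S \<times> {..<?L}. frag_of (head (Xn n) ((\<lambda>(s, l). (s, proj n (of_nat a + of_nat (?P * l)))) x)))"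
    by (rule sum.reindex_bij_betw[OF out_arcs_Xn[OF j], symmetric])
  also have "\<dots> = (\<Sum>(s, l)\<in>?S \<times> {..<?L}. frag_of (head (Xn n) (s, proj n (of_nat a + of_nat (?P * l)))))"
    by (intro sum.cong refl) (simp only: split_beta)
  also have "\<dots> = (\<Sum>s\<in>?S. \<Sum>l<?L. frag_of (head (Xn n) (s, proj n (of_nat a + of_nat (?P * l)))))"
    by (rule sum.cartesian_product[symmetric])
  also have "\<dots> = (\<Sum>s\<in>?S. \<Sum>l<?L. U n (idx (head X s)) (monom 1 (?P * l) * monom 1 a * monom 1 (nat (residue (\<alpha> s) n))))"
  proof (intro sum.cong refl)
    fix s l assume s: "s \<in> ?S"
    have "head (Xn n) (s, proj n (of_nat a + of_nat (?P * l))) = vtx n (idx (head X s)) (of_nat (?P * l + a) + \<alpha> s)"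
      using head_Xn[OF S(1)[OF s], of n "of_nat a + of_nat (?P * l)"] by (simp add: add_ac)
    also have "\<dots> = vtx n (idx (head X s)) (of_nat (?P * l + a + nat (residue (\<alpha> s) n)))"
      using vtx_residue[OF hd[OF s], of n "of_nat (?P * l + a)" "\<alpha> s"] by simp
    finally show "frag_of (head (Xn n) (s, proj n (of_nat a + of_nat (?P * l)))) = U n (idx (head X s)) (monom 1 (?P * l) * monom 1 a * monom 1 (nat (residue (\<alpha> s) n)))"
      by (simp only: mult_monom mult_1 U_monom frag_cmul_one)
  qed
  also have "\<dots> = (\<Sum>s\<in>?S. U n (idx (head X s)) (nu j n * monom 1 a * monom 1 (nat (residue (\<alpha> s) n))))"
    by (simp add: nu_def sum_distrib_right U_sum)
  also have "\<dots> = (\<Sum>s\<in>?S. \<Sum>i<g. if i = idx (head X s) then U n i (nu j n * monom 1 a * monom 1 (nat (residue (\<alpha> s) n))) else 0)"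
    by (intro sum.cong) (simp_all add: hd)
  also have "\<dots> = (\<Sum>i<g. \<Sum>s\<in>?S. if i = idx (head X s) then U n i (nu j n * monom 1 a * monom 1 (nat (residue (\<alpha> s) n))) else 0)"
    by (rule sum.swap)
  also have "\<dots> = (\<Sum>i<g. U n i (nu j n * monom 1 a * (\<Sum>s | s \<in> arcs X \<and> tail X s = w j \<and> head X s = w i. monom 1 (nat (residue (\<alpha> s) n)))))"
  proof (intro sum.cong refl)
    fix i assume i: "i \<in> {..<g}"
    have "{s \<in> ?S. i = idx (head X s)} = {s. s \<in> arcs X \<and> tail X s = w j \<and> head X s = w i}"
      using i w_idx idx_w by (auto simp: out_arcs_def)
    then show "(\<Sum>s\<in>?S. if i = idx (head X s) then U n i (nu j n * monom 1 a * monom 1 (nat (residue (\<alpha> s) n))) else 0)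
        = U n i (nu j n * monom 1 a * (\<Sum>s | s \<in> arcs X \<and> tail X s = w j \<and> head X s = w i. monom 1 (nat (residue (\<alpha> s) n))))"
      by (simp add: sum.inter_filter[symmetric] finite_out_arcs sum_distrib_left U_sum)
  qed
  finally have heads: "(\<Sum>e\<in>out_arcs (Xn n) (vtx n j (of_nat a)). frag_of (head (Xn n) e)) = \<dots>" .
  have "frag_cmul (int (card ?S * ?L)) (frag_of (vtx n j (of_nat a))) = U n j (nu j n * monom 1 a * of_nat (card ?S))"
  proof -
    have "U n j (monom 1 (?P * l) * monom 1 a) = frag_of (vtx n j (of_nat a))" for l
    proof -
      have "vtx n j (of_nat (?P * l + a)) = vtx n j (of_nat a)" unfolding vtx_eq_iff[OF j] by simp
      then show ?thesis by (simp only: mult_monom mult_1 U_monom frag_cmul_one)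
    qed
    then have "U n j (nu j n * monom 1 a) = (\<Sum>l<?L. frag_of (vtx n j (of_nat a)))"
      by (simp only: nu_def sum_distrib_right U_sum)
    also have "\<dots> = frag_cmul (int ?L) (frag_of (vtx n j (of_nat a)))"
      by (intro poly_mapping_eqI) (simp add: lookup_sum)
    finally have "U n j (smult (int (card ?S)) (nu j n * monom 1 a)) = frag_cmul (int (card ?S)) (frag_cmul (int ?L) (frag_of (vtx n j (of_nat a))))"
      by (simp only: U_smult)
    moreover have "smult (int (card ?S)) (nu j n * monom 1 a) = nu j n * monom 1 a * of_nat (card ?S)"
      by (simp add: of_nat_poly mult.commute)
    ultimately show ?thesis by (simp only: frag_cmul_cmul of_nat_mult)
  qed
  also have "\<dots> = (\<Sum>i<g. U n i (nu j n * monom 1 a * (if i = j then of_nat (out_degree X (w j)) else 0)))"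
  proof -
    have "(\<Sum>i<g. U n i (nu j n * monom 1 a * (if i = j then of_nat (out_degree X (w j)) else 0)))
       = (\<Sum>i<g. if i = j then U n j (nu j n * monom 1 a * of_nat (card ?S)) else 0)"
      by (intro sum.cong) (auto simp: out_degree_def)
    then show ?thesis using j by simp
  qed
  finally show ?thesis
    unfolding laplacian_def frag_extend_of val heads kappa_def ell_def right_diff_distrib U_diff sum_subtractf by (simp only:)
qed

lemma laplacian_kappa: "laplacian (Xn n) (kappa n y) = kappa n (\<lambda>i. \<Sum>j<g. nu j n * y j * ell n j i)"
proof -
  have U: "laplacian (Xn n) (U n j q) = kappa n (\<lambda>i. nu j n * q * ell n j i)" if j: "j < g" for j q
  proof (induction q rule: poly_monom_induct)
    case 1
    show ?case by (simp add: kappa_def laplacian_def)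
  next
    case (2 q r)
    have "(\<lambda>i. nu j n * (q + r) * ell n j i) = (\<lambda>i. nu j n * q * ell n j i) + (\<lambda>i. nu j n * r * ell n j i)"
      by (simp add: fun_eq_iff algebra_simps)
    then show ?case using 2 by (simp only: kappa_add U_add laplacian_def frag_extend_add)
  next
    case (3 c a)
    have "(\<lambda>i. nu j n * monom c a * ell n j i) = (\<lambda>i. smult c (nu j n * monom 1 a * ell n j i))"
    proof
      fix i have "monom c a = smult c (monom 1 a)" by (simp add: smult_monom)
      then show "nu j n * monom c a * ell n j i = smult c (nu j n * monom 1 a * ell n j i)" by simp
    qed
    then show ?case using laplacian_vtx[OF j, of n a]
      by (simp only: kappa_cmul U_monom) (simp only: laplacian_def frag_extend_cmul)
  qed
  have "laplacian (Xn n) (kappa n y) = (\<Sum>j<g. laplacian (Xn n) (U n j (y j)))"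
  proof -
    have "laplacian (Xn n) (\<Sum>j\<in>I. f j) = (\<Sum>j\<in>I. laplacian (Xn n) (f j))" for I :: "nat set" and f
      by (induction I rule: infinite_finite_induct) (simp_all add: laplacian_def frag_extend_add)
    then show ?thesis unfolding kappa_def .
  qed
  also have "\<dots> = (\<Sum>j<g. kappa n (\<lambda>i. nu j n * y j * ell n j i))" by (intro sum.cong) (simp_all add: U)
  also have "\<dots> = (\<Sum>i<g. \<Sum>j<g. U n i (nu j n * y j * ell n j i))" unfolding kappa_def by (rule sum.swap)
  also have "\<dots> = kappa n (\<lambda>i. \<Sum>j<g. nu j n * y j * ell n j i)" by (simp only: kappa_def U_sum)
  finally show ?thesis .
qed

end

section \<open>Picard groups of the layers\<close>

context connected_serre_graph
begin

abbreviation K0 :: "('v \<Rightarrow>\<^sub>0 int) set"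
  where "K0 \<equiv> {D. Poly_Mapping.keys D \<subseteq> verts G \<and> divisor_degree D = 0}"

lemma Div0_simps: "carrier (Div0 G) = K0" "x \<otimes>\<^bsub>Div0 G\<^esub> y = x + y" "\<one>\<^bsub>Div0 G\<^esub> = 0"
  by (auto simp: Div0_def)

lemma K0_add: "D \<in> K0 \<Longrightarrow> E \<in> K0 \<Longrightarrow> D + E \<in> K0"
  using keys_add[of D E] by (auto simp: divisor_degree_add)

lemma K0_uminus: "D \<in> K0 \<Longrightarrow> - D \<in> K0"
  by (auto simp: divisor_degree_uminus)

lemma K0_0: "0 \<in> K0" by simp

lemma comm_group_Div0: "comm_group (Div0 G)"
proof (rule comm_groupI)
  fix x assume x: "x \<in> carrier (Div0 G)"
  show "\<exists>y\<in>carrier (Div0 G). y \<otimes>\<^bsub>Div0 G\<^esub> x = \<one>\<^bsub>Div0 G\<^esub>"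
    using x K0_uminus[of x] by (intro bexI[of _ "- x"]) (simp_all only: Div0_simps, simp)
  show "\<one>\<^bsub>Div0 G\<^esub> \<otimes>\<^bsub>Div0 G\<^esub> x = x" by (simp add: Div0_simps)
  fix y assume y: "y \<in> carrier (Div0 G)"
  show "x \<otimes>\<^bsub>Div0 G\<^esub> y \<in> carrier (Div0 G)" using x y K0_add by (simp only: Div0_simps)
  show "x \<otimes>\<^bsub>Div0 G\<^esub> y = y \<otimes>\<^bsub>Div0 G\<^esub> x" by (simp only: Div0_simps add.commute)
  fix z
  show "x \<otimes>\<^bsub>Div0 G\<^esub> y \<otimes>\<^bsub>Div0 G\<^esub> z = x \<otimes>\<^bsub>Div0 G\<^esub> (y \<otimes>\<^bsub>Div0 G\<^esub> z)" by (simp only: Div0_simps add.assoc)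
qed (simp only: Div0_simps K0_0)

lemma inv_Div0: "D \<in> K0 \<Longrightarrow> inv\<^bsub>Div0 G\<^esub> D = - D"
proof -
  assume D: "D \<in> K0"
  interpret comm_group "Div0 G" by (rule comm_group_Div0)
  show ?thesis using D K0_uminus[OF D] by (intro inv_equality) (simp_all only: Div0_simps, simp)
qed

abbreviation Pr :: "('v \<Rightarrow>\<^sub>0 int) set" where "Pr \<equiv> principal_divisors G"

lemma Pr_iff: "D \<in> Pr \<longleftrightarrow> (\<exists>E. Poly_Mapping.keys E \<subseteq> verts G \<and> D = laplacian G E)"
  by (auto simp: principal_divisors_def) blast

lemma Pr_0: "0 \<in> Pr" unfolding Pr_iff by (intro exI[of _ 0]) (simp add: laplacian_def)

lemma Pr_diff: "D \<in> Pr \<Longrightarrow> E \<in> Pr \<Longrightarrow> D - E \<in> Pr"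
proof -
  assume "D \<in> Pr" "E \<in> Pr"
  then obtain D' E' where *: "Poly_Mapping.keys D' \<subseteq> verts G" "Poly_Mapping.keys E' \<subseteq> verts G" "D = laplacian G D'" "E = laplacian G E'"
    unfolding Pr_iff by blast
  then have "D - E = laplacian G (D' - E')" by (simp add: laplacian_def frag_extend_diff)
  moreover have "Poly_Mapping.keys (D' - E') \<subseteq> verts G" using * keys_diff[of D' E'] by blast
  ultimately show ?thesis unfolding Pr_iff by blast
qed

lemma Pr_uminus: "D \<in> Pr \<Longrightarrow> - D \<in> Pr" using Pr_diff[OF Pr_0, of D] by simp

lemma Pr_add: "D \<in> Pr \<Longrightarrow> E \<in> Pr \<Longrightarrow> D + E \<in> Pr" using Pr_diff[OF _ Pr_uminus, of D E] by simp

lemma Pr_subset: "Pr \<subseteq> K0"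
proof
  fix D assume "D \<in> Pr"
  then obtain E where E: "Poly_Mapping.keys E \<subseteq> verts G" "D = laplacian G E" unfolding Pr_iff by blast
  show "D \<in> K0" unfolding E(2) using keys_laplacian[OF E(1)] divisor_degree_laplacian[OF E(1)] by simp
qed

lemma subgroup_Pr: "subgroup Pr (Div0 G)"
proof (rule subgroup.intro)
  show "Pr \<subseteq> carrier (Div0 G)" using Pr_subset by (simp only: Div0_simps)
  show "inv\<^bsub>Div0 G\<^esub> x \<in> Pr" if "x \<in> Pr" for x
    using inv_Div0[OF subsetD[OF Pr_subset that]] Pr_uminus[OF that] by (simp only:)
qed (simp_all only: Div0_simps Pr_0 Pr_add)

definition cls :: "('v \<Rightarrow>\<^sub>0 int) \<Rightarrow> ('v \<Rightarrow>\<^sub>0 int) set"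
  where "cls D = Pr #>\<^bsub>Div0 G\<^esub> D"

lemma mem_cls_iff: "E \<in> cls D \<longleftrightarrow> E - D \<in> Pr"
proof -
  have "E \<in> cls D \<longleftrightarrow> (\<exists>h\<in>Pr. E = h + D)" by (simp add: cls_def r_coset_def Div0_simps)
  also have "\<dots> \<longleftrightarrow> E - D \<in> Pr" by (metis add_diff_cancel diff_add_cancel)
  finally show ?thesis .
qed

lemma cls_eq_iff: "cls D = cls E \<longleftrightarrow> D - E \<in> Pr"
proof
  assume "cls D = cls E"
  moreover have "D \<in> cls D" by (simp add: mem_cls_iff Pr_0)
  ultimately show "D - E \<in> Pr" by (simp add: mem_cls_iff)
next
  assume d: "D - E \<in> Pr"
  have "F - D \<in> Pr \<longleftrightarrow> F - E \<in> Pr" for F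
    using Pr_add[OF _ d, of "F - D"] Pr_diff[OF _ d, of "F - E"] by auto
  then show "cls D = cls E" using mem_cls_iff by blast
qed

lemma comm_group_Pic0: "comm_group (Pic0 G)"
  unfolding Pic0_def by (rule comm_group.abelian_FactGroup[OF comm_group_Div0 subgroup_Pr])

lemma Pic0_carrier: "carrier (Pic0 G) = cls ` K0"
  by (auto simp: Pic0_def FactGroup_def RCOSETS_def cls_def Div0_simps)

lemma Pic0_mult: "D \<in> K0 \<Longrightarrow> E \<in> K0 \<Longrightarrow> cls D \<otimes>\<^bsub>Pic0 G\<^esub> cls E = cls (D + E)"
proof -
  assume DE: "D \<in> K0" "E \<in> K0"
  have "normal Pr (Div0 G)" using comm_group.subgroup_imp_normal[OF comm_group_Div0 subgroup_Pr] .
  from normal.rcos_sum[OF this, of D E] DE show ?thesis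
    unfolding Pic0_def FactGroup_def cls_def by (simp only: Div0_simps monoid.simps)
qed

lemma Pic0_one: "\<one>\<^bsub>Pic0 G\<^esub> = cls 0"
proof -
  have "cls 0 = Pr" using mem_cls_iff[of _ 0] by auto
  then show ?thesis by (simp add: Pic0_def FactGroup_def)
qed

lemma cls_eq_one_iff: "cls D = \<one>\<^bsub>Pic0 G\<^esub> \<longleftrightarrow> D \<in> Pr"
  by (simp add: Pic0_one cls_eq_iff)

end

text \<open>\<open>Pic0_map\<close> extracts the only element of an image, and the image of a class
  is a singleton when principal divisors are pushed to principal divisors.\<close>

lemma Pic0_map_cls:
  assumes "connected_serre_graph Y bar" "connected_serre_graph Z bar'"
    and push: "\<And>D. D \<in> principal_divisors Y \<Longrightarrow> pushforward \<phi> D \<in> principal_divisors Z"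
  shows "Pic0_map Z \<phi> (connected_serre_graph.cls Y D) = connected_serre_graph.cls Z (pushforward \<phi> D)"
proof -
  interpret Y: connected_serre_graph Y bar by fact
  interpret Z: connected_serre_graph Z bar' by fact
  have "(\<lambda>E. Z.cls (pushforward \<phi> E)) ` Y.cls D = {Z.cls (pushforward \<phi> D)}"
  proof -
    have "Z.cls (pushforward \<phi> E) = Z.cls (pushforward \<phi> D)" if "E \<in> Y.cls D" for E
      using that push[of "E - D"] by (simp add: Y.mem_cls_iff Z.cls_eq_iff pushforward_simps)
    moreover have "D \<in> Y.cls D" by (simp add: Y.mem_cls_iff Y.Pr_0)
    ultimately show ?thesis by blast
  qed
  then show ?thesis unfolding Pic0_map_def Z.cls_def[symmetric] by simp
qed

lemma poly_root_1_dvd: "poly (q :: int poly) 1 = 0 \<Longrightarrow> \<exists>r. q = [:-1, 1:] * r"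
  by (simp add: poly_eq_0_iff_dvd dvd_def)

context branched_tower
begin

lemma g_pos: "g > 0"
  using Xn.verts_nonempty[of 0] unfolding verts_Xn by (auto intro: gr0I)

text \<open>In terms of the standard generators, \<open>Bm\<close> embeds \<open>\<int>[\<gamma>]\<^sup>g\<close> onto the elements of degree zero:
  its columns are \<open>T v\<^sub>1\<close> and the \<open>v\<^sub>i - v\<^sub>1\<close>.\<close>

definition Bm :: "(nat \<Rightarrow> int poly) \<Rightarrow> nat \<Rightarrow> int poly"
  where "Bm q i = (if i = 0 then [:-1, 1:] * q 0 - (\<Sum>j=1..<g. q j) else q i)"

lemma Bm_add: "Bm (q + r) = Bm q + Bm r"
  by (simp add: Bm_def fun_eq_iff algebra_simps sum.distrib)

lemma Bm_mult: "Bm (\<lambda>i. s * q i) = (\<lambda>i. s * Bm q i)"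
  by (auto simp: Bm_def fun_eq_iff algebra_simps sum_distrib_left)

lemma Bm_cong: "(\<And>i. i < g \<Longrightarrow> q i = r i) \<Longrightarrow> i < g \<Longrightarrow> Bm q i = Bm r i"
  using g_pos by (simp add: Bm_def)

lemma sum_split_0: "(\<Sum>i<g. f i) = f 0 + (\<Sum>i=1..<g. f i)" for f :: "nat \<Rightarrow> 'z :: comm_monoid_add"
  using g_pos by (simp add: lessThan_atLeast0 sum.atLeast_Suc_lessThan)

lemma sum_Bm: "(\<Sum>i<g. Bm q i) = [:-1, 1:] * q 0"
  unfolding sum_split_0 by (simp add: Bm_def)

lemma kappa_Bm_K0: "kappa n (Bm q) \<in> Xn.K0 n"
proof -
  have "divisor_degree (kappa n (Bm q)) = poly (\<Sum>i<g. Bm q i) 1" by (simp add: divisor_degree_kappa poly_sum)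
  then show ?thesis using keys_kappa[of n "Bm q"] unfolding sum_Bm by simp
qed

text \<open>For a vector of degree zero the sum of the components vanishes at \<gamma> = 1, so T
  divides it; the quotient is the new component 0.\<close>

lemma Bm_surj:
  assumes "(\<Sum>i<g. poly (r i) 1) = 0"
  shows "\<exists>q. (\<forall>i<g. Bm q i = r i) \<and> (\<Sum>i<g. r i) = [:-1, 1:] * q 0 \<and> (\<forall>i. i \<noteq> 0 \<longrightarrow> q i = r i)"
proof -
  have "poly (\<Sum>i<g. r i) 1 = 0" using assms by (simp add: poly_sum)
  then obtain s where s: "(\<Sum>i<g. r i) = [:-1, 1:] * s" using poly_root_1_dvd by blast
  define q where "q i = (if i = 0 then s else r i)" for i
  have "(\<Sum>j=1..<g. q j) = (\<Sum>j=1..<g. r j)" by (intro sum.cong) (auto simp: q_def)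
  then have "Bm q 0 = r 0" using s unfolding sum_split_0 by (simp add: Bm_def q_def)
  then have "Bm q i = r i" for i by (cases "i = 0") (simp_all add: Bm_def q_def)
  then show ?thesis using s by (intro exI[of _ q]) (simp add: q_def)
qed

definition theta :: "nat \<Rightarrow> (nat \<Rightarrow> int poly) \<Rightarrow> ('v \<times> 'p padic_int set set \<Rightarrow>\<^sub>0 int) set"
  where "theta n q = Xn.cls n (kappa n (Bm q))"

text \<open>If the fibre does not grow from level \<open>n\<close> to the next, the two \<omega> of
  these levels divide one another over the same denominator. If it grows, then
  \<open>m j n = n\<close> and \<open>nu j n\<close> is 1.\<close>

lemma nu_dvd: "nu j n dvd nu j (Suc n)"
proof (cases "m j n = m j (Suc n)")
  case True
  have nz: "omega (CARD('p) ^ m j n) \<noteq> 0"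
  proof -
    have "CARD('p) ^ m j n \<noteq> 0" using card_gt_1[where 'p = 'p] by simp
    then have "coeff (omega (CARD('p) ^ m j n)) (CARD('p) ^ m j n) = 1" by (simp add: omega_def coeff_1)
    then show ?thesis by auto
  qed
  have "omega (CARD('p) ^ n) dvd omega (CARD('p) ^ Suc n)" by (rule omega_dvd) simp
  then have "omega (CARD('p) ^ m j n) * nu j n dvd omega (CARD('p) ^ m j n) * nu j (Suc n)"
    using nu_omega[of j n] nu_omega[of j "Suc n"] True by simp
  then show ?thesis using nz by simp
next
  case False
  then have "m j n = n" by (auto simp: m_def split: if_splits)
  then have "nu j n = 1" by (simp add: nu_def one_poly_eq_simps monom_eq_1_iff)
  then show ?thesis by simp
qed

lemma omega_dvd_ell_diff:
  assumes "n \<le> n'"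
  shows "omega (CARD('p) ^ n) dvd ell n' j i - ell n j i"
proof -
  have "omega (CARD('p) ^ n) dvd monom 1 (nat (residue (\<alpha> s) n)) - monom 1 (nat (residue (\<alpha> s) n'))" for s
  proof (rule omega_dvd_monom_diff)
    have "int (nat (residue (\<alpha> s) n') mod CARD('p) ^ n) = int (nat (residue (\<alpha> s) n) mod CARD('p) ^ n)"
      using residue_mod_le[OF assms, of "\<alpha> s"] residue_nonneg[of "\<alpha> s" n] residue_nonneg[of "\<alpha> s" n']
      by (simp add: zmod_int)
    then show "nat (residue (\<alpha> s) n) mod CARD('p) ^ n = nat (residue (\<alpha> s) n') mod CARD('p) ^ n" by (simp only: of_nat_eq_iff)
  qed
  then have "omega (CARD('p) ^ n) dvd (\<Sum>s | s \<in> arcs X \<and> tail X s = w j \<and> head X s = w i.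
      monom 1 (nat (residue (\<alpha> s) n)) - monom 1 (nat (residue (\<alpha> s) n')))" by (intro dvd_sum)
  then show ?thesis by (simp add: ell_def sum_subtractf)
qed

lemma omega_m_dvd: "omega (CARD('p) ^ m i n) dvd omega (CARD('p) ^ n)"
  by (rule omega_dvd) (rule le_imp_power_dvd[OF m_le])

lemma Pr_Xn_iff: "D \<in> Xn.Pr n \<longleftrightarrow> (\<exists>y. D = kappa n (\<lambda>i. \<Sum>j<g. nu j n * y j * ell n j i))"
proof
  assume "D \<in> Xn.Pr n"
  then obtain E where "Poly_Mapping.keys E \<subseteq> verts (Xn n)" "D = laplacian (Xn n) E" unfolding Xn.Pr_iff by blast
  then show "\<exists>y. D = kappa n (\<lambda>i. \<Sum>j<g. nu j n * y j * ell n j i)" using kappa_surj laplacian_kappa by metis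
next
  assume "\<exists>y. D = kappa n (\<lambda>i. \<Sum>j<g. nu j n * y j * ell n j i)"
  then show "D \<in> Xn.Pr n" unfolding Xn.Pr_iff using keys_kappa laplacian_kappa by metis
qed

lemma Pr_translate: "D \<in> Xn.Pr n \<Longrightarrow> pushforward (layer_translate n 1) D \<in> Xn.Pr n"
proof -
  assume "D \<in> Xn.Pr n"
  then obtain y where y: "D = kappa n (\<lambda>i. \<Sum>j<g. nu j n * y j * ell n j i)" unfolding Pr_Xn_iff by blast
  have "pushforward (layer_translate n 1) D = kappa n (\<lambda>i. \<Sum>j<g. nu j n * (monom 1 1 * y j) * ell n j i)"
    unfolding y kappa_translate by (intro kappa_cong) (simp add: sum_distrib_left mult_ac)
  then show ?thesis unfolding Pr_Xn_iff by (intro exI[of _ "\<lambda>j. monom 1 1 * y j"])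
qed

text \<open>The factor \<open>nu j (Suc n)\<close> is a multiple of \<open>nu j n\<close>, which is
  absorbed into the divisor, and the voltages of the two levels agree modulo p^n.\<close>

lemma Pr_reduce: "D \<in> Xn.Pr (Suc n) \<Longrightarrow> pushforward (layer_reduce n) D \<in> Xn.Pr n"
proof -
  assume "D \<in> Xn.Pr (Suc n)"
  then obtain y where y: "D = kappa (Suc n) (\<lambda>i. \<Sum>j<g. nu j (Suc n) * y j * ell (Suc n) j i)" unfolding Pr_Xn_iff by blast
  have "\<forall>j. \<exists>r. nu j (Suc n) = nu j n * r" using nu_dvd by (meson dvdE)
  then obtain r where r: "\<And>j. nu j (Suc n) = nu j n * r j" by metis
  have "pushforward (layer_reduce n) D = kappa n (\<lambda>i. \<Sum>j<g. nu j (Suc n) * y j * ell (Suc n) j i)"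
    unfolding y kappa_reduce ..
  also have "\<dots> = kappa n (\<lambda>i. \<Sum>j<g. nu j n * (r j * y j) * ell n j i)"
    unfolding kappa_eq_iff
  proof (intro allI impI)
    fix i assume "i < g"
    have "(\<Sum>j<g. nu j (Suc n) * y j * ell (Suc n) j i) - (\<Sum>j<g. nu j n * (r j * y j) * ell n j i)
        = (\<Sum>j<g. nu j n * (r j * y j) * (ell (Suc n) j i - ell n j i))"
      by (simp add: r sum_subtractf[symmetric] algebra_simps)
    moreover have "omega (CARD('p) ^ m i n) dvd (\<Sum>j<g. nu j n * (r j * y j) * (ell (Suc n) j i - ell n j i))"
      using dvd_trans[OF omega_m_dvd omega_dvd_ell_diff[of n "Suc n"]] by (intro dvd_sum dvd_mult) simp
    ultimately show "omega (CARD('p) ^ m i n) dvd (\<Sum>j<g. nu j (Suc n) * y j * ell (Suc n) j i) - (\<Sum>j<g. nu j n * (r j * y j) * ell n j i)" by simp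
  qed
  finally show ?thesis unfolding Pr_Xn_iff by (intro exI[of _ "\<lambda>j. r j * y j"])
qed

lemma connected_serre_Xn: "connected_serre_graph (Xn n) (voltage_bar (Gamma n) bar (\<lambda>s. proj n (\<alpha> s)))"
  by unfold_locales

sublocale torsion_tower "\<lambda>n. Pic0 (Xn n)" "\<lambda>n. Pic0_map (Xn n) (layer_translate n 1)"
  "\<lambda>n. Pic0_map (Xn n) (layer_reduce n)" theta g "TYPE('p)"
proof (rule torsion_tower.intro)
  fix n
  show "comm_group (Pic0 (Xn n))" by (rule Xn.comm_group_Pic0)
  show "carrier (Pic0 (Xn n)) = range (theta n)"
  proof (intro equalityI subsetI)
    fix x assume "x \<in> carrier (Pic0 (Xn n))"
    then obtain D where D: "D \<in> Xn.K0 n" "x = Xn.cls n D" unfolding Xn.Pic0_carrier by blast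
    then obtain r where r: "D = kappa n r" using kappa_surj[of D n] by blast
    have "(\<Sum>i<g. poly (r i) 1) = 0" using D(1) divisor_degree_kappa[of n r] r by simp
    then obtain q where "\<forall>i<g. Bm q i = r i" using Bm_surj by blast
    then have "x = theta n q" unfolding D(2) r theta_def using kappa_cong[of r "Bm q" n] by simp
    then show "x \<in> range (theta n)" by blast
  next
    fix x assume "x \<in> range (theta n)"
    then show "x \<in> carrier (Pic0 (Xn n))" unfolding Xn.Pic0_carrier theta_def using kappa_Bm_K0 by blast
  qed
  show "theta n (q + r) = theta n q \<otimes>\<^bsub>Pic0 (Xn n)\<^esub> theta n r" for q r
    unfolding theta_def Bm_add kappa_add by (rule Xn.Pic0_mult[OF kappa_Bm_K0 kappa_Bm_K0, symmetric])
  show "theta n q = theta n r" if "\<And>i. i < g \<Longrightarrow> q i = r i" for q r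
    unfolding theta_def using kappa_cong[OF Bm_cong[of q r]] that by simp
  show "Pic0_map (Xn n) (layer_translate n 1) (theta n q) = theta n (\<lambda>i. monom 1 1 * q i)" for q
  proof -
    have "Pic0_map (Xn n) (layer_translate n 1) (Xn.cls n D) = Xn.cls n (pushforward (layer_translate n 1) D)" for D
      by (rule Pic0_map_cls[OF connected_serre_Xn connected_serre_Xn]) (rule Pr_translate)
    then show ?thesis by (simp only: theta_def kappa_translate Bm_mult)
  qed
  show "Pic0_map (Xn n) (layer_reduce n) (theta (Suc n) q) = theta n q" for q
  proof -
    have "Pic0_map (Xn n) (layer_reduce n) (Xn.cls (Suc n) D) = Xn.cls n (pushforward (layer_reduce n) D)" for D
      by (rule Pic0_map_cls[OF connected_serre_Xn connected_serre_Xn]) (rule Pr_reduce)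
    then show ?thesis by (simp only: theta_def kappa_reduce)
  qed
  show "theta n (\<lambda>i. omega (CARD('p) ^ n) * q i) = \<one>\<^bsub>Pic0 (Xn n)\<^esub>" for q
  proof -
    have "kappa n (\<lambda>i. omega (CARD('p) ^ n) * Bm q i) = 0" unfolding kappa_eq_0_iff using omega_m_dvd by (simp add: dvd_mult2)
    then show ?thesis unfolding theta_def Bm_mult Xn.cls_eq_one_iff using Xn.Pr_0 by simp
  qed
  \<comment> \<open>An exponent of the Picard group of the layer; it exists because the layer is
    connected.\<close>
  obtain w0 where w0: "w0 \<in> verts (Xn n)" using Xn.verts_nonempty[of n] by blast
  obtain d :: int where d: "d > 0" "\<And>D. Poly_Mapping.keys D \<subseteq> verts (Xn n) \<Longrightarrow> divisor_degree D = 0 \<Longrightarrow> frag_cmul d D \<in> Xn.Pr n"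
    using Xn.laplacian_exponent[OF w0] by blast
  have "theta n (\<lambda>i. of_nat (nat d) * q i) = \<one>\<^bsub>Pic0 (Xn n)\<^esub>" for q
  proof -
    have "(\<lambda>i. of_nat (nat d) * Bm q i) = (\<lambda>i. smult d (Bm q i))" using d(1) by (simp add: of_nat_poly)
    then have "kappa n (\<lambda>i. of_nat (nat d) * Bm q i) = frag_cmul d (kappa n (Bm q))" by (simp only: kappa_cmul)
    then show ?thesis unfolding theta_def Bm_mult Xn.cls_eq_one_iff using d(2)[of "kappa n (Bm q)"] kappa_Bm_K0[of n q] by simp
  qed
  then show "\<exists>d>0. \<forall>q. theta n (\<lambda>i. of_nat d * q i) = \<one>\<^bsub>Pic0 (Xn n)\<^esub>"
    using d(1) by (intro exI[of _ "nat d"]) simp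
qed

lemma Pic0_Lambda_eq: "Pic0_Lambda X G \<alpha> = limit_module"
  unfolding Pic0_Lambda_def limit_module_def ..

lemma kern_iff:
  "q \<in> kern n \<longleftrightarrow> (\<exists>y. \<forall>i<g. omega (CARD('p) ^ m i n) dvd Bm q i - (\<Sum>j<g. nu j n * y j * ell n j i))"
proof -
  have "q \<in> kern n \<longleftrightarrow> kappa n (Bm q) \<in> Xn.Pr n" by (simp add: kern_def theta_def Xn.cls_eq_one_iff)
  then show ?thesis unfolding Pr_Xn_iff kappa_eq_iff .
qed

end

section \<open>The presentation matrix\<close>

context branched_tower
begin

text \<open>The limit of the relations at all levels. Over a ramified vertex the Laplacian column
  tends to 0, and what survives is the relation that the stabiliser fixes the vertex.\<close>

definition A :: "nat \<Rightarrow> nat \<Rightarrow> 'p padic_int fps"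
  where "A i j = (if j < t then (if i = j then of_nat (out_degree X (w j)) else 0)
      - (\<Sum>s | s \<in> arcs X \<and> tail X s = w j \<and> head X s = w i. one_plus_T_powr (\<alpha> s))
    else if i = j then (1 + fps_X) ^ (CARD('p) ^ k (w j)) - 1 else 0)"

text \<open>\<open>A\<close> in the coordinates of \<open>Bm\<close>: its inverse keeps the
  components from 1 on and replaces component 0 by the sum of all of them divided by T.\<close>

definition A' :: "nat \<Rightarrow> nat \<Rightarrow> 'p padic_int fps"
  where "A' i j = (if i = 0 then fps_shift 1 (\<Sum>l<g. A l j) else A i j)"

lemma one_plus_T_powr_nth_0: "fps_nth (one_plus_T_powr a) 0 = 1"
  using fact_mult_padic_binomial[of 0 a] by (simp add: one_plus_T_powr_def)

lemma sum_out_arcs: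
  fixes f :: "'e \<Rightarrow> 'z :: comm_monoid_add"
  assumes j: "j < g"
  shows "(\<Sum>i<g. \<Sum>s | s \<in> arcs X \<and> tail X s = w j \<and> head X s = w i. f s) = (\<Sum>s\<in>out_arcs X (w j). f s)"
proof -
  have "(\<Sum>i<g. \<Sum>s | s \<in> arcs X \<and> tail X s = w j \<and> head X s = w i. f s)
      = (\<Sum>u\<in>w ` {..<g}. \<Sum>s | s \<in> arcs X \<and> tail X s = w j \<and> head X s = u. f s)"
    using bij_w by (subst sum.reindex) (auto simp: bij_betw_def)
  also have "\<dots> = (\<Sum>u\<in>verts X. \<Sum>s | s \<in> out_arcs X (w j) \<and> head X s = u. f s)"
    using bij_w by (intro sum.cong) (auto simp: bij_betw_def out_arcs_def)
  also have "\<dots> = (\<Sum>s\<in>out_arcs X (w j). f s)"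
    by (rule sum.group) (auto simp: out_arcs_def)
  finally show ?thesis .
qed

text \<open>The shift in \<open>A'\<close> is an exact division, because column sums vanish at T =
  0: out-degrees count arcs, and a power of 1 + T minus 1 has no constant term.\<close>

lemma fps_X_A'_0:
  assumes j: "j < g"
  shows "fps_X * A' 0 j = (\<Sum>l<g. A l j)"
proof -
  have "fps_nth (\<Sum>l<g. A l j) 0 = 0"
  proof (cases "j < t")
    case True
    have "(\<Sum>l<g. A l j) = (\<Sum>l<g. if l = j then of_nat (out_degree X (w j)) else 0)
        - (\<Sum>l<g. \<Sum>s | s \<in> arcs X \<and> tail X s = w j \<and> head X s = w l. one_plus_T_powr (\<alpha> s))"
      using True by (simp add: A_def sum_subtractf)
    also have "\<dots> = of_nat (out_degree X (w j)) - (\<Sum>s\<in>out_arcs X (w j). one_plus_T_powr (\<alpha> s))"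
      unfolding sum_out_arcs[OF j] using j by simp
    finally show ?thesis by (simp add: fps_sum_nth one_plus_T_powr_nth_0 of_nat_fps_nth out_degree_def)
  next
    case False
    have "(\<Sum>l<g. A l j) = (\<Sum>l<g. if l = j then (1 + fps_X) ^ (CARD('p) ^ k (w j)) - 1 else 0)"
      using False by (simp add: A_def)
    then show ?thesis using j by (simp add: one_plus_X_power_nth)
  qed
  then show ?thesis unfolding A'_def by (intro fps_ext) simp
qed

lemma arcs_approx:
  "\<exists>m0. \<forall>M\<ge>m0. \<forall>s\<in>arcs X. one_plus_T_powr (\<alpha> s) - (1 + fps_X) ^ nat (residue (\<alpha> s) M) \<in> max_power N"
proof -
  have "\<forall>s. \<exists>m0. \<forall>M\<ge>m0. one_plus_T_powr (\<alpha> s) - (1 + fps_X) ^ nat (residue (\<alpha> s) M) \<in> max_power N"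
    by (rule allI) (rule one_plus_T_powr_approx)
  from choice[OF this] obtain f where f: "\<And>s M. M \<ge> f s \<Longrightarrow> one_plus_T_powr (\<alpha> s) - (1 + fps_X) ^ nat (residue (\<alpha> s) M) \<in> max_power N"
    by blast
  have "f s \<le> (\<Sum>s\<in>arcs X. f s)" if "s \<in> arcs X" for s using that by (intro member_le_sum) auto
  then show ?thesis using f by (intro exI[of _ "\<Sum>s\<in>arcs X. f s"] allI impI ballI) (meson le_trans)
qed

lemma A_ell_approx:
  assumes "j < t" "\<forall>s\<in>arcs X. one_plus_T_powr (\<alpha> s) - (1 + fps_X) ^ nat (residue (\<alpha> s) M) \<in> max_power N"
  shows "A i j - iota (ell M j i) \<in> max_power N"
proof -
  let ?S = "{s. s \<in> arcs X \<and> tail X s = w j \<and> head X s = w i}"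
  have "iota (ell M j i) = (if i = j then of_nat (out_degree X (w j)) else 0) - (\<Sum>s\<in>?S. (1 + fps_X) ^ nat (residue (\<alpha> s) M) :: 'p padic_int fps)"
    unfolding ell_def iota_simps iota_sum iota_monom by simp
  then have "A i j - iota (ell M j i) = - (\<Sum>s\<in>?S. one_plus_T_powr (\<alpha> s) - (1 + fps_X) ^ nat (residue (\<alpha> s) M))"
    using assms(1) by (simp add: A_def sum_subtractf)
  also have "\<dots> \<in> max_power N" using assms(2) by (intro max_power_uminus max_power_sum) auto
  finally show ?thesis .
qed

lemma nu_unr: "j < t \<Longrightarrow> nu j n = 1"
  by (simp add: nu_def m_def one_poly_eq_simps monom_eq_1_iff)

lemma sum_poly_ell: "j < g \<Longrightarrow> (\<Sum>i<g. poly (ell M j i) 1) = 0"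
proof -
  assume j: "j < g"
  have "(\<Sum>i<g. poly (ell M j i) 1) = (\<Sum>i<g. if i = j then int (out_degree X (w j)) else 0)
      - (\<Sum>i<g. \<Sum>s | s \<in> arcs X \<and> tail X s = w j \<and> head X s = w i. 1)"
    unfolding sum_subtractf[symmetric] by (intro sum.cong) (auto simp: ell_def poly_sum poly_monom)
  also have "\<dots> = int (out_degree X (w j)) - (\<Sum>s\<in>out_arcs X (w j). 1)"
    using sum_out_arcs[OF j, of "\<lambda>_. 1 :: int"] j by simp
  finally show ?thesis by (simp add: out_degree_def)
qed

lemma split_unr_ram: "(\<Sum>j<g. f j) = (\<Sum>j<t. f j) + (\<Sum>j=t..<g. f j)" for f :: "nat \<Rightarrow> 'z :: comm_monoid_add"
  using t_le by (simp add: lessThan_atLeast0 sum.atLeastLessThan_concat)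

lemma sum_A_ram: "i < g \<Longrightarrow> (\<Sum>j=t..<g. A i j * u j) = (if t \<le> i then ((1 + fps_X) ^ (CARD('p) ^ k (w i)) - 1) * u i else 0)"
proof -
  assume i: "i < g"
  have "(\<Sum>j=t..<g. A i j * u j) = (\<Sum>j=t..<g. if j = i then ((1 + fps_X) ^ (CARD('p) ^ k (w i)) - 1) * u i else 0)"
    by (intro sum.cong) (auto simp: A_def)
  then show ?thesis using i by auto
qed

text \<open>An integer version of \<open>A\<close> times \<open>y\<close>. The precision
  \<open>M\<close> of the voltages is chosen independently of the level at which the vector is
  read.\<close>

definition rr :: "nat \<Rightarrow> (nat \<Rightarrow> int poly) \<Rightarrow> nat \<Rightarrow> int poly"
  where "rr M y i = (\<Sum>j<t. ell M j i * y j) + (if t \<le> i then omega (CARD('p) ^ k (w i)) * y i else 0)"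

lemma rr_approx:
  assumes M: "\<forall>s\<in>arcs X. one_plus_T_powr (\<alpha> s) - (1 + fps_X) ^ nat (residue (\<alpha> s) M) \<in> max_power N"
    and y: "\<And>j. j < g \<Longrightarrow> u j - iota (y j) \<in> max_power N" and i: "i < g"
  shows "(\<Sum>j<g. A i j * u j) - iota (rr M y i) \<in> max_power N"
proof -
  let ?o = "(1 + fps_X :: 'p padic_int fps) ^ (CARD('p) ^ k (w i)) - 1"
  have "(\<Sum>j<g. A i j * u j) - iota (rr M y i)
      = (\<Sum>j<t. A i j * u j - iota (ell M j i) * iota (y j)) + (if t \<le> i then ?o * (u i - iota (y i)) else 0)"
    unfolding split_unr_ram sum_A_ram[OF i] rr_def by (simp add: sum_subtractf iota_omega right_diff_distrib)
  also have "\<dots> \<in> max_power N"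
  proof (intro max_power_add max_power_sum)
    fix j assume "j \<in> {..<t}"
    then have j: "j < t" "j < g" using t_le by auto
    have "A i j * u j - iota (ell M j i) * iota (y j) = (A i j - iota (ell M j i)) * u j + iota (ell M j i) * (u j - iota (y j))"
      by (simp add: algebra_simps)
    also have "\<dots> \<in> max_power N"
      using A_ell_approx[OF j(1) M] y[OF j(2)] by (intro max_power_add max_power_mult_right max_power_mult_left)
    finally show "A i j * u j - iota (ell M j i) * iota (y j) \<in> max_power N" .
  qed (use y[OF i] max_power_mult_left in auto)
  finally show ?thesis .
qed

lemma sum_poly_rr: "(\<Sum>i<g. poly (rr M y i) 1) = 0"
proof -
  have "(\<Sum>i<g. poly (rr M y i) 1) = (\<Sum>i<g. \<Sum>j<t. poly (ell M j i) 1 * poly (y j) 1)"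
    by (intro sum.cong) (auto simp: rr_def poly_sum omega_def poly_monom)
  also have "\<dots> = (\<Sum>j<t. (\<Sum>i<g. poly (ell M j i) 1) * poly (y j) 1)"
    by (subst sum.swap) (simp add: sum_distrib_right)
  also have "\<dots> = 0" using sum_poly_ell t_le by (intro sum.neutral) auto
  finally show ?thesis .
qed

text \<open>At level \<open>n\<close> the ramified relations vanish, since p^(m i n) divides p^k,
  and what is left is the Laplacian of the unramified part of \<open>y\<close>.\<close>

lemma rr_omega:
  assumes "n \<le> M" "i < g"
  shows "omega (CARD('p) ^ m i n) dvd rr M y i - (\<Sum>j<g. nu j n * (if j < t then y j else 0) * ell n j i)"
proof -
  have "(\<Sum>j<g. nu j n * (if j < t then y j else 0) * ell n j i) = (\<Sum>j<t. ell n j i * y j)"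
    unfolding split_unr_ram by (simp add: nu_unr mult.commute)
  then have "rr M y i - (\<Sum>j<g. nu j n * (if j < t then y j else 0) * ell n j i)
      = (\<Sum>j<t. (ell M j i - ell n j i) * y j) + (if t \<le> i then omega (CARD('p) ^ k (w i)) * y i else 0)"
    by (simp add: rr_def sum_subtractf left_diff_distrib)
  moreover have "omega (CARD('p) ^ m i n) dvd (\<Sum>j<t. (ell M j i - ell n j i) * y j)"
    using dvd_trans[OF omega_m_dvd omega_dvd_ell_diff[OF assms(1)]] by (intro dvd_sum dvd_mult2) simp
  moreover have "omega (CARD('p) ^ m i n) dvd (if t \<le> i then omega (CARD('p) ^ k (w i)) * y i else 0)"
  proof (cases "t \<le> i")
    case True
    then have "m i n \<le> k (w i)" by (simp add: m_def)
    then have "omega (CARD('p) ^ m i n) dvd omega (CARD('p) ^ k (w i))" by (intro omega_dvd le_imp_power_dvd)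
    then show ?thesis using True by (simp add: dvd_mult2)
  qed simp
  ultimately show ?thesis by (simp only: dvd_add)
qed

text \<open>For ramified \<open>j\<close> the number \<open>m j n\<close> is bounded, so this sends
  the Laplacian of a ramified vertex to 0 as \<open>n\<close> grows.\<close>

lemma iota_nu_max_power: "iota (nu j n) \<in> (max_power (n - m j n) :: 'p padic_int fps set)"
proof -
  have "iota (nu j n) = (\<Sum>l<CARD('p) ^ (n - m j n). ((1 + fps_X :: 'p padic_int fps) ^ (CARD('p) ^ m j n)) ^ l)"
    unfolding nu_def iota_sum iota_monom power_mult ..
  then show ?thesis using geometric_sum_max_power[OF one_plus_X_minus_1] by simp
qed

text \<open>A combination of columns is approximated by integer polynomials in the kernel of each
  level. Conversely, approximations from deeper and deeper levels supply coefficients, and a limit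
  point of these solves the equation exactly because all error terms tend to 0.\<close>

lemma closure_kern_eq: "closure_kern = {c. \<exists>u. \<forall>i<g. c i = (\<Sum>j<g. A' i j * u j)}"
proof (intro equalityI subsetI)
  fix c assume "c \<in> {c. \<exists>u. \<forall>i<g. c i = (\<Sum>j<g. A' i j * u j)}"
  then obtain u where u: "\<And>i. i < g \<Longrightarrow> c i = (\<Sum>j<g. A' i j * u j)" by blast
  have "\<exists>q\<in>kern n. approx N c q" for n N
  proof -
    \<comment> \<open>One step of precision beyond \<open>N\<close>, to be lost when component 0 is
      divided by T.\<close>
    obtain m0 where m0: "\<And>M. M \<ge> m0 \<Longrightarrow> \<forall>s\<in>arcs X. one_plus_T_powr (\<alpha> s) - (1 + fps_X) ^ nat (residue (\<alpha> s) M) \<in> max_power (Suc N)"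
      using arcs_approx by blast
    define M where "M = max m0 n"
    define y where "y j = trunc (Suc N) (u j)" for j
    have ap: "(\<Sum>j<g. A i j * u j) - iota (rr M y i) \<in> max_power (Suc N)" if "i < g" for i
      using that by (intro rr_approx m0) (simp_all add: M_def y_def trunc_approx)
    obtain q where q: "\<And>i. i < g \<Longrightarrow> Bm q i = rr M y i" "(\<Sum>i<g. rr M y i) = [:-1, 1:] * q 0" "\<And>i. i \<noteq> 0 \<Longrightarrow> q i = rr M y i"
      using Bm_surj[OF sum_poly_rr] by metis
    have "q \<in> kern n"
      unfolding kern_iff
    proof (intro exI[of _ "\<lambda>j. if j < t then y j else 0"] allI impI)
      fix i assume i: "i < g"
      show "omega (CARD('p) ^ m i n) dvd Bm q i - (\<Sum>j<g. nu j n * (if j < t then y j else 0) * ell n j i)"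
        unfolding q(1)[OF i] by (rule rr_omega[OF _ i]) (simp add: M_def)
    qed
    moreover have "approx N c q"
      unfolding approx_def
    proof (intro allI impI)
      fix i assume i: "i < g"
      show "c i - iota (q i) \<in> max_power N"
      proof (cases "i = 0")
        case True
        have "fps_X * c 0 = (\<Sum>j<g. (fps_X * A' 0 j) * u j)" unfolding u[OF g_pos] by (simp add: sum_distrib_left mult.assoc)
        also have "\<dots> = (\<Sum>j<g. \<Sum>l<g. A l j * u j)"
          by (intro sum.cong) (simp_all only: fps_X_A'_0 sum_distrib_right lessThan_iff)
        also have "\<dots> = (\<Sum>l<g. \<Sum>j<g. A l j * u j)" by (rule sum.swap)
        finally have c0: "fps_X * c 0 = (\<Sum>l<g. \<Sum>j<g. A l j * u j)" .
        have "fps_X * iota (q 0) = (\<Sum>i<g. iota (rr M y i) :: 'p padic_int fps)"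
        proof -
          have "iota (\<Sum>i<g. rr M y i) = (fps_X * iota (q 0) :: 'p padic_int fps)" unfolding q(2) iota_simps iota_X ..
          then show ?thesis by (simp only: iota_sum)
        qed
        then have "fps_X * (c 0 - iota (q 0)) = (\<Sum>i<g. (\<Sum>j<g. A i j * u j) - iota (rr M y i))"
          by (simp add: right_diff_distrib c0 sum_subtractf)
        also have "\<dots> \<in> max_power (Suc N)" by (rule max_power_sum) (simp add: ap)
        finally show ?thesis unfolding True fps_X_mult_in_max_power_iff .
      next
        case False
        then have "c i - iota (q i) \<in> max_power (Suc N)"
          using ap[OF i] u[OF i] q(3)[OF False] by (simp add: A'_def)
        then show ?thesis by (rule max_power_mono[rotated]) simp
      qed
    qed
    ultimately show ?thesis by blast
  qed
  then show "c \<in> closure_kern" unfolding closure_kern_def by blast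
next
  fix c assume c: "c \<in> closure_kern"
  define Bc where "Bc i = (if i = 0 then fps_X * c 0 - (\<Sum>j=1..<g. c j) else c i)" for i
  have "\<forall>n. \<exists>q y. approx n c q \<and> (\<forall>i<g. omega (CARD('p) ^ m i n) dvd Bm q i - (\<Sum>j<g. nu j n * y j * ell n j i))"
  proof
    fix n
    obtain q where "q \<in> kern n" "approx n c q" using c unfolding closure_kern_def mem_Collect_eq by blast
    then show "\<exists>q y. approx n c q \<and> (\<forall>i<g. omega (CARD('p) ^ m i n) dvd Bm q i - (\<Sum>j<g. nu j n * y j * ell n j i))"
      unfolding kern_iff by (elim exE) (intro exI conjI)
  qed
  from choice[OF this] obtain q where
    "\<forall>n. \<exists>y. approx n c (q n) \<and> (\<forall>i<g. omega (CARD('p) ^ m i n) dvd Bm (q n) i - (\<Sum>j<g. nu j n * y j * ell n j i))" ..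
  from choice[OF this] obtain y where
    qy: "\<forall>n. approx n c (q n) \<and> (\<forall>i<g. omega (CARD('p) ^ m i n) dvd Bm (q n) i - (\<Sum>j<g. nu j n * y n j * ell n j i))" ..
  have q: "approx n c (q n)" for n using qy by (elim allE conjE)
  have y: "omega (CARD('p) ^ m i n) dvd Bm (q n) i - (\<Sum>j<g. nu j n * y n j * ell n j i)" if "i < g" for n i
    using qy that by simp
  define z where "z n i = (SOME z. Bm (q n) i - (\<Sum>j<g. nu j n * y n j * ell n j i) = omega (CARD('p) ^ m i n) * z)" for n i
  have z: "Bm (q n) i - (\<Sum>j<g. nu j n * y n j * ell n j i) = omega (CARD('p) ^ m i n) * z n i" if "i < g" for n i
    unfolding z_def by (rule someI_ex) (rule y[OF that, of n, unfolded dvd_def])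
  \<comment> \<open>For ramified \<open>j\<close> the Laplacian coefficient carries
    \<open>nu j n\<close> and disappears in the limit; the coefficient that survives is the one of
    \<omega> in component \<open>j\<close>.\<close>
  define us where "us n j = (if j < t then iota (y n j) else iota (z n j) :: 'p padic_int fps)" for n j
  have Bq: "Bc i - iota (Bm (q n) i) \<in> max_power n" if i: "i < g" for i n
  proof (cases "i = 0")
    case True
    have "Bm (q n) 0 = [:-1, 1:] * q n 0 - (\<Sum>j=1..<g. q n j)" by (simp only: Bm_def simp_thms if_True)
    then have "iota (Bm (q n) 0) = fps_X * iota (q n 0) - (\<Sum>j=1..<g. iota (q n j) :: 'p padic_int fps)"
      by (simp only: iota_simps iota_X iota_sum)
    then have "Bc 0 - iota (Bm (q n) 0) = fps_X * (c 0 - iota (q n 0)) - (\<Sum>j=1..<g. c j - iota (q n j))"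
      by (simp add: Bc_def algebra_simps sum_subtractf)
    also have "\<dots> \<in> max_power n"
      by (rule max_power_diff[OF max_power_mult_left max_power_sum]) (use q[of n] g_pos in \<open>auto simp: approx_def\<close>)
    finally show ?thesis using True by simp
  next
    case False
    then show ?thesis using q[of n] i by (simp add: Bc_def Bm_def approx_def)
  qed
  \<comment> \<open>For \<open>n\<close> at least m0 + N plus the sum of all \<open>k\<close> of
    vertices, the ramified fibres have reached their final size, and both \<open>nu j n\<close> at
    ramified vertices and the \<omega> of level \<open>n\<close> at unramified ones lie in
    \<open>max_power N\<close>.\<close>
  have close: "\<exists>n0. \<forall>n\<ge>n0. \<forall>i<g. Bc i - (\<Sum>j<g. A i j * us n j) \<in> max_power N" for N
  proof -
    obtain m0 where m0: "\<And>M. M \<ge> m0 \<Longrightarrow> \<forall>s\<in>arcs X. one_plus_T_powr (\<alpha> s) - (1 + fps_X) ^ nat (residue (\<alpha> s) M) \<in> max_power N"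
      using arcs_approx by blast
    let ?ks = "\<Sum>j<g. k (w j)"
    have "Bc i - (\<Sum>j<g. A i j * us n j) \<in> max_power N" if n: "n \<ge> m0 + N + ?ks" and i: "i < g" for n i
    proof -
      have kj: "k (w j) \<le> ?ks" if "j < g" for j using that by (intro member_le_sum) auto
      have t1: "Bc i - iota (Bm (q n) i) \<in> max_power N" by (rule max_power_mono[OF _ Bq[OF i]]) (use n in simp)
      have t2: "(\<Sum>j<t. (iota (ell n j i) - A i j) * iota (y n j)) \<in> max_power N"
      proof (intro max_power_sum max_power_mult_right)
        fix j assume "j \<in> {..<t}"
        then have "A i j - iota (ell n j i) \<in> max_power N" using n by (intro A_ell_approx m0) auto
        then have "- (A i j - iota (ell n j i)) \<in> max_power N" by (rule max_power_uminus)
        then show "iota (ell n j i) - A i j \<in> max_power N" by simp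
      qed
      have t3: "(\<Sum>j=t..<g. iota (nu j n) * (iota (y n j) * iota (ell n j i))) \<in> (max_power N :: 'p padic_int fps set)"
      proof (intro max_power_sum max_power_mult_right)
        fix j assume j: "j \<in> {t..<g}"
        then have "m j n \<le> ?ks" using kj[of j] by (auto simp: m_def)
        then show "iota (nu j n) \<in> (max_power N :: 'p padic_int fps set)"
          using n by (intro max_power_mono[OF _ iota_nu_max_power]) simp
      qed
      have t4: "iota (omega (CARD('p) ^ m i n)) * iota (z n i) - (if t \<le> i then ((1 + fps_X) ^ (CARD('p) ^ k (w i)) - 1) * us n i else 0) \<in> (max_power N :: 'p padic_int fps set)"
      proof (cases "t \<le> i")
        case True
        then have "m i n = k (w i)" using kj[OF i] n by (simp add: m_def)
        then show ?thesis using True by (simp add: us_def iota_omega)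
      next
        case False
        then have "m i n = n" by (simp add: m_def)
        moreover have "iota (omega (CARD('p) ^ n)) * iota (z n i) \<in> (max_power N :: 'p padic_int fps set)"
          using n by (intro max_power_mult_right max_power_mono[OF _ iota_omega_max_power]) simp
        ultimately show ?thesis using False by simp
      qed
      have Bmq: "Bm (q n) i = (\<Sum>j<g. nu j n * y n j * ell n j i) + omega (CARD('p) ^ m i n) * z n i"
        using z[OF i, of n] by (simp add: algebra_simps)
      have "iota (Bm (q n) i) = (\<Sum>j<t. iota (y n j) * iota (ell n j i)) + (\<Sum>j=t..<g. iota (nu j n) * (iota (y n j) * iota (ell n j i)))
          + (iota (omega (CARD('p) ^ m i n)) * iota (z n i) :: 'p padic_int fps)"
        unfolding Bmq split_unr_ram by (simp add: nu_unr mult.assoc)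
      moreover have "(\<Sum>j<g. A i j * us n j) = (\<Sum>j<t. A i j * iota (y n j)) + (if t \<le> i then ((1 + fps_X) ^ (CARD('p) ^ k (w i)) - 1) * us n i else 0)"
        unfolding split_unr_ram sum_A_ram[OF i] by (simp add: us_def)
      moreover have "(\<Sum>j<t. (iota (ell n j i) - A i j) * iota (y n j)) = (\<Sum>j<t. iota (y n j) * iota (ell n j i)) - (\<Sum>j<t. A i j * iota (y n j))"
        unfolding sum_subtractf[symmetric] by (intro sum.cong refl) (simp add: algebra_simps)
      moreover have "b - (s4 + s5) = (b - (s1 + s2 + s3)) + ((s1 - s4) + (s2 + (s3 - s5)))" for b s1 s2 s3 s4 s5 :: "'p padic_int fps"
        by simp
      ultimately have "Bc i - (\<Sum>j<g. A i j * us n j) = (Bc i - iota (Bm (q n) i)) + ((\<Sum>j<t. (iota (ell n j i) - A i j) * iota (y n j))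
        + ((\<Sum>j=t..<g. iota (nu j n) * (iota (y n j) * iota (ell n j i)))
        + (iota (omega (CARD('p) ^ m i n)) * iota (z n i) - (if t \<le> i then ((1 + fps_X) ^ (CARD('p) ^ k (w i)) - 1) * us n i else 0))))"
        by (simp only:)
      also have "\<dots> \<in> max_power N" by (rule max_power_add[OF t1 max_power_add[OF t2 max_power_add[OF t3 t4]]])
      finally show ?thesis .
    qed
    then show ?thesis by blast
  qed
  obtain u where u: "\<And>M. infinite {n. \<forall>i<M. u i - us n i \<in> max_power M}" using max_power_accumulation by blast
  have BA: "Bc i = (\<Sum>j<g. A i j * u j)" if i: "i < g" for i
  proof -
    have "Bc i - (\<Sum>j<g. A i j * u j) \<in> max_power N" for N
    proof -
      obtain n0 where n0: "\<And>n i. n \<ge> n0 \<Longrightarrow> i < g \<Longrightarrow> Bc i - (\<Sum>j<g. A i j * us n j) \<in> max_power N" using close by blast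
      obtain n where n: "n \<ge> n0" "\<forall>i<max g N. u i - us n i \<in> max_power (max g N)"
        using u[of "max g N"] unfolding infinite_nat_iff_unbounded_le by blast
      have un: "u j - us n j \<in> max_power N" if "j < g" for j
      proof -
        have "u j - us n j \<in> max_power (max g N)" using n(2) that by simp
        then show ?thesis by (rule max_power_mono[rotated]) simp
      qed
      have "Bc i - (\<Sum>j<g. A i j * u j) = (Bc i - (\<Sum>j<g. A i j * us n j)) - (\<Sum>j<g. A i j * (u j - us n j))"
        by (simp add: right_diff_distrib sum_subtractf)
      also have "\<dots> \<in> max_power N"
        by (rule max_power_diff[OF n0[OF n(1) i] max_power_sum]) (simp add: max_power_mult_left un)
      finally show ?thesis .
    qed
    then have "Bc i - (\<Sum>j<g. A i j * u j) = 0" by (rule max_power_all_imp_0)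
    then show ?thesis by simp
  qed
  have "c i = (\<Sum>j<g. A' i j * u j)" if i: "i < g" for i
  proof (cases "i = 0")
    case True
    have "fps_X * c 0 = (\<Sum>i<g. Bc i)" unfolding sum_split_0 by (simp add: Bc_def)
    also have "\<dots> = (\<Sum>i<g. \<Sum>j<g. A i j * u j)" by (intro sum.cong) (simp_all add: BA)
    also have "\<dots> = (\<Sum>j<g. \<Sum>i<g. A i j * u j)" by (rule sum.swap)
    also have "\<dots> = (\<Sum>j<g. fps_X * (A' 0 j * u j))"
      by (intro sum.cong) (simp_all only: fps_X_A'_0 sum_distrib_right lessThan_iff mult.assoc[symmetric])
    also have "\<dots> = fps_X * (\<Sum>j<g. A' 0 j * u j)" by (simp add: sum_distrib_left)
    finally show ?thesis using True by simp
  next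
    case False
    then show ?thesis using BA[OF i] by (simp add: Bc_def A'_def)
  qed
  then show "c \<in> {c. \<exists>u. \<forall>i<g. c i = (\<Sum>j<g. A' i j * u j)}" by blast
qed

end

lemma iota_smult: "iota (smult c q) = of_int c * iota q"
proof -
  have "smult c q = [:c:] * q" by simp
  then show ?thesis by (simp only: iota_simps iota_of_int)
qed

context branched_tower
begin

section \<open>Non-vanishing of the determinant\<close>

definition unr_mat :: "'p padic_int fps mat"
  where "unr_mat = mat t t (\<lambda>(i, j). A i j)"

lemma unr_mat_carrier: "unr_mat \<in> carrier_mat t t" by (simp add: unr_mat_def)

text \<open>Setting T = 0 turns the block into the Laplacian of X with the ramified vertices
  deleted, which is nonsingular since X is connected.\<close>

lemma det_unr_nonzero_ram:
  assumes conn: "connected X" and tg: "t < g"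
  shows "det unr_mat \<noteq> 0"
proof -
  interpret XX: connected_serre_graph X bar using conn by unfold_locales
  let ?h = "\<lambda>f :: 'p padic_int fps. fps_nth f 0"
  interpret h: comm_ring_hom ?h by unfold_locales simp_all
  have inj: "inj_on w {..<t}" using bij_w t_le by (auto simp: bij_betw_def inj_on_def)
  have sub: "w ` {..<t} \<subset> verts X"
  proof -
    have "w ` {..<t} \<subseteq> verts X" using w_verts t_le by auto
    moreover have "w t \<notin> w ` {..<t}"
    proof
      assume "w t \<in> w ` {..<t}"
      then obtain x where "x < t" "w t = w x" by blast
      then show False using w_inj[of t x] tg by simp
    qed
    ultimately show ?thesis using w_verts[OF tg] by blast
  qed
  have eq: "map_mat ?h unr_mat = map_mat of_int (XX.red_lap w t)"
  proof (rule eq_matI)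
    fix i j assume "i < dim_row (map_mat of_int (XX.red_lap w t) :: 'p padic_int mat)" "j < dim_col (map_mat of_int (XX.red_lap w t) :: 'p padic_int mat)"
    then have ij: "i < t" "j < t" by (simp_all add: XX.red_lap_def)
    have "?h (A i j) = of_int ((if i = j then int (out_degree X (w i)) else 0) - int (card {e \<in> arcs X. tail X e = w j \<and> head X e = w i}))"
      using ij by (simp add: A_def fps_sum_nth one_plus_T_powr_nth_0 of_nat_fps_nth)
    then show "map_mat ?h unr_mat $$ (i, j) = map_mat of_int (XX.red_lap w t) $$ (i, j)"
      using ij by (simp add: unr_mat_def XX.red_lap_def)
  qed (simp_all add: unr_mat_def XX.red_lap_def)
  have "?h (det unr_mat) = det (map_mat of_int (XX.red_lap w t))" unfolding h.hom_det[symmetric] eq ..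
  also have "\<dots> = of_int (det (XX.red_lap w t))" by (rule of_int_hom.hom_det)
  finally have "?h (det unr_mat) \<noteq> 0" using XX.det_red_lap_nonzero[OF inj sub] by simp
  then show ?thesis by auto
qed

lemma vtx_nat_inj:
  assumes i: "i < g" "m i n = n" and b: "b < CARD('p) ^ n" "b' < CARD('p) ^ n" "vtx n i (of_nat b) = vtx n i (of_nat b')"
  shows "b = b'"
proof -
  have "padic_p ^ n dvd (of_int (int b - int b') :: 'p padic_int)" using b(3) unfolding vtx_eq_iff[OF i(1)] i(2) by simp
  then have "int (CARD('p) ^ n) dvd int b - int b'" unfolding padic_p_power_dvd_of_int by simp
  then have "int b mod int (CARD('p) ^ n) = int b' mod int (CARD('p) ^ n)" by (simp only: mod_eq_dvd_iff)
  then show ?thesis using b(1,2) by (simp only: zmod_int[symmetric] of_nat_eq_iff mod_less)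
qed

lemma lookup_U_norm:
  assumes i: "i < g" "m i n = n"
  shows "Poly_Mapping.lookup (U n i (\<Sum>l<CARD('p) ^ n. monom 1 l)) (vtx n i b) = 1"
proof -
  let ?j = "nat (residue b n)"
  have j: "?j < CARD('p) ^ n" using residue_less[of b n] residue_nonneg[of b n] by (simp add: nat_less_iff)
  have bj: "vtx n i b = vtx n i (of_nat ?j)" using vtx_residue[OF i(1), of n 0 b] by simp
  have "Poly_Mapping.lookup (U n i (\<Sum>l<CARD('p) ^ n. monom 1 l)) (vtx n i b) = (\<Sum>l<CARD('p) ^ n. if l = ?j then 1 else 0)"
    unfolding U_sum U_monom lookup_sum bj
  proof (intro sum.cong refl)
    fix l assume "l \<in> {..<CARD('p) ^ n}"
    then show "Poly_Mapping.lookup (frag_cmul 1 (frag_of (vtx n i (of_nat l)))) (vtx n i (of_nat ?j)) = (if l = ?j then 1 else 0)"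
      using vtx_nat_inj[OF i, of l ?j] j by auto
  qed
  then show ?thesis using j by simp
qed

text \<open>At T = 0 the full Laplacian is singular, so the layers are used instead. An integer
  approximation of a null vector is harmonic on X_n modulo a high power of p, hence constant there
  modulo p^n after allowing for the exponent of the Picard group. Constants are multiples of the
  norm element, which T kills modulo \<omega>; so T times the null vector lies in every power of the
  maximal ideal.\<close>

lemma det_unr_nonzero_unr:
  assumes tg: "t = g"
  shows "det unr_mat \<noteq> 0"
proof
  assume "det unr_mat = 0"
  then obtain x where x: "x \<in> carrier_vec t" "x \<noteq> 0\<^sub>v t" "unr_mat *\<^sub>v x = 0\<^sub>v t"
    using det_0_iff_vec_prod_zero[OF unr_mat_carrier] by blast
  define u where "u j = x $ j" for j
  have Au: "(\<Sum>j<g. A i j * u j) = 0" if i: "i < g" for i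
  proof -
    have it: "i < t" using i tg by simp
    have "(\<Sum>j<t. A i j * u j) = (unr_mat *\<^sub>v x) $ i"
      using it x(1) by (auto simp: unr_mat_def u_def mult_mat_vec_def scalar_prod_def lessThan_atLeast0)
    then have "(\<Sum>j<t. A i j * u j) = 0" using x(3) it by simp
    then show ?thesis unfolding tg .
  qed
  have lt: "i < t" if "i < g" for i using that unfolding tg .
  have mn: "m i n = n" if "i < g" for i n using lt[OF that] by (simp add: m_def)
  have small: "fps_X * u i \<in> max_power n" if i: "i < g" for i n
  proof -
    let ?p = "CARD('p)"
    have w0: "vtx n 0 0 \<in> verts (Xn n)" using g_pos by (auto simp: verts_Xn)
    obtain d :: int where d: "d > 0" and dv: "\<And>D a x. Poly_Mapping.keys D \<subseteq> verts (Xn n) \<Longrightarrow>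
        (\<forall>w. a dvd Poly_Mapping.lookup (laplacian (Xn n) D) w) \<Longrightarrow> x \<in> verts (Xn n) \<Longrightarrow>
        a dvd d * (Poly_Mapping.lookup D x - Poly_Mapping.lookup D (vtx n 0 0))"
      using Xn.laplacian_exponent[OF w0] by blast
    have "nat d \<noteq> 0" "\<not> is_unit ?p" using d card_gt_1[where 'p = 'p] by simp_all
    then obtain d' where d': "nat d = ?p ^ multiplicity ?p (nat d) * d'" "\<not> ?p dvd d'"
      by (rule multiplicity_decompose')
    \<comment> \<open>The valuation of the exponent \<open>d\<close>. The summand \<open>b\<close>
      in \<open>a = n + b\<close> pays for the division by \<open>d\<close>.\<close>
    define b where "b = multiplicity ?p (nat d)"
    have db: "d = int ?p ^ b * int d'"
    proof -
      have "d = int (nat d)" using d by simp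
      also have "\<dots> = int (?p ^ b * d')" using d'(1) unfolding b_def by simp
      finally show ?thesis by simp
    qed
    have cop: "coprime d' ?p" using d'(2) prime_card[where 'a = 'p] by (metis coprime_commute prime_imp_coprime)
    define a where "a = n + b"
    \<comment> \<open>The first summand is the threshold of \<open>iota_small_decomposition\<close>;
      the second keeps the approximation of \<open>u\<close> correct to precision
      \<open>n\<close>.\<close>
    define N where "N = a * (?p ^ n + 1) + n"
    obtain m0 where m0: "\<And>M. M \<ge> m0 \<Longrightarrow> \<forall>s\<in>arcs X. one_plus_T_powr (\<alpha> s) - (1 + fps_X) ^ nat (residue (\<alpha> s) M) \<in> max_power N"
      using arcs_approx by blast
    define M where "M = max m0 n"
    define y where "y j = trunc N (u j)" for j
    have "\<exists>q' q''. l < g \<longrightarrow> rr M y l = of_nat (?p ^ a) * q' + omega (?p ^ n) * q''" for l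
    proof (cases "l < g")
      case True
      have "(\<Sum>j<g. A l j * u j) - iota (rr M y l) \<in> max_power N"
        using True by (intro rr_approx m0) (simp_all add: M_def y_def trunc_approx)
      then have "iota (rr M y l) \<in> (max_power N :: 'p padic_int fps set)" using Au[OF True] max_power_uminus[of "- iota (rr M y l)"] by simp
      moreover have "a * (?p ^ n + 1) \<le> N" by (simp add: N_def)
      ultimately show ?thesis using iota_small_decomposition by blast
    qed simp
    then have "\<forall>l. \<exists>q'. \<exists>q''. l < g \<longrightarrow> rr M y l = of_nat (?p ^ a) * q' + omega (?p ^ n) * q''" by blast
    from choice[OF this] obtain q' where "\<forall>l. \<exists>q''. l < g \<longrightarrow> rr M y l = of_nat (?p ^ a) * q' l + omega (?p ^ n) * q''" ..
    from choice[OF this] obtain q'' where q: "\<forall>l. l < g \<longrightarrow> rr M y l = of_nat (?p ^ a) * q' l + omega (?p ^ n) * q'' l" ..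
    have "laplacian (Xn n) (kappa n y) = kappa n (\<lambda>l. smult (int (?p ^ a)) (q' l))"
      unfolding laplacian_kappa kappa_eq_iff
    proof (intro allI impI)
      fix l assume l: "l < g"
      let ?S = "\<Sum>j<g. nu j n * y j * ell n j l"
      have "?S = (\<Sum>j<g. nu j n * (if j < t then y j else 0) * ell n j l)" by (intro sum.cong refl) (simp add: lt)
      then have r: "omega (?p ^ m l n) dvd rr M y l - ?S" using rr_omega[OF _ l, of n M y] by (simp add: M_def)
      have "rr M y l - smult (int (?p ^ a)) (q' l) = omega (?p ^ n) * q'' l"
        using q l by (simp add: of_nat_poly)
      then have "omega (?p ^ m l n) dvd rr M y l - smult (int (?p ^ a)) (q' l)" using omega_m_dvd by (simp add: dvd_mult2)
      from dvd_diff[OF this r] show "omega (?p ^ m l n) dvd ?S - smult (int (?p ^ a)) (q' l)" by simp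
    qed
    then have lap: "\<forall>x. int (?p ^ a) dvd Poly_Mapping.lookup (laplacian (Xn n) (kappa n y)) x"
      by (simp only: kappa_cmul lookup_frag_cmul dvd_triv_left simp_thms)
    define c where "c = Poly_Mapping.lookup (kappa n y) (vtx n 0 0)"
    \<comment> \<open>The sum over a whole fibre: using \<open>smult c \<sigma>\<close> in every
      component gives the constant function with value \<open>c\<close>.\<close>
    define \<sigma> where "\<sigma> = (\<Sum>l<?p ^ n. monom (1 :: int) l)"
    have "\<exists>z r. smult d (y i - smult c \<sigma>) = omega (?p ^ m i n) * z + smult (int (?p ^ a)) r"
    proof (rule kappa_dvd[OF _ i, of "int (?p ^ a)" n "\<lambda>l. smult d (y l - smult c \<sigma>)"])
      fix x
      show "int (?p ^ a) dvd Poly_Mapping.lookup (kappa n (\<lambda>l. smult d (y l - smult c \<sigma>))) x"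
      proof (cases "x \<in> verts (Xn n)")
        case True
        then obtain l e where l: "l < g" "x = vtx n l e" by (auto simp: verts_Xn)
        have "Poly_Mapping.lookup (kappa n (\<lambda>l. smult d (y l - smult c \<sigma>))) x = d * (Poly_Mapping.lookup (kappa n y) x - c)"
          unfolding l(2) lookup_kappa[OF l(1)] U_smult U_diff lookup_frag_cmul lookup_minus \<sigma>_def
            lookup_U_norm[OF l(1) mn[OF l(1)]] by simp
        then show ?thesis using dv[OF keys_kappa lap True] by (simp add: c_def)
      next
        case False
        then have "x \<notin> Poly_Mapping.keys (kappa n (\<lambda>l. smult d (y l - smult c \<sigma>)))" using keys_kappa by blast
        then show ?thesis by (simp add: in_keys_iff)
      qed
    qed
    then obtain z r where zr: "smult d (y i - smult c \<sigma>) = omega (?p ^ n) * z + smult (int (?p ^ a)) r" unfolding mn[OF i] by blast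
    have X\<sigma>: "[:-1, 1:] * \<sigma> = omega (?p ^ n)"
    proof -
      have "[:-1, 1:] = omega 1" by (simp add: omega_def monom_altdef one_pCons)
      then show ?thesis using omega_mult_eq[of 1 "?p ^ n"] by (simp add: \<sigma>_def)
    qed
    define P where "P = [:-1, 1:: int:]"
    define Y where "Y = smult (int d') (P * y i) - smult (int ?p ^ n) (P * r)"
    define z2 where "z2 = P * z + [:d * c:]"
    \<comment> \<open>Multiplication by T turns \<sigma> into \<omega>, so the constant joins the
      multiple of \<omega>, and p^b divides the rest.\<close>
    have key: "omega (?p ^ n) * z2 = smult (int ?p ^ b) Y"
    proof -
      have "P * (omega (?p ^ n) * z + smult (int (?p ^ a)) r) = P * smult d (y i - smult c \<sigma>)" using zr by simp
      then have "omega (?p ^ n) * (P * z) + smult (int (?p ^ a)) (P * r) = smult d (P * y i) - smult (d * c) (P * \<sigma>)"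
        by (simp add: algebra_simps smult_diff_right)
      then have "omega (?p ^ n) * (P * z) + smult (d * c) (omega (?p ^ n)) = smult d (P * y i) - smult (int (?p ^ a)) (P * r)"
        unfolding X\<sigma>[folded P_def] by (simp add: algebra_simps)
      moreover have "int (?p ^ a) = int ?p ^ b * int ?p ^ n" by (simp add: a_def power_add)
      ultimately show ?thesis unfolding z2_def Y_def db by (simp add: distrib_left smult_diff_right mult.commute)
    qed
    have prime: "prime_elem [:int ?p:]" by (rule lift_prime_elem_poly[OF prime_imp_prime_elem[OF prime_card_int]])
    \<comment> \<open>Being monic, \<omega> is not divisible by p, so the power p^b passes to the
      cofactor \<open>z2\<close> and can be cancelled.\<close>
    have nd: "\<not> [:int ?p:] dvd omega (?p ^ n)"
    proof
      assume "[:int ?p:] dvd omega (?p ^ n)"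
      then have "int ?p dvd coeff (omega (?p ^ n)) (?p ^ n)" unfolding const_poly_dvd_iff by blast
      moreover have "?p ^ n \<noteq> 0" using card_gt_1[where 'p = 'p] by simp
      then have "coeff (omega (?p ^ n)) (?p ^ n) = 1" by (simp add: omega_def coeff_1)
      ultimately show False using card_gt_1[where 'p = 'p] by simp
    qed
    have pb: "[:int ?p:] ^ b = [:int ?p ^ b:]" by (simp add: poly_const_pow)
    have "smult (int ?p ^ b) Y = [:int ?p ^ b:] * Y" by simp
    then have "[:int ?p:] ^ b dvd omega (?p ^ n) * z2" unfolding key pb by (metis dvd_triv_left)
    then have "[:int ?p:] ^ b dvd z2" by (rule prime_elem_power_dvd_multD[OF prime nd])
    then obtain z3 where "z2 = [:int ?p ^ b:] * z3" unfolding pb by (elim dvdE)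
    then have "smult (int ?p ^ b) (omega (?p ^ n) * z3) = smult (int ?p ^ b) Y" using key by simp
    then have "smult (int ?p ^ b) (omega (?p ^ n) * z3 - Y) = 0" unfolding smult_diff_right by simp
    moreover have "int ?p ^ b \<noteq> 0" using card_gt_1[where 'p = 'p] by simp
    ultimately have "omega (?p ^ n) * z3 - Y = 0" unfolding smult_eq_0_iff by blast
    then have "omega (?p ^ n) * z3 = Y" by simp
    then have "smult (int d') (P * y i) = omega (?p ^ n) * z3 + smult (int ?p ^ n) (P * r)" unfolding Y_def by simp
    then have "iota (smult (int d') (P * y i)) = (iota (omega (?p ^ n) * z3 + smult (int ?p ^ n) (P * r)) :: 'p padic_int fps)" by simp
    then have e: "of_nat d' * (fps_X * iota (y i)) = iota (omega (?p ^ n)) * iota z3 + (of_nat ?p ^ n * iota (P * r) :: 'p padic_int fps)"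
      unfolding iota_smult P_def iota_simps iota_X by simp
    have "iota (omega (?p ^ n)) * iota z3 + of_nat ?p ^ n * iota (P * r) \<in> (max_power n :: 'p padic_int fps set)"
    proof (intro max_power_add max_power_mult_right)
      show "iota (omega (?p ^ n)) \<in> (max_power n :: 'p padic_int fps set)"
        by (rule max_power_mono[OF _ iota_omega_max_power]) simp
      show "of_nat ?p ^ n \<in> (max_power n :: 'p padic_int fps set)" by (rule max_power_power[OF padic_p_in_max_power])
    qed
    then have Xy: "fps_X * iota (y i) \<in> (max_power n :: 'p padic_int fps set)"
      unfolding e[symmetric] by (rule max_power_mult_coprime[OF cop])
    have "u i - iota (y i) \<in> max_power N" unfolding y_def by (rule trunc_approx)
    then have "u i - iota (y i) \<in> max_power n" by (rule max_power_mono[rotated]) (simp add: N_def)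
    then have "fps_X * (u i - iota (y i)) \<in> max_power n" by (rule max_power_mult_left)
    from max_power_add[OF this Xy] show ?thesis by (simp add: right_diff_distrib)
  qed
  have "u i = 0" if i: "i < g" for i
  proof -
    have "fps_X * u i = 0" by (rule max_power_all_imp_0) (rule small[OF i])
    then show ?thesis by simp
  qed
  then have "x $ i = 0" if "i < t" for i using that unfolding tg u_def by blast
  then have "x = 0\<^sub>v t" using x(1) by (intro eq_vecI) auto
  then show False using x(2) by simp
qed

end

context branched_tower
begin

section \<open>Determinants and the characteristic ideal\<close>

definition A_mat :: "'p padic_int fps mat" where "A_mat = mat g g (\<lambda>(i, j). A i j)"
definition A'_mat :: "'p padic_int fps mat" where "A'_mat = mat g g (\<lambda>(i, j). A' i j)"

text \<open>\<open>B\<close> is the matrix of \<open>Bm\<close>, upper triangular with diagonal T,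
  1, ..., 1.\<close>

lemma det_A_mat_A'_mat: "det A_mat = fps_X * det A'_mat"
proof -
  define B where "B = mat g g (\<lambda>(i, j). if i = 0 then (if j = 0 then fps_X else - 1) else if i = j then 1 else 0 :: 'p padic_int fps)"
  have B: "B \<in> carrier_mat g g" by (simp add: B_def)
  have A'c: "A'_mat \<in> carrier_mat g g" by (simp add: A'_mat_def)
  have "A_mat = B * A'_mat"
  proof (rule eq_matI)
    fix i j assume "i < dim_row (B * A'_mat)" "j < dim_col (B * A'_mat)"
    then have ij: "i < g" "j < g" by (simp_all add: B_def A'_mat_def)
    have "(B * A'_mat) $$ (i, j) = (\<Sum>l<g. B $$ (i, l) * A' l j)"
      unfolding index_mult_mat_sum[OF B A'c ij] using ij by (intro sum.cong) (simp_all add: A'_mat_def)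
    also have "\<dots> = A i j"
    proof (cases "i = 0")
      case True
      have "(\<Sum>l<g. B $$ (i, l) * A' l j) = fps_X * A' 0 j + (\<Sum>l=1..<g. - A l j)"
        unfolding sum_split_0 using True g_pos by (intro arg_cong2[of _ _ _ _ "(+)"] sum.cong) (simp_all add: B_def A'_def)
      also have "\<dots> = A 0 j" unfolding fps_X_A'_0[OF ij(2)] sum_split_0 by (simp add: sum_negf)
      finally show ?thesis using True by simp
    next
      case False
      have "(\<Sum>l<g. B $$ (i, l) * A' l j) = (\<Sum>l<g. if l = i then A' i j else 0)"
        using False ij by (intro sum.cong) (auto simp: B_def)
      then show ?thesis using False ij by (simp add: A'_def)
    qed
    finally show "A_mat $$ (i, j) = (B * A'_mat) $$ (i, j)" using ij by (simp add: A_mat_def)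
  qed (simp_all add: A_mat_def B_def A'_mat_def)
  moreover have "det B = fps_X"
  proof -
    have "det B = prod_list (diag_mat B)"
      by (rule det_upper_triangular[OF _ B]) (auto simp: upper_triangular_def B_def)
    also have "\<dots> = (\<Prod>i = 0..<g. if i = 0 then fps_X else 1)"
      unfolding prod_list_diag_prod using B by (intro prod.cong) (auto simp: B_def)
    finally show ?thesis using g_pos by simp
  qed
  ultimately show ?thesis by (simp add: det_mult[OF B A'c])
qed

text \<open>A ramified column is zero off the diagonal, so the upper right block vanishes and the
  lower right one is diagonal.\<close>

lemma det_A_mat: "det A_mat = det unr_mat * (\<Prod>j=t..<g. (1 + fps_X) ^ (CARD('p) ^ k (w j)) - 1)"
proof -
  let ?r = "g - t"
  define C where "C = mat ?r t (\<lambda>(i, j). A (i + t) j)"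
  define D where "D = mat ?r ?r (\<lambda>(i, j). A (i + t) (j + t))"
  have D: "D \<in> carrier_mat ?r ?r" and C: "C \<in> carrier_mat ?r t" by (simp_all add: C_def D_def)
  have "A_mat = four_block_mat unr_mat (0\<^sub>m t ?r) C D"
  proof (rule eq_matI)
    fix i j assume "i < dim_row (four_block_mat unr_mat (0\<^sub>m t ?r) C D)" "j < dim_col (four_block_mat unr_mat (0\<^sub>m t ?r) C D)"
    then have ij: "i < g" "j < g" using t_le by (simp_all add: unr_mat_def C_def D_def)
    then show "A_mat $$ (i, j) = four_block_mat unr_mat (0\<^sub>m t ?r) C D $$ (i, j)"
      using t_le by (auto simp: A_mat_def unr_mat_def C_def D_def A_def)
  qed (use t_le in \<open>simp_all add: A_mat_def unr_mat_def C_def D_def\<close>)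
  then have "det A_mat = det unr_mat * det D"
    using det_four_block_mat_upper_right_zero[OF unr_mat_carrier refl C D] by simp
  also have "det D = prod_list (diag_mat D)"
    by (rule det_upper_triangular[OF _ D]) (auto simp: upper_triangular_def D_def A_def)
  also have "\<dots> = (\<Prod>i = 0..<?r. (1 + fps_X) ^ (CARD('p) ^ k (w (i + t))) - 1)"
    unfolding prod_list_diag_prod using D by (intro prod.cong) (auto simp: D_def A_def)
  also have "\<dots> = (\<Prod>j=t..<g. (1 + fps_X) ^ (CARD('p) ^ k (w j)) - 1)"
    using t_le prod.shift_bounds_nat_ivl[of "\<lambda>j. (1 + fps_X) ^ (CARD('p) ^ k (w j)) - 1 :: 'p padic_int fps" 0 t ?r] by simp
  finally show ?thesis .
qed

lemma det_A'_mat_nonzero: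
  assumes "connected X"
  shows "det A'_mat \<noteq> 0"
proof -
  have "det unr_mat \<noteq> 0" using det_unr_nonzero_ram[OF assms] det_unr_nonzero_unr t_le by (cases "t < g") auto
  \<comment> \<open>The coefficient of T is p^k, which is nonzero.\<close>
  moreover have "(1 + fps_X :: 'p padic_int fps) ^ (CARD('p) ^ k (w j)) - 1 \<noteq> 0" for j
  proof
    assume "(1 + fps_X :: 'p padic_int fps) ^ (CARD('p) ^ k (w j)) - 1 = 0"
    then have "fps_nth ((1 + fps_X :: 'p padic_int fps) ^ (CARD('p) ^ k (w j)) - 1) 1 = fps_nth 0 1" by (rule arg_cong)
    then have "(of_nat (CARD('p) ^ k (w j)) :: 'p padic_int) = 0"
      unfolding fps_sub_nth one_plus_X_power_nth by simp
    then have "CARD('p) ^ k (w j) = 0" by (simp only: of_nat_eq_0_iff)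
    then show False using card_gt_1[where 'p = 'p] by simp
  qed
  ultimately have "det A_mat \<noteq> 0" unfolding det_A_mat by simp
  then show ?thesis unfolding det_A_mat_A'_mat by auto
qed

text \<open>The lengths at all height one primes are valuations of one determinant, and unique
  factorisation assembles the prime powers into its ideal.\<close>

theorem char_ideal_Pic0_Lambda:
  assumes "connected X"
  shows "char_ideal Lambda (Pic0_Lambda X G \<alpha>) = {f. det A'_mat dvd f}"
proof -
  let ?M = "Pic0_Lambda X G \<alpha>"
  obtain \<Phi> where \<Phi>: "carrier ?M = range \<Phi>" "\<And>c d. \<Phi> (c + d) = \<Phi> c \<oplus>\<^bsub>?M\<^esub> \<Phi> d"
    "\<And>f c. \<Phi> (fun_scale f c) = f \<odot>\<^bsub>?M\<^esub> \<Phi> c" "\<zero>\<^bsub>?M\<^esub> = \<Phi> 0" "\<And>c d. \<Phi> c = \<Phi> d \<longleftrightarrow> c - d \<in> closure_kern"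
    using limit_module_presentation unfolding Pic0_Lambda_eq by blast
  have K: "closure_kern = column_module g g A'_mat"
    unfolding closure_kern_eq column_module_def A'_mat_def by simp
  have A'c: "A'_mat \<in> carrier_mat g g" by (simp add: A'_mat_def)
  have len: "the_enat (module_length (localized_ring Lambda {f. \<pi> dvd f}) (localized_module Lambda {f. \<pi> dvd f} ?M)) = n"
    if \<pi>: "prime_elem \<pi>" "det A'_mat = \<pi> ^ n * y" "\<not> \<pi> dvd y" for \<pi> n y
  proof -
    have ps: "prime_saturation (fun_scale :: 'p padic_int fps \<Rightarrow> _) \<pi>"
      using module_fun_scale \<pi>(1) iwasawa_pi_adic[OF \<pi>(1)]
      by (intro prime_saturation.intro prime_saturation_axioms.intro)
    have "module_presentation (fun_scale :: 'p padic_int fps \<Rightarrow> _) \<pi> ?M \<Phi> closure_kern"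
      using ps \<Phi> by (intro module_presentation.intro module_presentation_axioms.intro)
    then interpret mp: module_presentation "fun_scale :: 'p padic_int fps \<Rightarrow> _" \<pi> ?M \<Phi> closure_kern .
    have "mp.sat_length closure_kern UNIV n"
      unfolding K by (rule sat_length_column_module[OF ps A'c \<pi>(2,3)])
    then show ?thesis using mp.module_length_localized by simp
  qed
  show ?thesis
    unfolding char_ideal_def by (rule gfinprod_height_one_primes[where e = "\<lambda>P. the_enat (module_length (localized_ring Lambda P) (localized_module Lambda P ?M))",
        OF det_A'_mat_nonzero[OF assms] len])
qed

end

theorem theorem6p15:
  fixes X :: "('v, 'e) pre_digraph"
    and bar :: "'e \<Rightarrow> 'e"
    and \<alpha> :: "'e \<Rightarrow> 'p :: prime_card padic_int"
    and G :: "'v \<Rightarrow> 'p padic_int set"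
    and k :: "'v \<Rightarrow> nat"
    and v :: "nat \<Rightarrow> 'v"
    and g t :: nat
  assumes "serre_graph X bar" and "fin_digraph X" and "connected X"
    and "\<And>s. s \<in> arcs X \<Longrightarrow> \<alpha> (bar s) = - \<alpha> s"
    and "\<And>w. w \<in> verts X \<Longrightarrow> subgroup (G w) Zp_group"
    and "\<And>w. w \<in> verts X \<Longrightarrow> closed (G w)"
    and "bij_betw v {1..g} (verts X)" and "t \<le> g"
    and "{w \<in> verts X. G w = {0}} = v ` {1..t}"
    and "{w \<in> verts X. G w \<noteq> {0}} = v ` {t+1..g}"
    and "\<And>w. w \<in> verts X \<Longrightarrow> G w \<noteq> {0} \<Longrightarrow> G w = p_power_multiples (k w)"
    and "\<And>n. connected (layer X G \<alpha> n)"
  shows "char_ideal Lambda (Pic0_Lambda X G \<alpha>) \<cdot>\<^bsub>Lambda\<^esub> (PIdl\<^bsub>Lambda\<^esub> fps_X)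
    = (PIdl\<^bsub>Lambda\<^esub> (det (valency_matrix X v t - voltage_adjacency_matrix X \<alpha> v t)))
      \<cdot>\<^bsub>Lambda\<^esub>
      (PIdl\<^bsub>Lambda\<^esub> (\<Prod>w \<in> {w \<in> verts X. G w \<noteq> {0}}. (1 + fps_X) ^ (CARD('p) ^ k w) - 1))"
proof -
  let ?w = "\<lambda>i. v (Suc i)"
  have bijw: "bij_betw ?w {..<g} (verts X)"
  proof -
    have "bij_betw Suc {..<g} {1..g}"
      by (rule bij_betw_byWitness[of _ "\<lambda>i. i - 1"]) auto
    from bij_betw_trans[OF this assms(7)] show ?thesis by (simp add: comp_def)
  qed
  have unr: "G (?w i) = {0}" if "i < t" for i
  proof -
    have "?w i \<in> v ` {1..t}" using that by auto
    then show ?thesis unfolding assms(9)[symmetric] by blast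
  qed
  have ram: "G (?w i) = p_power_multiples (k (?w i))" if "t \<le> i" "i < g" for i
  proof -
    have "?w i \<in> v ` {t+1..g}" using that by auto
    then show ?thesis unfolding assms(10)[symmetric] using assms(11) by blast
  qed
  interpret branched_tower X bar \<alpha> G k ?w g t
    using assms(1,2) assms(4) bijw assms(8) unr ram assms(12)
    by (intro branched_tower.intro branched_tower_axioms.intro)
  have "valency_matrix X v t - voltage_adjacency_matrix X \<alpha> v t = unr_mat"
    by (rule eq_matI) (auto simp: valency_matrix_def voltage_adjacency_matrix_def unr_mat_def A_def)
  moreover have "(\<Prod>w \<in> {w \<in> verts X. G w \<noteq> {0}}. (1 + fps_X) ^ (CARD('p) ^ k w) - 1)
      = (\<Prod>j=t..<g. (1 + fps_X) ^ (CARD('p) ^ k (?w j)) - 1 :: 'p padic_int fps)"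
  proof -
    have "v ` {t+1..g} = ?w ` {t..<g}"
    proof -
      have "{t+1..g} = Suc ` {t..<g}" by (auto simp: image_iff Suc_le_eq)
      then show ?thesis by (simp only: image_image)
    qed
    moreover have "inj_on ?w {t..<g}" using bijw by (auto simp: bij_betw_def inj_on_def)
    ultimately show ?thesis unfolding assms(10) by (simp add: prod.reindex)
  qed
  \<comment> \<open>Both sides are generated by \<open>det A_mat\<close>; the factor T on the left
    is the determinant of the passage to degree zero.\<close>
  ultimately have rhs: "det (valency_matrix X v t - voltage_adjacency_matrix X \<alpha> v t) *
      (\<Prod>w \<in> {w \<in> verts X. G w \<noteq> {0}}. (1 + fps_X) ^ (CARD('p) ^ k w) - 1) = det A'_mat * fps_X"
    using det_A_mat det_A_mat_A'_mat by (simp add: mult.commute)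
  show ?thesis
    unfolding char_ideal_Pic0_Lambda[OF assms(3)] PIdl_type ideal_prod_multiples rhs ..
qed

end
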